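(* Let $\delta\in(1/2,1)$, let $x_1<x_2$ be real numbers, set $\rho(x)=\min(|x-x_1|,|x-x_2|)$ and $c(x)=\Big(\dfrac{\rho(x)^2}{1+\rho(x)^2}\Big)^{\delta}$ for $x\in\mathbb{R}$. Let $H_0$ be the viscosity operator on $L_2(\mathbb{R})$ with coefficient $c$, and $K^{(0)}_t$ the kernel of its semigroup $S^{(0)}_t$. Then $H_0$ is subelliptic of order $1-\delta$, but: (1) $\|K^{(0)}_t\|_\infty\ge(x_2-x_1)^{-1}$ for all $t>0$; in particular there is no $a>0$ such that $\|K^{(0)}_t\|_\infty\le a\,t^{-1/2}$ for all $t\ge1$; (2) there are no $a,b>0$ such that $K^{(0)}_t(x;y)\le a\,t^{-1/2}e^{-b|x-y|^2t^{-1}}$ for (almost) all $x,y\in\mathbb{R}$ and all $t\ge1$; (3) there are no $a',b'>0$ such that $K^{(0)}_t(x;y)\ge a'\,t^{-1/2}e^{-b'|x-y|^2t^{-1}}$ for (almost) all $x,y\in\mathbb{R}$ and all $t>0$.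
   Context: For a real-valued $c\in L_\infty(\mathbb{R})$ with $c\ge0$ a.e. and $\varepsilon\in(0,1]$, let $H_\varepsilon$ be the positive self-adjoint operator on $L_2(\mathbb{R})$ associated with the closed form $h_\varepsilon(\varphi)=\int_{\mathbb{R}}(c+\varepsilon)|\varphi'|^2$ with domain $W^{1,2}(\mathbb{R})$. As $\varepsilon\downarrow0$, $H_\varepsilon$ converges in the strong resolvent sense to a positive self-adjoint operator $H_0$, the viscosity operator with coefficient $c$; $S^{(0)}_t=e^{-tH_0}$ is the viscosity semigroup. With $\Delta=-d^2/dx^2$ the positive self-adjoint Laplacian on $L_2(\mathbb{R})$, $H_0$ is called subelliptic of order $\gamma\in(0,1]$ if there exist $\mu>0$, $\nu\ge0$ such that $D(H_0^{1/2})\subseteq D(\Delta^{\gamma/2})$ and $\|H_0^{1/2}\varphi\|_2^2+\nu\|\varphi\|_2^2\ge\mu\|\Delta^{\gamma/2}\varphi\|_2^2$ for all $\varphi\in D(H_0^{1/2})$. For subelliptic $H_0$ the operator $S^{(0)}_t$, $t>0$, has a bounded measurable kernel $K^{(0)}_t$, i.e. $(S^{(0)}_t\varphi)(x)=\int K^{(0)}_t(x;y)\varphi(y)\,dy$. *)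

theory Defs
  imports "HOL-Probability.Probability"
begin

definition square_integrable :: "(real \<Rightarrow> complex) \<Rightarrow> bool" where
  "square_integrable f \<longleftrightarrow>
     f \<in> borel_measurable lborel \<and> integrable lborel (\<lambda>x. (cmod (f x))\<^sup>2)"

definition l2_eq :: "(real \<Rightarrow> complex) \<Rightarrow> (real \<Rightarrow> complex) \<Rightarrow> bool" where
  "l2_eq f g \<longleftrightarrow> square_integrable f \<and> square_integrable g \<and> (AE x in lborel. f x = g x)"

lemma square_integrable_zero: "square_integrable (\<lambda>x. 0)"
  by (simp add: square_integrable_def)

lemma square_integrable_scaleC:
  "square_integrable f \<Longrightarrow> square_integrable (\<lambda>x. a * f x)"
  by (auto simp: square_integrable_def norm_mult power_mult_distrib)

lemma square_integrable_scaleR: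
  "square_integrable f \<Longrightarrow> square_integrable (\<lambda>x. r *\<^sub>R f x)"
  using square_integrable_scaleC[of f "of_real r"] by (simp add: scaleR_conv_of_real)

lemma square_integrable_uminus:
  "square_integrable f \<Longrightarrow> square_integrable (\<lambda>x. - f x)"
  using square_integrable_scaleC[of f "-1"] by simp

lemma square_integrable_add:
  assumes "square_integrable f" "square_integrable g"
  shows "square_integrable (\<lambda>x. f x + g x)"
proof -
  have [measurable]: "f \<in> borel_measurable lborel" "g \<in> borel_measurable lborel"
    using assms by (auto simp: square_integrable_def)
  have i: "integrable lborel (\<lambda>x. 2 * (cmod (f x))\<^sup>2 + 2 * (cmod (g x))\<^sup>2)"
    using assms by (auto simp: square_integrable_def)
  have b: "(cmod (f x + g x))\<^sup>2 \<le> 2 * (cmod (f x))\<^sup>2 + 2 * (cmod (g x))\<^sup>2" for x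
  proof -
    have "(cmod (f x + g x))\<^sup>2 \<le> (cmod (f x) + cmod (g x))\<^sup>2"
      by (intro power_mono norm_triangle_ineq) auto
    also have "\<dots> \<le> 2 * (cmod (f x))\<^sup>2 + 2 * (cmod (g x))\<^sup>2"
      using zero_le_power2[of "cmod (f x) - cmod (g x)"]
      by (simp add: power2_eq_square algebra_simps)
    finally show ?thesis .
  qed
  have "integrable lborel (\<lambda>x. (cmod (f x + g x))\<^sup>2)"
    by (rule Bochner_Integration.integrable_bound[OF i]) (use b in auto)
  then show ?thesis by (simp add: square_integrable_def)
qed

lemma square_integrable_diff:
  assumes "square_integrable f" "square_integrable g"
  shows "square_integrable (\<lambda>x. f x - g x)"
  using square_integrable_add[OF assms(1) square_integrable_uminus[OF assms(2)]] by simp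

lemma integrable_mult_cnj:
  assumes "square_integrable f" "square_integrable g"
  shows "integrable lborel (\<lambda>x. f x * cnj (g x))"
proof -
  have [measurable]: "f \<in> borel_measurable lborel" "g \<in> borel_measurable lborel"
    using assms by (auto simp: square_integrable_def)
  have i: "integrable lborel (\<lambda>x. (cmod (f x))\<^sup>2 + (cmod (g x))\<^sup>2)"
    using assms by (auto simp: square_integrable_def)
  have b: "cmod (f x) * cmod (g x) \<le> (cmod (f x))\<^sup>2 + (cmod (g x))\<^sup>2" for x
  proof -
    have "0 \<le> (cmod (f x) - cmod (g x))\<^sup>2" "0 \<le> cmod (f x) * cmod (g x)" by auto
    then show ?thesis unfolding power2_diff by linarith
  qed
  show ?thesis
  proof (rule Bochner_Integration.integrable_bound[OF i])
    have "(\<lambda>x. cnj (g x)) \<in> borel_measurable lborel"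
      by (rule borel_measurable_continuous_on[OF _ \<open>g \<in> borel_measurable lborel\<close>])
        (intro continuous_intros)
    then show "(\<lambda>x. f x * cnj (g x)) \<in> borel_measurable lborel"
      using \<open>f \<in> borel_measurable lborel\<close> by (rule borel_measurable_times[rotated])
  qed (use b in \<open>auto simp: norm_mult\<close>)
qed

quotient_type l2 = "real \<Rightarrow> complex" / partial: l2_eq
  morphisms l2_rep l2_abs
proof (rule part_equivpI)
  show "\<exists>x. l2_eq x x"
    by (rule exI[of _ "\<lambda>x. 0"]) (simp add: l2_eq_def square_integrable_zero)
  show "symp l2_eq"
    by (rule sympI) (auto simp: l2_eq_def eq_commute)
  show "transp l2_eq"
    by (rule transpI) (auto simp: l2_eq_def)
qed

lift_definition scaleC :: "complex \<Rightarrow> l2 \<Rightarrow> l2" is "\<lambda>a f x. a * f x"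
  by (auto simp: l2_eq_def intro: square_integrable_scaleC)

text \<open>Linear in the first argument, conjugate linear in the second.\<close>

lift_definition cinner :: "l2 \<Rightarrow> l2 \<Rightarrow> complex"
  is "\<lambda>f g. LINT x|lborel. f x * cnj (g x)"
proof -
  fix f f' g g' assume a: "l2_eq f f'" "l2_eq g g'"
  then have [measurable]: "f \<in> borel_measurable lborel" "g \<in> borel_measurable lborel"
     "f' \<in> borel_measurable lborel" "g' \<in> borel_measurable lborel"
    by (auto simp: l2_eq_def square_integrable_def)
  have "AE x in lborel. f x * cnj (g x) = f' x * cnj (g' x)"
    using a by (auto simp: l2_eq_def elim: eventually_elim2)
  then show "(LINT x|lborel. f x * cnj (g x)) = (LINT x|lborel. f' x * cnj (g' x))"
    using a integrable_mult_cnj[of f g] integrable_mult_cnj[of f' g']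
    by (intro integral_cong_AE) (auto simp: l2_eq_def dest: borel_measurable_integrable)
qed

instantiation l2 :: real_vector
begin

lift_definition zero_l2 :: l2 is "\<lambda>x. 0"
  by (simp add: l2_eq_def square_integrable_zero)

lift_definition plus_l2 :: "l2 \<Rightarrow> l2 \<Rightarrow> l2" is "\<lambda>f g x. f x + g x"
  by (auto simp: l2_eq_def intro: square_integrable_add elim: eventually_elim2)

lift_definition uminus_l2 :: "l2 \<Rightarrow> l2" is "\<lambda>f x. - f x"
  by (auto simp: l2_eq_def intro: square_integrable_uminus)

lift_definition minus_l2 :: "l2 \<Rightarrow> l2 \<Rightarrow> l2" is "\<lambda>f g x. f x - g x"
  by (auto simp: l2_eq_def intro: square_integrable_diff elim: eventually_elim2)

lift_definition scaleR_l2 :: "real \<Rightarrow> l2 \<Rightarrow> l2" is "\<lambda>r f x. r *\<^sub>R f x"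
  by (auto simp: l2_eq_def intro: square_integrable_scaleR)

instance
proof
  fix x y z :: l2 and a b :: real
  show "x + y + z = x + (y + z)"
    by transfer (auto simp: l2_eq_def algebra_simps intro!: square_integrable_add)
  show "x + y = y + x"
    by transfer (auto simp: l2_eq_def algebra_simps intro!: square_integrable_add)
  show "0 + x = x"
    by transfer (auto simp: l2_eq_def)
  show "- x + x = 0"
    by transfer (auto simp: l2_eq_def intro: square_integrable_zero)
  show "x - y = x + - y"
    by transfer (auto simp: l2_eq_def intro: square_integrable_diff)
  show "a *\<^sub>R (x + y) = a *\<^sub>R x + a *\<^sub>R y"
    by transfer (auto simp: l2_eq_def algebra_simps
        intro!: square_integrable_add square_integrable_scaleR)
  show "(a + b) *\<^sub>R x = a *\<^sub>R x + b *\<^sub>R x"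
    by transfer (auto simp: l2_eq_def scaleR_add_left
        intro!: square_integrable_add square_integrable_scaleR)
  show "a *\<^sub>R b *\<^sub>R x = (a * b) *\<^sub>R x"
    by transfer (use square_integrable_scaleR in \<open>auto simp: l2_eq_def\<close>)
  show "1 *\<^sub>R x = x"
    by transfer (auto simp: l2_eq_def)
qed

end

instantiation l2 :: real_inner
begin

definition inner_l2 :: "l2 \<Rightarrow> l2 \<Rightarrow> real" where
  "inner_l2 f g = Re (cinner f g)"

definition norm_l2 :: "l2 \<Rightarrow> real" where
  "norm_l2 f = sqrt (f \<bullet> f)"

definition sgn_l2 :: "l2 \<Rightarrow> l2" where
  "sgn_l2 f = f /\<^sub>R norm f"

definition dist_l2 :: "l2 \<Rightarrow> l2 \<Rightarrow> real" where
  "dist_l2 f g = norm (f - g)"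

definition uniformity_l2 :: "(l2 \<times> l2) filter" where
  "uniformity_l2 = (INF e\<in>{0<..}. principal {(x, y). dist x y < e})"

definition open_l2 :: "l2 set \<Rightarrow> bool" where
  "open_l2 U \<longleftrightarrow> (\<forall>x\<in>U. \<forall>\<^sub>F (x', y) in uniformity. x' = x \<longrightarrow> y \<in> U)"

instance
proof
  fix x y z :: l2 and r :: real
  show "x \<bullet> y = y \<bullet> x"
    unfolding inner_l2_def
  proof transfer
    fix f g :: "real \<Rightarrow> complex" assume "l2_eq f f" "l2_eq g g"
    have "(LINT x|lborel. f x * cnj (g x)) = (LINT x|lborel. cnj (g x * cnj (f x)))"
      by (simp add: mult.commute)
    also have "\<dots> = cnj (LINT x|lborel. g x * cnj (f x))"
      by (rule Bochner_Integration.integral_cnj)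
    finally show "Re (LINT x|lborel. f x * cnj (g x)) = Re (LINT x|lborel. g x * cnj (f x))"
      by simp
  qed
  show "(x + y) \<bullet> z = x \<bullet> z + y \<bullet> z"
    unfolding inner_l2_def
    by transfer (simp add: l2_eq_def algebra_simps integrable_mult_cnj)
  show "(r *\<^sub>R x) \<bullet> y = r * (x \<bullet> y)"
    unfolding inner_l2_def by transfer simp
  have sq: "Re (LINT x|lborel. f x * cnj (f x)) = (LINT x|lborel. (cmod (f x))\<^sup>2)"
    for f :: "real \<Rightarrow> complex"
    by (simp add: complex_norm_square[symmetric] del: of_real_power)
  show "0 \<le> x \<bullet> x"
    unfolding inner_l2_def by transfer (simp add: sq)
  show "x \<bullet> x = 0 \<longleftrightarrow> x = 0"
    unfolding inner_l2_def
  proof transfer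
    fix f assume "l2_eq f f"
    then show "Re (LINT x|lborel. f x * cnj (f x)) = 0 \<longleftrightarrow> l2_eq f (\<lambda>x. 0)"
      by (auto simp: sq l2_eq_def square_integrable_def integral_nonneg_eq_0_iff_AE)
  qed
  show "norm x = sqrt (x \<bullet> x)" by (rule norm_l2_def)
  show "sgn x = x /\<^sub>R norm x" by (rule sgn_l2_def)
  show "dist x y = norm (x - y)" by (rule dist_l2_def)
next
  show "uniformity = (INF e\<in>{0<..}. principal {(x::l2, y). dist x y < e})"
    by (rule uniformity_l2_def)
next
  fix U :: "l2 set"
  show "open U \<longleftrightarrow> (\<forall>x\<in>U. \<forall>\<^sub>F (x', y) in uniformity. x' = x \<longrightarrow> y \<in> U)"
    by (rule open_l2_def)
qed

end

text \<open>An operator is its graph; its domain is \<^const>\<open>Domain\<close> of the graph.\<close>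

type_synonym l2_op = "(l2 \<times> l2) set"

definition linear_operator :: "l2_op \<Rightarrow> bool" where
  "linear_operator A \<longleftrightarrow> single_valued A \<and> (0, 0) \<in> A \<and>
     (\<forall>\<phi> \<psi> \<phi>' \<psi>'. (\<phi>, \<psi>) \<in> A \<longrightarrow> (\<phi>', \<psi>') \<in> A \<longrightarrow> (\<phi> + \<phi>', \<psi> + \<psi>') \<in> A) \<and>
     (\<forall>a \<phi> \<psi>. (\<phi>, \<psi>) \<in> A \<longrightarrow> (scaleC a \<phi>, scaleC a \<psi>) \<in> A)"

definition adjoint_operator :: "l2_op \<Rightarrow> l2_op" where
  "adjoint_operator A = {(\<phi>, \<psi>). \<forall>(\<xi>, \<eta>) \<in> A. cinner \<eta> \<phi> = cinner \<xi> \<psi>}"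

definition positive_self_adjoint :: "l2_op \<Rightarrow> bool" where
  "positive_self_adjoint A \<longleftrightarrow> linear_operator A \<and> closure (Domain A) = UNIV \<and>
     adjoint_operator A = A \<and> (\<forall>(\<phi>, \<psi>) \<in> A. 0 \<le> Re (cinner \<psi> \<phi>))"

text \<open>\<open>(l + A)\<close> inverted, for \<open>l > 0\<close> and positive self-adjoint \<open>A\<close>; note the sign convention.\<close>

definition resolvent :: "l2_op \<Rightarrow> real \<Rightarrow> l2 \<Rightarrow> l2" where
  "resolvent A l f = (THE u. (u, f - l *\<^sub>R u) \<in> A)"

definition strong_resolvent_limit :: "('a \<Rightarrow> l2_op) \<Rightarrow> l2_op \<Rightarrow> 'a filter \<Rightarrow> bool" where
  "strong_resolvent_limit A B F \<longleftrightarrow>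
     (\<forall>l>0. \<forall>f. ((\<lambda>i. resolvent (A i) l f) \<longlongrightarrow> resolvent B l f) F)"

definition orthogonal_projection :: "(l2 \<Rightarrow> l2) \<Rightarrow> bool" where
  "orthogonal_projection P \<longleftrightarrow>
     (\<forall>\<phi> \<psi>. P (\<phi> + \<psi>) = P \<phi> + P \<psi>) \<and> (\<forall>a \<phi>. P (scaleC a \<phi>) = scaleC a (P \<phi>)) \<and>
     (\<forall>\<phi>. P (P \<phi>) = P \<phi>) \<and> (\<forall>\<phi> \<psi>. cinner (P \<phi>) \<psi> = cinner \<phi> (P \<psi>))"

definition projection_valued_measure :: "(real set \<Rightarrow> l2 \<Rightarrow> l2) \<Rightarrow> bool" where
  "projection_valued_measure E \<longleftrightarrow>
     (\<forall>B \<in> sets borel. orthogonal_projection (E B)) \<and>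
     (\<forall>\<phi>. E {} \<phi> = 0) \<and> (\<forall>\<phi>. E UNIV \<phi> = \<phi>) \<and>
     (\<forall>A \<in> sets borel. \<forall>B \<in> sets borel. \<forall>\<phi>. E (A \<inter> B) \<phi> = E A (E B \<phi>)) \<and>
     (\<forall>B :: nat \<Rightarrow> real set. range B \<subseteq> sets borel \<longrightarrow> disjoint_family B \<longrightarrow>
        (\<forall>\<phi>. (\<lambda>i. E (B i) \<phi>) sums E (\<Union>i. B i) \<phi>))"

definition spectral_scalar_measure :: "(real set \<Rightarrow> l2 \<Rightarrow> l2) \<Rightarrow> l2 \<Rightarrow> real measure" where
  "spectral_scalar_measure E \<phi> =
     measure_of UNIV (sets borel) (\<lambda>B. ennreal (Re (cinner (E B \<phi>) \<phi>)))"

definition spectral_domain :: "(real set \<Rightarrow> l2 \<Rightarrow> l2) \<Rightarrow> (real \<Rightarrow> real) \<Rightarrow> l2 set" where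
  "spectral_domain E f =
     {\<phi>. (\<integral>\<^sup>+ s. ennreal ((f s)\<^sup>2) \<partial>spectral_scalar_measure E \<phi>) < \<infinity>}"

text \<open>The integral of \<open>f\<close> against the complex measure \<open>B \<mapsto> cinner (E B \<phi>) \<xi>\<close>, which is
  written out as a combination of four positive measures by polarization.\<close>

definition spectral_sesq :: "(real set \<Rightarrow> l2 \<Rightarrow> l2) \<Rightarrow> (real \<Rightarrow> real) \<Rightarrow> l2 \<Rightarrow> l2 \<Rightarrow> complex" where
  "spectral_sesq E f \<phi> \<xi> = (1 / 4) * (\<Sum>k<4. \<i> ^ k *
     complex_of_real (LINT s|spectral_scalar_measure E (\<phi> + scaleC (\<i> ^ k) \<xi>). f s))"

definition spectral_integral :: "(real set \<Rightarrow> l2 \<Rightarrow> l2) \<Rightarrow> (real \<Rightarrow> real) \<Rightarrow> l2_op" where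
  "spectral_integral E f = {(\<phi>, \<psi>). \<phi> \<in> spectral_domain E f \<and>
     (\<forall>\<xi> \<in> spectral_domain E f. cinner \<psi> \<xi> = spectral_sesq E f \<phi> \<xi>)}"

text \<open>\<open>f(A)\<close> for self-adjoint \<open>A\<close>; the spectral measure of \<open>A\<close> is unique on Borel sets.\<close>

definition function_of_operator :: "(real \<Rightarrow> real) \<Rightarrow> l2_op \<Rightarrow> l2_op" where
  "function_of_operator f A = {(\<phi>, \<psi>). \<exists>E. projection_valued_measure E \<and>
     spectral_integral E (\<lambda>s. s) = A \<and> (\<phi>, \<psi>) \<in> spectral_integral E f}"

definition test_function :: "(real \<Rightarrow> real) \<Rightarrow> bool" where
  "test_function \<eta> \<longleftrightarrow> (\<forall>n x. (deriv ^^ n) \<eta> field_differentiable at x) \<and>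
     (\<exists>R. \<forall>x. \<bar>x\<bar> > R \<longrightarrow> \<eta> x = 0)"

definition weak_derivative :: l2_op where
  "weak_derivative = {(\<phi>, \<psi>). \<forall>\<eta>. test_function \<eta> \<longrightarrow>
     (LINT x|lborel. deriv \<eta> x *\<^sub>R l2_rep \<phi> x) = - (LINT x|lborel. \<eta> x *\<^sub>R l2_rep \<psi> x)}"

definition W12 :: "l2 set" where
  "W12 = Domain weak_derivative"

definition weak_deriv :: "l2 \<Rightarrow> l2" where
  "weak_deriv \<phi> = (THE \<psi>. (\<phi>, \<psi>) \<in> weak_derivative)"

definition laplacian :: l2_op where
  "laplacian = {(\<phi>, - \<psi>) | \<phi> \<psi>. (\<phi>, \<psi>) \<in> weak_derivative O weak_derivative}"

definition form_operator :: "l2 set \<Rightarrow> (l2 \<Rightarrow> l2 \<Rightarrow> complex) \<Rightarrow> l2_op" where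
  "form_operator D h = {(\<phi>, \<psi>). \<phi> \<in> D \<and> (\<forall>\<xi> \<in> D. h \<phi> \<xi> = cinner \<psi> \<xi>)}"

text \<open>The sesquilinear form whose quadratic form is \<open>h\<^sub>\<epsilon>(\<phi>) = \<integral> (c + \<epsilon>) \<bar>\<phi>'\<bar>\<^sup>2\<close>.\<close>

definition viscosity_form :: "(real \<Rightarrow> real) \<Rightarrow> real \<Rightarrow> l2 \<Rightarrow> l2 \<Rightarrow> complex" where
  "viscosity_form c \<epsilon> \<phi> \<xi> = (LINT x|lborel.
     (c x + \<epsilon>) *\<^sub>R (l2_rep (weak_deriv \<phi>) x * cnj (l2_rep (weak_deriv \<xi>) x)))"

definition viscosity_operator :: "(real \<Rightarrow> real) \<Rightarrow> l2_op \<Rightarrow> bool" where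
  "viscosity_operator c H \<longleftrightarrow> positive_self_adjoint H \<and>
     strong_resolvent_limit (\<lambda>\<epsilon>. form_operator W12 (viscosity_form c \<epsilon>)) H (at_right 0)"

definition subelliptic :: "l2_op \<Rightarrow> real \<Rightarrow> bool" where
  "subelliptic H \<gamma> \<longleftrightarrow> 0 < \<gamma> \<and> \<gamma> \<le> 1 \<and> (\<exists>\<mu>>0. \<exists>\<nu>\<ge>0.
     Domain (function_of_operator sqrt H)
       \<subseteq> Domain (function_of_operator (\<lambda>s. s powr (\<gamma> / 2)) laplacian) \<and>
     (\<forall>\<phi> \<psi> \<eta>. (\<phi>, \<psi>) \<in> function_of_operator sqrt H \<longrightarrow>
        (\<phi>, \<eta>) \<in> function_of_operator (\<lambda>s. s powr (\<gamma> / 2)) laplacian \<longrightarrow>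
        (norm \<psi>)\<^sup>2 + \<nu> * (norm \<phi>)\<^sup>2 \<ge> \<mu> * (norm \<eta>)\<^sup>2))"

definition semigroup_of :: "l2_op \<Rightarrow> real \<Rightarrow> l2_op" where
  "semigroup_of H t = function_of_operator (\<lambda>s. exp (- t * s)) H"

definition bounded_kernel_of :: "l2_op \<Rightarrow> (real \<Rightarrow> real \<Rightarrow> real) \<Rightarrow> bool" where
  "bounded_kernel_of T k \<longleftrightarrow>
     (\<lambda>(x, y). k x y) \<in> borel_measurable (lborel \<Otimes>\<^sub>M lborel) \<and>
     (\<exists>M. AE (x, y) in lborel \<Otimes>\<^sub>M lborel. \<bar>k x y\<bar> \<le> M) \<and>
     (\<forall>\<phi>. \<exists>\<psi>. (\<phi>, \<psi>) \<in> T \<and>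
        (AE x in lborel. integrable lborel (\<lambda>y. k x y *\<^sub>R l2_rep \<phi> y) \<and>
           l2_rep \<psi> x = (LINT y|lborel. k x y *\<^sub>R l2_rep \<phi> y)))"

definition kernel_sup_norm :: "(real \<Rightarrow> real \<Rightarrow> real) \<Rightarrow> ereal" where
  "kernel_sup_norm k = esssup (lborel \<Otimes>\<^sub>M lborel) (\<lambda>(x, y). ereal \<bar>k x y\<bar>)"

definition two_point_coeff :: "real \<Rightarrow> real \<Rightarrow> real \<Rightarrow> real \<Rightarrow> real" where
  "two_point_coeff \<delta> x1 x2 x = (let r = min \<bar>x - x1\<bar> \<bar>x - x2\<bar> in (r\<^sup>2 / (1 + r\<^sup>2)) powr \<delta>)"

end

theory Submission
  imports Defs "HOL-Computational_Algebra.Polynomial"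
begin

text \<open>
  Since \<open>2 * \<delta> > 1\<close>, the coefficient vanishes so fast at \<open>x1\<close> and \<open>x2\<close> that the indicator function
  of \<open>{x1..x2}\<close> is an \<open>L\<^sub>2\<close> limit of test functions whose degenerate energy tends to \<open>0\<close>. It is therefore
  killed by \<open>H0\<close> and fixed by the semigroup, so no mass leaves the interval: for almost every \<open>x\<close> in
  it, \<open>K t x\<close> has integral \<open>1\<close> over the interval, and for almost every \<open>x\<close> outside, integral \<open>0\<close>.
  The first fact bounds the kernel from below by \<open>1 / (x2 - x1)\<close> in the supremum norm, the second one
  prevents it from being positive.

  For the subellipticity, a test function is split, at every scale \<open>2 ^ (- k)\<close>, by a cutoff living
  away from the degenerate points at that distance. Summing over the scales, the degenerate form
  controls the \<open>K\<close>-functional that characterises the domain of the fractional power of the Laplacian;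
  the part near the degenerate points is absorbed by a Hardy inequality with weight
  \<open>(x - x1)\<^sup>2 powr (\<delta> - 1)\<close>, which is available because \<open>2 * (1 - \<delta>) < 1\<close>.
\<close>

subsection \<open>Square integrable functions\<close>

text \<open>Two definitions shape the argument. \<open>viscosity_operator\<close> gives access to
  the operator only through strong resolvent convergence, so everything is read off from
  \<open>resolvent\<close> at \<open>1\<close>: a trial function with small energy close to
  \<open>f\<close> forces \<open>f - resolvent H 1 f\<close> to be small, and conversely a
  spectrally truncated vector is a value of the resolvent, hence a limit of weakly differentiable
  functions with controlled energies. \<open>function_of_operator\<close> quantifies the spectral
  measure existentially, so each estimate is shown for an arbitrary \<open>E\<close> that integrates
  to the operator. For the Laplacian the domain inclusion also demands that some \<open>E\<close>
  exists; this is why the Fourier transform on the whole of \<open>L2\<close> is built. The order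
  \<open>1 - \<delta>\<close> comes from a balance of scales: near a degenerate point, at distance
  \<open>r\<close>, the weight \<open>4 powr (k * (1 - \<delta>))\<close> times the price
  \<open>4 powr (- k)\<close> of a squared derivative sums over the scales
  \<open>2 powr (- k)\<close> below \<open>r\<close> to about \<open>r powr (2 * \<delta>)\<close>,
  which is the size of the coefficient.\<close>

lemma square_integrable_l2_rep: "square_integrable (l2_rep \<phi>)"
  using Quotient3_rep_reflp[OF Quotient3_l2, of \<phi>] by (simp add: l2_eq_def)

lemma borel_measurable_l2_rep [measurable]: "l2_rep \<phi> \<in> borel_measurable borel"
  using square_integrable_l2_rep[of \<phi>] by (simp add: square_integrable_def)

lemma integrable_l2_rep_sq: "integrable lborel (\<lambda>x. (cmod (l2_rep \<phi> x))\<^sup>2)"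
  using square_integrable_l2_rep[of \<phi>] by (simp add: square_integrable_def)

lemma l2_abs_rep: "l2_abs (l2_rep \<phi>) = \<phi>"
  by (rule Quotient3_abs_rep[OF Quotient3_l2])

lemma l2_abs_eq_iff:
  assumes "square_integrable f" "square_integrable g"
  shows "l2_abs f = l2_abs g \<longleftrightarrow> (AE x in lborel. f x = g x)"
  using Quotient3_rel[OF Quotient3_l2, of f g] assms by (auto simp: l2_eq_def)

lemma l2_rep_abs_AE: "square_integrable f \<Longrightarrow> AE x in lborel. l2_rep (l2_abs f) x = f x"
  using l2_abs_eq_iff[of "l2_rep (l2_abs f)" f] square_integrable_l2_rep by (simp add: l2_abs_rep)

lemma l2_eq_iff_AE: "\<phi> = \<psi> \<longleftrightarrow> (AE x in lborel. l2_rep \<phi> x = l2_rep \<psi> x)"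
  using l2_abs_eq_iff[of "l2_rep \<phi>" "l2_rep \<psi>"] square_integrable_l2_rep by (simp add: l2_abs_rep)

lemma l2_abs_add:
  assumes "square_integrable f" "square_integrable g"
  shows "l2_abs f + l2_abs g = l2_abs (\<lambda>x. f x + g x)"
  using assms by (auto intro!: plus_l2.abs_eq simp: l2_eq_def)

lemma l2_abs_diff:
  assumes "square_integrable f" "square_integrable g"
  shows "l2_abs f - l2_abs g = l2_abs (\<lambda>x. f x - g x)"
  using assms by (auto intro!: minus_l2.abs_eq simp: l2_eq_def)

lemma l2_abs_uminus: "square_integrable f \<Longrightarrow> - l2_abs f = l2_abs (\<lambda>x. - f x)"
  by (auto intro!: uminus_l2.abs_eq simp: l2_eq_def)

lemma scaleC_l2_abs: "square_integrable f \<Longrightarrow> scaleC a (l2_abs f) = l2_abs (\<lambda>x. a * f x)"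
  by (auto intro!: scaleC.abs_eq simp: l2_eq_def)

lemma scaleR_l2_abs: "square_integrable f \<Longrightarrow> r *\<^sub>R l2_abs f = l2_abs (\<lambda>x. r *\<^sub>R f x)"
  by (auto intro!: scaleR_l2.abs_eq simp: l2_eq_def)

lemma l2_rep_add_AE: "AE x in lborel. l2_rep (\<phi> + \<psi>) x = l2_rep \<phi> x + l2_rep \<psi> x"
  using l2_rep_abs_AE[OF square_integrable_add[OF square_integrable_l2_rep square_integrable_l2_rep, of \<phi> \<psi>]]
  by (simp add: l2_abs_add[symmetric] square_integrable_l2_rep l2_abs_rep)

lemma l2_rep_diff_AE: "AE x in lborel. l2_rep (\<phi> - \<psi>) x = l2_rep \<phi> x - l2_rep \<psi> x"
  using l2_rep_abs_AE[OF square_integrable_diff[OF square_integrable_l2_rep square_integrable_l2_rep, of \<phi> \<psi>]]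
  by (simp add: l2_abs_diff[symmetric] square_integrable_l2_rep l2_abs_rep)

lemma l2_rep_uminus_AE: "AE x in lborel. l2_rep (- \<phi>) x = - l2_rep \<phi> x"
  using l2_rep_abs_AE[OF square_integrable_uminus[OF square_integrable_l2_rep, of \<phi>]]
  by (simp add: l2_abs_uminus[symmetric] square_integrable_l2_rep l2_abs_rep)

lemma l2_rep_scaleC_AE: "AE x in lborel. l2_rep (scaleC a \<phi>) x = a * l2_rep \<phi> x"
  using l2_rep_abs_AE[OF square_integrable_scaleC[OF square_integrable_l2_rep, of a \<phi>]]
  by (simp add: scaleC_l2_abs[symmetric] square_integrable_l2_rep l2_abs_rep)

lemma l2_rep_zero_AE: "AE x in lborel. l2_rep 0 x = 0"
  using l2_rep_abs_AE[OF square_integrable_zero] by (simp add: zero_l2_def)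

lemma scaleR_scaleC: "r *\<^sub>R \<phi> = scaleC (complex_of_real r) \<phi>"
  using scaleR_l2_abs[OF square_integrable_l2_rep, of r \<phi>] scaleC_l2_abs[OF square_integrable_l2_rep, of r \<phi>]
  by (simp add: l2_abs_rep scaleR_conv_of_real)

lemma cinner_eq: "cinner \<phi> \<psi> = (LINT x|lborel. l2_rep \<phi> x * cnj (l2_rep \<psi> x))"
  by (simp add: cinner.rep_eq)

lemma borel_measurable_cnj [measurable (raw)]:
  "f \<in> borel_measurable M \<Longrightarrow> (\<lambda>x. cnj (f x)) \<in> borel_measurable M"
  by (rule borel_measurable_continuous_on[OF _ ]) (intro continuous_intros)

lemma cinner_l2_abs:
  assumes "square_integrable f" "square_integrable g"
  shows "cinner (l2_abs f) (l2_abs g) = (LINT x|lborel. f x * cnj (g x))"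
  using assms by (auto intro!: cinner.abs_eq simp: l2_eq_def)

lemma cinner_add_left: "cinner (\<phi> + \<psi>) \<xi> = cinner \<phi> \<xi> + cinner \<psi> \<xi>"
  by (transfer) (simp add: l2_eq_def algebra_simps integrable_mult_cnj)

lemma cinner_scaleC_left: "cinner (scaleC a \<phi>) \<psi> = a * cinner \<phi> \<psi>"
  by (transfer) (simp add: mult.assoc)

lemma cinner_commute: "cinner \<phi> \<psi> = cnj (cinner \<psi> \<phi>)"
  by (simp add: cinner_eq Bochner_Integration.integral_cnj[symmetric] mult.commute)

lemma cinner_scaleC_right: "cinner \<phi> (scaleC a \<psi>) = cnj a * cinner \<phi> \<psi>"
  by (subst (1 2) cinner_commute) (simp add: cinner_scaleC_left)

lemma cinner_add_right: "cinner \<phi> (\<psi> + \<xi>) = cinner \<phi> \<psi> + cinner \<phi> \<xi>"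
  by (subst (1 2 3) cinner_commute) (simp add: cinner_add_left)

lemma cinner_scaleR_left: "cinner (r *\<^sub>R \<phi>) \<psi> = r *\<^sub>R cinner \<phi> \<psi>"
  by (simp add: scaleR_scaleC cinner_scaleC_left scaleR_conv_of_real)

lemma cinner_scaleR_right: "cinner \<phi> (r *\<^sub>R \<psi>) = r *\<^sub>R cinner \<phi> \<psi>"
  by (simp add: scaleR_scaleC cinner_scaleC_right scaleR_conv_of_real)

lemma cinner_minus_left: "cinner (- \<phi>) \<psi> = - cinner \<phi> \<psi>"
  using cinner_scaleR_left[of "-1" \<phi> \<psi>] by simp

lemma cinner_minus_right: "cinner \<phi> (- \<psi>) = - cinner \<phi> \<psi>"
  using cinner_scaleR_right[of \<phi> "-1" \<psi>] by simp

lemma cinner_diff_left: "cinner (\<phi> - \<psi>) \<xi> = cinner \<phi> \<xi> - cinner \<psi> \<xi>"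
  using cinner_add_left[of \<phi> "- \<psi>"] by (simp add: cinner_minus_left)

lemma cinner_diff_right: "cinner \<phi> (\<psi> - \<xi>) = cinner \<phi> \<psi> - cinner \<phi> \<xi>"
  using cinner_add_right[of \<phi> \<psi> "- \<xi>"] by (simp add: cinner_minus_right)

lemma cinner_zero_left [simp]: "cinner 0 \<phi> = 0"
  using cinner_scaleR_left[of 0 0 \<phi>] by simp

lemma cinner_zero_right [simp]: "cinner \<phi> 0 = 0"
  using cinner_scaleR_right[of \<phi> 0 0] by simp

lemmas cinner_simps = cinner_add_left cinner_add_right cinner_diff_left cinner_diff_right
  cinner_scaleC_left cinner_scaleC_right cinner_scaleR_left cinner_scaleR_right
  cinner_minus_left cinner_minus_right

lemma cinner_self: "cinner \<phi> \<phi> = complex_of_real ((norm \<phi>)\<^sup>2)"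
proof -
  have "cinner \<phi> \<phi> = complex_of_real (LINT x|lborel. (cmod (l2_rep \<phi> x))\<^sup>2)"
    unfolding cinner_eq by (simp add: complex_norm_square[symmetric] del: of_real_power)
  moreover have "(norm \<phi>)\<^sup>2 = Re (cinner \<phi> \<phi>)"
    by (simp add: norm_l2_def inner_l2_def[symmetric])
  ultimately show ?thesis by simp
qed

lemma norm_l2_sq: "(norm \<phi>)\<^sup>2 = (LINT x|lborel. (cmod (l2_rep \<phi> x))\<^sup>2)"
proof -
  have "cinner \<phi> \<phi> = complex_of_real (LINT x|lborel. (cmod (l2_rep \<phi> x))\<^sup>2)"
    unfolding cinner_eq by (simp add: complex_norm_square[symmetric] del: of_real_power)
  then show ?thesis unfolding cinner_self by (simp only: of_real_eq_iff)
qed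

lemma norm_l2_abs_sq:
  assumes "square_integrable f"
  shows "(norm (l2_abs f))\<^sup>2 = (LINT x|lborel. (cmod (f x))\<^sup>2)"
  unfolding norm_l2_sq
  using l2_rep_abs_AE[OF assms] assms square_integrable_l2_rep[of "l2_abs f"]
  by (intro integral_cong_AE) (auto simp: square_integrable_def)

lemma nn_integral_l2_rep_sq: "(\<integral>\<^sup>+ x. ennreal ((cmod (l2_rep \<phi> x))\<^sup>2) \<partial>lborel) = ennreal ((norm \<phi>)\<^sup>2)"
  unfolding norm_l2_sq by (rule nn_integral_eq_integral[OF integrable_l2_rep_sq]) simp

lemma norm_scaleC: "norm (scaleC a \<phi>) = cmod a * norm \<phi>"
proof -
  have "complex_of_real ((norm (scaleC a \<phi>))\<^sup>2) = complex_of_real ((cmod a * norm \<phi>)\<^sup>2)"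
    unfolding cinner_self[symmetric] cinner_scaleC_left cinner_scaleC_right
    by (simp only: cinner_self power_mult_distrib of_real_mult complex_norm_square mult_ac)
  then have "(norm (scaleC a \<phi>))\<^sup>2 = (cmod a * norm \<phi>)\<^sup>2" by (simp only: of_real_eq_iff)
  then show ?thesis by (simp add: power2_eq_iff_nonneg)
qed

lemma scaleC_add_right: "scaleC a (\<phi> + \<psi>) = scaleC a \<phi> + scaleC a \<psi>"
  by transfer (auto simp: l2_eq_def algebra_simps intro!: square_integrable_add square_integrable_scaleC)

lemma scaleC_add_left: "scaleC (a + b) \<phi> = scaleC a \<phi> + scaleC b \<phi>"
  by transfer (auto simp: l2_eq_def algebra_simps intro!: square_integrable_add square_integrable_scaleC)

lemma scaleC_scaleC [simp]: "scaleC a (scaleC b \<phi>) = scaleC (a * b) \<phi>"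
  by transfer (auto simp: l2_eq_def algebra_simps intro!: square_integrable_add square_integrable_scaleC)

lemma scaleC_one [simp]: "scaleC 1 \<phi> = \<phi>"
  using scaleR_scaleC[of 1 \<phi>] by simp

lemma scaleC_zero_left [simp]: "scaleC 0 \<phi> = 0"
  using scaleR_scaleC[of 0 \<phi>] by simp

lemma scaleC_zero_right [simp]: "scaleC a 0 = 0"
  using scaleC_scaleC[of a 0 0] by simp

lemma inner_eq_Re_cinner: "\<phi> \<bullet> \<psi> = Re (cinner \<phi> \<psi>)"
  by (rule inner_l2_def)

text \<open>The library theory of subspaces and orthogonality is over the reals. Testing the real
  inner product against both \<open>\<psi>\<close> and \<open>scaleC \<i> \<psi>\<close> recovers
  the complex one, and every later passage from real to complex orthogonality goes this way.\<close>

lemma cinner_eq_inner: "cinner \<phi> \<psi> = Complex (\<phi> \<bullet> \<psi>) (\<phi> \<bullet> scaleC \<i> \<psi>)"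
  by (simp add: inner_l2_def cinner_scaleC_right complex_eq_iff)

lemma cmod_cinner_le: "cmod (cinner \<phi> \<psi>) \<le> norm \<phi> * norm \<psi>"
proof (cases "cinner \<phi> \<psi> = 0")
  case False
  \<comment> \<open>Rotating \<open>\<psi>\<close> by this phase makes the complex inner product
    real and nonnegative, so the real Cauchy-Schwarz inequality applies.\<close>
  define a where "a = cinner \<phi> \<psi> / cmod (cinner \<phi> \<psi>)"
  have a: "cmod a = 1" using False by (simp add: a_def norm_divide)
  have "cinner \<phi> \<psi> * cnj (cinner \<phi> \<psi>) = cmod (cinner \<phi> \<psi>) * cmod (cinner \<phi> \<psi>)"
    by (simp add: complex_norm_square[symmetric] power2_eq_square[symmetric] flip: of_real_power of_real_mult)
  then have "cinner \<phi> (scaleC a \<psi>) = of_real (cmod (cinner \<phi> \<psi>))"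
    using False by (simp add: cinner_scaleC_right a_def field_simps)
  then have "\<phi> \<bullet> scaleC a \<psi> = cmod (cinner \<phi> \<psi>)" by (simp add: inner_l2_def)
  then show ?thesis using norm_cauchy_schwarz[of \<phi> "scaleC a \<psi>"] a by (simp add: norm_scaleC)
qed simp

lemma bounded_bilinear_cinner: "bounded_bilinear cinner"
  by (rule bounded_bilinear.intro)
    (auto simp: cinner_simps intro!: exI[of _ 1] cmod_cinner_le)

lemmas tendsto_cinner [tendsto_intros] = bounded_bilinear.tendsto[OF bounded_bilinear_cinner]
lemmas continuous_on_cinner [continuous_intros] = bounded_bilinear.continuous_on[OF bounded_bilinear_cinner]

lemma bounded_linear_scaleC: "bounded_linear (scaleC a)"
  by (rule bounded_linear_intro[of _ "cmod a"])
    (auto simp: scaleC_add_right norm_scaleC scaleR_scaleC mult.commute)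

lemmas continuous_on_scaleC [continuous_intros] = bounded_linear.continuous_on[OF bounded_linear_scaleC]

lemma integrable_square_integrable_mult:
  assumes "square_integrable f" "square_integrable g"
  shows "integrable lborel (\<lambda>x. f x * g x)"
proof -
  have "square_integrable (\<lambda>x. cnj (g x))"
    using assms(2) by (auto simp: square_integrable_def)
  from integrable_mult_cnj[OF assms(1) this] show ?thesis by simp
qed

lemma square_integrable_bounded_mult:
  assumes [measurable]: "g \<in> borel_measurable borel" and "square_integrable f"
    and b: "\<And>x. cmod (g x) \<le> C"
  shows "square_integrable (\<lambda>x. g x * f x)"
proof -
  have [measurable]: "f \<in> borel_measurable borel" and i: "integrable lborel (\<lambda>x. (cmod (f x))\<^sup>2)"
    using assms(2) by (auto simp: square_integrable_def)
  have "integrable lborel (\<lambda>x. C\<^sup>2 * (cmod (f x))\<^sup>2)" using i by simp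
  then have "integrable lborel (\<lambda>x. (cmod (g x * f x))\<^sup>2)"
    by (rule Bochner_Integration.integrable_bound)
      (auto simp: norm_mult power_mult_distrib intro!: mult_right_mono power_mono b)
  then show ?thesis by (simp add: square_integrable_def)
qed

subsection \<open>Completeness\<close>

text \<open>Along a rapidly convergent subsequence, \<open>\<Sum>k. 4 ^ k * \<bar>f\<^sub>k\<^sub>+\<^sub>1 - f\<^sub>k\<bar>\<^sup>2\<close> is integrable,
  hence finite almost everywhere, which forces pointwise convergence.\<close>

lemma l2_rapidly_Cauchy_convergent:
  fixes X :: "nat \<Rightarrow> l2"
  assumes r: "\<And>k. (norm (X (Suc k) - X k))\<^sup>2 \<le> (1/8) ^ k"
    and C: "Cauchy X"
  shows "convergent X"
proof -
  define d where "d k x = l2_rep (X (Suc k)) x - l2_rep (X k) x" for k x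
  have [measurable]: "d k \<in> borel_measurable borel" for k unfolding d_def by measurable
  have d_int: "(\<integral>\<^sup>+ x. ennreal ((cmod (d k x))\<^sup>2) \<partial>lborel) \<le> ennreal ((1/8)^k)" for k
  proof -
    have "(\<integral>\<^sup>+ x. ennreal ((cmod (d k x))\<^sup>2) \<partial>lborel)
      = (\<integral>\<^sup>+ x. ennreal ((cmod (l2_rep (X (Suc k) - X k) x))\<^sup>2) \<partial>lborel)"
      by (rule nn_integral_cong_AE) (use l2_rep_diff_AE[of "X (Suc k)" "X k"] in \<open>auto simp: d_def\<close>)
    also have "\<dots> \<le> ennreal ((1/8)^k)" unfolding nn_integral_l2_rep_sq using r by (simp add: ennreal_leI)
    finally show ?thesis .
  qed
  have "(\<integral>\<^sup>+ x. (\<Sum>k. ennreal (4^k * (cmod (d k x))\<^sup>2)) \<partial>lborel)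
     = (\<Sum>k. \<integral>\<^sup>+ x. ennreal (4^k * (cmod (d k x))\<^sup>2) \<partial>lborel)"
    by (rule nn_integral_suminf) auto
  also have "\<dots> \<le> (\<Sum>k. ennreal ((1/2)^k))"
  proof (rule suminf_le)
    fix k :: nat
    have "(\<integral>\<^sup>+ x. ennreal (4^k * (cmod (d k x))\<^sup>2) \<partial>lborel) =
       ennreal (4^k) * (\<integral>\<^sup>+ x. ennreal ((cmod (d k x))\<^sup>2) \<partial>lborel)"
      by (simp add: ennreal_mult nn_integral_cmult)
    also have "\<dots> \<le> ennreal (4^k) * ennreal ((1/8)^k)"
      by (intro mult_left_mono d_int) auto
    also have "\<dots> = ennreal ((1/2)^k)"
      by (simp add: ennreal_mult[symmetric] power_mult_distrib[symmetric])
    finally show "(\<integral>\<^sup>+ x. ennreal (4^k * (cmod (d k x))\<^sup>2) \<partial>lborel) \<le> ennreal ((1/2)^k)" .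
  qed auto
  also have "\<dots> = ennreal (\<Sum>k. (1/2)^k)"
    by (rule suminf_ennreal2) auto
  also have "\<dots> < \<infinity>" by simp
  finally have "AE x in lborel. (\<Sum>k. ennreal (4^k * (cmod (d k x))\<^sup>2)) \<noteq> \<infinity>"
    by (intro nn_integral_PInf_AE) auto
  then have conv: "AE x in lborel. convergent (\<lambda>k. l2_rep (X k) x)"
  proof eventually_elim
    case (elim x)
    define M where "M = enn2real (\<Sum>k. ennreal (4^k * (cmod (d k x))\<^sup>2))"
    have M: "(\<Sum>k. ennreal (4^k * (cmod (d k x))\<^sup>2)) = ennreal M" "M \<ge> 0"
      using elim by (simp_all add: M_def ennreal_enn2real_if)
    have b: "cmod (d k x) \<le> sqrt M * (1/2)^k" for k
    proof -
      have "(\<Sum>j\<in>{k}. ennreal (4^j * (cmod (d j x))\<^sup>2)) \<le> ennreal M"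
        unfolding M(1)[symmetric] by (rule sum_le_suminf) auto
      then have "ennreal (4^k * (cmod (d k x))\<^sup>2) \<le> ennreal M" by (simp only: sum.insert sum.empty finite.emptyI empty_iff not_False_eq_True add_0_right)
      moreover have four: "(4::real)^k = 2^k * 2^k" by (simp flip: power_mult_distrib)
      ultimately have "4^k * (cmod (d k x))\<^sup>2 \<le> M" using M(2) by simp
      then have "(2^k * cmod (d k x))\<^sup>2 \<le> M"
        by (simp add: power2_eq_square mult_ac four)
      then have "2^k * cmod (d k x) \<le> sqrt M" by (rule real_le_rsqrt)
      then show ?thesis by (simp add: field_simps power_divide)
    qed
    have "summable (\<lambda>k. sqrt M * (1/2)^k :: real)" by (intro summable_mult summable_geometric) simp
    then have "summable (\<lambda>k. d k x)"
      by (rule summable_comparison_test'[of _ 0]) (use b in auto)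
    then have "convergent (\<lambda>n. \<Sum>k<n. d k x)" by (simp add: summable_iff_convergent)
    then have "convergent (\<lambda>n. (\<Sum>k<n. d k x) + l2_rep (X 0) x)" by (intro convergent_add convergent_const)
    moreover have "(\<Sum>k<n. d k x) + l2_rep (X 0) x = l2_rep (X n) x" for n
      by (simp add: d_def sum_lessThan_telescope[of "\<lambda>k. l2_rep (X k) x"])
    ultimately show ?case by simp
  qed
  define f where "f x = lim (\<lambda>k. l2_rep (X k) x)" for x
  have [measurable]: "f \<in> borel_measurable borel" unfolding f_def by measurable
  have fl: "AE x in lborel. (\<lambda>k. l2_rep (X k) x) \<longlonglongrightarrow> f x"
    using conv by eventually_elim (auto simp: f_def convergent_LIMSEQ_iff)
  \<comment> \<open>Fatou's lemma in \<open>m\<close> is applied twice: with \<open>e = 1\<close> it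
    shows that the pointwise limit \<open>f\<close> is square integrable, and with small
    \<open>e\<close> that \<open>X\<close> converges to it in norm.\<close>
  have fatou: "(\<integral>\<^sup>+ x. ennreal ((cmod (f x - l2_rep (X n) x))\<^sup>2) \<partial>lborel) \<le> ennreal (e\<^sup>2)"
    if e: "\<And>m. m \<ge> N \<Longrightarrow> norm (X m - X n) \<le> e" for n N e
  proof -
    have "(\<integral>\<^sup>+ x. ennreal ((cmod (f x - l2_rep (X n) x))\<^sup>2) \<partial>lborel)
      = (\<integral>\<^sup>+ x. liminf (\<lambda>m. ennreal ((cmod (l2_rep (X m) x - l2_rep (X n) x))\<^sup>2)) \<partial>lborel)"
    proof (rule nn_integral_cong_AE, use fl in eventually_elim)
      case (elim x)
      then have "(\<lambda>m. ennreal ((cmod (l2_rep (X m) x - l2_rep (X n) x))\<^sup>2)) \<longlonglongrightarrow>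
         ennreal ((cmod (f x - l2_rep (X n) x))\<^sup>2)"
        by (intro tendsto_intros tendsto_ennrealI)
      then show ?case by (intro lim_imp_Liminf[symmetric]) auto
    qed
    also have "\<dots> \<le> liminf (\<lambda>m. \<integral>\<^sup>+ x. ennreal ((cmod (l2_rep (X m) x - l2_rep (X n) x))\<^sup>2) \<partial>lborel)"
      by (rule nn_integral_liminf) simp
    also have "(\<lambda>m. \<integral>\<^sup>+ x. ennreal ((cmod (l2_rep (X m) x - l2_rep (X n) x))\<^sup>2) \<partial>lborel)
      = (\<lambda>m. ennreal ((norm (X m - X n))\<^sup>2))"
    proof
      fix m
      show "(\<integral>\<^sup>+ x. ennreal ((cmod (l2_rep (X m) x - l2_rep (X n) x))\<^sup>2) \<partial>lborel) = ennreal ((norm (X m - X n))\<^sup>2)"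
        unfolding nn_integral_l2_rep_sq[symmetric]
        by (rule nn_integral_cong_AE) (use l2_rep_diff_AE[of "X m" "X n"] in auto)
    qed
    also have "liminf \<dots> \<le> limsup \<dots>" by (rule Liminf_le_Limsup) simp
    also have "\<dots> \<le> ennreal (e\<^sup>2)"
      by (rule Limsup_bounded) (use e in \<open>auto simp: eventually_sequentially intro!: exI[of _ N] ennreal_leI power_mono\<close>)
    finally show ?thesis .
  qed
  obtain N where N: "\<And>m. m \<ge> N \<Longrightarrow> norm (X m - X N) \<le> 1"
    using CauchyD[OF C, of 1] by (metis le_refl less_imp_le zero_less_one)
  have "square_integrable (\<lambda>x. f x - l2_rep (X N) x)"
    using fatou[of N N 1] N by (auto simp: square_integrable_def integrable_iff_bounded intro: le_less_trans[of _ 1])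
  from square_integrable_add[OF this square_integrable_l2_rep[of "X N"]]
  have f: "square_integrable f" by simp
  have "X \<longlonglongrightarrow> l2_abs f"
  proof (rule LIMSEQ_I)
    fix e :: real assume "e > 0"
    then obtain N where N: "\<And>m n. m \<ge> N \<Longrightarrow> n \<ge> N \<Longrightarrow> norm (X m - X n) < e / 2"
      using CauchyD[OF C, of "e/2"] by auto
    show "\<exists>N. \<forall>n\<ge>N. norm (X n - l2_abs f) < e"
    proof (intro exI allI impI)
      fix n assume n: "n \<ge> N"
      have "ennreal ((norm (l2_abs f - X n))\<^sup>2)
         = (\<integral>\<^sup>+ x. ennreal ((cmod (f x - l2_rep (X n) x))\<^sup>2) \<partial>lborel)"
        unfolding nn_integral_l2_rep_sq[symmetric]
        by (rule nn_integral_cong_AE)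
          (use l2_rep_diff_AE[of "l2_abs f" "X n"] l2_rep_abs_AE[OF f] in auto)
      also have "\<dots> \<le> ennreal ((e/2)\<^sup>2)"
        by (rule fatou[of N]) (use N n in \<open>auto intro: less_imp_le\<close>)
      finally have "(norm (l2_abs f - X n))\<^sup>2 \<le> (e/2)\<^sup>2" by simp
      then have "norm (l2_abs f - X n) \<le> e/2" using \<open>e > 0\<close> by (simp add: power2_le_iff_abs_le)
      then show "norm (X n - l2_abs f) < e" using \<open>e > 0\<close> by (simp add: norm_minus_commute)
    qed
  qed
  then show ?thesis by (auto simp: convergent_def)
qed

instance l2 :: complete_space
proof
  fix X :: "nat \<Rightarrow> l2" assume C: "Cauchy X"
  \<comment> \<open>The rate \<open>1/3\<close> is taken because its square \<open>1/9\<close> lies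
    below the \<open>1/8\<close> required of the squared increments.\<close>
  have "\<exists>s :: nat \<Rightarrow> nat. strict_mono s \<and> (\<forall>k. \<forall>m\<ge>s k. \<forall>n\<ge>s k. norm (X m - X n) < (1/3)^k)"
  proof -
    have "\<exists>N. \<forall>m\<ge>N. \<forall>n\<ge>N. norm (X m - X n) < (1/3)^k" for k
      using CauchyD[OF C, of "(1/3)^k"] by simp
    then obtain N where N: "\<And>k m n. m \<ge> N k \<Longrightarrow> n \<ge> N k \<Longrightarrow> norm (X m - X n) < (1/3)^k" by metis
    \<comment> \<open>The sum dominates every \<open>N j\<close> with \<open>j \<le> k\<close>, and
      the summand \<open>k\<close> makes \<open>s\<close> strictly increasing.\<close>
    define s where "s k = k + (\<Sum>j\<le>k. N j)" for k
    have "strict_mono s" by (rule strict_monoI_Suc) (simp add: s_def)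
    moreover have "N k \<le> s k" for k
      unfolding s_def using member_le_sum[of k "{..k}" N] by simp
    ultimately show ?thesis by (intro exI[of _ s]) (metis N order_trans)
  qed
  then obtain s :: "nat \<Rightarrow> nat" where s: "strict_mono s"
    and sN: "\<And>k m n. m \<ge> s k \<Longrightarrow> n \<ge> s k \<Longrightarrow> norm (X m - X n) < (1/3)^k" by blast
  have "convergent (X \<circ> s)"
  proof (rule l2_rapidly_Cauchy_convergent)
    fix k
    have "norm (X (s (Suc k)) - X (s k)) < (1/3)^k"
      by (rule sN) (use s in \<open>auto simp: strict_mono_def intro: less_imp_le\<close>)
    then have "(norm (X (s (Suc k)) - X (s k)))\<^sup>2 \<le> ((1/3)^k)\<^sup>2" by (intro power_mono) auto
    also have "\<dots> = (1/9)^k" by (simp add: power2_eq_square flip: power_mult_distrib)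
    also have "\<dots> \<le> (1/8)^k" by (rule power_mono) auto
    finally show "(norm ((X \<circ> s) (Suc k) - (X \<circ> s) k))\<^sup>2 \<le> (1/8)^k" by simp
  qed (rule Cauchy_subseq_Cauchy[OF C s])
  then obtain L where "(X \<circ> s) \<longlonglongrightarrow> L" by (auto simp: convergent_def)
  then have "X \<longlonglongrightarrow> L" by (rule Cauchy_converges_subseq[OF C s])
  then show "convergent X" by (auto simp: convergent_def)
qed

subsection \<open>Orthogonal projection\<close>

lemma orthogonal_projection_exists:
  fixes x :: "'a :: {real_inner, complete_space}"
  assumes S: "subspace S" "closed S"
  obtains y where "y \<in> S" "\<And>z. z \<in> S \<Longrightarrow> (x - y) \<bullet> z = 0"
proof -
  define d where "d = (INF y\<in>S. (norm (x - y))\<^sup>2)"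
  have bdd: "bdd_below ((\<lambda>y. (norm (x - y))\<^sup>2) ` S)" by (rule bdd_belowI[of _ 0]) auto
  have dle: "d \<le> (norm (x - y))\<^sup>2" if "y \<in> S" for y
    unfolding d_def by (rule cINF_lower[OF bdd that])
  have "S \<noteq> {}" using S(1) subspace_0 by auto
  have "\<exists>y\<in>S. (norm (x - y))\<^sup>2 < d + 1 / Suc n" for n
  proof -
    have "d < d + 1 / Suc n" by simp
    then show ?thesis unfolding d_def using cINF_less_iff[OF \<open>S \<noteq> {}\<close> bdd] by blast
  qed
  then obtain Y where Y: "\<And>n. Y n \<in> S" "\<And>n. (norm (x - Y n))\<^sup>2 < d + 1 / Suc n" by metis
  \<comment> \<open>Parallelogram law: the midpoint of \<open>Y m\<close> and \<open>Y n\<close>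
    lies in \<open>S\<close>, so its squared distance from \<open>x\<close> is at least
    \<open>d\<close>, which leaves only the excesses \<open>1 / Suc m\<close> and
    \<open>1 / Suc n\<close>.\<close>
  have YY: "(norm (Y m - Y n))\<^sup>2 \<le> 2 / Suc m + 2 / Suc n" for m n
  proof -
    have mid: "(1/2) *\<^sub>R (Y m + Y n) \<in> S" using S(1) Y by (intro subspace_scale subspace_add)
    have "(norm (Y m - Y n))\<^sup>2 = 2 * (norm (x - Y m))\<^sup>2 + 2 * (norm (x - Y n))\<^sup>2
        - 4 * (norm (x - (1/2) *\<^sub>R (Y m + Y n)))\<^sup>2"
      unfolding power2_norm_eq_inner by (simp add: inner_simps inner_commute) (simp add: field_simps)
    moreover have "2 / real (Suc m) = 2 * (1 / Suc m)" "2 / real (Suc n) = 2 * (1 / Suc n)" by simp_all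
    ultimately show ?thesis using dle[OF mid] Y(2)[of m] Y(2)[of n] by linarith
  qed
  have "Cauchy Y"
  proof (rule CauchyI)
    fix e :: real assume e: "e > 0"
    obtain N where N: "4 / e\<^sup>2 < real N" using reals_Archimedean2 by blast
    then have N: "4 / e\<^sup>2 < real (Suc N)" by simp
    show "\<exists>M. \<forall>m\<ge>M. \<forall>n\<ge>M. norm (Y m - Y n) < e"
    proof (intro exI allI impI)
      fix m n assume mn: "m \<ge> N" "n \<ge> N"
      have "(norm (Y m - Y n))\<^sup>2 \<le> 2 / Suc m + 2 / Suc n" by (rule YY)
      also have "\<dots> \<le> 2 / Suc N + 2 / Suc N" using mn by (intro add_mono divide_left_mono) auto
      also have "\<dots> = 4 / real (Suc N)" by (simp add: add_divide_distrib[symmetric] del: of_nat_Suc)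
      also have "\<dots> < e\<^sup>2" using N e by (simp add: field_simps)
      finally show "norm (Y m - Y n) < e" using e by (simp add: power2_less_imp_less)
    qed
  qed
  then obtain y where y: "Y \<longlonglongrightarrow> y" using Cauchy_convergent convergent_def by blast
  have yS: "y \<in> S" using closed_sequentially[OF S(2) _ y] Y by auto
  have yd: "(norm (x - y))\<^sup>2 = d"
  proof (rule antisym)
    have "(\<lambda>n. (norm (x - Y n))\<^sup>2) \<longlonglongrightarrow> (norm (x - y))\<^sup>2" by (intro tendsto_intros y)
    moreover have "(\<lambda>n. d + 1 / Suc n) \<longlonglongrightarrow> d + 0"
      by (intro tendsto_intros LIMSEQ_Suc[OF lim_1_over_n, unfolded o_def])
    ultimately show "(norm (x - y))\<^sup>2 \<le> d"
      using LIMSEQ_le[of "\<lambda>n. (norm (x - Y n))\<^sup>2" "(norm (x - y))\<^sup>2" "\<lambda>n. d + 1 / real (Suc n)" "d + 0"]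
        less_imp_le[OF Y(2)] by simp
  qed (rule dle[OF yS])
  have "(x - y) \<bullet> z = 0" if z: "z \<in> S" for z
  proof (cases "z = 0")
    case False
    \<comment> \<open>This is the \<open>t\<close> at which the squared distance from
      \<open>x\<close> to \<open>y + t *\<^sub>R z\<close> is least; minimality of \<open>y\<close>
      forces it to be \<open>0\<close>.\<close>
    define t where "t = ((x - y) \<bullet> z) / (z \<bullet> z)"
    have "y + t *\<^sub>R z \<in> S" using S(1) yS z by (intro subspace_add subspace_scale)
    from dle[OF this] have "(norm (x - y))\<^sup>2 \<le> (norm (x - (y + t *\<^sub>R z)))\<^sup>2" by (simp add: yd)
    also have "\<dots> = (norm (x - y))\<^sup>2 - 2 * t * ((x - y) \<bullet> z) + t\<^sup>2 * (z \<bullet> z)"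
      unfolding power2_norm_eq_inner by (simp add: inner_simps inner_commute power2_eq_square algebra_simps)
    finally have "2 * t * ((x - y) \<bullet> z) \<le> t\<^sup>2 * (z \<bullet> z)" by simp
    moreover have "t * (z \<bullet> z) = (x - y) \<bullet> z" using False by (simp add: t_def)
    ultimately have "2 * t * (t * (z \<bullet> z)) \<le> t * (t * (z \<bullet> z))" by (simp add: power2_eq_square mult.assoc)
    then have "t * (t * (z \<bullet> z)) \<le> 0" by simp
    moreover have "z \<bullet> z > 0" using False by simp
    ultimately have "t = 0" by (metis mult_pos_pos mult_neg_neg linorder_not_le linorder_neqE_linordered_idom mult.assoc not_real_square_gt_zero)
    then show ?thesis using \<open>t * (z \<bullet> z) = (x - y) \<bullet> z\<close> by simp
  qed simp
  with that yS show thesis by blast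
qed

lemma subspace_closure:
  fixes S :: "'a :: real_normed_vector set"
  assumes "subspace S"
  shows "subspace (closure S)"
proof (rule subspaceI)
  show "0 \<in> closure S" using assms subspace_0 closure_subset by blast
  show "x + y \<in> closure S" if xy: "x \<in> closure S" "y \<in> closure S" for x y
  proof -
    obtain X Y where "\<And>n. X n \<in> S" "X \<longlonglongrightarrow> x" "\<And>n. Y n \<in> S" "Y \<longlonglongrightarrow> y"
      using xy unfolding closure_sequential by blast
    then have "(\<lambda>n. X n + Y n) \<longlonglongrightarrow> x + y" "\<And>n. X n + Y n \<in> S"
      using assms by (auto intro: tendsto_add subspace_add)
    then show ?thesis unfolding closure_sequential by (intro exI[of _ "\<lambda>n. X n + Y n"]) auto
  qed
  show "c *\<^sub>R x \<in> closure S" if xy: "x \<in> closure S" for c x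
  proof -
    obtain X where "\<And>n. X n \<in> S" "X \<longlonglongrightarrow> x"
      using xy unfolding closure_sequential by blast
    then have "(\<lambda>n. c *\<^sub>R X n) \<longlonglongrightarrow> c *\<^sub>R x" "\<And>n. c *\<^sub>R X n \<in> S"
      using assms by (auto intro: tendsto_intros subspace_scale)
    then show ?thesis unfolding closure_sequential by (intro exI[of _ "\<lambda>n. c *\<^sub>R X n"]) auto
  qed
qed

lemma closure_eq_UNIV_if_orthogonal_trivial:
  fixes S :: "'a :: {real_inner, complete_space} set"
  assumes "subspace S" "\<And>x. (\<And>z. z \<in> S \<Longrightarrow> x \<bullet> z = 0) \<Longrightarrow> x = 0"
  shows "closure S = UNIV"
proof -
  have "x \<in> closure S" for x
  proof -
    obtain y where y: "y \<in> closure S" "\<And>z. z \<in> closure S \<Longrightarrow> (x - y) \<bullet> z = 0"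
      using orthogonal_projection_exists[OF subspace_closure[OF assms(1)] closed_closure] by blast
    have "x - y = 0" by (rule assms(2)) (use y closure_subset in blast)
    then show ?thesis using y by simp
  qed
  then show ?thesis by auto
qed

subsection \<open>Smooth functions\<close>

text \<open>\<open>test_function\<close> speaks of iterates of \<open>deriv\<close>. Exhibiting a
  derivative in each step instead lets the closure properties be proved by induction on
  \<open>n\<close>, without computing any \<open>deriv\<close>;
  \<open>times_differentiable_iff_deriv\<close> translates back.\<close>

fun times_differentiable :: "nat \<Rightarrow> (real \<Rightarrow> real) \<Rightarrow> bool" where
  "times_differentiable 0 f \<longleftrightarrow> True"
| "times_differentiable (Suc n) f \<longleftrightarrow>
     (\<exists>f'. (\<forall>x. (f has_real_derivative f' x) (at x)) \<and> times_differentiable n f')"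

lemma times_differentiable_Suc_deriv:
  "times_differentiable (Suc n) f \<longleftrightarrow>
     (\<forall>x. f field_differentiable at x) \<and> times_differentiable n (deriv f)"
proof
  assume "times_differentiable (Suc n) f"
  then obtain f' where f': "\<And>x. (f has_real_derivative f' x) (at x)" "times_differentiable n f'" by auto
  then have "deriv f = f'" by (intro ext DERIV_imp_deriv)
  with f' show "(\<forall>x. f field_differentiable at x) \<and> times_differentiable n (deriv f)"
    by (auto simp: field_differentiable_def)
next
  assume "(\<forall>x. f field_differentiable at x) \<and> times_differentiable n (deriv f)"
  then show "times_differentiable (Suc n) f"
    by (auto simp: field_differentiable_derivI intro!: exI[of _ "deriv f"])
qed

lemma times_differentiable_iff_deriv:
  "times_differentiable n f \<longleftrightarrow> (\<forall>m<n. \<forall>x. (deriv ^^ m) f field_differentiable at x)"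
proof (induction n arbitrary: f)
  case (Suc n)
  have "(\<forall>m<Suc n. P m) \<longleftrightarrow> P 0 \<and> (\<forall>m<n. P (Suc m))" for P
    by (metis less_Suc_eq_0_disj Suc_less_eq)
  then show ?case unfolding times_differentiable_Suc_deriv Suc.IH
    by (simp add: funpow_Suc_right del: funpow.simps(2))
qed simp

lemma times_differentiable_Suc_imp: "times_differentiable (Suc n) f \<Longrightarrow> times_differentiable n f"
  unfolding times_differentiable_iff_deriv by simp

definition smooth :: "(real \<Rightarrow> real) \<Rightarrow> bool" where
  "smooth f \<longleftrightarrow> (\<forall>n. times_differentiable n f)"

lemma test_function_iff_smooth: "test_function f \<longleftrightarrow> smooth f \<and> (\<exists>R. \<forall>x. \<bar>x\<bar> > R \<longrightarrow> f x = 0)"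
  unfolding test_function_def smooth_def times_differentiable_iff_deriv by (metis lessI)

lemma times_differentiable_const: "times_differentiable n (\<lambda>x. c)"
proof (induction n arbitrary: c)
  case (Suc n)
  show ?case using Suc[of 0] by (auto intro!: exI[of _ "\<lambda>x. 0"] derivative_eq_intros)
qed simp

lemma times_differentiable_add:
  "times_differentiable n f \<Longrightarrow> times_differentiable n g \<Longrightarrow> times_differentiable n (\<lambda>x. f x + g x)"
proof (induction n arbitrary: f g)
  case (Suc n)
  then obtain f' g' where "\<And>x. (f has_real_derivative f' x) (at x)" "times_differentiable n f'"
    "\<And>x. (g has_real_derivative g' x) (at x)" "times_differentiable n g'" by auto
  then show ?case using Suc.IH by (auto intro!: exI[of _ "\<lambda>x. f' x + g' x"] derivative_eq_intros)
qed simp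

lemma times_differentiable_mult:
  "times_differentiable n f \<Longrightarrow> times_differentiable n g \<Longrightarrow> times_differentiable n (\<lambda>x. f x * g x)"
proof (induction n arbitrary: f g)
  case (Suc n)
  then obtain f' g' where d: "\<And>x. (f has_real_derivative f' x) (at x)" "times_differentiable n f'"
    "\<And>x. (g has_real_derivative g' x) (at x)" "times_differentiable n g'" by auto
  have "times_differentiable n (\<lambda>x. f' x * g x + f x * g' x)"
    using Suc d by (intro times_differentiable_add) (auto intro: times_differentiable_Suc_imp simp del: times_differentiable.simps)
  moreover have "((\<lambda>x. f x * g x) has_real_derivative f' x * g x + f x * g' x) (at x)" for x
    using d by (auto intro!: derivative_eq_intros)
  ultimately show ?case by (auto intro!: exI[of _ "\<lambda>x. f' x * g x + f x * g' x"])
qed simp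

lemma times_differentiable_inverse:
  "times_differentiable n f \<Longrightarrow> (\<And>x. f x \<noteq> 0) \<Longrightarrow> times_differentiable n (\<lambda>x. inverse (f x))"
proof (induction n arbitrary: f)
  case (Suc n)
  then obtain f' where d: "\<And>x. (f has_real_derivative f' x) (at x)" "times_differentiable n f'" by auto
  have i: "times_differentiable n (\<lambda>x. inverse (f x))"
    using Suc.IH[of f] Suc.prems times_differentiable_Suc_imp by blast
  have "times_differentiable n (\<lambda>x. (- 1) * (f' x * (inverse (f x) * inverse (f x))))"
    by (intro times_differentiable_mult times_differentiable_const i d)
  moreover have "((\<lambda>x. inverse (f x)) has_real_derivative (- 1) * (f' x * (inverse (f x) * inverse (f x)))) (at x)" for x
    using d Suc.prems(2) by (auto intro!: derivative_eq_intros simp: power2_eq_square)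
  ultimately show ?case by (auto intro!: exI[of _ "\<lambda>x. (- 1) * (f' x * (inverse (f x) * inverse (f x)))"])
qed simp

lemma times_differentiable_affine:
  "times_differentiable n f \<Longrightarrow> times_differentiable n (\<lambda>x. f (a * x + b))"
proof (induction n arbitrary: f)
  case (Suc n)
  then obtain f' where d: "\<And>x. (f has_real_derivative f' x) (at x)" "times_differentiable n f'" by auto
  have "times_differentiable n (\<lambda>x. a * f' (a * x + b))"
    by (intro times_differentiable_mult times_differentiable_const Suc.IH d)
  moreover have "((\<lambda>x. f (a * x + b)) has_real_derivative a * f' (a * x + b)) (at x)" for x
  proof -
    have "((\<lambda>x. a * x + b) has_real_derivative a) (at x)" by (auto intro!: derivative_eq_intros)
    from DERIV_chain2[OF d(1) this] show ?thesis by (simp add: mult.commute)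
  qed
  ultimately show ?case by (auto intro!: exI[of _ "\<lambda>x. a * f' (a * x + b)"])
qed simp

lemma smooth_const [intro]: "smooth (\<lambda>x. c)"
  and smooth_add [intro]: "smooth f \<Longrightarrow> smooth g \<Longrightarrow> smooth (\<lambda>x. f x + g x)"
  and smooth_mult [intro]: "smooth f \<Longrightarrow> smooth g \<Longrightarrow> smooth (\<lambda>x. f x * g x)"
  and smooth_inverse: "smooth f \<Longrightarrow> (\<And>x. f x \<noteq> 0) \<Longrightarrow> smooth (\<lambda>x. inverse (f x))"
  and smooth_affine: "smooth f \<Longrightarrow> smooth (\<lambda>x. f (a * x + b))"
  by (auto simp: smooth_def times_differentiable_const times_differentiable_add
      times_differentiable_mult times_differentiable_inverse times_differentiable_affine)

lemma smooth_antiderivative: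
  assumes "\<And>x. (f has_real_derivative f' x) (at x)" "smooth f'"
  shows "smooth f"
  unfolding smooth_def
proof
  show "times_differentiable n f" for n
    using assms by (cases n) (auto simp: smooth_def)
qed

lemma smooth_ident [intro]: "smooth (\<lambda>x. x)"
  by (rule smooth_antiderivative[of _ "\<lambda>x. 1"]) (auto intro!: derivative_eq_intros)

lemma smooth_exp: "smooth (\<lambda>x. exp x)"
  unfolding smooth_def
proof
  show "times_differentiable n (\<lambda>x. exp x)" for n
    by (induction n) (auto intro!: exI[of _ exp] derivative_eq_intros)
qed

lemma smooth_exp_minus: "smooth (\<lambda>x. exp (- x))"
  using smooth_affine[OF smooth_exp, of "-1" 0] by simp

lemma smooth_deriv: "smooth f \<Longrightarrow> smooth (deriv f)"
  by (metis smooth_def times_differentiable_Suc_deriv)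

lemma smooth_has_deriv: "smooth f \<Longrightarrow> (f has_real_derivative deriv f x) (at x)"
  by (metis smooth_def times_differentiable_Suc_deriv field_differentiable_derivI)

lemma smooth_continuous: "smooth f \<Longrightarrow> continuous_on A f"
  by (metis smooth_has_deriv DERIV_continuous continuous_at_imp_continuous_on)

text \<open>The factor \<open>y ^ n\<close> absorbs the power that each \<open>pCons\<close>
  contributes, so the induction closes with \<open>n\<close> arbitrary. The case
  \<open>n = 1\<close> later yields the difference quotient of \<open>poly_exp p\<close> at
  \<open>0\<close>.\<close>

lemma tendsto_poly_power_div_exp_0: "((\<lambda>y::real. poly p y * y ^ n / exp y) \<longlongrightarrow> 0) at_top"
proof (induction p arbitrary: n)
  case (pCons a p)
  have "((\<lambda>y::real. a * (y ^ n / exp y) + poly p y * y ^ Suc n / exp y) \<longlongrightarrow> a * 0 + 0) at_top"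
    by (intro tendsto_intros tendsto_power_div_exp_0 pCons.IH)
  then show ?case by (simp add: add_divide_distrib algebra_simps)
qed simp

text \<open>The functions \<open>p(1/x) * exp(-1/x)\<close>, continued by \<open>0\<close>, form a
  class closed under differentiation: \<open>p\<close> is replaced by \<open>X^2 * (p - p')\<close>.
  One derivative computation therefore gives smoothness of all orders, the point \<open>0\<close>
  included.\<close>

definition poly_exp :: "real poly \<Rightarrow> real \<Rightarrow> real" where
  "poly_exp p x = (if x > 0 then poly p (1 / x) * exp (- (1 / x)) else 0)"

lemma poly_exp_has_derivative:
  "(poly_exp p has_real_derivative poly_exp (monom 1 2 * (p - pderiv p)) x) (at x)"
proof -
  consider "x > 0" | "x = 0" | "x < 0" by linarith
  then show ?thesis
  proof cases
    case 1
    have "((\<lambda>x. poly p (1 / x) * exp (- (1 / x))) has_real_derivative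
       poly_exp (monom 1 2 * (p - pderiv p)) x) (at x)"
      using 1 by (auto intro!: derivative_eq_intros DERIV_chain'[OF _ poly_DERIV]
          simp: poly_exp_def poly_monom power2_eq_square field_simps)
    then show ?thesis
    proof (rule DERIV_cong_ev[OF refl _ refl, THEN iffD1, rotated])
      show "\<forall>\<^sub>F y in nhds x. poly p (1 / y) * exp (- (1 / y)) = poly_exp p y"
        using eventually_nhds_in_open[of "{0<..}" x] 1 by (auto elim!: eventually_mono simp: poly_exp_def)
    qed
  next
    case 3
    have "((\<lambda>x. 0) has_real_derivative poly_exp (monom 1 2 * (p - pderiv p)) x) (at x)"
      using 3 by (auto simp: poly_exp_def)
    then show ?thesis
    proof (rule DERIV_cong_ev[OF refl _ refl, THEN iffD1, rotated])
      show "\<forall>\<^sub>F y in nhds x. 0 = poly_exp p y"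
        using eventually_nhds_in_open[of "{..<0}" x] 3 by (auto elim!: eventually_mono simp: poly_exp_def)
    qed
  next
    case 2
    \<comment> \<open>With \<open>y = 1 / h\<close> the factor \<open>y ^ 1\<close> is the
      \<open>1 / h\<close> of the difference quotient at \<open>0\<close>.\<close>
    have "((\<lambda>y. poly p y * y ^ 1 / exp y) \<longlongrightarrow> 0) at_top" by (rule tendsto_poly_power_div_exp_0)
    then have "((\<lambda>h. poly p (inverse h) * inverse h ^ 1 / exp (inverse h)) \<longlongrightarrow> 0) (at_right 0)"
      by (rule filterlim_compose[OF _ filterlim_inverse_at_top_right])
    then have r: "((\<lambda>h. poly_exp p h / h) \<longlongrightarrow> 0) (at_right 0)"
      by (rule Lim_transform_eventually)
        (auto simp: eventually_at_right_less poly_exp_def field_simps exp_minus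
          intro!: eventually_mono[OF eventually_at_right_less[of 0]])
    have l: "((\<lambda>h. poly_exp p h / h) \<longlongrightarrow> 0) (at_left 0)"
      by (rule Lim_transform_eventually[OF tendsto_const])
        (auto simp: poly_exp_def eventually_at_filter)
    have "((\<lambda>h. poly_exp p h / h) \<longlongrightarrow> 0) (at 0)"
      using l r by (simp add: filterlim_at_split)
    then show ?thesis using 2 by (simp add: DERIV_def poly_exp_def)
  qed
qed

lemma smooth_poly_exp: "smooth (poly_exp p)"
  unfolding smooth_def
proof
  show "times_differentiable n (poly_exp p)" for n
    by (induction n arbitrary: p) (auto intro: poly_exp_has_derivative)
qed

definition hexp :: "real \<Rightarrow> real" where
  "hexp x = (if x > 0 then exp (- (1 / x)) else 0)"

lemma hexp_eq_poly_exp: "hexp = poly_exp 1"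
  by (simp add: fun_eq_iff hexp_def poly_exp_def)

lemma smooth_hexp: "smooth hexp"
  by (simp add: hexp_eq_poly_exp smooth_poly_exp)

lemma hexp_has_derivative: "(hexp has_real_derivative hexp x / x\<^sup>2) (at x)"
proof -
  have "poly_exp (monom 1 2 * (1 - pderiv 1)) x = hexp x / x\<^sup>2"
    by (simp add: poly_exp_def hexp_def poly_monom power_divide)
  then show ?thesis using poly_exp_has_derivative[of 1 x] by (simp add: hexp_eq_poly_exp[symmetric])
qed

lemma hexp_bounds: "0 \<le> hexp x" "hexp x \<le> 1"
  by (auto simp: hexp_def)

text \<open>Each factor \<open>exp(- 1 / (n * y))\<close>, with \<open>y\<close> the distance from
  an end point, vanishes to infinite order at that end and tends to \<open>1\<close> inside. As a
  function of \<open>n * y\<close> it has a fixed profile, so the weighted energy can be computed by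
  scaling; the transition is not confined to a layer near the ends, but its derivative decays
  quadratically in \<open>n * y\<close>.\<close>

definition bump :: "real \<Rightarrow> real \<Rightarrow> nat \<Rightarrow> real \<Rightarrow> real" where
  "bump a b n x = hexp (real n * (x - a)) * hexp (real n * (b - x))"

lemma smooth_bump: "smooth (bump a b n)"
proof -
  have "smooth (\<lambda>x. hexp (real n * x + (- real n * a)) * hexp (- real n * x + real n * b))"
    by (intro smooth_mult smooth_affine smooth_hexp)
  then show ?thesis by (simp add: bump_def[abs_def] algebra_simps)
qed

lemma bump_bounds: "0 \<le> bump a b n x" "bump a b n x \<le> 1"
  by (auto simp: bump_def hexp_bounds intro!: mult_nonneg_nonneg mult_le_one)

lemma bump_eq_0: "x \<notin> {a<..<b} \<Longrightarrow> bump a b n x = 0"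
  by (auto simp: bump_def hexp_def zero_less_mult_iff)

lemma test_function_bump: "test_function (bump a b n)"
  unfolding test_function_iff_smooth
  by (intro conjI smooth_bump exI[of _ "\<bar>a\<bar> + \<bar>b\<bar>"]) (auto intro!: bump_eq_0)

lemma hexp_tendsto_1: "x > 0 \<Longrightarrow> (\<lambda>n. hexp (real n * x)) \<longlonglongrightarrow> 1"
proof -
  assume x: "x > 0"
  have "(\<lambda>n. exp (- (1 / real n * (1 / x)))) \<longlonglongrightarrow> exp (- (0 * (1 / x)))"
    by (intro tendsto_intros lim_1_over_n)
  then have "(\<lambda>n. exp (- (1 / real n * (1 / x)))) \<longlonglongrightarrow> 1" by simp
  then show ?thesis
    by (rule Lim_transform_eventually)
      (auto simp: hexp_def x intro!: eventually_mono[OF eventually_gt_at_top[of 0]])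
qed

lemma bump_tendsto: "(\<lambda>n. bump a b n x) \<longlonglongrightarrow> indicator {a<..<b} x"
proof (cases "x \<in> {a<..<b}")
  case True
  then have "(\<lambda>n. bump a b n x) \<longlonglongrightarrow> 1 * 1"
    unfolding bump_def by (intro tendsto_mult hexp_tendsto_1) auto
  with True show ?thesis by simp
qed (simp add: bump_eq_0)

subsection \<open>Test functions\<close>

lemma test_function_smooth: "test_function \<eta> \<Longrightarrow> smooth \<eta>"
  by (simp add: test_function_iff_smooth)

lemma test_function_support:
  assumes "test_function \<eta>"
  obtains R where "R > 0" "\<And>x. \<bar>x\<bar> > R \<Longrightarrow> \<eta> x = 0"
proof -
  obtain R where "\<And>x. \<bar>x\<bar> > R \<Longrightarrow> \<eta> x = 0" using assms by (auto simp: test_function_iff_smooth)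
  then have "\<eta> x = 0" if "\<bar>x\<bar> > \<bar>R\<bar> + 1" for x using that by auto
  then show thesis by (intro that[of "\<bar>R\<bar> + 1"]) auto
qed

lemma test_function_smooth_mult:
  assumes "test_function \<eta>" "smooth f"
  shows "test_function (\<lambda>x. f x * \<eta> x)"
  using assms by (auto simp: test_function_iff_smooth)

lemma test_function_lincomb:
  assumes "test_function \<eta>" "test_function \<zeta>"
  shows "test_function (\<lambda>x. \<eta> x + c * \<zeta> x)"
proof -
  obtain R R' where "\<And>x. \<bar>x\<bar> > R \<Longrightarrow> \<eta> x = 0" "\<And>x. \<bar>x\<bar> > R' \<Longrightarrow> \<zeta> x = 0"
    using assms test_function_support by metis
  then have "\<forall>x. \<bar>x\<bar> > max R R' \<longrightarrow> \<eta> x + c * \<zeta> x = 0" by auto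
  moreover have "smooth (\<lambda>x. \<eta> x + c * \<zeta> x)"
    by (intro smooth_add smooth_mult smooth_const) (use assms in \<open>auto simp: test_function_iff_smooth\<close>)
  ultimately show ?thesis unfolding test_function_iff_smooth by blast
qed

lemma test_function_deriv:
  assumes "test_function \<eta>"
  shows "test_function (deriv \<eta>)"
proof -
  obtain R where R: "\<And>x. \<bar>x\<bar> > R \<Longrightarrow> \<eta> x = 0" using assms test_function_support by metis
  have "deriv \<eta> x = 0" if "\<bar>x\<bar> > R" for x
  proof (rule DERIV_imp_deriv)
    have "((\<lambda>x. 0) has_real_derivative 0) (at x)" by simp
    then show "(\<eta> has_real_derivative 0) (at x)"
    proof (rule DERIV_cong_ev[OF refl _ refl, THEN iffD1, rotated])
      have "open {x::real. \<bar>x\<bar> > R}" by (intro open_Collect_less continuous_intros)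
      then show "\<forall>\<^sub>F y in nhds x. 0 = \<eta> y"
        using eventually_nhds_in_open[of "{x. \<bar>x\<bar> > R}" x] that R by (auto elim!: eventually_mono)
    qed
  qed
  then show ?thesis using assms by (auto simp: test_function_iff_smooth intro: smooth_deriv)
qed

lemma integrable_compact_support:
  fixes f :: "real \<Rightarrow> 'a :: {banach, second_countable_topology}"
  assumes c: "continuous_on UNIV f" and s: "\<And>x. \<bar>x\<bar> > R \<Longrightarrow> f x = 0"
  shows "integrable lborel f"
proof -
  have "set_integrable lborel {-R..R} f"
    by (rule borel_integrable_atLeastAtMost') (use c continuous_on_subset in blast)
  moreover have "(\<lambda>x. indicat_real {-R..R} x *\<^sub>R f x) = f"
    using s by (auto simp: fun_eq_iff indicator_def)
  ultimately show ?thesis by (simp add: set_integrable_def)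
qed

lemma integral_derivative_compact_support:
  fixes f :: "real \<Rightarrow> 'a :: euclidean_space"
  assumes d: "\<And>x. (F has_vector_derivative f x) (at x)"
    and c: "continuous_on UNIV f" and s: "\<And>x. \<bar>x\<bar> > R \<Longrightarrow> F x = 0"
  shows "(LINT x|lborel. f x) = 0"
proof -
  \<comment> \<open>Enlarged by \<open>1\<close> so that \<open>F\<close> vanishes at the end points
    \<open>R'\<close> and \<open>- R'\<close> themselves; the hypothesis speaks of
    \<open>\<bar>x\<bar> > R\<close> strictly.\<close>
  define R' where "R' = \<bar>R\<bar> + 1"
  have s': "F x = 0" if "\<bar>x\<bar> \<ge> R'" for x using s that by (auto simp: R'_def)
  have f0: "f x = 0" if "\<bar>x\<bar> > R'" for x
  proof -
    have "((\<lambda>x. 0) has_vector_derivative f x) (at x)"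
    proof (rule has_vector_derivative_transform_within_open[OF d])
      show "open {x. \<bar>x\<bar> > R'}" by (intro open_Collect_less continuous_intros)
    qed (use s' that in auto)
    then show ?thesis using vector_derivative_unique_at[OF _ has_vector_derivative_const] by blast
  qed
  have "(LINT x|lborel. indicator {-R'..R'} x *\<^sub>R f x) = F R' - F (- R')"
    by (rule integral_FTC_atLeastAtMost)
      (use d c in \<open>auto simp: R'_def intro: has_vector_derivative_at_within continuous_on_subset\<close>)
  moreover have "(\<lambda>x. indicator {-R'..R'} x *\<^sub>R f x) = f"
    using f0 by (auto simp: fun_eq_iff indicator_def)
  ultimately show ?thesis by (simp add: s')
qed

lemma test_function_continuous: "test_function \<eta> \<Longrightarrow> continuous_on A \<eta>"
  by (intro smooth_continuous test_function_smooth)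

lemma borel_measurable_smooth: "smooth f \<Longrightarrow> f \<in> borel_measurable borel"
  by (intro borel_measurable_continuous_onI smooth_continuous)

lemma borel_measurable_test_function: "test_function f \<Longrightarrow> f \<in> borel_measurable borel"
  by (intro borel_measurable_smooth test_function_smooth)

lemma integrable_test_function: "test_function \<eta> \<Longrightarrow> integrable lborel \<eta>"
  using test_function_support[of \<eta>] integrable_compact_support[OF test_function_continuous, of \<eta>] by metis

lemma integral_deriv_test_function: "test_function \<eta> \<Longrightarrow> (LINT x|lborel. deriv \<eta> x) = 0"
  by (rule test_function_support[of \<eta>], assumption,
      rule integral_derivative_compact_support[of \<eta>])
    (auto simp: has_real_derivative_iff_has_vector_derivative[symmetric]
      intro: smooth_has_deriv test_function_smooth test_function_continuous test_function_deriv)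

lemma square_integrable_of_real_test_function:
  assumes "test_function \<eta>"
  shows "square_integrable (\<lambda>x. complex_of_real (\<eta> x))"
proof -
  have "test_function (\<lambda>x. \<eta> x * \<eta> x)"
    by (intro test_function_smooth_mult assms test_function_smooth)
  then show ?thesis
    using borel_measurable_test_function[OF assms] integrable_test_function[of "\<lambda>x. \<eta> x * \<eta> x"]
    by (auto simp: square_integrable_def power2_eq_square)
qed

section \<open>Test functions as elements of \<open>l2\<close>, and their weak derivatives\<close>

definition emb :: "(real \<Rightarrow> real) \<Rightarrow> l2" where
  "emb \<eta> = l2_abs (\<lambda>x. complex_of_real (\<eta> x))"

lemma cinner_emb:
  assumes "test_function \<eta>"
  shows "cinner \<phi> (emb \<eta>) = (LINT x|lborel. \<eta> x *\<^sub>R l2_rep \<phi> x)"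
proof -
  have "cinner \<phi> (emb \<eta>) = cinner (l2_abs (l2_rep \<phi>)) (emb \<eta>)" by (simp add: l2_abs_rep)
  also have "\<dots> = (LINT x|lborel. l2_rep \<phi> x * cnj (complex_of_real (\<eta> x)))"
    unfolding emb_def
    by (intro cinner_l2_abs square_integrable_l2_rep square_integrable_of_real_test_function assms)
  finally show ?thesis by (simp add: scaleR_conv_of_real mult.commute)
qed

text \<open>Test functions are real, so conjugation in the second argument does no harm, and the
  distributional identity becomes a family of continuous linear conditions on the pair. That
  \<open>weak_derivative\<close> is a closed subspace is then immediate.\<close>

lemma weak_derivative_iff:
  "(\<phi>, \<psi>) \<in> weak_derivative \<longleftrightarrow>
     (\<forall>\<eta>. test_function \<eta> \<longrightarrow> cinner \<phi> (emb (deriv \<eta>)) = - cinner \<psi> (emb \<eta>))"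
  by (auto simp: weak_derivative_def cinner_emb test_function_deriv)

lemma emb_weak_derivative:
  assumes "test_function \<eta>"
  shows "(emb \<eta>, emb (deriv \<eta>)) \<in> weak_derivative"
  unfolding weak_derivative_iff
proof (intro allI impI)
  fix \<zeta> assume z: "test_function \<zeta>"
  have p: "test_function (\<lambda>x. \<eta> x * \<zeta> x)" "test_function (\<lambda>x. \<eta> x * deriv \<zeta> x)" "test_function (\<lambda>x. deriv \<eta> x * \<zeta> x)"
    using assms z by (auto intro!: test_function_smooth_mult intro: test_function_smooth test_function_deriv)
  have "deriv (\<lambda>x. \<eta> x * \<zeta> x) x = \<eta> x * deriv \<zeta> x + deriv \<eta> x * \<zeta> x" for x
    using smooth_has_deriv[OF test_function_smooth[OF assms]] smooth_has_deriv[OF test_function_smooth[OF z]]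
    by (intro DERIV_imp_deriv) (auto intro!: derivative_eq_intros)
  then have "(LINT x|lborel. \<eta> x * deriv \<zeta> x + deriv \<eta> x * \<zeta> x) = 0"
    using integral_deriv_test_function[OF p(1)] by simp
  then have "(LINT x|lborel. \<eta> x * deriv \<zeta> x) = - (LINT x|lborel. deriv \<eta> x * \<zeta> x)"
    using p(2,3)[THEN integrable_test_function] by simp
  then have "(LINT x|lborel. complex_of_real (\<eta> x * deriv \<zeta> x)) = - (LINT x|lborel. complex_of_real (deriv \<eta> x * \<zeta> x))"
    unfolding integral_complex_of_real by simp
  then show "cinner (emb \<eta>) (emb (deriv \<zeta>)) = - cinner (emb (deriv \<eta>)) (emb \<zeta>)"
    unfolding emb_def
    by (simp add: cinner_l2_abs square_integrable_of_real_test_function test_function_deriv assms z)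
qed

subsection \<open>The fundamental lemma of the calculus of variations\<close>

text \<open>Since \<open>ennreal\<close> truncates at \<open>0\<close>, the two densities are the
  positive and the negative part of \<open>f\<close>. The measures they define agree and are finite
  on all half lines, hence coincide; by uniqueness of densities both parts are equal almost
  everywhere, and as one of them is always \<open>0\<close>, so is \<open>f\<close>.\<close>

lemma AE_eq_0_if_integral_Ioi_eq_0:
  fixes f :: "real \<Rightarrow> real"
  assumes f: "integrable lborel f"
    and z: "\<And>x. (LINT y|lborel. indicator {x<..} y *\<^sub>R f y) = 0"
  shows "AE x in lborel. f x = 0"
proof -
  have [measurable]: "f \<in> borel_measurable borel" using f by auto
  let ?M = "density lborel (\<lambda>x. ennreal (f x))" and ?N = "density lborel (\<lambda>x. ennreal (- f x))"
  have fin: "(\<integral>\<^sup>+ y. ennreal (indicator {x<..} y * f y) \<partial>lborel) < \<infinity>"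
    "(\<integral>\<^sup>+ y. ennreal (- (indicator {x<..} y * f y)) \<partial>lborel) < \<infinity>" for x
  proof -
    have "integrable lborel (\<lambda>y. indicator {x<..} y * f y)"
      using integrable_mult_indicator[OF _ f, of "{x<..}"] by simp
    then show "(\<integral>\<^sup>+ y. ennreal (indicator {x<..} y * f y) \<partial>lborel) < \<infinity>"
      "(\<integral>\<^sup>+ y. ennreal (- (indicator {x<..} y * f y)) \<partial>lborel) < \<infinity>"
      by (auto simp: real_integrable_def top.not_eq_extremum)
  qed
  have em: "emeasure ?M {x<..} = (\<integral>\<^sup>+ y. ennreal (indicator {x<..} y * f y) \<partial>lborel)"
    "emeasure ?N {x<..} = (\<integral>\<^sup>+ y. ennreal (- (indicator {x<..} y * f y)) \<partial>lborel)" for x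
    by (auto simp: emeasure_density intro!: nn_integral_cong split: split_indicator)
  have "?M = ?N"
  proof (rule measure_eqI_lessThan)
    fix x
    show "emeasure ?M {x<..} < \<infinity>" using fin em by simp
    have "integrable lborel (\<lambda>y. indicator {x<..} y * f y)"
      using integrable_mult_indicator[OF _ f, of "{x<..}"] by simp
    from real_lebesgue_integral_def[OF this] z[of x]
    have "enn2real (\<integral>\<^sup>+ y. ennreal (indicator {x<..} y * f y) \<partial>lborel)
      = enn2real (\<integral>\<^sup>+ y. ennreal (- (indicator {x<..} y * f y)) \<partial>lborel)" by simp
    then show "emeasure ?M {x<..} = emeasure ?N {x<..}"
      unfolding em using fin[of x] by (metis ennreal_enn2real infinity_ennreal_def)
  qed auto
  then have "AE x in lborel. ennreal (f x) = ennreal (- f x)"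
    by (subst (asm) sigma_finite_measure.density_unique_iff[OF sigma_finite_lborel]) auto
  then show ?thesis
  proof eventually_elim
    case (elim x)
    then show ?case by (cases "f x" "0 :: real" rule: linorder_cases) (auto simp: ennreal_neg)
  qed
qed

lemma AE_eq_0_if_interval_integrals_eq_0:
  fixes f :: "real \<Rightarrow> complex"
  assumes i: "\<And>a b. set_integrable lborel {a<..<b} f"
    and z: "\<And>a b. a < b \<Longrightarrow> (LINT x:{a<..<b}|lborel. f x) = 0"
  shows "AE x in lborel. f x = 0"
proof -
  have "AE x in lborel. x \<in> {- real n<..<real n} \<longrightarrow> f x = 0" for n
  proof -
    let ?I = "{- real n<..<real n}"
    have I: "integrable lborel (\<lambda>x. indicator ?I x *\<^sub>R f x)" using i by (simp add: set_integrable_def)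
    have z': "(LINT y|lborel. indicator {x<..} y *\<^sub>R (indicator ?I y *\<^sub>R f y)) = 0" for x
    proof -
      have e: "indicator {x<..} y *\<^sub>R (indicator ?I y *\<^sub>R f y) = indicator {max x (- real n)<..<real n} y *\<^sub>R f y" for y
        by (auto split: split_indicator)
      show ?thesis unfolding e using z[of "max x (- real n)" "real n"]
        by (cases "max x (- real n) < real n") (auto simp: set_lebesgue_integral_def)
    qed
    have ReIm: "integrable lborel (\<lambda>x. Re (indicator ?I x *\<^sub>R f x))" "integrable lborel (\<lambda>x. Im (indicator ?I x *\<^sub>R f x))"
      by (rule integrable_Re[OF I], rule integrable_Im[OF I])
    have iz: "integrable lborel (\<lambda>y. indicator {x<..} y *\<^sub>R (indicator ?I y *\<^sub>R f y))" for x
      by (rule integrable_mult_indicator[OF _ I]) auto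
    have "AE x in lborel. Re (indicator ?I x *\<^sub>R f x) = 0"
    proof (rule AE_eq_0_if_integral_Ioi_eq_0)
      fix x
      show "(LINT y|lborel. indicator {x<..} y *\<^sub>R Re (indicator ?I y *\<^sub>R f y)) = 0"
        using integral_Re[OF iz[of x]] z'[of x] by (simp add: mult.assoc)
    qed (rule ReIm)
    moreover have "AE x in lborel. Im (indicator ?I x *\<^sub>R f x) = 0"
    proof (rule AE_eq_0_if_integral_Ioi_eq_0)
      fix x
      show "(LINT y|lborel. indicator {x<..} y *\<^sub>R Im (indicator ?I y *\<^sub>R f y)) = 0"
        using integral_Im[OF iz[of x]] z'[of x] by (simp add: mult.assoc)
    qed (rule ReIm)
    ultimately show ?thesis by eventually_elim (auto simp: complex_eq_iff)
  qed
  then have "AE x in lborel. \<forall>n. x \<in> {- real n<..<real n} \<longrightarrow> f x = 0"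
    unfolding AE_all_countable by blast
  then show ?thesis
  proof eventually_elim
    case (elim x)
    obtain n where "\<bar>x\<bar> < real n" using reals_Archimedean2 by blast
    then have "x \<in> {- real n<..<real n}" by auto
    with elim show ?case by blast
  qed
qed

text \<open>The bumps on \<open>{a<..<b}\<close> lie between \<open>0\<close> and the indicator
  function and converge to it, so by dominated convergence the integral of \<open>f\<close> over
  each open interval vanishes too.\<close>

lemma AE_eq_0_if_test_integrals_eq_0:
  fixes f :: "real \<Rightarrow> complex"
  assumes i: "\<And>a b. set_integrable lborel {a<..<b} f"
    and z: "\<And>\<eta>. test_function \<eta> \<Longrightarrow> (LINT x|lborel. \<eta> x *\<^sub>R f x) = 0"
  shows "AE x in lborel. f x = 0"
proof (rule AE_eq_0_if_interval_integrals_eq_0[OF i])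
  fix a b :: real
  have I: "integrable lborel (\<lambda>x. indicator {a<..<b} x *\<^sub>R f x)" using i by (simp add: set_integrable_def)
  have e: "bump a b n x *\<^sub>R f x = bump a b n x *\<^sub>R (indicator {a<..<b} x *\<^sub>R f x)" for n x
    using bump_eq_0[of x a b n] by (auto split: split_indicator)
  have "(\<lambda>n. LINT x|lborel. bump a b n x *\<^sub>R (indicator {a<..<b} x *\<^sub>R f x)) \<longlonglongrightarrow>
     (LINT x|lborel. indicator {a<..<b} x *\<^sub>R (indicator {a<..<b} x *\<^sub>R f x))"
  proof (rule integral_dominated_convergence[where w = "\<lambda>x. norm (indicator {a<..<b} x *\<^sub>R f x)"])
    show "integrable lborel (\<lambda>x. norm (indicat_real {a<..<b} x *\<^sub>R f x))"
      using I by (rule integrable_norm)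
    have [measurable]: "(\<lambda>x. indicat_real {a<..<b} x *\<^sub>R f x) \<in> borel_measurable borel" using I by auto
    have [measurable]: "bump a b n \<in> borel_measurable borel" for n
      by (intro borel_measurable_test_function test_function_bump)
    show "(\<lambda>x. bump a b n x *\<^sub>R indicat_real {a<..<b} x *\<^sub>R f x) \<in> borel_measurable lborel" for n by measurable
    show "(\<lambda>x. indicat_real {a<..<b} x *\<^sub>R indicat_real {a<..<b} x *\<^sub>R f x) \<in> borel_measurable lborel" by measurable
    show "AE x in lborel. (\<lambda>n. bump a b n x *\<^sub>R indicat_real {a<..<b} x *\<^sub>R f x)
         \<longlonglongrightarrow> indicat_real {a<..<b} x *\<^sub>R indicat_real {a<..<b} x *\<^sub>R f x"
      by (intro AE_I2 tendsto_intros bump_tendsto)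
    show "AE x in lborel. norm (bump a b n x *\<^sub>R indicat_real {a<..<b} x *\<^sub>R f x)
         \<le> norm (indicat_real {a<..<b} x *\<^sub>R f x)" for n
      using bump_bounds[of a b n] by (intro AE_I2) (auto intro!: mult_left_le_one_le simp: mult.assoc)
  qed
  moreover have "(LINT x|lborel. bump a b n x *\<^sub>R (indicator {a<..<b} x *\<^sub>R f x)) = 0" for n
    unfolding e[symmetric] by (intro z test_function_bump)
  ultimately have "(LINT x|lborel. indicat_real {a<..<b} x *\<^sub>R (indicat_real {a<..<b} x *\<^sub>R f x)) = 0"
    by (simp add: LIMSEQ_const_iff)
  moreover have "indicat_real {a<..<b} x *\<^sub>R (indicat_real {a<..<b} x *\<^sub>R f x) = indicat_real {a<..<b} x *\<^sub>R f x" for x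
    by (auto split: split_indicator)
  ultimately show "(LINT x:{a<..<b}|lborel. f x) = 0" unfolding set_lebesgue_integral_def by (simp only:)
qed

lemma square_integrable_indicator_Icc: "square_integrable (\<lambda>x. complex_of_real (indicator {a..b} x))"
proof -
  have "(cmod (complex_of_real (indicator {a..b} x)))\<^sup>2 = indicator {a..b} x" for x
    by (auto split: split_indicator)
  then show ?thesis
    by (auto simp: square_integrable_def emeasure_lborel_Icc_eq intro!: integrable_real_indicator)
qed

lemma set_integrable_l2_rep: "set_integrable lborel {a<..<b} (l2_rep \<phi>)"
proof -
  have "integrable lborel (\<lambda>x. complex_of_real (indicator {a..b} x) * l2_rep \<phi> x)"
    by (intro integrable_square_integrable_mult square_integrable_indicator_Icc square_integrable_l2_rep)
  then have "set_integrable lborel {a..b} (l2_rep \<phi>)"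
    by (simp add: set_integrable_def scaleR_conv_of_real)
  then show ?thesis by (rule set_integrable_subset) auto
qed

lemma l2_eq_0_if_orthogonal_test_functions:
  assumes "\<And>\<eta>. test_function \<eta> \<Longrightarrow> cinner \<phi> (emb \<eta>) = 0"
  shows "\<phi> = 0"
proof -
  have "AE x in lborel. l2_rep \<phi> x = 0"
    by (rule AE_eq_0_if_test_integrals_eq_0[OF set_integrable_l2_rep]) (use assms cinner_emb in auto)
  then show ?thesis unfolding l2_eq_iff_AE using l2_rep_zero_AE by eventually_elim simp
qed

subsection \<open>The equation \<open>u' = u\<close>\<close>

text \<open>The primitive normalised at \<open>- R\<close> vanishes on the left because
  \<open>q\<close> does, and to the right of the support its value is the total integral, which is
  zero by hypothesis.\<close>

lemma test_function_antiderivative: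
  assumes q: "test_function q" and z: "(LINT x|lborel. q x) = 0"
  obtains G where "test_function G" "\<And>x. (G has_real_derivative q x) (at x)"
proof -
  obtain R where R: "R > 0" "\<And>x. \<bar>x\<bar> > R \<Longrightarrow> q x = 0" using test_function_support[OF q] by metis
  obtain F where F: "\<And>x. (F has_vector_derivative q x) (at x)"
    using einterval_antiderivative[of "-\<infinity>" "\<infinity>" q] continuous_on_interior[OF test_function_continuous[OF q, of UNIV]] by auto
  have FTC: "F y - F x = (LINT t|lborel. indicator {x..y} t *\<^sub>R q t)" if "x \<le> y" for x y
    by (rule integral_FTC_atLeastAtMost[symmetric, OF that])
      (use F test_function_continuous[OF q] in \<open>auto intro: has_vector_derivative_at_within\<close>)
  define G where "G x = F x - F (- R)" for x
  have d: "(G has_real_derivative q x) (at x)" for x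
    unfolding G_def using F by (auto intro!: derivative_eq_intros simp: has_real_derivative_iff_has_vector_derivative)
  moreover have "G x = 0" if "\<bar>x\<bar> > R" for x
  proof (cases "x > 0")
    case True
    have "G x = (LINT t|lborel. indicator {-R..x} t *\<^sub>R q t)" unfolding G_def by (rule FTC) (use True R in auto)
    also have "\<dots> = (LINT t|lborel. q t)"
      by (rule Bochner_Integration.integral_cong) (use True that R(2) in \<open>auto split: split_indicator\<close>)
    finally show ?thesis using z by simp
  next
    case False
    have "- G x = (LINT t|lborel. indicator {x..-R} t *\<^sub>R q t)" unfolding G_def
      using FTC[of x "-R"] False that by auto
    \<comment> \<open>\<open>q\<close> is known to vanish only for \<open>\<bar>t\<bar> > R\<close>,
      so the end point \<open>- R\<close> is kept as a set of measure zero.\<close>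
    also have "\<dots> = (LINT t|lborel. indicator {-R} t *\<^sub>R q t)"
      by (rule Bochner_Integration.integral_cong) (use False that R(2) in \<open>auto split: split_indicator\<close>)
    also have "\<dots> = (LINT t|lborel. indicator {-R} t *\<^sub>R q (-R))"
      by (rule Bochner_Integration.integral_cong) (auto split: split_indicator)
    also have "\<dots> = 0" by simp
    finally show ?thesis by simp
  qed
  moreover have "smooth G"
    by (rule smooth_antiderivative[OF d test_function_smooth[OF q]])
  ultimately show thesis using that[of G] by (auto simp: test_function_iff_smooth)
qed

text \<open>A weak solution of \<open>u' = u\<close> must be a multiple of \<open>exp\<close>, and
  no nonzero multiple is square integrable. To see the first, \<open>key\<close> shows that pairing
  \<open>\<phi>\<close> with \<open>g\<close> depends only on the integral \<open>L g\<close> of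
  \<open>exp\<close> against \<open>g\<close>; subtracting \<open>L g * g0\<close> with
  \<open>L g0 = 1\<close> reduces this to \<open>L g = 0\<close>.\<close>

lemma weak_derivative_fixpoint_eq_0:
  assumes "(\<phi>, \<phi>) \<in> weak_derivative"
  shows "\<phi> = 0"
proof -
  define L where "L g = (LINT x|lborel. exp x * g x)" for g :: "real \<Rightarrow> real"
  have te: "test_function (\<lambda>x. exp x * g x)" if "test_function g" for g
    by (intro test_function_smooth_mult that smooth_exp)
  have "L (bump 0 1 1) \<noteq> 0"
  proof
    assume "L (bump 0 1 1) = 0"
    then have "AE x in lborel. exp x * bump 0 1 1 x = 0"
      unfolding L_def by (subst (asm) integral_nonneg_eq_0_iff_AE)
        (auto simp: bump_bounds intro!: integrable_test_function te test_function_bump)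
    then have "AE x in lborel. x \<notin> {0<..<1::real}"
      by eventually_elim (auto simp: bump_def hexp_def)
    then have "emeasure lborel {0<..<1::real} = 0"
      by (subst (asm) AE_iff_measurable[of "{0<..<1}"]) auto
    then show False by simp
  qed
  define g0 where "g0 x = bump 0 1 1 x / L (bump 0 1 1)" for x
  have g0: "test_function g0" unfolding g0_def
    using test_function_smooth_mult[OF test_function_bump[of 0 1 1] smooth_const[of "inverse (L (bump 0 1 1))"]]
    by (simp add: field_simps)
  have L0: "L g0 = 1" unfolding g0_def L_def using \<open>L (bump 0 1 1) \<noteq> 0\<close> by (simp add: L_def)
  define C where "C = cinner \<phi> (emb g0)"
  have key: "cinner \<phi> (emb g) = of_real (L g) * C" if g: "test_function g" for g
  proof -
    define g1 where "g1 x = g x + (- L g) * g0 x" for x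
    have g1: "test_function g1" unfolding g1_def by (intro test_function_lincomb g g0)
    have "(LINT x|lborel. exp x * g1 x) = (LINT x|lborel. exp x * g x + (- L g) * (exp x * g0 x))"
      by (simp add: g1_def algebra_simps)
    also have "\<dots> = L g - L g * L g0"
      using te[OF g, THEN integrable_test_function] te[OF g0, THEN integrable_test_function]
      by (simp add: L_def)
    finally have "(LINT x|lborel. exp x * g1 x) = 0" using L0 by simp
    then obtain G where G: "test_function G" "\<And>x. (G has_real_derivative exp x * g1 x) (at x)"
      using test_function_antiderivative[OF te[OF g1]] by blast
    \<comment> \<open>Solves \<open>\<eta>' + \<eta> = g1\<close>; it has compact support because
      \<open>G\<close> does. Testing the equation for \<open>\<phi>\<close> with this
      \<open>\<eta>\<close> cancels the two \<open>\<eta>\<close> terms and leaves the pairing of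
      \<open>\<phi>\<close> with \<open>g1\<close>.\<close>
    define \<eta> where "\<eta> x = exp (- x) * G x" for x
    have \<eta>: "test_function \<eta>" unfolding \<eta>_def by (intro test_function_smooth_mult G smooth_exp_minus)
    have "(\<eta> has_real_derivative g1 x + (- 1) * \<eta> x) (at x)" for x
      unfolding \<eta>_def by (auto intro!: derivative_eq_intros G simp: exp_minus field_simps)
    then have d: "deriv \<eta> = (\<lambda>x. g1 x + (- 1) * \<eta> x)" by (intro ext DERIV_imp_deriv)
    have lin: "cinner \<phi> (emb (\<lambda>x. a x + c * b x)) = cinner \<phi> (emb a) + of_real c * cinner \<phi> (emb b)"
      if "test_function a" "test_function b" for a b c
    proof -
      have "emb (\<lambda>x. a x + c * b x) = emb a + c *\<^sub>R emb b"
        unfolding emb_def using that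
        by (simp add: scaleR_l2_abs l2_abs_add square_integrable_of_real_test_function
            square_integrable_scaleR scaleR_conv_of_real)
          (simp add: l2_abs_add square_integrable_scaleC square_integrable_of_real_test_function)
      then show ?thesis by (simp add: cinner_simps scaleR_conv_of_real)
    qed
    have "cinner \<phi> (emb (deriv \<eta>)) = - cinner \<phi> (emb \<eta>)"
      using assms \<eta> unfolding weak_derivative_iff by blast
    then have "cinner \<phi> (emb g1) = 0"
      unfolding d using lin[OF g1 \<eta>, of "-1"] by simp
    then show ?thesis using lin[OF g g0, of "- L g"] by (simp add: C_def g1_def[abs_def])
  qed
  have sint: "set_integrable lborel {a<..<b} (\<lambda>x. C * complex_of_real (exp x))" for a b :: real
    by (rule set_integrable_subset[OF borel_integrable_atLeastAtMost'[of a b]]) (auto intro!: continuous_intros)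
  have "AE x in lborel. l2_rep \<phi> x - C * of_real (exp x) = 0"
  proof (rule AE_eq_0_if_test_integrals_eq_0)
    show "set_integrable lborel {a<..<b} (\<lambda>x. l2_rep \<phi> x - C * of_real (exp x))" for a b
      by (rule set_integral_diff(1)[OF set_integrable_l2_rep sint])
    fix g assume g: "test_function g"
    have 1: "integrable lborel (\<lambda>x. g x *\<^sub>R l2_rep \<phi> x)"
      using integrable_square_integrable_mult[OF square_integrable_of_real_test_function[OF g] square_integrable_l2_rep[of \<phi>]]
      by (simp add: scaleR_conv_of_real)
    have e: "g x *\<^sub>R (C * complex_of_real (exp x)) = C * complex_of_real (exp x * g x)" for x
      by (simp add: scaleR_conv_of_real)
    have 2: "integrable lborel (\<lambda>x. C * complex_of_real (exp x * g x))"
      using integrable_test_function[OF te[OF g]] by (intro integrable_mult_right integrable_of_real)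
    have 3: "(LINT x|lborel. C * complex_of_real (exp x * g x)) = C * of_real (L g)"
      unfolding L_def by (simp only: integral_mult_right_zero integral_complex_of_real)
    show "(LINT x|lborel. g x *\<^sub>R (l2_rep \<phi> x - C * of_real (exp x))) = 0"
      unfolding scaleR_diff_right e using 1 2 3 key[OF g] cinner_emb[OF g, of \<phi>]
      by (simp only: Bochner_Integration.integral_diff) simp
  qed
  then have ae: "AE x in lborel. (cmod (l2_rep \<phi> x))\<^sup>2 = (cmod C)\<^sup>2 * exp (2 * x)"
    by eventually_elim (simp add: norm_mult power_mult_distrib exp_double)
  have "integrable lborel (\<lambda>x. (cmod C)\<^sup>2 * exp (2 * x))"
    using integrable_cong_AE[OF _ _ ae] integrable_l2_rep_sq[of \<phi>] by simp
  \<comment> \<open>On the half line \<open>exp (2 * x) \<ge> 1\<close>, so a nonzero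
    \<open>C\<close> would give the half line finite measure.\<close>
  then have int: "integrable lborel (\<lambda>x::real. (cmod C)\<^sup>2 * indicator {0..} x :: real)"
    by (rule Bochner_Integration.integrable_bound) (auto simp: abs_mult indicator_def mult_le_cancel_left1 intro!: AE_I2)
  have "C = 0"
  proof (rule ccontr)
    assume "C \<noteq> 0"
    with int have "emeasure lborel {0 :: real ..} < \<infinity>" by (simp add: integrable_indicator_iff)
    then obtain r where r: "emeasure lborel {0 :: real ..} = ennreal r" "r \<ge> 0"
      by (cases "emeasure lborel {0 :: real ..}") auto
    obtain n where n: "r < real n" using reals_Archimedean2 by blast
    have "emeasure lborel {0 .. real n} \<le> emeasure lborel {0 :: real ..}" by (rule emeasure_mono) auto
    then show False using r n by (simp add: emeasure_lborel_Icc)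
  qed
  then show ?thesis using key l2_eq_0_if_orthogonal_test_functions by simp
qed

subsection \<open>Projection valued measures\<close>

lemma cinner_eqI: "(\<And>\<xi>. cinner \<phi> \<xi> = cinner \<psi> \<xi>) \<Longrightarrow> \<phi> = \<psi>"
proof -
  assume "\<And>\<xi>. cinner \<phi> \<xi> = cinner \<psi> \<xi>"
  then have "cinner (\<phi> - \<psi>) (\<phi> - \<psi>) = 0" by (simp add: cinner_simps)
  then show ?thesis by (simp add: cinner_self)
qed

lemma integral_finite_range:
  fixes g :: "real \<Rightarrow> real"
  assumes "finite_measure M" and M: "sets M = sets borel" and [measurable]: "g \<in> borel_measurable borel"
    and f: "finite (range g)"
  shows "integrable M g" "(LINT x|M. g x) = (\<Sum>y\<in>range g. y * measure M (g -` {y}))"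
proof -
  interpret finite_measure M by fact
  have sp: "space M = UNIV" using sets_eq_imp_space_eq[OF M] by simp
  have B: "g -` {y} \<in> sets M" for y
    unfolding M using measurable_sets[OF assms(3), of "{y}"] by simp
  have g: "g = (\<lambda>x. \<Sum>y\<in>range g. y * indicator (g -` {y}) x)"
  proof
    fix x
    have "(\<Sum>y\<in>range g. y * indicator (g -` {y}) x) = (\<Sum>y\<in>range g. if y = g x then y else 0)"
      by (intro sum.cong) (auto split: split_indicator)
    then show "g x = (\<Sum>y\<in>range g. y * indicator (g -` {y}) x)" using f by simp
  qed
  have i0: "integrable M (indicat_real (g -` {y}))" for y
    using B[of y] by (intro integrable_real_indicator) (auto simp: emeasure_eq_measure)
  then have i: "integrable M (\<lambda>x. y * indicator (g -` {y}) x)" for y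
    by (intro integrable_mult_right)
  show "integrable M g" by (subst g) (intro Bochner_Integration.integrable_sum i)
  have "(LINT x|M. g x) = (LINT x|M. (\<Sum>y\<in>range g. y * indicator (g -` {y}) x))"
    by (rule arg_cong[where f = "\<lambda>h. LINT x|M. h x"]) (rule g)
  also have "\<dots> = (\<Sum>y\<in>range g. y * measure M (g -` {y}))"
    by (subst Bochner_Integration.integral_sum) (auto intro!: i0 sum.cong simp: sp)
  finally show "(LINT x|M. g x) = (\<Sum>y\<in>range g. y * measure M (g -` {y}))" .
qed

locale pvm =
  fixes E :: "real set \<Rightarrow> l2 \<Rightarrow> l2"
  assumes pvm: "projection_valued_measure E"
begin

abbreviation \<mu> :: "l2 \<Rightarrow> real measure" where
  "\<mu> \<equiv> spectral_scalar_measure E"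

lemma E_UNIV [simp]: "E UNIV \<phi> = \<phi>" and E_empty [simp]: "E {} \<phi> = 0"
  using pvm by (auto simp: projection_valued_measure_def)

lemma E_Int: "A \<in> sets borel \<Longrightarrow> B \<in> sets borel \<Longrightarrow> E (A \<inter> B) \<phi> = E A (E B \<phi>)"
  using pvm by (auto simp: projection_valued_measure_def)

lemma
  assumes "B \<in> sets borel"
  shows E_add: "E B (\<phi> + \<psi>) = E B \<phi> + E B \<psi>"
    and E_scaleC: "E B (scaleC a \<phi>) = scaleC a (E B \<phi>)"
    and E_idem: "E B (E B \<phi>) = E B \<phi>"
    and E_adjoint: "cinner (E B \<phi>) \<psi> = cinner \<phi> (E B \<psi>)"
  using pvm assms by (auto simp: projection_valued_measure_def orthogonal_projection_def)

lemma cinner_E_self: "B \<in> sets borel \<Longrightarrow> cinner (E B \<phi>) \<phi> = of_real ((norm (E B \<phi>))\<^sup>2)"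
  by (metis E_idem E_adjoint cinner_self)

lemma sets_\<mu> [measurable_cong, simp]: "sets (\<mu> \<phi>) = sets borel"
  and space_\<mu> [simp]: "space (\<mu> \<phi>) = UNIV"
  by (simp_all add: spectral_scalar_measure_def sigma_algebra.sets_measure_of_eq[OF sets.sigma_algebra_axioms[of borel, simplified]])

text \<open>\<open>measure_of\<close> takes the prescribed values only if they are countably
  additive. This is the strong convergence of \<open>E (B i) \<phi>\<close> paired with the fixed
  vector \<open>\<phi>\<close>.\<close>

lemma emeasure_\<mu>:
  assumes "B \<in> sets borel"
  shows "emeasure (\<mu> \<phi>) B = ennreal ((norm (E B \<phi>))\<^sup>2)"
proof -
  have "emeasure (\<mu> \<phi>) B = ennreal (Re (cinner (E B \<phi>) \<phi>))"
    unfolding spectral_scalar_measure_def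
  proof (rule emeasure_measure_of_sigma)
    show "sigma_algebra UNIV (sets borel :: real set set)"
      using sets.sigma_algebra_axioms[of borel] by simp
    show "positive (sets borel) (\<lambda>B. ennreal (Re (cinner (E B \<phi>) \<phi>)))"
      by (simp add: positive_def)
    show "countably_additive (sets borel) (\<lambda>B. ennreal (Re (cinner (E B \<phi>) \<phi>)))"
      unfolding countably_additive_def
    proof (intro allI impI)
      fix A :: "nat \<Rightarrow> real set"
      assume A: "range A \<subseteq> sets borel" "disjoint_family A"
      then have "(\<lambda>i. E (A i) \<phi>) sums E (\<Union>i. A i) \<phi>"
        using pvm by (auto simp: projection_valued_measure_def)
      then have "(\<lambda>n. inner (\<Sum>i<n. E (A i) \<phi>) \<phi>) \<longlonglongrightarrow> inner (E (\<Union>i. A i) \<phi>) \<phi>"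
        unfolding sums_def by (intro tendsto_intros)
      then have "(\<lambda>i. Re (cinner (E (A i) \<phi>) \<phi>)) sums Re (cinner (E (\<Union>i. A i) \<phi>) \<phi>)"
        unfolding inner_sum_left unfolding sums_def inner_eq_Re_cinner .
      then show "(\<Sum>i. ennreal (Re (cinner (E (A i) \<phi>) \<phi>))) = ennreal (Re (cinner (E (\<Union> (range A)) \<phi>) \<phi>))"
        using A by (intro suminf_ennreal_eq) (auto simp: cinner_E_self)
    qed
  qed fact
  then show ?thesis using assms by (simp add: cinner_E_self)
qed

lemma finite_measure_\<mu>: "finite_measure (\<mu> \<phi>)"
  by (rule finite_measureI) (simp add: emeasure_\<mu>)

lemma measure_\<mu>: "B \<in> sets borel \<Longrightarrow> measure (\<mu> \<phi>) B = (norm (E B \<phi>))\<^sup>2"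
  by (simp add: measure_def emeasure_\<mu>)

lemma measure_\<mu>_cinner: "B \<in> sets borel \<Longrightarrow> complex_of_real (measure (\<mu> \<phi>) B) = cinner (E B \<phi>) \<phi>"
  by (simp add: measure_\<mu> cinner_E_self)

lemma integrable_bounded_\<mu>:
  fixes f :: "real \<Rightarrow> real"
  assumes "f \<in> borel_measurable borel" "\<And>x. \<bar>f x\<bar> \<le> C"
  shows "integrable (\<mu> \<phi>) f"
proof -
  interpret finite_measure "\<mu> \<phi>" by (rule finite_measure_\<mu>)
  show ?thesis by (rule integrable_const_bound[of _ C]) (use assms in auto)
qed

lemma \<mu>_scaleC: "\<mu> (scaleC a \<phi>) = density (\<mu> \<phi>) (\<lambda>x. ennreal ((cmod a)\<^sup>2))"
  by (rule measure_eqI)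
    (auto simp: emeasure_\<mu> E_scaleC norm_scaleC emeasure_density_const power_mult_distrib ennreal_mult)

lemma \<mu>_E: "B \<in> sets borel \<Longrightarrow> \<mu> (E B \<phi>) = density (\<mu> \<phi>) (indicator B)"
  by (rule measure_eqI)
    (auto simp: emeasure_\<mu> emeasure_density nn_integral_indicator E_Int[symmetric] indicator_inter_arith[symmetric] Int_commute)

lemma nn_integral_\<mu>_scaleC:
  "f \<in> borel_measurable borel \<Longrightarrow> (\<integral>\<^sup>+ x. f x \<partial>\<mu> (scaleC a \<phi>)) = ennreal ((cmod a)\<^sup>2) * (\<integral>\<^sup>+ x. f x \<partial>\<mu> \<phi>)"
  by (simp add: \<mu>_scaleC nn_integral_density nn_integral_cmult)

lemma integral_\<mu>_scaleC:
  fixes f :: "real \<Rightarrow> real"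
  shows "f \<in> borel_measurable borel \<Longrightarrow> (LINT x|\<mu> (scaleC a \<phi>). f x) = (cmod a)\<^sup>2 * (LINT x|\<mu> \<phi>. f x)"
  by (simp add: \<mu>_scaleC integral_density)

text \<open>For indicator functions this is \<open>|u + v|^2 \<le> 2 |u|^2 + 2 |v|^2\<close> for the
  projected vectors; the rest is the standard induction over nonnegative measurable functions. It
  replaces the triangle inequality wherever a vector is split, both for spectral domains and for the
  final estimate.\<close>

lemma nn_integral_\<mu>_add:
  assumes "f \<in> borel_measurable borel"
  shows "(\<integral>\<^sup>+ x. f x \<partial>\<mu> (\<phi> + \<psi>)) \<le> 2 * (\<integral>\<^sup>+ x. f x \<partial>\<mu> \<phi>) + 2 * (\<integral>\<^sup>+ x. f x \<partial>\<mu> \<psi>)"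
  using assms
proof (induction f rule: borel_measurable_induct)
  case (cong f g)
  then have "f = g" by (auto simp: fun_eq_iff)
  with cong show ?case by simp
next
  case (set B)
  have "(norm (E B \<phi> + E B \<psi>))\<^sup>2 \<le> 2 * (norm (E B \<phi>))\<^sup>2 + 2 * (norm (E B \<psi>))\<^sup>2"
    using zero_le_power2[of "norm (E B \<phi> - E B \<psi>)"]
    unfolding power2_norm_eq_inner by (simp add: inner_simps inner_commute)
  then have "ennreal ((norm (E B \<phi> + E B \<psi>))\<^sup>2) \<le> ennreal (2 * (norm (E B \<phi>))\<^sup>2 + 2 * (norm (E B \<psi>))\<^sup>2)"
    by (rule ennreal_leI)
  also have "\<dots> = 2 * ennreal ((norm (E B \<phi>))\<^sup>2) + 2 * ennreal ((norm (E B \<psi>))\<^sup>2)"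
    by (simp add: ennreal_mult)
  finally show ?case using set by (simp add: emeasure_\<mu> E_add)
next
  case (mult u c)
  have "(\<integral>\<^sup>+ x. c * u x \<partial>\<mu> (\<phi> + \<psi>)) = c * (\<integral>\<^sup>+ x. u x \<partial>\<mu> (\<phi> + \<psi>))"
    using mult by (simp add: nn_integral_cmult)
  also have "\<dots> \<le> c * (2 * (\<integral>\<^sup>+ x. u x \<partial>\<mu> \<phi>) + 2 * (\<integral>\<^sup>+ x. u x \<partial>\<mu> \<psi>))"
    by (intro mult_left_mono mult) auto
  finally show ?case using mult by (simp add: nn_integral_cmult distrib_left mult_ac)
next
  case (add u v)
  have "(\<integral>\<^sup>+ x. u x + v x \<partial>\<mu> (\<phi> + \<psi>)) = (\<integral>\<^sup>+ x. u x \<partial>\<mu> (\<phi> + \<psi>)) + (\<integral>\<^sup>+ x. v x \<partial>\<mu> (\<phi> + \<psi>))"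
    using add by (simp add: nn_integral_add)
  also have "\<dots> \<le> (2 * (\<integral>\<^sup>+ x. u x \<partial>\<mu> \<phi>) + 2 * (\<integral>\<^sup>+ x. u x \<partial>\<mu> \<psi>)) +
     (2 * (\<integral>\<^sup>+ x. v x \<partial>\<mu> \<phi>) + 2 * (\<integral>\<^sup>+ x. v x \<partial>\<mu> \<psi>))"
    by (intro add_mono add)
  finally show ?case using add by (simp add: nn_integral_add distrib_left add_ac)
next
  case (seq U)
  have m: "U i \<in> borel_measurable (\<mu> \<xi>)" for i \<xi> using seq by simp
  have "(\<integral>\<^sup>+ x. (SUP i. U i) x \<partial>\<mu> (\<phi> + \<psi>)) = (SUP i. \<integral>\<^sup>+ x. U i x \<partial>\<mu> (\<phi> + \<psi>))"
    using nn_integral_monotone_convergence_SUP[OF seq(3) m, of "\<phi> + \<psi>"] by (simp add: image_comp)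
  also have "\<dots> \<le> 2 * (\<integral>\<^sup>+ x. (SUP i. U i) x \<partial>\<mu> \<phi>) + 2 * (\<integral>\<^sup>+ x. (SUP i. U i) x \<partial>\<mu> \<psi>)"
  proof (rule SUP_least)
    fix i
    have "(\<integral>\<^sup>+ x. U i x \<partial>\<mu> (\<phi> + \<psi>)) \<le> 2 * (\<integral>\<^sup>+ x. U i x \<partial>\<mu> \<phi>) + 2 * (\<integral>\<^sup>+ x. U i x \<partial>\<mu> \<psi>)"
      by (rule seq)
    also have "\<dots> \<le> 2 * (\<integral>\<^sup>+ x. (SUP i. U i) x \<partial>\<mu> \<phi>) + 2 * (\<integral>\<^sup>+ x. (SUP i. U i) x \<partial>\<mu> \<psi>)"
      by (intro add_mono mult_left_mono nn_integral_mono) (auto intro: SUP_upper simp: image_comp)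
    finally show "(\<integral>\<^sup>+ x. U i x \<partial>\<mu> (\<phi> + \<psi>)) \<le> 2 * (\<integral>\<^sup>+ x. (SUP i. U i) x \<partial>\<mu> \<phi>) + 2 * (\<integral>\<^sup>+ x. (SUP i. U i) x \<partial>\<mu> \<psi>)" .
  qed
  finally show ?case .
qed

lemma spectral_domain_iff: "\<phi> \<in> spectral_domain E f \<longleftrightarrow> (\<integral>\<^sup>+ x. ennreal ((f x)\<^sup>2) \<partial>\<mu> \<phi>) < \<infinity>"
  by (simp add: spectral_domain_def)

lemma spectral_domain_add:
  assumes [measurable]: "f \<in> borel_measurable borel" and "\<phi> \<in> spectral_domain E f" "\<psi> \<in> spectral_domain E f"
  shows "\<phi> + \<psi> \<in> spectral_domain E f"
proof -
  have "(\<integral>\<^sup>+ x. ennreal ((f x)\<^sup>2) \<partial>\<mu> (\<phi> + \<psi>)) \<le> 2 * (\<integral>\<^sup>+ x. ennreal ((f x)\<^sup>2) \<partial>\<mu> \<phi>) + 2 * (\<integral>\<^sup>+ x. ennreal ((f x)\<^sup>2) \<partial>\<mu> \<psi>)"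
    by (rule nn_integral_\<mu>_add) measurable
  also have "\<dots> < \<infinity>" using assms(2,3) by (simp add: spectral_domain_iff ennreal_mult_less_top)
  finally show ?thesis by (simp add: spectral_domain_iff)
qed

lemma spectral_domain_scaleC:
  assumes [measurable]: "f \<in> borel_measurable borel" and "\<phi> \<in> spectral_domain E f"
  shows "scaleC a \<phi> \<in> spectral_domain E f"
  using assms(2) by (simp add: spectral_domain_iff nn_integral_\<mu>_scaleC ennreal_mult_less_top)

lemma spectral_domain_integrable:
  assumes [measurable]: "f \<in> borel_measurable borel" and "\<phi> \<in> spectral_domain E f"
  shows "integrable (\<mu> \<phi>) (\<lambda>x. (f x)\<^sup>2)" "integrable (\<mu> \<phi>) f"
proof -
  interpret finite_measure "\<mu> \<phi>" by (rule finite_measure_\<mu>)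
  show 1: "integrable (\<mu> \<phi>) (\<lambda>x. (f x)\<^sup>2)"
    using assms(2) by (auto simp: integrable_iff_bounded spectral_domain_iff)
  show "integrable (\<mu> \<phi>) f"
  proof (rule Bochner_Integration.integrable_bound)
    show "integrable (\<mu> \<phi>) (\<lambda>x. 1 + (f x)\<^sup>2)" using 1 by simp
    have "\<bar>f x\<bar> \<le> 1 + (f x)\<^sup>2" for x
      using zero_le_power2[of "\<bar>f x\<bar> - 1"] by (simp add: power2_diff)
    then show "AE x in \<mu> \<phi>. norm (f x) \<le> norm (1 + (f x)\<^sup>2)" by auto
  qed simp
qed

lemma polarization:
  assumes "B \<in> sets borel"
  shows "(1 / 4) * (\<Sum>k<4. \<i> ^ k * complex_of_real (measure (\<mu> (\<phi> + scaleC (\<i> ^ k) \<xi>)) B)) = cinner (E B \<phi>) \<xi>"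
proof -
  have "cinner (E B \<xi>) \<phi> = cinner \<xi> (E B \<phi>)" using assms by (rule E_adjoint)
  then show ?thesis
    unfolding measure_\<mu>_cinner[OF assms]
    by (simp add: E_add E_scaleC assms cinner_simps eval_nat_numeral algebra_simps)
qed

lemma spectral_sesq_add:
  assumes "\<And>k. k < 4 \<Longrightarrow> integrable (\<mu> (\<phi> + scaleC (\<i> ^ k) \<xi>)) f" "\<And>k. k < 4 \<Longrightarrow> integrable (\<mu> (\<phi> + scaleC (\<i> ^ k) \<xi>)) g"
  shows "spectral_sesq E (\<lambda>x. f x - g x) \<phi> \<xi> = spectral_sesq E f \<phi> \<xi> - spectral_sesq E g \<phi> \<xi>"
  using assms by (simp add: spectral_sesq_def sum_subtractf[symmetric] right_diff_distrib[symmetric])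

text \<open>The spectral integral of a function with finitely many values, as a bounded operator. If
  \<open>range g\<close> is infinite the sum has the default value \<open>0\<close>; all lemmas
  assume finiteness.\<close>

definition T :: "(real \<Rightarrow> real) \<Rightarrow> l2 \<Rightarrow> l2" where
  "T g \<phi> = (\<Sum>y\<in>range g. y *\<^sub>R E (g -` {y}) \<phi>)"

lemma vimage_borel: "g \<in> borel_measurable borel \<Longrightarrow> g -` {y :: real} \<in> sets (borel :: real measure)"
  using measurable_sets[of g borel borel "{y}"] by simp

lemma cinner_T:
  assumes g: "g \<in> borel_measurable borel" "finite (range g)"
  shows "cinner (T g \<phi>) \<xi> = spectral_sesq E g \<phi> \<xi>"
proof -
  have "cinner (T g \<phi>) \<xi> = (\<Sum>y\<in>range g. y *\<^sub>R cinner (E (g -` {y}) \<phi>) \<xi>)"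
    unfolding T_def
    by (induction rule: infinite_finite_induct) (simp_all add: cinner_simps)
  also have "\<dots> = (\<Sum>y\<in>range g. y *\<^sub>R ((1 / 4) * (\<Sum>k<4. \<i> ^ k * complex_of_real (measure (\<mu> (\<phi> + scaleC (\<i> ^ k) \<xi>)) (g -` {y})))))"
    by (subst polarization) (auto intro: vimage_borel g)
  also have "\<dots> = (1/4) * (\<Sum>k<4. \<i> ^ k * complex_of_real (\<Sum>y\<in>range g. y * measure (\<mu> (\<phi> + scaleC (\<i> ^ k) \<xi>)) (g -` {y})))"
    by (simp add: scaleR_conv_of_real sum_distrib_left mult_ac sum.swap[of _ "{..<4}"])
  also have "\<dots> = spectral_sesq E g \<phi> \<xi>"
    unfolding spectral_sesq_def
    by (subst integral_finite_range(2)[OF finite_measure_\<mu> sets_\<mu> g]) simp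
  finally show ?thesis .
qed

text \<open>Projections onto disjoint level sets have orthogonal ranges, so the double sum is
  diagonal. This isometry is what turns convergence of functions in the space of
  \<open>\<mu> \<phi>\<close> into convergence of vectors.\<close>

lemma norm_T:
  assumes g: "g \<in> borel_measurable borel" "finite (range g)"
  shows "(norm (T g \<phi>))\<^sup>2 = (LINT x|\<mu> \<phi>. (g x)\<^sup>2)"
proof -
  have orth: "E (g -` {y}) \<phi> \<bullet> E (g -` {z}) \<phi> = (if y = z then measure (\<mu> \<phi>) (g -` {y}) else 0)" for y z
  proof (cases "y = z")
    case False
    have "cinner (E (g -` {y}) \<phi>) (E (g -` {z}) \<phi>) = cinner (E (g -` {z} \<inter> g -` {y}) \<phi>) \<phi>"
      using g by (simp add: E_Int E_adjoint vimage_borel)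
    moreover have "g -` {z} \<inter> g -` {y} = {}" using False by auto
    ultimately show ?thesis using False by (simp add: inner_eq_Re_cinner)
  qed (simp add: measure_\<mu> vimage_borel g power2_norm_eq_inner)
  have "(norm (T g \<phi>))\<^sup>2 = (\<Sum>y\<in>range g. \<Sum>z\<in>range g. y * z * (E (g -` {y}) \<phi> \<bullet> E (g -` {z}) \<phi>))"
    unfolding T_def power2_norm_eq_inner
    by (simp add: inner_sum_left inner_sum_right sum_distrib_left mult_ac inner_commute)
  also have "\<dots> = (\<Sum>y\<in>range g. y\<^sup>2 * measure (\<mu> \<phi>) (g -` {y}))"
    unfolding orth using g(2) by (intro sum.cong) (auto simp: power2_eq_square if_distrib cong: if_cong)
  also have "\<dots> = (LINT x|\<mu> \<phi>. (\<Sum>y\<in>range g. y\<^sup>2 * indicator (g -` {y}) x))"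
  proof -
    interpret finite_measure "\<mu> \<phi>" by (rule finite_measure_\<mu>)
    show ?thesis
      by (subst Bochner_Integration.integral_sum)
        (auto intro!: integrable_real_indicator vimage_borel g simp: emeasure_eq_measure)
  qed
  also have "(\<lambda>x. \<Sum>y\<in>range g. y\<^sup>2 * indicator (g -` {y}) x) = (\<lambda>x. (g x)\<^sup>2)"
  proof
    fix x
    have "(\<Sum>y\<in>range g. y\<^sup>2 * indicator (g -` {y}) x) = (\<Sum>y\<in>range g. if y = g x then y\<^sup>2 else 0)"
      by (intro sum.cong) (auto split: split_indicator)
    then show "(\<Sum>y\<in>range g. y\<^sup>2 * indicator (g -` {y}) x) = (g x)\<^sup>2" using g by simp
  qed
  finally show ?thesis .
qed

lemma T_diff:
  assumes g: "g \<in> borel_measurable borel" "finite (range g)" and h: "h \<in> borel_measurable borel" "finite (range h)"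
  shows "T g \<phi> - T h \<phi> = T (\<lambda>x. g x - h x) \<phi>"
proof (rule cinner_eqI)
  fix \<xi>
  have "finite ((\<lambda>(a, b). a - b) ` (range g \<times> range h))" using g h by simp
  then have f: "finite (range (\<lambda>x. g x - h x))" by (rule finite_subset[rotated]) auto
  have "cinner (T g \<phi> - T h \<phi>) \<xi> = spectral_sesq E g \<phi> \<xi> - spectral_sesq E h \<phi> \<xi>"
    using g h by (simp add: cinner_simps cinner_T)
  also have "\<dots> = spectral_sesq E (\<lambda>x. g x - h x) \<phi> \<xi>"
    by (intro spectral_sesq_add[symmetric] integral_finite_range(1)[OF finite_measure_\<mu> sets_\<mu>] g h)
  also have "\<dots> = cinner (T (\<lambda>x. g x - h x) \<phi>) \<xi>"
    using g h f by (intro cinner_T[symmetric]) auto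
  finally show "cinner (T g \<phi> - T h \<phi>) \<xi> = cinner (T (\<lambda>x. g x - h x) \<phi>) \<xi>" .
qed

text \<open>\<open>f\<close> is approximated pointwise by functions \<open>G i\<close> of finite
  range. By the isometry \<open>norm_T\<close> the vectors \<open>T (G i) \<phi>\<close> form a
  Cauchy sequence, and both the norm identity and the polarised integrals pass to the limit by
  dominated convergence.\<close>

lemma spectral_integral_exists:
  assumes [measurable]: "f \<in> borel_measurable borel" and \<phi>: "\<phi> \<in> spectral_domain E f"
  shows "\<exists>\<psi>. (\<phi>, \<psi>) \<in> spectral_integral E f \<and> (norm \<psi>)\<^sup>2 = (LINT x|\<mu> \<phi>. (f x)\<^sup>2)"
proof -
  \<comment> \<open>The bound \<open>\<bar>G i x\<bar> \<le> 2 * \<bar>f x\<bar>\<close> supplies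
    all majorants: \<open>4 * f^2\<close> for the squares, \<open>9 * f^2\<close> for the squared
    differences and \<open>2 * \<bar>f\<bar>\<close> for the polarised integrals.\<close>
  obtain G where G: "\<And>i. simple_function borel (G i)" "\<And>x. (\<lambda>i. G i x) \<longlonglongrightarrow> f x"
    "\<And>i x. dist (G i x) 0 \<le> 2 * dist (f x) 0"
    using borel_measurable_implies_sequence_metric[of f borel 0] by auto
  have Gm [measurable]: "G i \<in> borel_measurable borel" and Gf: "finite (range (G i))" for i
    using G(1)[of i] by (auto intro: borel_measurable_simple_function simp: simple_function_def)
  have Gb: "\<bar>G i x\<bar> \<le> 2 * \<bar>f x\<bar>" for i x using G(3)[of i x] by simp
  have df: "finite (range (\<lambda>x. G i x - G j x))" for i j
  proof -
    have "finite ((\<lambda>(a, b). a - b) ` (range (G i) \<times> range (G j)))" using Gf by simp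
    then show ?thesis by (rule finite_subset[rotated]) auto
  qed
  have fint: "integrable (\<mu> \<phi>) (\<lambda>x. (f x)\<^sup>2)" by (rule spectral_domain_integrable[OF _ \<phi>]) simp
  have d9: "(G i x - f x)\<^sup>2 \<le> 9 * (f x)\<^sup>2" for i x
  proof -
    have "\<bar>G i x - f x\<bar> \<le> \<bar>3 * f x\<bar>" using Gb[of i x] by (simp add: abs_mult)
    then have "(G i x - f x)\<^sup>2 \<le> (3 * f x)\<^sup>2" by (simp add: abs_le_square_iff)
    then show ?thesis by (simp add: power_mult_distrib)
  qed
  have d4: "(G i x)\<^sup>2 \<le> 4 * (f x)\<^sup>2" for i x
  proof -
    have "\<bar>G i x\<bar> \<le> \<bar>2 * f x\<bar>" using Gb[of i x] by (simp add: abs_mult)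
    then have "(G i x)\<^sup>2 \<le> (2 * f x)\<^sup>2" by (simp add: abs_le_square_iff)
    then show ?thesis by (simp add: power_mult_distrib)
  qed
  have fi9: "integrable (\<mu> \<phi>) (\<lambda>x. (G i x - f x)\<^sup>2)" for i
    by (rule Bochner_Integration.integrable_bound[where f = "\<lambda>x. 9 * (f x)\<^sup>2"]) (use fint d9 in auto)
  have lim0: "(\<lambda>i. LINT x|\<mu> \<phi>. (G i x - f x)\<^sup>2) \<longlonglongrightarrow> (LINT x|\<mu> \<phi>. 0)"
  proof (rule integral_dominated_convergence[where w = "\<lambda>x. 9 * (f x)\<^sup>2"])
    have "(\<lambda>i. (G i x - f x)\<^sup>2) \<longlonglongrightarrow> (f x - f x)\<^sup>2" for x by (intro tendsto_intros G)
    then show "AE x in \<mu> \<phi>. (\<lambda>i. (G i x - f x)\<^sup>2) \<longlonglongrightarrow> 0" by simp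
  qed (use fint d9 in auto)
  define X where "X i = T (G i) \<phi>" for i
  have XX: "(norm (X i - X j))\<^sup>2 \<le> 2 * (LINT x|\<mu> \<phi>. (G i x - f x)\<^sup>2) + 2 * (LINT x|\<mu> \<phi>. (G j x - f x)\<^sup>2)" for i j
  proof -
    have "(norm (X i - X j))\<^sup>2 = (LINT x|\<mu> \<phi>. (G i x - G j x)\<^sup>2)"
      unfolding X_def T_diff[OF Gm Gf Gm Gf] by (rule norm_T[OF _ df]) simp
    also have "\<dots> \<le> (LINT x|\<mu> \<phi>. 2 * (G i x - f x)\<^sup>2 + 2 * (G j x - f x)\<^sup>2)"
    proof (rule integral_mono_AE')
      have "(G i x - G j x)\<^sup>2 \<le> 2 * (G i x - f x)\<^sup>2 + 2 * (G j x - f x)\<^sup>2" for x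
        using zero_le_power2[of "(G i x - f x) + (G j x - f x)"] by (simp add: power2_eq_square algebra_simps)
      then show "AE x in \<mu> \<phi>. (G i x - G j x)\<^sup>2 \<le> 2 * (G i x - f x)\<^sup>2 + 2 * (G j x - f x)\<^sup>2" by auto
    qed (use fi9 in auto)
    also have "\<dots> = 2 * (LINT x|\<mu> \<phi>. (G i x - f x)\<^sup>2) + 2 * (LINT x|\<mu> \<phi>. (G j x - f x)\<^sup>2)"
      using fi9 by simp
    finally show ?thesis .
  qed
  have "Cauchy X"
  proof (rule CauchyI)
    fix e :: real assume e: "e > 0"
    then have "\<forall>\<^sub>F i in sequentially. (LINT x|\<mu> \<phi>. (G i x - f x)\<^sup>2) < e\<^sup>2 / 4"
      using lim0 by (intro order_tendstoD) auto
    then obtain N where N: "\<And>i. i \<ge> N \<Longrightarrow> (LINT x|\<mu> \<phi>. (G i x - f x)\<^sup>2) < e\<^sup>2 / 4"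
      by (auto simp: eventually_sequentially)
    have "norm (X m - X n) < e" if "m \<ge> N" "n \<ge> N" for m n
    proof -
      have "(norm (X m - X n))\<^sup>2 < e\<^sup>2" using XX[of m n] N[OF that(1)] N[OF that(2)] by linarith
      then show ?thesis using e by (simp add: power2_less_imp_less)
    qed
    then show "\<exists>M. \<forall>m\<ge>M. \<forall>n\<ge>M. norm (X m - X n) < e" by blast
  qed
  then obtain \<psi> where \<psi>: "X \<longlonglongrightarrow> \<psi>" using Cauchy_convergent convergent_def by blast
  have "(\<lambda>i. (norm (X i))\<^sup>2) \<longlonglongrightarrow> (norm \<psi>)\<^sup>2" by (intro tendsto_intros \<psi>)
  moreover have "(\<lambda>i. LINT x|\<mu> \<phi>. (G i x)\<^sup>2) \<longlonglongrightarrow> (LINT x|\<mu> \<phi>. (f x)\<^sup>2)"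
    by (rule integral_dominated_convergence[where w = "\<lambda>x. 4 * (f x)\<^sup>2"])
      (use fint d4 G(2) in \<open>auto intro!: tendsto_intros\<close>)
  moreover have "(norm (X i))\<^sup>2 = (LINT x|\<mu> \<phi>. (G i x)\<^sup>2)" for i
    unfolding X_def by (rule norm_T[OF Gm Gf])
  ultimately have n: "(norm \<psi>)\<^sup>2 = (LINT x|\<mu> \<phi>. (f x)\<^sup>2)" using LIMSEQ_unique by auto
  have "cinner \<psi> \<xi> = spectral_sesq E f \<phi> \<xi>" if \<xi>: "\<xi> \<in> spectral_domain E f" for \<xi>
  proof -
    have "(\<lambda>i. spectral_sesq E (G i) \<phi> \<xi>) \<longlonglongrightarrow> spectral_sesq E f \<phi> \<xi>"
      unfolding spectral_sesq_def
    proof (intro tendsto_intros)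
      fix k
      have "\<phi> + scaleC (\<i> ^ k) \<xi> \<in> spectral_domain E f"
        by (intro spectral_domain_add spectral_domain_scaleC \<phi> \<xi>) auto
      then have i: "integrable (\<mu> (\<phi> + scaleC (\<i> ^ k) \<xi>)) f"
        by (intro spectral_domain_integrable) auto
      show "(\<lambda>i. LINT x|\<mu> (\<phi> + scaleC (\<i> ^ k) \<xi>). G i x) \<longlonglongrightarrow> (LINT x|\<mu> (\<phi> + scaleC (\<i> ^ k) \<xi>). f x)"
        by (rule integral_dominated_convergence[where w = "\<lambda>x. 2 * \<bar>f x\<bar>"])
          (use i Gb G(2) in auto)
    qed
    moreover have "(\<lambda>i. cinner (X i) \<xi>) \<longlonglongrightarrow> cinner \<psi> \<xi>" by (intro tendsto_intros \<psi>)
    moreover have "cinner (X i) \<xi> = spectral_sesq E (G i) \<phi> \<xi>" for i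
      unfolding X_def by (rule cinner_T[OF Gm Gf])
    ultimately show ?thesis using LIMSEQ_unique by auto
  qed
  with n \<phi> show ?thesis by (auto simp: spectral_integral_def)
qed

text \<open>Projecting \<open>\<psi>\<close> to the set where \<open>\<bar>f\<bar> \<le> n\<close>
  gives a vector of the domain, so orthogonality makes \<open>\<mu> \<psi>\<close> vanish on that
  set. These sets increase to the whole line, whose measure is the squared norm of
  \<open>\<psi>\<close>.\<close>

lemma spectral_domain_dense:
  assumes [measurable]: "f \<in> borel_measurable borel"
    and orth: "\<And>\<xi>. \<xi> \<in> spectral_domain E f \<Longrightarrow> cinner \<psi> \<xi> = 0"
  shows "\<psi> = 0"
proof -
  interpret finite_measure "\<mu> \<psi>" by (rule finite_measure_\<mu>)
  define B where "B n = {x. \<bar>f x\<bar> \<le> real n}" for n :: nat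
  have B [measurable]: "B n \<in> sets borel" for n unfolding B_def by measurable
  have "E (B n) \<psi> \<in> spectral_domain E f" for n
  proof -
    have "(\<integral>\<^sup>+ x. ennreal ((f x)\<^sup>2) \<partial>\<mu> (E (B n) \<psi>)) = (\<integral>\<^sup>+ x. indicator (B n) x * ennreal ((f x)\<^sup>2) \<partial>\<mu> \<psi>)"
      by (simp add: \<mu>_E nn_integral_density)
    also have "\<dots> \<le> (\<integral>\<^sup>+ x. ennreal ((real n)\<^sup>2) \<partial>\<mu> \<psi>)"
      by (intro nn_integral_mono) (auto simp: B_def abs_le_square_iff[symmetric] split: split_indicator intro!: ennreal_leI)
    also have "\<dots> < \<infinity>" by (simp add: ennreal_mult_less_top emeasure_\<mu>)
    finally show ?thesis by (simp add: spectral_domain_iff)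
  qed
  then have "cinner \<psi> (E (B n) \<psi>) = 0" for n by (rule orth)
  then have "measure (\<mu> \<psi>) (B n) = 0" for n
    using measure_\<mu>_cinner[OF B, of \<psi> n] E_adjoint[OF B] by simp
  moreover have "(\<lambda>n. measure (\<mu> \<psi>) (B n)) \<longlonglongrightarrow> measure (\<mu> \<psi>) (\<Union>n. B n)"
    by (rule finite_Lim_measure_incseq) (auto simp: incseq_def B_def)
  ultimately have "measure (\<mu> \<psi>) (\<Union>n. B n) = 0" by (simp add: LIMSEQ_const_iff)
  moreover have "(\<Union>n. B n) = UNIV" using real_arch_simple by (auto simp: B_def)
  ultimately show ?thesis by (simp add: measure_\<mu>)
qed

text \<open>\<open>spectral_integral\<close> tests \<open>\<psi>\<close> only against vectors of the
  domain. Density shows that \<open>\<psi>\<close> is determined, hence equal to the vector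
  constructed in \<open>spectral_integral_exists\<close>.\<close>

lemma spectral_integral_norm:
  assumes f: "f \<in> borel_measurable borel" and \<psi>: "(\<phi>, \<psi>) \<in> spectral_integral E f"
  shows "(norm \<psi>)\<^sup>2 = (LINT x|\<mu> \<phi>. (f x)\<^sup>2)"
proof -
  have "\<phi> \<in> spectral_domain E f" using \<psi> by (simp add: spectral_integral_def)
  then obtain \<psi>' where \<psi>': "(\<phi>, \<psi>') \<in> spectral_integral E f" "(norm \<psi>')\<^sup>2 = (LINT x|\<mu> \<phi>. (f x)\<^sup>2)"
    using spectral_integral_exists[OF f] by blast
  have "\<psi> - \<psi>' = 0"
    by (rule spectral_domain_dense[OF f]) (use \<psi> \<psi>' in \<open>auto simp: spectral_integral_def cinner_simps\<close>)
  then show ?thesis using \<psi>' by simp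
qed

lemma spectral_integral_nn_integral:
  assumes f: "f \<in> borel_measurable borel" and \<psi>: "(\<phi>, \<psi>) \<in> spectral_integral E f"
  shows "ennreal ((norm \<psi>)\<^sup>2) = (\<integral>\<^sup>+ x. ennreal ((f x)\<^sup>2) \<partial>\<mu> \<phi>)"
  unfolding spectral_integral_norm[OF assms]
  by (rule nn_integral_eq_integral[symmetric])
    (use spectral_domain_integrable[OF f] \<psi> in \<open>auto simp: spectral_integral_def\<close>)

lemma Domain_spectral_integral:
  "f \<in> borel_measurable borel \<Longrightarrow> Domain (spectral_integral E f) = spectral_domain E f"
proof (intro equalityI subsetI)
  fix \<phi> assume "f \<in> borel_measurable borel" "\<phi> \<in> spectral_domain E f"
  then show "\<phi> \<in> Domain (spectral_integral E f)" using spectral_integral_exists by blast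
qed (auto simp: spectral_integral_def)

lemma spectral_integral_quadratic:
  assumes f: "f \<in> borel_measurable borel" and \<psi>: "(\<phi>, \<psi>) \<in> spectral_integral E f"
  shows "cinner \<psi> \<phi> = of_real (LINT x|\<mu> \<phi>. f x)"
proof -
  \<comment> \<open>The four polarisation terms are multiples of one measure, with factors
    \<open>|1 + \<i> ^ k|^2 = 4, 2, 0, 2\<close>; weighted by \<open>\<i> ^ k\<close> they add up to
    \<open>4\<close>.\<close>
  have e: "\<phi> + scaleC a \<phi> = scaleC (1 + a) \<phi>" for a by (simp add: scaleC_add_left)
  have "cinner \<psi> \<phi> = spectral_sesq E f \<phi> \<phi>" using \<psi> by (auto simp: spectral_integral_def)
  also have "\<dots> = of_real (LINT x|\<mu> \<phi>. f x)"
    unfolding spectral_sesq_def e integral_\<mu>_scaleC[OF f]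
    by (simp add: eval_nat_numeral cmod_def)
  finally show ?thesis .
qed

text \<open>A vector localised in \<open>{- n .. - 1 / (m + 1)}\<close> lies in the domain because
  the set is bounded, and its quadratic form is at most \<open>- 1 / (m + 1)\<close> times its mass.
  Positivity forces the mass to be zero, and countably many such sets cover the negative half
  line.\<close>

lemma \<mu>_negative_eq_0:
  assumes pos: "\<And>\<phi> \<psi>. (\<phi>, \<psi>) \<in> spectral_integral E (\<lambda>s. s) \<Longrightarrow> 0 \<le> Re (cinner \<psi> \<phi>)"
  shows "AE x in \<mu> \<phi>. 0 \<le> x"
proof -
  have "emeasure (\<mu> \<phi>) {- real n .. - 1 / (Suc m)} = 0" for n m
  proof -
    let ?B = "{- real n .. - 1 / (Suc m)}"
    let ?\<phi> = "E ?B \<phi>"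
    have B: "?B \<in> sets borel" by simp
    have m: "\<mu> ?\<phi> = density (\<mu> \<phi>) (\<lambda>x. ennreal (indicator ?B x))"
      using \<mu>_E[OF B, of \<phi>] by (simp add: ennreal_indicator)
    have "(\<integral>\<^sup>+ x. ennreal (x\<^sup>2) \<partial>\<mu> ?\<phi>) = (\<integral>\<^sup>+ x. indicator ?B x * ennreal (x\<^sup>2) \<partial>\<mu> \<phi>)"
      by (subst \<mu>_E[OF B], subst nn_integral_density) auto
    also have "\<dots> \<le> (\<integral>\<^sup>+ x. ennreal ((real n)\<^sup>2) \<partial>\<mu> \<phi>)"
    proof (intro nn_integral_mono)
      fix x
      have sq: "x\<^sup>2 \<le> (real n)\<^sup>2" if "x \<in> ?B"
      proof -
        from that have "x \<le> - 1 / real (Suc m)" by simp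
        also have "\<dots> \<le> 0" by simp
        finally have "\<bar>x\<bar> \<le> \<bar>real n\<bar>" using that by auto
        then show ?thesis by (simp only: abs_le_square_iff)
      qed
      then show "indicator ?B x * ennreal (x\<^sup>2) \<le> ennreal ((real n)\<^sup>2)"
        using sq by (auto split: split_indicator intro!: ennreal_leI)
    qed
    also have "\<dots> < \<infinity>" by (simp add: ennreal_mult_less_top emeasure_\<mu>)
    finally have "?\<phi> \<in> spectral_domain E (\<lambda>s. s)" by (simp add: spectral_domain_iff)
    then obtain \<psi> where \<psi>: "(?\<phi>, \<psi>) \<in> spectral_integral E (\<lambda>s. s)"
      using spectral_integral_exists[of "\<lambda>s. s"] by auto
    have i1: "integrable (\<mu> \<phi>) (\<lambda>x. indicator ?B x :: real)"
      by (rule integrable_bounded_\<mu>[of _ 1]) (auto split: split_indicator)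
    have i2: "integrable (\<mu> \<phi>) (\<lambda>x. indicator ?B x * x)"
    proof (rule integrable_bounded_\<mu>[of _ "real n"])
      fix x
      have "\<bar>x\<bar> \<le> real n" if "x \<in> ?B"
      proof -
        from that have "x \<le> - 1 / real (Suc m)" by simp
        also have "\<dots> \<le> 0" by simp
        finally show ?thesis using that by auto
      qed
      then show "\<bar>indicator ?B x * x\<bar> \<le> real n" by (auto split: split_indicator)
    qed simp
    have "0 \<le> Re (cinner \<psi> ?\<phi>)" by (rule pos[OF \<psi>])
    also have "cinner \<psi> ?\<phi> = of_real (LINT x|\<mu> ?\<phi>. x)"
      by (rule spectral_integral_quadratic[OF _ \<psi>]) simp
    also have "Re (of_real (LINT x|\<mu> ?\<phi>. x)) = (LINT x|\<mu> \<phi>. indicator ?B x * x)"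
      unfolding m by (subst integral_density) auto
    also have "\<dots> \<le> (LINT x|\<mu> \<phi>. (- 1 / Suc m) * indicator ?B x)"
      by (intro integral_mono i2 integrable_mult_right i1) (auto split: split_indicator)
    also have "\<dots> = (- 1 / Suc m) * measure (\<mu> \<phi>) ?B" by simp
    finally have "measure (\<mu> \<phi>) ?B \<le> 0" by (simp add: field_simps)
    then show ?thesis using finite_measure.emeasure_eq_measure[OF finite_measure_\<mu>]
      by (simp add: antisym[OF _ measure_nonneg])
  qed
  then have "AE x in \<mu> \<phi>. \<forall>n m. x \<notin> {- real n .. - 1 / (Suc m)}"
    unfolding AE_all_countable by (intro allI AE_not_in) (auto simp: null_sets_def)
  then show ?thesis
  proof eventually_elim
    case (elim x)
    show ?case
    proof (rule ccontr)
      assume "\<not> 0 \<le> x"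
      then obtain m where "inverse (real (Suc m)) < - x" using reals_Archimedean[of "- x"] by auto
      moreover obtain n where "- x \<le> real n" using real_arch_simple by blast
      ultimately have "x \<in> {- real n .. - 1 / (Suc m)}" by (auto simp: inverse_eq_divide)
      with elim show False by blast
    qed
  qed
qed

lemma spectral_sesq_const_1: "spectral_sesq E (\<lambda>x. 1) \<phi> \<xi> = cinner \<phi> \<xi>"
  using polarization[of UNIV \<phi> \<xi>] by (simp add: spectral_sesq_def)

text \<open>If the operator kills \<open>\<phi>\<close>, the second moment of
  \<open>\<mu> \<phi>\<close> is zero and the measure sits at the point \<open>0\<close>, where
  \<open>f = 1\<close>. So \<open>\<psi> - \<phi>\<close>, the value of \<open>f - 1\<close> at
  \<open>\<phi>\<close>, has norm zero. The same \<open>E\<close> serves for the operator and for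
  \<open>f\<close>, as \<open>function_of_operator\<close> provides it.\<close>

lemma spectral_integral_kernel:
  assumes f: "f \<in> borel_measurable borel" "f 0 = 1"
    and k: "(\<phi>, 0) \<in> spectral_integral E (\<lambda>s. s)" and \<psi>: "(\<phi>, \<psi>) \<in> spectral_integral E f"
  shows "\<psi> = \<phi>"
proof -
  note [measurable] = f(1)
  have "(\<integral>\<^sup>+ x. ennreal (x\<^sup>2) \<partial>\<mu> \<phi>) = 0"
    using spectral_integral_nn_integral[OF _ k] by simp
  then have ae: "AE x in \<mu> \<phi>. x = 0"
    by (subst (asm) nn_integral_0_iff_AE) auto
  have z: "(LINT x|\<mu> \<phi>. (f x - 1)\<^sup>2) = 0"
    by (rule integral_eq_zero_AE) (use ae f(2) in \<open>auto elim: eventually_mono\<close>)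
  have nz: "(\<integral>\<^sup>+ x. ennreal ((f x - 1)\<^sup>2) \<partial>\<mu> \<phi>) = 0"
    by (subst nn_integral_0_iff_AE) (use ae f(2) in \<open>auto elim: eventually_mono\<close>)
  have "(\<phi>, \<psi> - \<phi>) \<in> spectral_integral E (\<lambda>x. f x - 1)"
    unfolding spectral_integral_def
  proof (clarsimp, intro conjI ballI)
    show "\<phi> \<in> spectral_domain E (\<lambda>x. f x - 1)" by (simp add: spectral_domain_iff nz)
    fix \<xi> assume \<xi>: "\<xi> \<in> spectral_domain E (\<lambda>x. f x - 1)"
    interpret finite_measure "\<mu> \<xi>" by (rule finite_measure_\<mu>)
    have "integrable (\<mu> \<xi>) (\<lambda>x. (f x - 1)\<^sup>2)" using spectral_domain_integrable(1)[OF _ \<xi>] by simp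
    then have "integrable (\<mu> \<xi>) (\<lambda>x. 2 * (f x - 1)\<^sup>2 + 2)" by simp
    \<comment> \<open>The definition requires testing with the domain of \<open>f - 1\<close>; as
      \<open>\<mu> \<xi>\<close> is finite, such a \<open>\<xi>\<close> is also in the domain of
      \<open>f\<close>, where the defining identity for \<open>\<psi>\<close> is available.\<close>
    then have "integrable (\<mu> \<xi>) (\<lambda>x. (f x)\<^sup>2)"
    proof (rule Bochner_Integration.integrable_bound)
      have "(f x)\<^sup>2 \<le> 2 * (f x - 1)\<^sup>2 + 2" for x
        using zero_le_power2[of "f x - 2"] by (simp add: power2_eq_square algebra_simps)
      then show "AE x in \<mu> \<xi>. norm ((f x)\<^sup>2) \<le> norm (2 * (f x - 1)\<^sup>2 + 2)" by auto
    qed simp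
    then have \<xi>f: "\<xi> \<in> spectral_domain E f"
      by (auto simp: spectral_domain_iff integrable_iff_bounded)
    have i: "integrable (\<mu> (\<phi> + scaleC (\<i> ^ k) \<xi>)) f" for k
      by (intro spectral_domain_integrable(2) f spectral_domain_add spectral_domain_scaleC \<xi>f)
        (use \<psi> in \<open>simp add: spectral_integral_def\<close>)
    have "cinner (\<psi> - \<phi>) \<xi> = spectral_sesq E f \<phi> \<xi> - spectral_sesq E (\<lambda>x. 1) \<phi> \<xi>"
      using \<psi> \<xi>f by (auto simp: cinner_simps spectral_sesq_const_1 spectral_integral_def)
    also have "\<dots> = spectral_sesq E (\<lambda>x. f x - 1) \<phi> \<xi>"
      by (intro spectral_sesq_add[symmetric] i integrable_bounded_\<mu>[of _ 1]) auto
    finally show "cinner (\<psi> - \<phi>) \<xi> = spectral_sesq E (\<lambda>x. f x - 1) \<phi> \<xi>" .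
  qed
  from spectral_integral_norm[OF _ this] have "(norm (\<psi> - \<phi>))\<^sup>2 = 0" by (simp add: z)
  then show ?thesis by simp
qed

end

subsection \<open>The Fourier transform on \<open>L\<^sub>2\<close>\<close>

text \<open>\<open>subspace\<close> is meant over the reals, hence the demand that \<open>W\<close>
  contain all complex multiples of the \<open>e a\<close>; the multiples by \<open>1\<close> and
  \<open>\<i>\<close> give the vanishing of the complex inner products.\<close>

lemma total_closed_subspace:
  fixes e :: "'i \<Rightarrow> l2"
  assumes tot: "\<And>x. (\<And>a. cinner x (e a) = 0) \<Longrightarrow> x = 0"
    and W: "subspace W" "closed W" "\<And>c a. scaleC c (e a) \<in> W"
  shows "x \<in> W"
proof -
  have "closure W = UNIV"
  proof (rule closure_eq_UNIV_if_orthogonal_trivial[OF W(1)])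
    fix x assume x: "\<And>z. z \<in> W \<Longrightarrow> x \<bullet> z = 0"
    show "x = 0"
      using x[OF W(3)[of 1]] x[OF W(3)[of \<i>]] by (intro tot) (simp add: cinner_eq_inner complex_eq_iff)
  qed
  then show ?thesis using W(2) by simp
qed

text \<open>The map is built as a graph \<open>G\<close>: the closure of the real span of all pairs
  of corresponding multiples. Equality of inner products is a closed bilinear condition, so it
  passes from the generators to \<open>G\<close>. Hence \<open>G\<close> is single valued, and its
  first projection is closed because a Cauchy sequence of arguments has a Cauchy sequence of values;
  by totality it is everything.\<close>

lemma isometry_extension:
  fixes e v :: "'i \<Rightarrow> l2"
  assumes ip: "\<And>a b. cinner (v a) (v b) = cinner (e a) (e b)"
    and tot: "\<And>x. (\<And>a. cinner x (e a) = 0) \<Longrightarrow> x = 0"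
  shows "\<exists>U. (\<forall>x y. cinner (U x) (U y) = cinner x y) \<and> (\<forall>a. U (e a) = v a) \<and>
    (\<forall>x y. U (x + y) = U x + U y) \<and> (\<forall>c x. U (scaleC c x) = scaleC c (U x))"
proof -
  define P where "P = {(scaleC c (e a), scaleC c (v a)) | c a. True}"
  define G where "G = closure (span P)"
  have Gsub: "subspace G" unfolding G_def by (intro subspace_closure subspace_span)
  have Gmin: "G \<subseteq> W" if "P \<subseteq> W" "subspace W" "closed W" for W
    unfolding G_def using that by (intro closure_minimal span_minimal)
  have PG: "P \<subseteq> G" unfolding G_def using span_superset closure_subset by blast
  have iso: "cinner (snd p) (snd q) = cinner (fst p) (fst q)" if "p \<in> G" "q \<in> G" for p q
  proof -
    \<comment> \<open>The condition is extended in one argument at a time, here for \<open>p\<close>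
      a generator and afterwards for \<open>p\<close> in \<open>G\<close>.\<close>
    have 1: "G \<subseteq> {q. cinner (snd p) (snd q) = cinner (fst p) (fst q)}" if "p \<in> P" for p
    proof (rule Gmin)
      show "P \<subseteq> {q. cinner (snd p) (snd q) = cinner (fst p) (fst q)}"
        using that by (auto simp: P_def cinner_simps ip)
      show "closed {q. cinner (snd p) (snd q) = cinner (fst p) (fst q)}"
        by (intro closed_Collect_eq continuous_intros)
    qed (auto simp: subspace_def cinner_simps)
    have "G \<subseteq> {p. cinner (snd p) (snd q) = cinner (fst p) (fst q)}"
    proof (rule Gmin)
      show "P \<subseteq> {p. cinner (snd p) (snd q) = cinner (fst p) (fst q)}" using 1 \<open>q \<in> G\<close> by auto
      show "closed {p. cinner (snd p) (snd q) = cinner (fst p) (fst q)}"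
        by (intro closed_Collect_eq continuous_intros)
    qed (auto simp: subspace_def cinner_simps)
    then show ?thesis using \<open>p \<in> G\<close> by auto
  qed
  have scal: "(scaleC c (fst p), scaleC c (snd p)) \<in> G" if "p \<in> G" for c p
  proof -
    have "G \<subseteq> {p. (scaleC c (fst p), scaleC c (snd p)) \<in> G}"
    proof (rule Gmin)
      show "P \<subseteq> {p. (scaleC c (fst p), scaleC c (snd p)) \<in> G}"
        using PG by (auto simp: P_def) (metis (mono_tags, lifting) mem_Collect_eq subsetD)
      have "closed ((\<lambda>p. (scaleC c (fst p), scaleC c (snd p))) -` G)"
        by (rule closed_vimage) (auto simp: G_def intro!: continuous_intros)
      then show "closed {p. (scaleC c (fst p), scaleC c (snd p)) \<in> G}" by (simp add: vimage_def)
      show "subspace {p. (scaleC c (fst p), scaleC c (snd p)) \<in> G}"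
        unfolding subspace_def
      proof (intro conjI ballI allI; clarsimp)
        show "(0, 0) \<in> G" using subspace_0[OF Gsub] by (simp add: zero_prod_def)
        show "(scaleC c (a + aa), scaleC c (b + ba)) \<in> G"
          if "(scaleC c a, scaleC c b) \<in> G" "(scaleC c aa, scaleC c ba) \<in> G" for a aa b ba
          using subspace_add[OF Gsub that] by (simp add: scaleC_add_right)
        show "(scaleC c (r *\<^sub>R a), scaleC c (r *\<^sub>R b)) \<in> G" if "(scaleC c a, scaleC c b) \<in> G" for r a b
          using subspace_scale[OF Gsub that, of r] by (simp add: scaleR_scaleC mult.commute)
      qed
    qed
    then show ?thesis using that by auto
  qed
  have nrm: "norm (snd p) = norm (fst p)" if "p \<in> G" for p
    using iso[OF that that] by (simp add: cinner_self del: of_real_power)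
  have ex: "\<exists>y. (x, y) \<in> G" for x
  proof -
    have "x \<in> fst ` G"
    proof (rule total_closed_subspace[of e, OF tot])
      show "subspace (fst ` G)"
        by (rule linear_subspace_image[OF _ Gsub]) (simp add: linear_fst)
      show "scaleC c (e a) \<in> fst ` G" for c a
        using PG by (force simp: P_def)
      show "closed (fst ` G)"
        unfolding closed_sequential_limits
      proof (intro allI impI, elim conjE)
        fix X l assume "\<forall>n. X n \<in> fst ` G" and X: "X \<longlonglongrightarrow> l"
        then have "\<forall>n. \<exists>y. (X n, y) \<in> G" by force
        then obtain Y where Y: "\<And>n. (X n, Y n) \<in> G" by metis
        have "norm (Y m - Y n) = norm (X m - X n)" for m n
          using nrm[OF subspace_diff[OF Gsub Y[of m] Y[of n]]] by simp
        then have "Cauchy Y" using LIMSEQ_imp_Cauchy[OF X] by (simp add: Cauchy_def dist_norm)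
        then obtain y where "Y \<longlonglongrightarrow> y" using Cauchy_convergent convergent_def by blast
        with X have "(\<lambda>n. (X n, Y n)) \<longlonglongrightarrow> (l, y)" by (rule tendsto_Pair)
        then have "(l, y) \<in> G"
          by (rule closed_sequentially[rotated 2]) (use Y in \<open>auto simp: G_def\<close>)
        then show "l \<in> fst ` G" by force
      qed
    qed
    then show ?thesis by force
  qed
  have uniq: "y = y'" if "(x, y) \<in> G" "(x, y') \<in> G" for x y y'
    using nrm[OF subspace_diff[OF Gsub that]] by simp
  define U where "U x = (SOME y. (x, y) \<in> G)" for x
  have U: "(x, U x) \<in> G" for x unfolding U_def by (rule someI_ex[OF ex])
  show ?thesis
  proof (intro exI[of _ U] conjI allI)
    show "cinner (U x) (U y) = cinner x y" for x y using iso[OF U U] by simp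
    show "U (e a) = v a" for a
    proof (rule uniq[OF U])
      have "(scaleC 1 (e a), scaleC 1 (v a)) \<in> P" unfolding P_def by blast
      then show "(e a, v a) \<in> G" using PG by auto
    qed
    show "U (x + y) = U x + U y" for x y
      by (rule uniq[OF U]) (use subspace_add[OF Gsub U U] in simp)
    show "U (scaleC c x) = scaleC c (U x)" for c x
      by (rule uniq[OF U]) (use scal[OF U] in simp)
  qed
qed

text \<open>Signed, so that integrating against it means integrating from \<open>0\<close> to
  \<open>a\<close> for either sign of \<open>a\<close>; differences give all intervals up to end
  points. The inner products of this family,
  \<open>(\<bar>a\<bar> + \<bar>b\<bar> - \<bar>a - b\<bar>) / 2\<close>, have the shape that the
  integrals of \<open>(1 - cos (a * x)) / x^2\<close> reproduce on the Fourier side.\<close>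

definition ind_fun :: "real \<Rightarrow> real \<Rightarrow> real" where
  "ind_fun a x = (if 0 \<le> a then indicator {0..a} x else - indicator {a..0} x)"

definition ind :: "real \<Rightarrow> l2" where
  "ind a = l2_abs (\<lambda>x. complex_of_real (ind_fun a x))"

lemma borel_measurable_ind_fun [measurable]: "ind_fun a \<in> borel_measurable borel"
  unfolding ind_fun_def by measurable

lemma abs_ind_fun_le: "\<bar>ind_fun a x\<bar> \<le> indicator {-\<bar>a\<bar>..\<bar>a\<bar>} x"
  by (auto simp: ind_fun_def split: split_indicator)

lemma square_integrable_ind_fun: "square_integrable (\<lambda>x. complex_of_real (ind_fun a x))"
proof -
  have "(cmod (complex_of_real (ind_fun a x)))\<^sup>2 = indicator (if 0 \<le> a then {0..a} else {a..0}) x" for x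
    by (auto simp: ind_fun_def split: split_indicator)
  then show ?thesis by (auto simp: square_integrable_def intro!: integrable_real_indicator)
qed

lemma cinner_ind: "cinner (ind a) (ind b) = complex_of_real ((\<bar>a\<bar> + \<bar>b\<bar> - \<bar>a - b\<bar>) / 2)"
proof -
  have "cinner (ind a) (ind b) = (LINT x|lborel. complex_of_real (ind_fun a x) * cnj (complex_of_real (ind_fun b x)))"
    unfolding ind_def by (intro cinner_l2_abs square_integrable_ind_fun)
  also have "\<dots> = complex_of_real (LINT x|lborel. ind_fun a x * ind_fun b x)"
    by (simp add: integral_complex_of_real[symmetric])
  also have "(LINT x|lborel. ind_fun a x * ind_fun b x) = (\<bar>a\<bar> + \<bar>b\<bar> - \<bar>a - b\<bar>) / 2"
  proof -
    consider "0 \<le> a" "0 \<le> b" | "a < 0" "b < 0" | "0 \<le> a" "b < 0" | "a < 0" "0 \<le> b" by linarith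
    then show ?thesis
    proof cases
      case 1
      then have "(\<lambda>x. ind_fun a x * ind_fun b x) = indicator {0..min a b}"
        by (auto simp: ind_fun_def fun_eq_iff split: split_indicator)
      then show ?thesis using 1 by (simp add: min_def)
    next
      case 2
      then have "(\<lambda>x. ind_fun a x * ind_fun b x) = indicator {max a b..0}"
        by (auto simp: ind_fun_def fun_eq_iff split: split_indicator)
      then show ?thesis using 2 by (simp add: max_def)
    next
      case 3
      then have "(\<lambda>x. ind_fun a x * ind_fun b x) = (\<lambda>x. - indicator {0} x)"
        by (auto simp: ind_fun_def fun_eq_iff split: split_indicator)
      then show ?thesis using 3 by simp
    next
      case 4
      then have "(\<lambda>x. ind_fun a x * ind_fun b x) = (\<lambda>x. - indicator {0} x)"
        by (auto simp: ind_fun_def fun_eq_iff split: split_indicator)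
      then show ?thesis using 4 by simp
    qed
  qed
  finally show ?thesis .
qed

lemma cinner_ind_right: "cinner \<phi> (ind a) = (LINT x|lborel. ind_fun a x *\<^sub>R l2_rep \<phi> x)"
proof -
  have "cinner \<phi> (ind a) = cinner (l2_abs (l2_rep \<phi>)) (ind a)" by (simp add: l2_abs_rep)
  also have "\<dots> = (LINT x|lborel. l2_rep \<phi> x * cnj (complex_of_real (ind_fun a x)))"
    unfolding ind_def by (intro cinner_l2_abs square_integrable_l2_rep square_integrable_ind_fun)
  finally show ?thesis by (simp add: scaleR_conv_of_real mult.commute)
qed

lemma AE_not_point: "AE x in lborel. x \<noteq> (a :: real)"
  by (rule AE_I'[of "{a}"]) auto

lemma integrable_ind_fun_mult:
  fixes f :: "real \<Rightarrow> complex"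
  assumes "\<And>a b. set_integrable lborel {a<..<b} f" and [measurable]: "f \<in> borel_measurable borel"
  shows "integrable lborel (\<lambda>x. ind_fun a x *\<^sub>R f x)"
proof (rule Bochner_Integration.integrable_bound)
  show "integrable lborel (\<lambda>x. indicat_real {-\<bar>a\<bar> - 1<..<\<bar>a\<bar> + 1} x *\<^sub>R f x)"
    using assms(1) by (simp add: set_integrable_def)
  show "AE x in lborel. norm (ind_fun a x *\<^sub>R f x) \<le> norm (indicat_real {-\<bar>a\<bar> - 1<..<\<bar>a\<bar> + 1} x *\<^sub>R f x)"
  proof (intro AE_I2)
    fix x
    have "\<bar>ind_fun a x\<bar> \<le> indicat_real {-\<bar>a\<bar> - 1<..<\<bar>a\<bar> + 1} x"
      by (auto simp: ind_fun_def split: split_indicator)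
    from mult_right_mono[OF this, of "norm (f x)"]
    show "norm (ind_fun a x *\<^sub>R f x) \<le> norm (indicat_real {-\<bar>a\<bar> - 1<..<\<bar>a\<bar> + 1} x *\<^sub>R f x)" by simp
  qed
qed simp

lemma AE_eq_0_if_ind_integrals_eq_0:
  fixes f :: "real \<Rightarrow> complex"
  assumes i: "\<And>a b. set_integrable lborel {a<..<b} f" and [measurable]: "f \<in> borel_measurable borel"
    and z: "\<And>a. (LINT x|lborel. ind_fun a x *\<^sub>R f x) = 0"
  shows "AE x in lborel. f x = 0"
proof (rule AE_eq_0_if_interval_integrals_eq_0[OF i])
  fix a b :: real assume ab: "a < b"
  have "(LINT x:{a<..<b}|lborel. f x) = (LINT x|lborel. ind_fun b x *\<^sub>R f x - ind_fun a x *\<^sub>R f x)"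
    unfolding set_lebesgue_integral_def
  proof (rule integral_cong_AE)
    show "AE x in lborel. indicat_real {a<..<b} x *\<^sub>R f x = ind_fun b x *\<^sub>R f x - ind_fun a x *\<^sub>R f x"
      using AE_not_point[of a] AE_not_point[of b] AE_not_point[of 0]
      by eventually_elim (use ab in \<open>auto simp: ind_fun_def split: split_indicator\<close>)
  qed auto
  also have "\<dots> = 0"
    by (subst Bochner_Integration.integral_diff) (auto intro!: integrable_ind_fun_mult i simp: z)
  finally show "(LINT x:{a<..<b}|lborel. f x) = 0" .
qed

lemma ind_total: "(\<And>a. cinner \<phi> (ind a) = 0) \<Longrightarrow> \<phi> = 0"
proof -
  assume "\<And>a. cinner \<phi> (ind a) = 0"
  then have "AE x in lborel. l2_rep \<phi> x = 0"
    by (intro AE_eq_0_if_ind_integrals_eq_0 set_integrable_l2_rep) (auto simp: cinner_ind_right)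
  then show "\<phi> = 0" unfolding l2_eq_iff_AE using l2_rep_zero_AE by eventually_elim simp
qed

text \<open>Integration by parts gives the primitive \<open>Si x - (1 - cos x) / x\<close> of
  \<open>(1 - cos x) / x^2\<close>, so the half line integral reduces to the known limit
  \<open>pi / 2\<close> of \<open>Si\<close>. Scaling by \<open>a\<close> turns the factor
  \<open>a^2\<close> into \<open>\<bar>a\<bar>\<close>.\<close>

lemma integral_one_minus_cos:
  "integrable lborel (\<lambda>x. (1 - cos (a * x)) / x\<^sup>2)" "(LINT x|lborel. (1 - cos (a * x)) / x\<^sup>2) = pi * \<bar>a\<bar>"
proof -
  \<comment> \<open>Equals \<open>(1 - cos x) / x^2\<close> away from \<open>0\<close> by the half
    angle formula, and is continuous at \<open>0\<close> as well, where the quotient has the default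
    value \<open>0\<close>.\<close>
  define q where "q x = (sinc (x / 2))\<^sup>2 / 2" for x :: real
  have qc: "isCont q x" for x
  proof -
    have "isCont (\<lambda>x. sinc (x / 2)) x" by (rule isCont_o2[OF _ isCont_sinc]) (auto intro!: continuous_intros)
    then show ?thesis unfolding q_def by (intro continuous_intros) auto
  qed
  have qm [measurable]: "q \<in> borel_measurable borel"
    by (intro borel_measurable_continuous_onI continuous_at_imp_continuous_on ballI qc)
  have q0: "q x \<ge> 0" for x by (simp add: q_def)
  have qe: "q (- x) = q x" for x by (simp add: q_def)
  have qx: "q x = (1 - cos x) / x\<^sup>2" if "x \<noteq> 0" for x
    using that cos_double_sin[of "x/2"] by (simp add: q_def power_divide field_simps)
  define F where "F x = Si x - x * q x" for x
  have dF: "(F has_real_derivative q x) (at x)" for x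
  proof (cases "x = 0")
    case True
    have "((\<lambda>x. x * q x) has_real_derivative q 0) (at 0)"
      unfolding DERIV_def using qc[of 0]
      by (simp add: isCont_def) (rule Lim_transform_eventually, assumption, auto simp: eventually_at_filter)
    then have "(F has_real_derivative sinc 0 - q 0) (at 0)"
      unfolding F_def by (intro DERIV_diff DERIV_Si)
    then show ?thesis using True by (simp add: q_def)
  next
    case False
    have "((\<lambda>x. Si x - (1 - cos x) / x) has_real_derivative sinc x - (sin x * x - (1 - cos x) * 1) / (x * x)) (at x)"
      using False by (auto intro!: derivative_eq_intros DERIV_Si)
    moreover have "sinc x - (sin x * x - (1 - cos x) * 1) / (x * x) = q x"
      using False by (simp add: qx field_simps power2_eq_square)
    ultimately have "((\<lambda>x. Si x - (1 - cos x) / x) has_real_derivative q x) (at x)" by simp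
    then show ?thesis
    proof (rule DERIV_cong_ev[OF refl _ refl, THEN iffD1, rotated])
      show "\<forall>\<^sub>F y in nhds x. Si y - (1 - cos y) / y = F y"
      proof -
        have "\<forall>\<^sub>F y in nhds x. y \<in> - {0}" by (rule eventually_nhds_in_open) (use False in auto)
        then show ?thesis by eventually_elim (simp add: F_def qx power2_eq_square)
      qed
    qed
  qed
  have limF: "(F \<longlongrightarrow> pi / 2) at_top"
  proof -
    have "((\<lambda>x. x * q x) \<longlongrightarrow> 0) at_top"
    proof (rule tendsto_sandwich[of "\<lambda>x. 0" _ _ "\<lambda>x. 2 / x"])
      show "((\<lambda>x::real. 2 / x) \<longlongrightarrow> 0) at_top"
        by (intro tendsto_divide_0[OF tendsto_const] filterlim_at_top_imp_at_infinity filterlim_ident)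
      show "\<forall>\<^sub>F x in at_top. x * q x \<le> 2 / x"
      proof (rule eventually_mono[OF eventually_gt_at_top[of 0]])
        fix x :: real assume "x > 0"
        moreover have "1 - cos x \<le> 2" using cos_ge_minus_one[of x] by linarith
        ultimately show "x * q x \<le> 2 / x" by (simp add: qx power2_eq_square divide_right_mono)
      qed
      show "\<forall>\<^sub>F x in at_top. 0 \<le> x * q x"
        by (rule eventually_mono[OF eventually_gt_at_top[of 0]]) (simp add: q0)
    qed simp
    from tendsto_diff[OF Si_at_top this] show ?thesis by (simp add: F_def[abs_def])
  qed
  have "(\<integral>\<^sup>+x. ennreal (q x) * indicator {0..} x \<partial>lborel) = ennreal (pi / 2 - F 0)"
    by (rule nn_integral_FTC_atLeast) (auto intro: dF q0 limF)
  then have h1: "(\<integral>\<^sup>+x. ennreal (q x) * indicator {0..} x \<partial>lborel) = ennreal (pi / 2)"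
    using Si_neg[of 0] by (simp add: F_def)
  have h2: "(\<integral>\<^sup>+x. ennreal (q x) * indicator {..0} x \<partial>lborel) = ennreal (pi / 2)"
  proof -
    have "(\<integral>\<^sup>+x. ennreal (q x) * indicator {..0} x \<partial>lborel) = (\<integral>\<^sup>+x. ennreal (q (0 + - 1 * x)) * indicator {..0} (0 + - 1 * x) \<partial>lborel)"
      by (subst nn_integral_real_affine[where c = "-1" and t = 0]) auto
    also have "\<dots> = (\<integral>\<^sup>+x. ennreal (q x) * indicator {0..} x \<partial>lborel)"
      by (intro nn_integral_cong) (auto simp: qe split: split_indicator)
    finally show ?thesis using h1 by simp
  qed
  have q_int: "(\<integral>\<^sup>+x. ennreal (q x) \<partial>lborel) = ennreal pi"
  proof -
    have "(\<integral>\<^sup>+x. ennreal (q x) \<partial>lborel) = (\<integral>\<^sup>+x. ennreal (q x) * indicator {0..} x + ennreal (q x) * indicator {..0} x \<partial>lborel)"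
      by (rule nn_integral_cong_AE) (use AE_not_point[of 0] in \<open>eventually_elim, auto split: split_indicator\<close>)
    also have "\<dots> = ennreal (pi / 2) + ennreal (pi / 2)"
      by (subst nn_integral_add) (auto simp: h1 h2)
    also have "\<dots> = ennreal pi" by (subst ennreal_plus[symmetric]) auto
    finally show ?thesis .
  qed
  have "has_bochner_integral lborel (\<lambda>x. (1 - cos (a * x)) / x\<^sup>2) (pi * \<bar>a\<bar>)"
  proof (cases "a = 0")
    case False
    show ?thesis
    proof (rule has_bochner_integral_nn_integral)
      have "(\<integral>\<^sup>+x. ennreal ((1 - cos (a * x)) / x\<^sup>2) \<partial>lborel) = (\<integral>\<^sup>+x. ennreal (a\<^sup>2) * ennreal (q (0 + a * x)) \<partial>lborel)"
      proof (rule nn_integral_cong_AE, use AE_not_point[of 0] in eventually_elim)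
        case (elim x)
        then show ?case using False by (simp add: qx ennreal_mult[symmetric] power_mult_distrib)
      qed
      also have "\<dots> = ennreal (a\<^sup>2) * (\<integral>\<^sup>+x. ennreal (q (0 + a * x)) \<partial>lborel)"
        by (rule nn_integral_cmult) measurable
      also have "a\<^sup>2 = \<bar>a\<bar> * \<bar>a\<bar>" by (simp add: power2_eq_square)
      also have "ennreal (\<bar>a\<bar> * \<bar>a\<bar>) * (\<integral>\<^sup>+x. ennreal (q (0 + a * x)) \<partial>lborel)
         = ennreal \<bar>a\<bar> * (ennreal \<bar>a\<bar> * (\<integral>\<^sup>+x. ennreal (q (0 + a * x)) \<partial>lborel))"
        by (simp only: ennreal_mult[OF abs_ge_zero abs_ge_zero] mult.assoc)
      also have "ennreal \<bar>a\<bar> * (\<integral>\<^sup>+x. ennreal (q (0 + a * x)) \<partial>lborel) = ennreal pi"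
        unfolding q_int[symmetric] by (rule nn_integral_real_affine[symmetric]) (use False in auto)
      finally show "(\<integral>\<^sup>+x. ennreal ((1 - cos (a * x)) / x\<^sup>2) \<partial>lborel) = ennreal (pi * \<bar>a\<bar>)"
        by (simp add: ennreal_mult[symmetric] mult.commute)
    qed (auto intro!: AE_I2)
  qed (simp add: has_bochner_integral_iff)
  then show "integrable lborel (\<lambda>x. (1 - cos (a * x)) / x\<^sup>2)" "(LINT x|lborel. (1 - cos (a * x)) / x\<^sup>2) = pi * \<bar>a\<bar>"
    by (auto simp: has_bochner_integral_iff)
qed

lemma integral_odd:
  fixes f :: "real \<Rightarrow> real"
  assumes "\<And>x. f (- x) = - f x"
  shows "(LINT x|lborel. f x) = 0"
proof -
  have "(LINT x|lborel. f x) = (LINT x|lborel. f (- x))"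
    using lborel_integral_real_affine[of "-1" f 0] by simp
  also have "\<dots> = - (LINT x|lborel. f x)" by (simp add: assms)
  finally show ?thesis by simp
qed

text \<open>At \<open>\<xi> = 0\<close> this is the junk value \<open>0\<close>.\<close>

definition ft_ind_fun :: "real \<Rightarrow> real \<Rightarrow> complex" where
  "ft_ind_fun a \<xi> = (1 - cis (- (a * \<xi>))) / (\<i> * of_real \<xi> * of_real (sqrt (2 * pi)))"

lemma borel_measurable_cis [measurable (raw)]:
  "f \<in> borel_measurable M \<Longrightarrow> (\<lambda>x. cis (f x)) \<in> borel_measurable M"
  by (rule borel_measurable_continuous_on[of cis]) (intro continuous_intros)

lemma borel_measurable_ft_ind_fun [measurable]: "ft_ind_fun a \<in> borel_measurable borel"
  unfolding ft_ind_fun_def by measurable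

text \<open>Arranged so that the real part is a combination of three instances of
  \<open>integral_one_minus_cos\<close> and the imaginary part is odd in \<open>\<xi>\<close>. At
  \<open>\<xi> = 0\<close> both sides are \<open>0\<close> through division by zero.\<close>

lemma ft_ind_fun_mult:
  "ft_ind_fun a \<xi> * cnj (ft_ind_fun b \<xi>) =
     Complex (((1 - cos (a * \<xi>)) / \<xi>\<^sup>2 + (1 - cos (b * \<xi>)) / \<xi>\<^sup>2 - (1 - cos ((a - b) * \<xi>)) / \<xi>\<^sup>2) / (2 * pi))
       ((sin (a * \<xi>) - sin (b * \<xi>) - sin ((a - b) * \<xi>)) / \<xi>\<^sup>2 / (2 * pi))"
proof -
  have s: "complex_of_real (sqrt (2 * pi)) * complex_of_real (sqrt (2 * pi)) = complex_of_real (2 * pi)"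
    by (simp flip: of_real_mult)
  have "ft_ind_fun a \<xi> * cnj (ft_ind_fun b \<xi>) =
    ((1 - cis (- (a * \<xi>))) * (1 - cis (b * \<xi>))) / (of_real \<xi> * of_real \<xi> * (of_real (sqrt (2 * pi)) * of_real (sqrt (2 * pi))))"
    by (simp add: ft_ind_fun_def cis_cnj field_simps)
  also have "\<dots> = ((1 - cis (- (a * \<xi>))) * (1 - cis (b * \<xi>))) / of_real (\<xi>\<^sup>2 * (2 * pi))"
    unfolding s by (simp add: power2_eq_square)
  also have "(1 - cis (- (a * \<xi>))) * (1 - cis (b * \<xi>)) =
     Complex ((1 - cos (a * \<xi>)) + (1 - cos (b * \<xi>)) - (1 - cos ((a - b) * \<xi>))) (sin (a * \<xi>) - sin (b * \<xi>) - sin ((a - b) * \<xi>))"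
    by (simp add: complex_eq_iff left_diff_distrib cos_diff sin_diff algebra_simps)
  also have "\<dots> / of_real (\<xi>\<^sup>2 * (2 * pi)) = Complex (((1 - cos (a * \<xi>)) + (1 - cos (b * \<xi>)) - (1 - cos ((a - b) * \<xi>))) / (\<xi>\<^sup>2 * (2 * pi))) ((sin (a * \<xi>) - sin (b * \<xi>) - sin ((a - b) * \<xi>)) / (\<xi>\<^sup>2 * (2 * pi)))"
    by (simp add: complex_eq_iff Re_divide_of_real Im_divide_of_real)
  finally show ?thesis by (simp add: add_divide_distrib diff_divide_distrib)
qed

lemma square_integrable_ft_ind_fun: "square_integrable (ft_ind_fun a)"
proof -
  have "(cmod (ft_ind_fun a \<xi>))\<^sup>2 = (1 - cos (a * \<xi>)) / \<xi>\<^sup>2 / pi" for \<xi>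
  proof -
    have "complex_of_real ((cmod (ft_ind_fun a \<xi>))\<^sup>2) = ft_ind_fun a \<xi> * cnj (ft_ind_fun a \<xi>)"
      by (rule complex_norm_square)
    also have "\<dots> = complex_of_real ((1 - cos (a * \<xi>)) / \<xi>\<^sup>2 / pi)"
    proof -
      have "(c / x + c / x - (1 - cos ((a - a) * \<xi>)) / x) / (2 * pi) = c / x / pi" for c x :: real by simp
      then show ?thesis unfolding ft_ind_fun_mult
        by (simp only: complex_eq_iff complex.sel Re_complex_of_real Im_complex_of_real) simp
    qed
    finally show ?thesis by (simp only: of_real_eq_iff)
  qed
  then show ?thesis
    using integrable_divide[OF integral_one_minus_cos(1)[of a], of pi]
    by (simp add: square_integrable_def)
qed

definition ft_ind :: "real \<Rightarrow> l2" where
  "ft_ind a = l2_abs (ft_ind_fun a)"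

definition ift_ind :: "real \<Rightarrow> l2" where
  "ift_ind a = l2_abs (\<lambda>x. cnj (ft_ind_fun a x))"

lemma square_integrable_cnj: "square_integrable f \<Longrightarrow> square_integrable (\<lambda>x. cnj (f x))"
  by (auto simp: square_integrable_def)

text \<open>Plancherel's identity on the total family \<open>ind a\<close>; by
  \<open>isometry_extension\<close> it suffices to define the transform on the whole space.\<close>

lemma cinner_ft_ind: "cinner (ft_ind a) (ft_ind b) = cinner (ind a) (ind b)"
proof -
  let ?f = "\<lambda>\<xi>. ft_ind_fun a \<xi> * cnj (ft_ind_fun b \<xi>)"
  have i: "integrable lborel ?f"
    by (intro integrable_mult_cnj square_integrable_ft_ind_fun)
  have "cinner (ft_ind a) (ft_ind b) = (LINT \<xi>|lborel. ?f \<xi>)"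
    unfolding ft_ind_def by (intro cinner_l2_abs square_integrable_ft_ind_fun)
  also have "\<dots> = cinner (ind a) (ind b)"
  proof (rule complex_eqI)
    have "Re (LINT \<xi>|lborel. ?f \<xi>) = (LINT \<xi>|lborel. Re (?f \<xi>))" using i by (rule integral_Re[symmetric])
    also have "\<dots> = (pi * \<bar>a\<bar> + pi * \<bar>b\<bar> - pi * \<bar>a - b\<bar>) / (2 * pi)"
      unfolding ft_ind_fun_mult using integral_one_minus_cos by simp
    also have "\<dots> = (\<bar>a\<bar> + \<bar>b\<bar> - \<bar>a - b\<bar>) / 2" by (simp add: field_simps)
    finally show "Re (LINT \<xi>|lborel. ?f \<xi>) = Re (cinner (ind a) (ind b))" by (simp add: cinner_ind)
    have "Im (LINT \<xi>|lborel. ?f \<xi>) = (LINT \<xi>|lborel. Im (?f \<xi>))" using i by (rule integral_Im[symmetric])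
    also have "\<dots> = 0"
    proof -
      have "sin (a * - \<xi>) - sin (b * - \<xi>) - sin ((a - b) * - \<xi>) = - (sin (a * \<xi>) - sin (b * \<xi>) - sin ((a - b) * \<xi>))" for \<xi>
        by simp
      then show ?thesis unfolding ft_ind_fun_mult complex.sel
        by (intro integral_odd) (simp only: power2_minus minus_divide_left)
    qed
    finally show "Im (LINT \<xi>|lborel. ?f \<xi>) = Im (cinner (ind a) (ind b))" by (simp add: cinner_ind)
  qed
  finally show ?thesis .
qed

lemma cinner_ift_ind: "cinner (ift_ind a) (ift_ind b) = cinner (ind a) (ind b)"
proof -
  have "cinner (ift_ind a) (ift_ind b) = (LINT x|lborel. cnj (ft_ind_fun a x) * cnj (cnj (ft_ind_fun b x)))"
    unfolding ift_ind_def by (intro cinner_l2_abs square_integrable_cnj square_integrable_ft_ind_fun)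
  also have "\<dots> = cinner (ft_ind b) (ft_ind a)"
    unfolding ft_ind_def by (simp add: cinner_l2_abs square_integrable_ft_ind_fun mult.commute)
  finally show ?thesis by (simp add: cinner_ft_ind cinner_ind abs_minus_commute add.commute)
qed

lemma cis_has_vector_derivative:
  "((\<lambda>x. cis (c * x)) has_vector_derivative \<i> * of_real c * cis (c * x)) (at x within S)"
proof -
  have "((\<lambda>z. exp (\<i> * (of_real c * z))) has_field_derivative \<i> * of_real c * exp (\<i> * (of_real c * of_real x))) (at (of_real x))"
    by (auto intro!: derivative_eq_intros)
  from has_vector_derivative_real_field[OF this] show ?thesis
    by (simp add: cis_conv_exp)
qed

lemma integral_ind_fun_cis:
  "(LINT x|lborel. ind_fun a x *\<^sub>R cis (- (x * \<xi>))) = of_real (sqrt (2 * pi)) * ft_ind_fun a \<xi>" if "\<xi> \<noteq> 0"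
proof -
  define F where "F x = cis (- \<xi> * x) * (\<i> / of_real \<xi>)" for x
  have d: "(F has_vector_derivative cis (- (x * \<xi>))) (at x within S)" for x S
  proof -
    have "(F has_vector_derivative (\<i> * of_real (- \<xi>) * cis (- \<xi> * x)) * (\<i> / of_real \<xi>)) (at x within S)"
      unfolding F_def by (rule has_vector_derivative_mult_left[OF cis_has_vector_derivative])
    then show ?thesis using that by (simp add: field_simps)
  qed
  have FTC: "(LINT x|lborel. indicator {u..v} x *\<^sub>R cis (- (x * \<xi>))) = F v - F u" if "u \<le> v" for u v
    by (rule integral_FTC_atLeastAtMost[OF that d]) (intro continuous_intros)
  have "(LINT x|lborel. ind_fun a x *\<^sub>R cis (- (x * \<xi>))) = F a - F 0"
    by (cases "0 \<le> a") (simp_all add: ind_fun_def FTC)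
  also have "\<dots> = of_real (sqrt (2 * pi)) * ft_ind_fun a \<xi>"
    using that by (simp add: F_def ft_ind_fun_def field_simps)
  finally show ?thesis .
qed

section \<open>The transform on \<open>L2\<close>, its adjoint and its inverse\<close>

interpretation lborel_pair: pair_sigma_finite "lborel :: real measure" "lborel :: real measure" ..

lemma integrable_box:
  fixes f :: "real \<times> real \<Rightarrow> complex"
  assumes "f \<in> borel_measurable (lborel \<Otimes>\<^sub>M lborel)"
    and "\<And>x y. cmod (f (x, y)) \<le> indicator {-a..a} x * indicator {-b..b} y"
  shows "integrable (lborel \<Otimes>\<^sub>M lborel) f"
proof (rule integrableI_bounded_set[of "{-a..a} \<times> {-b..b}" _ _ 1])
  show "emeasure (lborel \<Otimes>\<^sub>M lborel) ({- a..a} \<times> {- b..b}) < \<infinity>"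
    by (simp add: lborel.emeasure_pair_measure_Times emeasure_lborel_Icc_eq ennreal_mult_less_top)
  show "AE x in lborel \<Otimes>\<^sub>M lborel. x \<in> {- a..a} \<times> {- b..b} \<longrightarrow> norm (f x) \<le> 1"
  proof (intro AE_I2 impI)
    fix p :: "real \<times> real" assume "p \<in> {- a..a} \<times> {- b..b}"
    then show "cmod (f p) \<le> 1" using assms(2)[of "fst p" "snd p"] by (auto split: split_indicator)
  qed
  show "AE x in lborel \<Otimes>\<^sub>M lborel. x \<notin> {- a..a} \<times> {- b..b} \<longrightarrow> f x = 0"
  proof (intro AE_I2 impI)
    fix p :: "real \<times> real" assume "p \<notin> {- a..a} \<times> {- b..b}"
    then show "f p = 0" using assms(2)[of "fst p" "snd p"]
      by (cases p) (auto simp: indicator_def split: if_splits)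
  qed
qed (use assms(1) in auto)

text \<open>Fubini for \<open>ind_fun a x * ind_fun b \<xi> * cis (- (x * \<xi>))\<close>, which is
  bounded with bounded support: the kernel is symmetric in \<open>x\<close> and
  \<open>\<xi>\<close>. The factor \<open>sqrt (2 * pi)\<close> is carried along so that the inner
  integrals need no division.\<close>

lemma cinner_ft_ind_ind: "cinner (ft_ind a) (ind b) = cinner (ind a) (ift_ind b)"
proof -
  define s where "s = complex_of_real (sqrt (2 * pi))"
  have s0: "s \<noteq> 0" by (simp add: s_def)
  have "s * cinner (ft_ind a) (ind b) = (LINT \<xi>|lborel. s * (ft_ind_fun a \<xi> * cnj (complex_of_real (ind_fun b \<xi>))))"
    unfolding ft_ind_def ind_def
    by (simp add: cinner_l2_abs square_integrable_ft_ind_fun square_integrable_ind_fun)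
  also have "\<dots> = (LINT \<xi>|lborel. (LINT x|lborel. (ind_fun b \<xi> * ind_fun a x) *\<^sub>R cis (- (x * \<xi>))))"
  proof (rule integral_cong_AE)
    show "AE \<xi> in lborel. s * (ft_ind_fun a \<xi> * cnj (complex_of_real (ind_fun b \<xi>))) = (LINT x|lborel. (ind_fun b \<xi> * ind_fun a x) *\<^sub>R cis (- (x * \<xi>)))"
      using AE_not_point[of 0]
    proof eventually_elim
      case (elim \<xi>)
      have "(LINT x|lborel. (ind_fun b \<xi> * ind_fun a x) *\<^sub>R cis (- (x * \<xi>))) = ind_fun b \<xi> *\<^sub>R (LINT x|lborel. ind_fun a x *\<^sub>R cis (- (x * \<xi>)))"
        by (simp only: scaleR_scaleR[symmetric] integral_scaleR_right)
      then show ?case using integral_ind_fun_cis[OF elim, of a] by (simp add: s_def scaleR_conv_of_real mult_ac)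
    qed
  qed measurable
  also have "\<dots> = (LINT x|lborel. (LINT \<xi>|lborel. (ind_fun b \<xi> * ind_fun a x) *\<^sub>R cis (- (x * \<xi>))))"
  proof (rule lborel_pair.Fubini_integral)
    show "integrable (lborel \<Otimes>\<^sub>M lborel) (\<lambda>(x, \<xi>). (ind_fun b \<xi> * ind_fun a x) *\<^sub>R cis (- (x * \<xi>)))"
    proof (rule integrable_box[of _ "\<bar>a\<bar>" "\<bar>b\<bar>"])
      show "cmod (case (x, \<xi>) of (x, \<xi>) \<Rightarrow> (ind_fun b \<xi> * ind_fun a x) *\<^sub>R cis (- (x * \<xi>)))
          \<le> indicat_real {- \<bar>a\<bar>..\<bar>a\<bar>} x * indicat_real {- \<bar>b\<bar>..\<bar>b\<bar>} \<xi>" for x \<xi>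
        using mult_mono[OF abs_ind_fun_le[of a x] abs_ind_fun_le[of b \<xi>]] by (simp add: abs_mult mult.commute)
    qed measurable
  qed
  also have "\<dots> = (LINT x|lborel. s * (complex_of_real (ind_fun a x) * cnj (cnj (ft_ind_fun b x))))"
  proof (rule integral_cong_AE)
    show "AE x in lborel. (LINT \<xi>|lborel. (ind_fun b \<xi> * ind_fun a x) *\<^sub>R cis (- (x * \<xi>))) = s * (complex_of_real (ind_fun a x) * cnj (cnj (ft_ind_fun b x)))"
      using AE_not_point[of 0]
    proof eventually_elim
      case (elim x)
      have "(LINT \<xi>|lborel. (ind_fun b \<xi> * ind_fun a x) *\<^sub>R cis (- (x * \<xi>))) = ind_fun a x *\<^sub>R (LINT \<xi>|lborel. ind_fun b \<xi> *\<^sub>R cis (- (\<xi> * x)))"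
        by (simp only: scaleR_scaleR[symmetric] integral_scaleR_right[symmetric] mult.commute[of _ "ind_fun a x"] mult.commute[of x])
      then show ?case using integral_ind_fun_cis[OF elim, of b] by (simp add: s_def scaleR_conv_of_real mult_ac)
    qed
  qed measurable
  also have "\<dots> = s * cinner (ind a) (ift_ind b)"
    unfolding ift_ind_def ind_def
    by (simp add: cinner_l2_abs square_integrable_ft_ind_fun square_integrable_ind_fun square_integrable_cnj)
  finally show ?thesis using s0 by simp
qed

text \<open>Fixed by being a linear isometry with prescribed values on the total family
  \<open>ind a\<close>. Its agreement with the usual integral is proved where it is used, for test
  functions.\<close>

definition fourier :: "l2 \<Rightarrow> l2" where
  "fourier = (SOME U. (\<forall>x y. cinner (U x) (U y) = cinner x y) \<and> (\<forall>a. U (ind a) = ft_ind a) \<and>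
    (\<forall>x y. U (x + y) = U x + U y) \<and> (\<forall>c x. U (scaleC c x) = scaleC c (U x)))"

definition inv_fourier :: "l2 \<Rightarrow> l2" where
  "inv_fourier = (SOME U. (\<forall>x y. cinner (U x) (U y) = cinner x y) \<and> (\<forall>a. U (ind a) = ift_ind a) \<and>
    (\<forall>x y. U (x + y) = U x + U y) \<and> (\<forall>c x. U (scaleC c x) = scaleC c (U x)))"

lemma cinner_fourier: "cinner (fourier x) (fourier y) = cinner x y"
  and fourier_ind: "fourier (ind a) = ft_ind a"
  and fourier_add: "fourier (x + y) = fourier x + fourier y"
  and fourier_scaleC: "fourier (scaleC c x) = scaleC c (fourier x)"
  using someI_ex[OF isometry_extension[of ft_ind ind, OF cinner_ft_ind ind_total]]
  unfolding fourier_def[symmetric] by auto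

lemma cinner_inv_fourier: "cinner (inv_fourier x) (inv_fourier y) = cinner x y"
  and inv_fourier_ind: "inv_fourier (ind a) = ift_ind a"
  and inv_fourier_add: "inv_fourier (x + y) = inv_fourier x + inv_fourier y"
  and inv_fourier_scaleC: "inv_fourier (scaleC c x) = scaleC c (inv_fourier x)"
  using someI_ex[OF isometry_extension[of ift_ind ind, OF cinner_ift_ind ind_total]]
  unfolding inv_fourier_def[symmetric] by auto

lemma bounded_linear_isometry:
  assumes "\<And>x y. cinner (U x) (U y) = cinner x y" "\<And>x y. U (x + y) = U x + U y" "\<And>c x. U (scaleC c x) = scaleC c (U x)"
  shows "bounded_linear U"
proof (rule bounded_linear_intro[of _ 1])
  have "(norm (U x))\<^sup>2 = (norm x)\<^sup>2" for x
    using assms(1)[of x x] by (simp only: cinner_self of_real_eq_iff)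
  then show "norm (U x) \<le> norm x * 1" for x by (simp add: power2_eq_iff_nonneg)
qed (use assms in \<open>auto simp: scaleR_scaleC\<close>)

lemma bounded_linear_fourier: "bounded_linear fourier"
  by (intro bounded_linear_isometry cinner_fourier fourier_add fourier_scaleC)

lemma bounded_linear_inv_fourier: "bounded_linear inv_fourier"
  by (intro bounded_linear_isometry cinner_inv_fourier inv_fourier_add inv_fourier_scaleC)

lemmas continuous_on_fourier [continuous_intros] = bounded_linear.continuous_on[OF bounded_linear_fourier]
lemmas continuous_on_inv_fourier [continuous_intros] = bounded_linear.continuous_on[OF bounded_linear_inv_fourier]
lemmas fourier_diff = linear_diff[OF bounded_linear.linear[OF bounded_linear_fourier]]

lemma fourier_scaleR: "fourier (c *\<^sub>R x) = c *\<^sub>R fourier x"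
  and inv_fourier_scaleR: "inv_fourier (c *\<^sub>R x) = c *\<^sub>R inv_fourier x"
  and fourier_zero: "fourier 0 = 0" and inv_fourier_zero: "inv_fourier 0 = 0"
  using bounded_linear_fourier bounded_linear_inv_fourier
  by (auto simp: linear_simps)

lemma cinner_fourier_left: "cinner (fourier x) y = cinner x (inv_fourier y)"
proof -
  have 1: "x \<in> {x. cinner (fourier x) (ind b) = cinner x (inv_fourier (ind b))}" for x b
  proof (rule total_closed_subspace[of ind, OF ind_total])
    show "subspace {x. cinner (fourier x) (ind b) = cinner x (inv_fourier (ind b))}"
      by (auto simp: subspace_def fourier_add cinner_simps fourier_scaleR fourier_zero)
    show "closed {x. cinner (fourier x) (ind b) = cinner x (inv_fourier (ind b))}"
      by (intro closed_Collect_eq continuous_intros)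
  qed (auto simp: fourier_scaleC cinner_simps fourier_ind inv_fourier_ind cinner_ft_ind_ind)
  have "y \<in> {y. cinner (fourier x) y = cinner x (inv_fourier y)}"
  proof (rule total_closed_subspace[of ind, OF ind_total])
    show "subspace {y. cinner (fourier x) y = cinner x (inv_fourier y)}"
      by (auto simp: subspace_def inv_fourier_add cinner_simps inv_fourier_scaleR inv_fourier_zero)
    show "closed {y. cinner (fourier x) y = cinner x (inv_fourier y)}"
      by (intro closed_Collect_eq continuous_intros)
  qed (use 1 in \<open>auto simp: inv_fourier_scaleC cinner_simps\<close>)
  then show ?thesis by simp
qed

text \<open>The adjoint of an isometry is a left inverse, and the adjoint of \<open>fourier\<close>
  is \<open>inv_fourier\<close>. The reverse composition in the next lemma uses in the same way that
  \<open>inv_fourier\<close> is isometric.\<close>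

lemma inv_fourier_fourier [simp]: "inv_fourier (fourier x) = x"
proof (rule cinner_eqI)
  fix y
  have "cinner y (inv_fourier (fourier x)) = cinner y x"
    unfolding cinner_fourier_left[symmetric] by (rule cinner_fourier)
  then show "cinner (inv_fourier (fourier x)) y = cinner x y" by (metis cinner_commute)
qed

lemma fourier_inv_fourier [simp]: "fourier (inv_fourier x) = x"
  by (rule cinner_eqI) (simp add: cinner_fourier_left cinner_inv_fourier)

lemma norm_fourier: "norm (fourier x) = norm x"
proof -
  have "(norm (fourier x))\<^sup>2 = (norm x)\<^sup>2"
    using cinner_fourier[of x x] by (simp only: cinner_self of_real_eq_iff)
  then show ?thesis by (simp add: power2_eq_iff_nonneg)
qed

subsection \<open>The weak derivative as a Fourier multiplier\<close>

lemma ii_mult: "\<i> * x * (\<i> * y * z) = - (x * y * z)"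
proof -
  have "\<i> * x * (\<i> * y * z) = (\<i> * \<i>) * (x * y * z)" by (simp only: mult_ac)
  then show ?thesis by simp
qed

definition mulop :: "(real \<Rightarrow> complex) \<Rightarrow> l2 \<Rightarrow> l2" where
  "mulop m \<phi> = l2_abs (\<lambda>x. m x * l2_rep \<phi> x)"

lemma mulop_AE:
  assumes "m \<in> borel_measurable borel" "\<And>x. cmod (m x) \<le> C"
  shows "AE x in lborel. l2_rep (mulop m \<phi>) x = m x * l2_rep \<phi> x"
  unfolding mulop_def by (intro l2_rep_abs_AE square_integrable_bounded_mult[OF assms(1) _ assms(2)] square_integrable_l2_rep)

lemma cinner_mulop:
  assumes "m \<in> borel_measurable borel" "\<And>x. cmod (m x) \<le> C"
  shows "cinner (mulop m \<phi>) \<psi> = (LINT x|lborel. m x * l2_rep \<phi> x * cnj (l2_rep \<psi> x))"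
proof -
  note [measurable] = assms(1)
  show ?thesis
    unfolding cinner_eq
    by (intro integral_cong_AE) (use mulop_AE[OF assms, of \<phi>] in \<open>auto elim: eventually_mono\<close>)
qed

definition ft_fun :: "(real \<Rightarrow> real) \<Rightarrow> real \<Rightarrow> complex" where
  "ft_fun \<eta> \<xi> = (LINT x|lborel. \<eta> x *\<^sub>R cis (- (x * \<xi>))) / of_real (sqrt (2 * pi))"

text \<open>Both sides are compared after integration from \<open>0\<close> to \<open>a\<close>. On
  the left this is an inner product with \<open>ind a\<close>, which adjointness moves to
  \<open>ift_ind a\<close>; writing that as an integral over \<open>ind_fun a\<close> and exchanging
  the order of integration yields the right side.\<close>

lemma fourier_emb_AE:
  assumes \<eta>: "test_function \<eta>"
  shows "AE \<xi> in lborel. l2_rep (fourier (emb \<eta>)) \<xi> = ft_fun \<eta> \<xi>"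
proof -
  define s where "s = complex_of_real (sqrt (2 * pi))"
  have s0: "s \<noteq> 0" by (simp add: s_def)
  have [measurable]: "\<eta> \<in> borel_measurable borel" by (rule borel_measurable_test_function[OF \<eta>])
  have [measurable]: "ft_fun \<eta> \<in> borel_measurable borel" unfolding ft_fun_def by measurable
  have \<eta>i: "integrable lborel \<eta>" by (rule integrable_test_function[OF \<eta>])
  have b: "cmod (ft_fun \<eta> \<xi>) \<le> (LINT x|lborel. \<bar>\<eta> x\<bar>) / sqrt (2 * pi)" for \<xi>
    unfolding ft_fun_def using integral_norm_bound[of lborel "\<lambda>x. \<eta> x *\<^sub>R cis (- (x * \<xi>))"]
    by (auto simp: norm_divide intro: divide_right_mono)
  have li: "set_integrable lborel {u<..<v} (ft_fun \<eta>)" for u v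
    unfolding set_integrable_def
    by (rule integrableI_bounded_set[of "{u..v}" _ _ "(LINT x|lborel. \<bar>\<eta> x\<bar>) / sqrt (2 * pi)"])
      (use b in \<open>auto simp: emeasure_lborel_Icc_eq intro!: AE_I2 split: split_indicator\<close>)
  have "AE \<xi> in lborel. l2_rep (fourier (emb \<eta>)) \<xi> - ft_fun \<eta> \<xi> = 0"
  proof (rule AE_eq_0_if_ind_integrals_eq_0)
    show "set_integrable lborel {u<..<v} (\<lambda>\<xi>. l2_rep (fourier (emb \<eta>)) \<xi> - ft_fun \<eta> \<xi>)" for u v
      by (rule set_integral_diff(1)[OF set_integrable_l2_rep li])
    show "(LINT \<xi>|lborel. ind_fun a \<xi> *\<^sub>R (l2_rep (fourier (emb \<eta>)) \<xi> - ft_fun \<eta> \<xi>)) = 0" for a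
    proof -
      have ki: "integrable (lborel \<Otimes>\<^sub>M lborel) (\<lambda>(x, \<xi>). (ind_fun a \<xi> * \<eta> x) *\<^sub>R cis (- (x * \<xi>)))"
      proof (rule lborel_pair.Fubini_integrable)
        have "(LINT \<xi>|lborel. norm (case (x, \<xi>) of (x, \<xi>) \<Rightarrow> (ind_fun a \<xi> * \<eta> x) *\<^sub>R cis (- (x * \<xi>)))) = \<bar>\<eta> x\<bar> * (LINT \<xi>|lborel. \<bar>ind_fun a \<xi>\<bar>)" for x
          by (simp add: abs_mult mult.commute[of _ "\<bar>\<eta> x\<bar>"])
        then show "integrable lborel (\<lambda>x. LINT \<xi>|lborel. norm (case (x, \<xi>) of (x, \<xi>) \<Rightarrow> (ind_fun a \<xi> * \<eta> x) *\<^sub>R cis (- (x * \<xi>))))"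
          using \<eta>i by simp
        show "AE x in lborel. integrable lborel (\<lambda>\<xi>. case (x, \<xi>) of (x, \<xi>) \<Rightarrow> (ind_fun a \<xi> * \<eta> x) *\<^sub>R cis (- (x * \<xi>)))"
        proof (intro AE_I2)
          fix x
          have "integrable lborel (\<lambda>\<xi>. ind_fun a \<xi> *\<^sub>R (\<eta> x *\<^sub>R cis (- (x * \<xi>))))"
          proof (rule integrable_ind_fun_mult)
            show "set_integrable lborel {u<..<v} (\<lambda>\<xi>. \<eta> x *\<^sub>R cis (- (x * \<xi>)))" for u v
              by (rule set_integrable_subset[OF borel_integrable_atLeastAtMost'[of u v]]) (auto intro!: continuous_intros)
          qed measurable
          then show "integrable lborel (\<lambda>\<xi>. case (x, \<xi>) of (x, \<xi>) \<Rightarrow> (ind_fun a \<xi> * \<eta> x) *\<^sub>R cis (- (x * \<xi>)))" by simp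
        qed
      qed measurable
      have "s * (LINT \<xi>|lborel. ind_fun a \<xi> *\<^sub>R l2_rep (fourier (emb \<eta>)) \<xi>) = s * cinner (emb \<eta>) (ift_ind a)"
        unfolding cinner_ind_right[symmetric] cinner_fourier_left inv_fourier_ind ..
      also have "cinner (emb \<eta>) (ift_ind a) = (LINT x|lborel. complex_of_real (\<eta> x) * cnj (cnj (ft_ind_fun a x)))"
        unfolding emb_def ift_ind_def
        by (intro cinner_l2_abs square_integrable_cnj square_integrable_ft_ind_fun square_integrable_of_real_test_function \<eta>)
      also have "s * \<dots> = (LINT x|lborel. s * (complex_of_real (\<eta> x) * ft_ind_fun a x))" by simp
      also have "\<dots> = (LINT x|lborel. (LINT \<xi>|lborel. (ind_fun a \<xi> * \<eta> x) *\<^sub>R cis (- (x * \<xi>))))"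
      proof (rule integral_cong_AE)
        show "AE x in lborel. s * (complex_of_real (\<eta> x) * ft_ind_fun a x) = (LINT \<xi>|lborel. (ind_fun a \<xi> * \<eta> x) *\<^sub>R cis (- (x * \<xi>)))"
          using AE_not_point[of 0]
        proof eventually_elim
          case (elim x)
          have "(LINT \<xi>|lborel. (ind_fun a \<xi> * \<eta> x) *\<^sub>R cis (- (x * \<xi>))) = \<eta> x *\<^sub>R (LINT \<xi>|lborel. ind_fun a \<xi> *\<^sub>R cis (- (\<xi> * x)))"
            by (simp only: scaleR_scaleR[symmetric] integral_scaleR_right[symmetric] mult.commute[of _ "\<eta> x"] mult.commute[of x])
          then show ?case using integral_ind_fun_cis[OF elim, of a] by (simp add: s_def scaleR_conv_of_real mult_ac)
        qed
      qed measurable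
      also have "\<dots> = (LINT \<xi>|lborel. (LINT x|lborel. (ind_fun a \<xi> * \<eta> x) *\<^sub>R cis (- (x * \<xi>))))"
        by (rule lborel_pair.Fubini_integral[OF ki, symmetric])
      also have "\<dots> = (LINT \<xi>|lborel. s * (ind_fun a \<xi> *\<^sub>R ft_fun \<eta> \<xi>))"
        using s0 by (simp only: scaleR_scaleR[symmetric] integral_scaleR_right) (simp add: ft_fun_def s_def)
      also have "\<dots> = s * (LINT \<xi>|lborel. ind_fun a \<xi> *\<^sub>R ft_fun \<eta> \<xi>)" by (rule integral_mult_right_zero)
      finally have "(LINT \<xi>|lborel. ind_fun a \<xi> *\<^sub>R l2_rep (fourier (emb \<eta>)) \<xi>) = (LINT \<xi>|lborel. ind_fun a \<xi> *\<^sub>R ft_fun \<eta> \<xi>)"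
        using s0 by simp
      then show ?thesis
        unfolding scaleR_diff_right
        by (subst Bochner_Integration.integral_diff) (auto intro!: integrable_ind_fun_mult set_integrable_l2_rep li)
    qed
  qed measurable
  then show ?thesis by eventually_elim simp
qed

lemma ft_fun_deriv:
  assumes \<eta>: "test_function \<eta>"
  shows "ft_fun (deriv \<eta>) \<xi> = \<i> * of_real \<xi> * ft_fun \<eta> \<xi>"
proof -
  obtain R where R: "\<And>x. \<bar>x\<bar> > R \<Longrightarrow> \<eta> x = 0" using test_function_support[OF \<eta>] by metis
  have i: "integrable lborel (\<lambda>x. \<zeta> x *\<^sub>R cis (- (x * \<xi>)))" if "test_function \<zeta>" for \<zeta>
  proof -
    have [measurable]: "\<zeta> \<in> borel_measurable borel" by (rule borel_measurable_test_function[OF that])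
    show ?thesis
      by (rule Bochner_Integration.integrable_bound[OF integrable_test_function[OF that]]) auto
  qed
  have "(LINT x|lborel. \<eta> x *\<^sub>R (\<i> * of_real (- \<xi>) * cis (- \<xi> * x)) + deriv \<eta> x *\<^sub>R cis (- \<xi> * x)) = 0"
  proof (rule integral_derivative_compact_support[where F = "\<lambda>x. \<eta> x *\<^sub>R cis (- \<xi> * x)" and R = R])
    show "((\<lambda>x. \<eta> x *\<^sub>R cis (- \<xi> * x)) has_vector_derivative
        \<eta> x *\<^sub>R (\<i> * of_real (- \<xi>) * cis (- \<xi> * x)) + deriv \<eta> x *\<^sub>R cis (- \<xi> * x)) (at x)" for x
      by (intro has_vector_derivative_scaleR smooth_has_deriv test_function_smooth \<eta> cis_has_vector_derivative)
    show "continuous_on UNIV (\<lambda>x. \<eta> x *\<^sub>R (\<i> * of_real (- \<xi>) * cis (- \<xi> * x)) + deriv \<eta> x *\<^sub>R cis (- \<xi> * x))"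
      by (intro continuous_intros test_function_continuous \<eta> test_function_deriv)
  qed (use R in auto)
  also have "(\<lambda>x. \<eta> x *\<^sub>R (\<i> * of_real (- \<xi>) * cis (- \<xi> * x)) + deriv \<eta> x *\<^sub>R cis (- \<xi> * x)) =
     (\<lambda>x. (- \<i> * of_real \<xi>) * (\<eta> x *\<^sub>R cis (- (x * \<xi>))) + deriv \<eta> x *\<^sub>R cis (- (x * \<xi>)))"
    by (simp add: fun_eq_iff mult.commute)
  also have "(LINT x|lborel. (- \<i> * of_real \<xi>) * (\<eta> x *\<^sub>R cis (- (x * \<xi>))) + deriv \<eta> x *\<^sub>R cis (- (x * \<xi>))) =
     (- \<i> * of_real \<xi>) * (LINT x|lborel. \<eta> x *\<^sub>R cis (- (x * \<xi>))) + (LINT x|lborel. deriv \<eta> x *\<^sub>R cis (- (x * \<xi>)))"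
    by (subst Bochner_Integration.integral_add[OF integrable_mult_right[OF i[OF \<eta>]] i[OF test_function_deriv[OF \<eta>]]])
      (simp only: integral_mult_right_zero)
  finally have "(LINT x|lborel. deriv \<eta> x *\<^sub>R cis (- (x * \<xi>))) = \<i> * of_real \<xi> * (LINT x|lborel. \<eta> x *\<^sub>R cis (- (x * \<xi>)))"
    by (simp add: neg_eq_iff_add_eq_0[symmetric] add.commute)
  then show ?thesis by (simp add: ft_fun_def)
qed

definition ft_deriv :: "(l2 \<times> l2) set" where
  "ft_deriv = {(\<phi>, \<psi>). AE \<xi> in lborel. l2_rep (fourier \<psi>) \<xi> = \<i> * of_real \<xi> * l2_rep (fourier \<phi>) \<xi>}"

lemma ft_deriv_subset: "ft_deriv \<subseteq> weak_derivative"
proof (clarsimp simp: ft_deriv_def weak_derivative_iff)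
  fix \<phi> \<psi> \<eta> assume ae: "AE \<xi> in lborel. l2_rep (fourier \<psi>) \<xi> = \<i> * of_real \<xi> * l2_rep (fourier \<phi>) \<xi>"
    and \<eta>: "test_function \<eta>"
  have "cinner \<phi> (emb (deriv \<eta>)) = cinner (fourier \<phi>) (fourier (emb (deriv \<eta>)))" by (simp add: cinner_fourier)
  also have "\<dots> = (LINT \<xi>|lborel. - (l2_rep (fourier \<psi>) \<xi> * cnj (l2_rep (fourier (emb \<eta>)) \<xi>)))"
    unfolding cinner_eq
  proof (rule integral_cong_AE)
    show "AE \<xi> in lborel. l2_rep (fourier \<phi>) \<xi> * cnj (l2_rep (fourier (emb (deriv \<eta>))) \<xi>) = - (l2_rep (fourier \<psi>) \<xi> * cnj (l2_rep (fourier (emb \<eta>)) \<xi>))"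
      using ae fourier_emb_AE[OF \<eta>] fourier_emb_AE[OF test_function_deriv[OF \<eta>]]
      by eventually_elim (simp add: ft_fun_deriv[OF \<eta>])
  qed measurable
  also have "\<dots> = - cinner (fourier \<psi>) (fourier (emb \<eta>))" by (simp add: cinner_eq)
  finally show "cinner \<phi> (emb (deriv \<eta>)) = - cinner \<psi> (emb \<eta>)" by (simp add: cinner_fourier)
qed

lemma subspace_weak_derivative: "subspace weak_derivative"
  unfolding subspace_def by (auto simp: weak_derivative_iff cinner_simps zero_prod_def)

lemma weak_derivative_scaleC: "(\<phi>, \<psi>) \<in> weak_derivative \<Longrightarrow> (scaleC c \<phi>, scaleC c \<psi>) \<in> weak_derivative"
  by (auto simp: weak_derivative_iff cinner_simps)

lemma closed_weak_derivative: "closed weak_derivative"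
proof -
  have "weak_derivative = (\<Inter>\<eta>\<in>{\<eta>. test_function \<eta>}. {p. cinner (fst p) (emb (deriv \<eta>)) = - cinner (snd p) (emb \<eta>)})"
    by (auto simp: weak_derivative_iff)
  also have "closed \<dots>"
    by (intro closed_INT ballI closed_Collect_eq continuous_intros)
  finally show ?thesis .
qed

lemma cmod_one_minus_ii: "1 \<le> cmod (1 - \<i> * of_real x)" "\<bar>x\<bar> \<le> cmod (1 - \<i> * of_real x)" "1 - \<i> * complex_of_real x \<noteq> 0"
proof -
  show "1 \<le> cmod (1 - \<i> * of_real x)" using abs_Re_le_cmod[of "1 - \<i> * of_real x"] by simp
  then show "1 - \<i> * complex_of_real x \<noteq> 0" by auto
  show "\<bar>x\<bar> \<le> cmod (1 - \<i> * of_real x)" using abs_Im_le_cmod[of "1 - \<i> * of_real x"] by simp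
qed

text \<open>On the Fourier side \<open>1 - d/dx\<close> is onto, and it is injective on the maximal domain, so the
  weak derivative cannot properly extend the multiplier.\<close>

lemma weak_derivative_eq_ft_deriv: "weak_derivative = ft_deriv"
proof (rule antisym[OF _ ft_deriv_subset], clarify)
  fix \<phi> \<psi> assume w: "(\<phi>, \<psi>) \<in> weak_derivative"
  define g where "g = fourier (\<phi> - \<psi>)"
  \<comment> \<open>\<open>m\<close> and \<open>m'\<close> are the symbols of
    \<open>(1 - d/dx)^{-1}\<close> and of \<open>d/dx (1 - d/dx)^{-1}\<close>. Both are bounded by
    \<open>1\<close>, and \<open>m - m' = 1\<close>.\<close>
  define m where "m \<xi> = 1 / (1 - \<i> * complex_of_real \<xi>)" for \<xi>
  define m' where "m' \<xi> = \<i> * complex_of_real \<xi> / (1 - \<i> * complex_of_real \<xi>)" for \<xi>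
  have [measurable]: "m \<in> borel_measurable borel" "m' \<in> borel_measurable borel"
    unfolding m_def m'_def by measurable
  have mb: "cmod (m \<xi>) \<le> 1" "cmod (m' \<xi>) \<le> 1" for \<xi>
    using cmod_one_minus_ii[of \<xi>] by (auto simp: m_def m'_def norm_divide norm_mult divide_le_eq_1)
  define \<theta> where "\<theta> = inv_fourier (mulop m g)"
  define \<theta>' where "\<theta>' = inv_fourier (mulop m' g)"
  have a: "AE \<xi> in lborel. l2_rep (fourier \<theta>) \<xi> = m \<xi> * l2_rep g \<xi>"
    unfolding \<theta>_def by (simp add: mulop_AE[of _ 1] mb)
  have a': "AE \<xi> in lborel. l2_rep (fourier \<theta>') \<xi> = m' \<xi> * l2_rep g \<xi>"
    unfolding \<theta>'_def by (simp add: mulop_AE[of _ 1] mb)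
  have f: "(\<theta>, \<theta>') \<in> ft_deriv"
    unfolding ft_deriv_def using a a' by (auto simp: m_def m'_def elim: eventually_elim2)
  have "fourier (\<theta> - \<theta>') = g"
    unfolding l2_eq_iff_AE fourier_diff
    using a a' l2_rep_diff_AE[of "fourier \<theta>" "fourier \<theta>'"]
  proof eventually_elim
    case (elim \<xi>)
    have "m \<xi> - m' \<xi> = 1" using cmod_one_minus_ii(3)[of \<xi>]
      by (simp add: m_def m'_def diff_divide_distrib[symmetric])
    then have "m \<xi> * l2_rep g \<xi> - m' \<xi> * l2_rep g \<xi> = l2_rep g \<xi>" by (simp add: left_diff_distrib[symmetric])
    with elim show ?case by simp
  qed
  then have "inv_fourier (fourier (\<theta> - \<theta>')) = inv_fourier g" by simp
  then have e: "\<theta> - \<theta>' = \<phi> - \<psi>" by (simp add: g_def)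
  have "(\<phi>, \<psi>) - (\<theta>, \<theta>') \<in> weak_derivative"
    using subspace_diff[OF subspace_weak_derivative w] f ft_deriv_subset by blast
  moreover have "\<psi> - \<theta>' = \<phi> - \<theta>" using e by (simp add: algebra_simps)
  \<comment> \<open>The two pairs have the same image under \<open>1 - d/dx\<close>, so their
    difference solves \<open>u' = u\<close>.\<close>
  ultimately have "(\<phi> - \<theta>, \<phi> - \<theta>) \<in> weak_derivative" by simp
  then have "\<phi> - \<theta> = 0" by (rule weak_derivative_fixpoint_eq_0)
  with \<open>\<psi> - \<theta>' = \<phi> - \<theta>\<close> have "\<phi> = \<theta>" "\<psi> = \<theta>'" by auto
  with f show "(\<phi>, \<psi>) \<in> ft_deriv" by simp
qed

lemma fourier_inject: "fourier \<phi> = fourier \<psi> \<longleftrightarrow> \<phi> = \<psi>"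
  by (metis inv_fourier_fourier)

lemma weak_derivative_unique: "(\<phi>, \<psi>) \<in> weak_derivative \<Longrightarrow> (\<phi>, \<psi>') \<in> weak_derivative \<Longrightarrow> \<psi> = \<psi>'"
  unfolding weak_derivative_eq_ft_deriv ft_deriv_def
  by (subst fourier_inject[symmetric], subst l2_eq_iff_AE) (auto elim: eventually_elim2)

lemma weak_deriv_eqI: "(\<phi>, \<psi>) \<in> weak_derivative \<Longrightarrow> weak_deriv \<phi> = \<psi>"
  unfolding weak_deriv_def using weak_derivative_unique by blast

lemma weak_derivative_skew:
  assumes "(\<phi>, \<phi>') \<in> weak_derivative" "(\<psi>, \<psi>') \<in> weak_derivative"
  shows "cinner \<phi>' \<psi> = - cinner \<phi> \<psi>'"
proof -
  have "cinner (fourier \<phi>') (fourier \<psi>) = (LINT x|lborel. - (l2_rep (fourier \<phi>) x * cnj (l2_rep (fourier \<psi>') x)))"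
    unfolding cinner_eq
  proof (rule integral_cong_AE)
    have "AE x in lborel. l2_rep (fourier \<phi>') x = \<i> * of_real x * l2_rep (fourier \<phi>) x"
      "AE x in lborel. l2_rep (fourier \<psi>') x = \<i> * of_real x * l2_rep (fourier \<psi>) x"
      using assms by (simp_all add: weak_derivative_eq_ft_deriv ft_deriv_def)
    then show "AE x in lborel. l2_rep (fourier \<phi>') x * cnj (l2_rep (fourier \<psi>) x) = - (l2_rep (fourier \<phi>) x * cnj (l2_rep (fourier \<psi>') x))"
      by eventually_elim simp
  qed measurable
  then show ?thesis by (simp add: cinner_eq[symmetric] cinner_fourier)
qed

lemma emb_lincomb:
  assumes "test_function a" "test_function b"
  shows "emb (\<lambda>x. a x + c * b x) = emb a + c *\<^sub>R emb b"
  unfolding emb_def using assms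
  by (simp add: scaleR_l2_abs l2_abs_add square_integrable_of_real_test_function
      square_integrable_scaleR scaleR_conv_of_real)
    (simp add: l2_abs_add square_integrable_scaleC square_integrable_of_real_test_function)

lemma deriv_lincomb:
  assumes "test_function a" "test_function b"
  shows "deriv (\<lambda>x. a x + c * b x) = (\<lambda>x. deriv a x + c * deriv b x)"
  using smooth_has_deriv[OF test_function_smooth[OF assms(1)]] smooth_has_deriv[OF test_function_smooth[OF assms(2)]]
  by (intro ext DERIV_imp_deriv) (auto intro!: derivative_eq_intros)

text \<open>\<open>test_function\<close> is about real valued functions; a complex test function is
  a pair of them, its real and imaginary part.\<close>

definition cemb :: "(real \<Rightarrow> real) \<Rightarrow> (real \<Rightarrow> real) \<Rightarrow> l2" where
  "cemb a b = emb a + scaleC \<i> (emb b)"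

lemma cemb_weak_derivative:
  "test_function a \<Longrightarrow> test_function b \<Longrightarrow> (cemb a b, cemb (deriv a) (deriv b)) \<in> weak_derivative"
  using subspace_add[OF subspace_weak_derivative, of "(emb a, emb (deriv a))" "(scaleC \<i> (emb b), scaleC \<i> (emb (deriv b)))"]
  by (simp add: cemb_def emb_weak_derivative weak_derivative_scaleC)

lemma test_function_zero: "test_function (\<lambda>x. 0)"
  by (auto simp: test_function_iff_smooth)

text \<open>Density in the graph norm, by projecting onto the closure of the test pairs. A remainder
  \<open>(u, v)\<close> orthogonal to all test pairs satisfies \<open>v = u'\<close> and, weakly,
  \<open>u = v'\<close>, that is \<open>u'' = u\<close>. On the Fourier side
  \<open>(1 + \<xi>^2)\<close> then annihilates the transform of \<open>u\<close>.\<close>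

lemma test_functions_dense_W12:
  assumes w: "(\<phi>, \<psi>) \<in> weak_derivative" and e: "e > 0"
  obtains a b where "test_function a" "test_function b"
    "norm (\<phi> - cemb a b) < e" "norm (\<psi> - cemb (deriv a) (deriv b)) < e"
proof -
  define N where "N = {(cemb a b, cemb (deriv a) (deriv b)) | a b. test_function a \<and> test_function b}"
  have N: "subspace N"
    unfolding subspace_def
  proof (intro conjI ballI allI)
    have z: "emb (\<lambda>x. 0) = 0" by (simp add: emb_def zero_l2_def)
    have "(cemb (\<lambda>x. 0) (\<lambda>x. 0), cemb (deriv (\<lambda>x. 0)) (deriv (\<lambda>x. 0))) \<in> N"
      unfolding N_def using test_function_zero by blast
    then show "0 \<in> N" by (simp add: cemb_def z zero_prod_def)
  next
    fix p q assume "p \<in> N" "q \<in> N"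
    then obtain a b c d where t: "test_function a" "test_function b" "test_function c" "test_function d"
      and pq: "p = (cemb a b, cemb (deriv a) (deriv b))" "q = (cemb c d, cemb (deriv c) (deriv d))"
      by (auto simp: N_def)
    have "(cemb (\<lambda>x. a x + 1 * c x) (\<lambda>x. b x + 1 * d x), cemb (deriv (\<lambda>x. a x + 1 * c x)) (deriv (\<lambda>x. b x + 1 * d x))) \<in> N"
      unfolding N_def using t test_function_lincomb by blast
    also have "(cemb (\<lambda>x. a x + 1 * c x) (\<lambda>x. b x + 1 * d x), cemb (deriv (\<lambda>x. a x + 1 * c x)) (deriv (\<lambda>x. b x + 1 * d x))) = p + q"
      unfolding deriv_lincomb[OF t(1,3)] deriv_lincomb[OF t(2,4)] cemb_def pq
        emb_lincomb[OF t(1,3)] emb_lincomb[OF t(2,4)]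
        emb_lincomb[OF t(1,3)[THEN test_function_deriv]] emb_lincomb[OF t(2,4)[THEN test_function_deriv]]
      by (simp add: scaleC_add_right)
    finally show "p + q \<in> N" .
  next
    fix r p assume "p \<in> N"
    then obtain a b where t: "test_function a" "test_function b"
      and p: "p = (cemb a b, cemb (deriv a) (deriv b))" by (auto simp: N_def)
    note z = test_function_zero
    have z0: "emb (\<lambda>x. 0) = 0" by (simp add: emb_def zero_l2_def)
    have "(cemb (\<lambda>x. 0 + r * a x) (\<lambda>x. 0 + r * b x), cemb (deriv (\<lambda>x. 0 + r * a x)) (deriv (\<lambda>x. 0 + r * b x))) \<in> N"
      unfolding N_def using t test_function_lincomb[OF z] by blast
    also have "(cemb (\<lambda>x. 0 + r * a x) (\<lambda>x. 0 + r * b x), cemb (deriv (\<lambda>x. 0 + r * a x)) (deriv (\<lambda>x. 0 + r * b x))) = r *\<^sub>R p"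
      unfolding deriv_lincomb[OF z t(1)] deriv_lincomb[OF z t(2)] cemb_def p
        emb_lincomb[OF z t(1)] emb_lincomb[OF z t(2)]
        deriv_const emb_lincomb[OF z t(1)[THEN test_function_deriv]] emb_lincomb[OF z t(2)[THEN test_function_deriv]]
      by (simp add: z0 scaleR_add_right scaleR_scaleC scaleC_add_right mult.commute)
    finally show "r *\<^sub>R p \<in> N" .
  qed
  have "(\<phi>, \<psi>) \<in> closure N"
  proof -
    obtain y where y: "y \<in> closure N" "\<And>z. z \<in> closure N \<Longrightarrow> ((\<phi>, \<psi>) - y) \<bullet> z = 0"
      using orthogonal_projection_exists[OF subspace_closure[OF N] closed_closure] by blast
    have "N \<subseteq> weak_derivative" by (auto simp: N_def cemb_weak_derivative)
    then have "closure N \<subseteq> weak_derivative" by (rule closure_minimal[OF _ closed_weak_derivative])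
    then have d: "(\<phi>, \<psi>) - y \<in> weak_derivative"
      using y(1) w subspace_diff[OF subspace_weak_derivative] by blast
    obtain u v where uv: "(\<phi>, \<psi>) - y = (u, v)" by force
    \<comment> \<open>Orthogonality to \<open>(\<eta>, \<eta>')\<close> in the product space, once
      for \<open>\<eta>\<close> and once for \<open>\<i> * \<eta>\<close>, says exactly that
      \<open>u\<close> is the weak derivative of \<open>v\<close>.\<close>
    have "cinner v (emb (deriv \<eta>)) = - cinner u (emb \<eta>)" if \<eta>: "test_function \<eta>" for \<eta>
    proof -
      have z0: "emb (\<lambda>x. 0) = 0" by (simp add: emb_def zero_l2_def)
      have "(cemb \<eta> (\<lambda>x. 0), cemb (deriv \<eta>) (deriv (\<lambda>x. 0))) \<in> closure N"
        "(cemb (\<lambda>x. 0) \<eta>, cemb (deriv (\<lambda>x. 0)) (deriv \<eta>)) \<in> closure N"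
        using \<eta> test_function_zero closure_subset[of N] unfolding N_def by blast+
      from y(2)[OF this(1)] y(2)[OF this(2)]
      have "u \<bullet> emb \<eta> + v \<bullet> emb (deriv \<eta>) = 0" "u \<bullet> scaleC \<i> (emb \<eta>) + v \<bullet> scaleC \<i> (emb (deriv \<eta>)) = 0"
        by (simp_all add: uv cemb_def z0)
      then show ?thesis by (simp add: cinner_eq_inner complex_eq_iff)
    qed
    then have "(v, u) \<in> weak_derivative" by (simp add: weak_derivative_iff)
    with d uv have uv': "(u, v) \<in> ft_deriv" "(v, u) \<in> ft_deriv" by (simp_all add: weak_derivative_eq_ft_deriv)
    then have "AE \<xi> in lborel. l2_rep (fourier u) \<xi> = \<i> * of_real \<xi> * l2_rep (fourier v) \<xi>"
      "AE \<xi> in lborel. l2_rep (fourier v) \<xi> = \<i> * of_real \<xi> * l2_rep (fourier u) \<xi>"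
      by (simp_all add: ft_deriv_def)
    then have "AE \<xi> in lborel. l2_rep (fourier u) \<xi> = 0"
    proof eventually_elim
      case (elim \<xi>)
      then have "l2_rep (fourier u) \<xi> = - (of_real \<xi> * of_real \<xi> * l2_rep (fourier u) \<xi>)" by (metis ii_mult)
      then have "complex_of_real (1 + \<xi> * \<xi>) * l2_rep (fourier u) \<xi> = 0"
        unfolding eq_neg_iff_add_eq_0 by (simp add: distrib_right)
      moreover have "1 + \<xi> * \<xi> \<noteq> 0" using zero_le_square[of \<xi>] by linarith
      ultimately show ?case by (metis mult_eq_0_iff of_real_eq_0_iff)
    qed
    then have "fourier u = 0" unfolding l2_eq_iff_AE using l2_rep_zero_AE by eventually_elim simp
    then have u0: "u = 0" by (metis fourier_zero fourier_inject)
    have "(0, 0) \<in> weak_derivative" using subspace_0[OF subspace_weak_derivative] by (simp add: zero_prod_def)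
    with d uv u0 have "v = 0" using weak_derivative_unique by auto
    with u0 uv have "(\<phi>, \<psi>) = y" by (simp add: zero_prod_def[symmetric])
    with y show ?thesis by simp
  qed
  then obtain p where "p \<in> N" "dist p (\<phi>, \<psi>) < e" using e closure_approachable by blast
  then obtain a b where t: "test_function a" "test_function b"
    and d: "dist (\<phi>, \<psi>) (cemb a b, cemb (deriv a) (deriv b)) < e" by (auto simp: N_def dist_commute)
  have "dist \<phi> (cemb a b) < e" "dist \<psi> (cemb (deriv a) (deriv b)) < e"
    using dist_fst_le[of "(\<phi>, \<psi>)" "(cemb a b, cemb (deriv a) (deriv b))"]
      dist_snd_le[of "(\<phi>, \<psi>)" "(cemb a b, cemb (deriv a) (deriv b))"] d by auto
  with t show thesis by (intro that) (auto simp: dist_norm)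
qed

subsection \<open>The spectral measure of the Laplacian\<close>

definition lap_pvm :: "real set \<Rightarrow> l2 \<Rightarrow> l2" where
  "lap_pvm B \<phi> = inv_fourier (mulop (\<lambda>\<xi>. indicator B (\<xi>\<^sup>2)) (fourier \<phi>))"

lemma fourier_lap_pvm_AE:
  assumes [measurable]: "B \<in> sets borel"
  shows "AE \<xi> in lborel. l2_rep (fourier (lap_pvm B \<phi>)) \<xi> = indicator B (\<xi>\<^sup>2) * l2_rep (fourier \<phi>) \<xi>"
proof -
  have "AE \<xi> in lborel. l2_rep (mulop (\<lambda>\<xi>. indicator B (\<xi>\<^sup>2)) (fourier \<phi>)) \<xi> = indicator B (\<xi>\<^sup>2) * l2_rep (fourier \<phi>) \<xi>"
    by (rule mulop_AE[of _ 1]) (auto split: split_indicator)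
  then show ?thesis by (simp add: lap_pvm_def)
qed

lemma l2_eq_iff_fourier_AE: "\<phi> = \<psi> \<longleftrightarrow> (AE \<xi> in lborel. l2_rep (fourier \<phi>) \<xi> = l2_rep (fourier \<psi>) \<xi>)"
  unfolding l2_eq_iff_AE[symmetric] fourier_inject ..

lemma lap_pvm_disjoint_Un:
  assumes "A \<in> sets borel" "B \<in> sets borel" "A \<inter> B = {}"
  shows "lap_pvm (A \<union> B) \<phi> = lap_pvm A \<phi> + lap_pvm B \<phi>"
  unfolding l2_eq_iff_fourier_AE fourier_add
  using l2_rep_add_AE[of "fourier (lap_pvm A \<phi>)" "fourier (lap_pvm B \<phi>)"]
    fourier_lap_pvm_AE[OF assms(1), of \<phi>] fourier_lap_pvm_AE[OF assms(2), of \<phi>] fourier_lap_pvm_AE[OF sets.Un[OF assms(1,2)], of \<phi>]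
  by eventually_elim (use assms(3) in \<open>auto split: split_indicator\<close>)

lemma projection_valued_measure_lap_pvm: "projection_valued_measure lap_pvm"
  unfolding projection_valued_measure_def
proof (intro conjI ballI allI impI)
  fix B :: "real set" assume B: "B \<in> sets borel"
  show "orthogonal_projection (lap_pvm B)"
    unfolding orthogonal_projection_def
  proof (intro conjI allI)
    show "lap_pvm B (\<phi> + \<psi>) = lap_pvm B \<phi> + lap_pvm B \<psi>" for \<phi> \<psi>
      unfolding l2_eq_iff_fourier_AE fourier_add
      using l2_rep_add_AE[of "fourier \<phi>" "fourier \<psi>", folded fourier_add]
        l2_rep_add_AE[of "fourier (lap_pvm B \<phi>)" "fourier (lap_pvm B \<psi>)"]
        fourier_lap_pvm_AE[OF B, of \<phi>] fourier_lap_pvm_AE[OF B, of \<psi>] fourier_lap_pvm_AE[OF B, of "\<phi> + \<psi>"]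
      by eventually_elim (simp add: algebra_simps)
    show "lap_pvm B (scaleC a \<phi>) = scaleC a (lap_pvm B \<phi>)" for a \<phi>
      unfolding l2_eq_iff_fourier_AE fourier_scaleC
      using l2_rep_scaleC_AE[of a "fourier \<phi>", folded fourier_scaleC]
        l2_rep_scaleC_AE[of a "fourier (lap_pvm B \<phi>)"]
        fourier_lap_pvm_AE[OF B, of \<phi>] fourier_lap_pvm_AE[OF B, of "scaleC a \<phi>"]
      by eventually_elim (simp add: algebra_simps)
    show "lap_pvm B (lap_pvm B \<phi>) = lap_pvm B \<phi>" for \<phi>
      unfolding l2_eq_iff_fourier_AE
      using fourier_lap_pvm_AE[OF B, of \<phi>] fourier_lap_pvm_AE[OF B, of "lap_pvm B \<phi>"]
      by eventually_elim (simp split: split_indicator)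
    show "cinner (lap_pvm B \<phi>) \<psi> = cinner \<phi> (lap_pvm B \<psi>)" for \<phi> \<psi>
    proof -
      have "cinner (fourier (lap_pvm B \<phi>)) (fourier \<psi>) = cinner (fourier \<phi>) (fourier (lap_pvm B \<psi>))"
        unfolding cinner_eq
      proof (rule integral_cong_AE)
        show "AE x in lborel. l2_rep (fourier (lap_pvm B \<phi>)) x * cnj (l2_rep (fourier \<psi>) x)
          = l2_rep (fourier \<phi>) x * cnj (l2_rep (fourier (lap_pvm B \<psi>)) x)"
          using fourier_lap_pvm_AE[OF B, of \<phi>] fourier_lap_pvm_AE[OF B, of \<psi>]
          by eventually_elim (simp split: split_indicator)
      qed measurable
      then show ?thesis by (simp add: cinner_fourier)
    qed
  qed
next
  show "lap_pvm {} \<phi> = 0" for \<phi>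
    unfolding l2_eq_iff_fourier_AE fourier_zero
    using fourier_lap_pvm_AE[of "{}" \<phi>] l2_rep_zero_AE by (auto elim: eventually_elim2)
  show "lap_pvm UNIV \<phi> = \<phi>" for \<phi>
    unfolding l2_eq_iff_fourier_AE using fourier_lap_pvm_AE[of UNIV \<phi>] by simp
  show "lap_pvm (A \<inter> B) \<phi> = lap_pvm A (lap_pvm B \<phi>)" if AB: "A \<in> sets borel" "B \<in> sets borel" for A B \<phi>
    unfolding l2_eq_iff_fourier_AE
    using fourier_lap_pvm_AE[OF AB(2), of \<phi>] fourier_lap_pvm_AE[OF AB(1), of "lap_pvm B \<phi>"]
      fourier_lap_pvm_AE[OF sets.Int[OF AB], of \<phi>]
    by eventually_elim (simp split: split_indicator)
next
  fix B :: "nat \<Rightarrow> real set" and \<phi>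
  assume B: "range B \<subseteq> sets borel" and disj: "disjoint_family B"
  have Bi [measurable]: "B i \<in> sets borel" for i using B by auto
  have Un: "(\<Union>i. B i) \<in> sets borel" "(\<Union>i<n. B i) \<in> sets borel" for n by auto
  have [measurable]: "(\<lambda>\<xi>. indicator (\<Union>i<n. B i) (\<xi>\<^sup>2) :: complex) \<in> borel_measurable borel" for n
    by (rule measurable_compose[OF _ borel_measurable_indicator[OF Un(2)]]) measurable
  have [measurable]: "(\<lambda>\<xi>. indicator (\<Union>i. B i) (\<xi>\<^sup>2) :: complex) \<in> borel_measurable borel"
    by (rule measurable_compose[OF _ borel_measurable_indicator[OF Un(1)]]) measurable
  have fin: "(\<Sum>i<n. lap_pvm (B i) \<phi>) = lap_pvm (\<Union>i<n. B i) \<phi>" for n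
  proof (induction n)
    case 0
    show ?case unfolding l2_eq_iff_fourier_AE
      using fourier_lap_pvm_AE[of "{}" \<phi>] l2_rep_zero_AE by (auto simp: fourier_zero elim: eventually_elim2)
  next
    case (Suc n)
    have "(\<Union>i<n. B i) \<inter> B n = {}" using disj
      by (auto simp: disjoint_family_on_def) (metis IntI emptyE less_irrefl)
    then have "lap_pvm ((\<Union>i<n. B i) \<union> B n) \<phi> = lap_pvm (\<Union>i<n. B i) \<phi> + lap_pvm (B n) \<phi>"
      by (intro lap_pvm_disjoint_Un) auto
    moreover have "(\<Union>i<n. B i) \<union> B n = (\<Union>i<Suc n. B i)" by (auto simp: lessThan_Suc)
    ultimately show ?case using Suc by simp
  qed
  have nrm: "(norm (lap_pvm (\<Union>i<n. B i) \<phi> - lap_pvm (\<Union>i. B i) \<phi>))\<^sup>2 =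
     (LINT \<xi>|lborel. (cmod ((indicator (\<Union>i<n. B i) (\<xi>\<^sup>2) - indicator (\<Union>i. B i) (\<xi>\<^sup>2)) * l2_rep (fourier \<phi>) \<xi>))\<^sup>2)" for n
  proof -
    have "(norm (fourier (lap_pvm (\<Union>i<n. B i) \<phi> - lap_pvm (\<Union>i. B i) \<phi>)))\<^sup>2 =
     (LINT \<xi>|lborel. (cmod ((indicator (\<Union>i<n. B i) (\<xi>\<^sup>2) - indicator (\<Union>i. B i) (\<xi>\<^sup>2)) * l2_rep (fourier \<phi>) \<xi>))\<^sup>2)"
      unfolding norm_l2_sq fourier_diff
    proof (rule integral_cong_AE)
      show "AE \<xi> in lborel. (cmod (l2_rep (fourier (lap_pvm (\<Union>i<n. B i) \<phi>) - fourier (lap_pvm (\<Union>i. B i) \<phi>)) \<xi>))\<^sup>2 =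
        (cmod ((indicator (\<Union>i<n. B i) (\<xi>\<^sup>2) - indicator (\<Union>i. B i) (\<xi>\<^sup>2)) * l2_rep (fourier \<phi>) \<xi>))\<^sup>2"
        using l2_rep_diff_AE[of "fourier (lap_pvm (\<Union>i<n. B i) \<phi>)" "fourier (lap_pvm (\<Union>i. B i) \<phi>)"]
          fourier_lap_pvm_AE[OF Un(1), of \<phi>] fourier_lap_pvm_AE[OF Un(2), of n \<phi>]
        by eventually_elim (simp add: left_diff_distrib)
    qed measurable
    then show ?thesis by (simp add: norm_fourier)
  qed
  have "(\<lambda>n. LINT \<xi>|lborel. (cmod ((indicator (\<Union>i<n. B i) (\<xi>\<^sup>2) - indicator (\<Union>i. B i) (\<xi>\<^sup>2)) * l2_rep (fourier \<phi>) \<xi>))\<^sup>2)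
     \<longlonglongrightarrow> (LINT \<xi>|(lborel :: real measure). (0::real))"
  proof (rule integral_dominated_convergence[where w = "\<lambda>\<xi>. (cmod (l2_rep (fourier \<phi>) \<xi>))\<^sup>2"])
    show "integrable lborel (\<lambda>\<xi>. (cmod (l2_rep (fourier \<phi>) \<xi>))\<^sup>2)" by (rule integrable_l2_rep_sq)
    show "AE \<xi> in lborel. (\<lambda>n. (cmod ((indicator (\<Union>i<n. B i) (\<xi>\<^sup>2) - indicator (\<Union>i. B i) (\<xi>\<^sup>2)) * l2_rep (fourier \<phi>) \<xi>))\<^sup>2) \<longlonglongrightarrow> 0"
    proof (intro AE_I2)
      fix \<xi> :: real
      have "(\<lambda>n. (cmod ((indicator (\<Union>i<n. B i) (\<xi>\<^sup>2) - indicator (\<Union>i. B i) (\<xi>\<^sup>2)) * l2_rep (fourier \<phi>) \<xi>))\<^sup>2) \<longlonglongrightarrow>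
        (cmod ((indicator (\<Union>i. B i) (\<xi>\<^sup>2) - indicator (\<Union>i. B i) (\<xi>\<^sup>2)) * l2_rep (fourier \<phi>) \<xi>))\<^sup>2"
        by (intro tendsto_intros LIMSEQ_indicator_UN)
      then show "(\<lambda>n. (cmod ((indicator (\<Union>i<n. B i) (\<xi>\<^sup>2) - indicator (\<Union>i. B i) (\<xi>\<^sup>2)) * l2_rep (fourier \<phi>) \<xi>))\<^sup>2) \<longlonglongrightarrow> 0" by simp
    qed
    show "AE \<xi> in lborel. norm ((cmod ((indicator (\<Union>i<n. B i) (\<xi>\<^sup>2) - indicator (\<Union>i. B i) (\<xi>\<^sup>2)) * l2_rep (fourier \<phi>) \<xi>))\<^sup>2) \<le> (cmod (l2_rep (fourier \<phi>) \<xi>))\<^sup>2" for n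
      by (intro AE_I2) (auto simp: norm_mult split: split_indicator)
  qed measurable
  then have "(\<lambda>n. (norm (lap_pvm (\<Union>i<n. B i) \<phi> - lap_pvm (\<Union>i. B i) \<phi>))\<^sup>2) \<longlonglongrightarrow> 0"
    unfolding nrm by simp
  from tendsto_real_sqrt[OF this]
  have "(\<lambda>n. norm (lap_pvm (\<Union>i<n. B i) \<phi> - lap_pvm (\<Union>i. B i) \<phi>)) \<longlonglongrightarrow> 0" by simp
  then show "(\<lambda>i. lap_pvm (B i) \<phi>) sums lap_pvm (\<Union>i. B i) \<phi>"
    unfolding sums_def fin by (subst (asm) tendsto_norm_zero_iff, subst (asm) LIM_zero_iff)
qed

interpretation lap: pvm lap_pvm
  by unfold_locales (rule projection_valued_measure_lap_pvm)

lemma lap_\<mu>: "lap.\<mu> \<phi> = distr (density lborel (\<lambda>\<xi>. ennreal ((cmod (l2_rep (fourier \<phi>) \<xi>))\<^sup>2))) borel (\<lambda>\<xi>. \<xi>\<^sup>2)"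
proof (rule measure_eqI)
  fix B assume "B \<in> sets (lap.\<mu> \<phi>)"
  then have B [measurable]: "B \<in> sets borel" by simp
  have "emeasure (lap.\<mu> \<phi>) B = ennreal ((norm (fourier (lap_pvm B \<phi>)))\<^sup>2)"
    by (simp add: lap.emeasure_\<mu> norm_fourier)
  also have "\<dots> = (\<integral>\<^sup>+ \<xi>. ennreal ((cmod (l2_rep (fourier \<phi>) \<xi>))\<^sup>2) * indicator B (\<xi>\<^sup>2) \<partial>lborel)"
    unfolding nn_integral_l2_rep_sq[symmetric]
  proof (rule nn_integral_cong_AE)
    show "AE \<xi> in lborel. ennreal ((cmod (l2_rep (fourier (lap_pvm B \<phi>)) \<xi>))\<^sup>2) = ennreal ((cmod (l2_rep (fourier \<phi>) \<xi>))\<^sup>2) * indicator B (\<xi>\<^sup>2)"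
      using fourier_lap_pvm_AE[OF B, of \<phi>] by eventually_elim (simp split: split_indicator)
  qed
  also have "\<dots> = (\<integral>\<^sup>+ \<xi>. ennreal ((cmod (l2_rep (fourier \<phi>) \<xi>))\<^sup>2) * indicator ((\<lambda>\<xi>. \<xi>\<^sup>2) -` B) \<xi> \<partial>lborel)"
    by (intro nn_integral_cong) (simp split: split_indicator)
  finally show "emeasure (lap.\<mu> \<phi>) B = emeasure (distr (density lborel (\<lambda>\<xi>. ennreal ((cmod (l2_rep (fourier \<phi>) \<xi>))\<^sup>2))) borel (\<lambda>\<xi>. \<xi>\<^sup>2)) B"
    by (subst emeasure_distr, simp, simp, subst emeasure_density)
      (auto intro!: measurable_sets_borel[where M = borel])
qed simp

lemma lap_nn_integral:
  assumes [measurable]: "g \<in> borel_measurable borel"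
  shows "(\<integral>\<^sup>+ x. g x \<partial>lap.\<mu> \<phi>) = (\<integral>\<^sup>+ \<xi>. ennreal ((cmod (l2_rep (fourier \<phi>) \<xi>))\<^sup>2) * g (\<xi>\<^sup>2) \<partial>lborel)"
  by (simp add: lap_\<mu> nn_integral_distr nn_integral_density)

lemma lap_integral:
  fixes g :: "real \<Rightarrow> real"
  assumes [measurable]: "g \<in> borel_measurable borel"
  shows "(LINT x|lap.\<mu> \<phi>. g x) = (LINT \<xi>|lborel. (cmod (l2_rep (fourier \<phi>) \<xi>))\<^sup>2 * g (\<xi>\<^sup>2))"
  by (simp add: lap_\<mu> integral_distr integral_density)

lemma polarization_complex:
  "(1 / 4) * (\<Sum>k<4. \<i> ^ k * complex_of_real ((cmod (z + \<i> ^ k * w))\<^sup>2)) = z * cnj w"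
  by (simp only: complex_norm_square) (simp add: eval_nat_numeral algebra_simps)

text \<open>Each of the four measures in \<open>spectral_sesq\<close> has the density
  \<open>|(\<phi> + \<i> ^ k * \<theta>)^|^2\<close> carried over by
  \<open>\<xi> \<mapsto> \<xi>^2\<close>, so polarisation may be done pointwise under the integral.
  For the converse, the multiplier defines a second value at \<open>\<phi>\<close>, and density of
  the domain identifies it with \<open>\<psi>\<close>.\<close>

lemma lap_spectral_integral_iff:
  "(\<phi>, \<psi>) \<in> spectral_integral lap_pvm (\<lambda>s. s) \<longleftrightarrow>
     (AE \<xi> in lborel. l2_rep (fourier \<psi>) \<xi> = of_real (\<xi>\<^sup>2) * l2_rep (fourier \<phi>) \<xi>)" (is "?L \<longleftrightarrow> ?R")
proof -
  have sq: "\<phi> \<in> spectral_domain lap_pvm (\<lambda>s. s) \<longleftrightarrow> square_integrable (\<lambda>\<xi>. of_real (\<xi>\<^sup>2) * l2_rep (fourier \<phi>) \<xi>)" for \<phi>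
  proof -
    have "(\<integral>\<^sup>+ x. ennreal (x\<^sup>2) \<partial>lap.\<mu> \<phi>) = (\<integral>\<^sup>+ \<xi>. ennreal ((cmod (of_real (\<xi>\<^sup>2) * l2_rep (fourier \<phi>) \<xi>))\<^sup>2) \<partial>lborel)"
      by (subst lap_nn_integral) (auto intro!: nn_integral_cong simp: ennreal_mult[symmetric] norm_mult power_mult_distrib mult.commute norm_power)
    then show ?thesis by (auto simp: lap.spectral_domain_iff square_integrable_def integrable_iff_bounded)
  qed
  have key: "(\<phi>, \<psi>) \<in> spectral_integral lap_pvm (\<lambda>s. s)"
    if \<phi>: "\<phi> \<in> spectral_domain lap_pvm (\<lambda>s. s)"
      and \<psi>: "AE \<xi> in lborel. l2_rep (fourier \<psi>) \<xi> = of_real (\<xi>\<^sup>2) * l2_rep (fourier \<phi>) \<xi>" for \<phi> \<psi>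
    unfolding spectral_integral_def
  proof (clarsimp, intro conjI ballI \<phi>)
    fix \<theta> assume \<theta>: "\<theta> \<in> spectral_domain lap_pvm (\<lambda>s. s)"
    define h where "h k \<xi> = (cmod (l2_rep (fourier (\<phi> + scaleC (\<i> ^ k) \<theta>)) \<xi>))\<^sup>2 * \<xi>\<^sup>2" for k :: nat and \<xi> :: real
    have [measurable]: "h k \<in> borel_measurable borel" for k unfolding h_def by measurable
    have hi: "integrable lborel (h k)" for k
    proof -
      have d: "\<phi> + scaleC (\<i> ^ k) \<theta> \<in> spectral_domain lap_pvm (\<lambda>s. s)"
        by (intro lap.spectral_domain_add lap.spectral_domain_scaleC \<phi> \<theta>) auto
      have "integrable lborel (\<lambda>x. cmod (of_real (x\<^sup>2) * l2_rep (fourier (\<phi> + scaleC (\<i> ^ k) \<theta>)) x * cnj (l2_rep (fourier (\<phi> + scaleC (\<i> ^ k) \<theta>)) x)))"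
        using d unfolding sq by (intro integrable_norm integrable_mult_cnj square_integrable_l2_rep)
      moreover have "cmod (of_real (x\<^sup>2) * z * cnj z) = (cmod z)\<^sup>2 * x\<^sup>2" for x z
        by (simp add: norm_mult norm_power power2_eq_square[of "cmod z"])
      ultimately show ?thesis unfolding h_def[abs_def] by simp
    qed
    have "spectral_sesq lap_pvm (\<lambda>s. s) \<phi> \<theta> = (1 / 4) * (\<Sum>k<4. \<i> ^ k * (LINT \<xi>|lborel. complex_of_real (h k \<xi>)))"
      unfolding spectral_sesq_def integral_complex_of_real by (subst lap_integral) (auto simp: h_def[abs_def])
    also have "\<dots> = (LINT \<xi>|lborel. (1 / 4) * (\<Sum>k<4. \<i> ^ k * complex_of_real (h k \<xi>)))"
      using hi by (simp add: Bochner_Integration.integral_sum)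
    also have "\<dots> = cinner (fourier \<psi>) (fourier \<theta>)"
      unfolding cinner_eq
    proof (rule integral_cong_AE)
      have "AE \<xi> in lborel. \<forall>k. l2_rep (fourier (\<phi> + scaleC (\<i> ^ k) \<theta>)) \<xi> = l2_rep (fourier \<phi>) \<xi> + \<i> ^ k * l2_rep (fourier \<theta>) \<xi>"
        unfolding AE_all_countable
      proof
        fix k :: nat
        show "AE \<xi> in lborel. l2_rep (fourier (\<phi> + scaleC (\<i> ^ k) \<theta>)) \<xi> = l2_rep (fourier \<phi>) \<xi> + \<i> ^ k * l2_rep (fourier \<theta>) \<xi>"
          unfolding fourier_add fourier_scaleC
          using l2_rep_add_AE[of "fourier \<phi>" "scaleC (\<i> ^ k) (fourier \<theta>)"] l2_rep_scaleC_AE[of "\<i> ^ k" "fourier \<theta>"]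
          by eventually_elim simp
      qed
      then show "AE \<xi> in lborel. (1 / 4) * (\<Sum>k<4. \<i> ^ k * complex_of_real (h k \<xi>)) = l2_rep (fourier \<psi>) \<xi> * cnj (l2_rep (fourier \<theta>) \<xi>)"
        using \<psi>
      proof eventually_elim
        case (elim \<xi>)
        have "(1 / 4) * (\<Sum>k<4. \<i> ^ k * complex_of_real (h k \<xi>)) =
           of_real (\<xi>\<^sup>2) * ((1 / 4) * (\<Sum>k<4. \<i> ^ k * complex_of_real ((cmod (l2_rep (fourier \<phi>) \<xi> + \<i> ^ k * l2_rep (fourier \<theta>) \<xi>))\<^sup>2)))"
          using elim(1) by (simp add: h_def sum_distrib_left mult_ac)
        then show ?case unfolding polarization_complex using elim(2) by simp
      qed
    qed measurable
    finally show "cinner \<psi> \<theta> = spectral_sesq lap_pvm (\<lambda>s. s) \<phi> \<theta>" by (simp add: cinner_fourier)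
  qed
  show ?thesis
  proof
    assume L: ?L
    then have \<phi>: "\<phi> \<in> spectral_domain lap_pvm (\<lambda>s. s)" by (simp add: spectral_integral_def)
    define \<psi>' where "\<psi>' = inv_fourier (l2_abs (\<lambda>\<xi>. of_real (\<xi>\<^sup>2) * l2_rep (fourier \<phi>) \<xi>))"
    have a: "AE \<xi> in lborel. l2_rep (fourier \<psi>') \<xi> = of_real (\<xi>\<^sup>2) * l2_rep (fourier \<phi>) \<xi>"
      unfolding \<psi>'_def fourier_inv_fourier by (rule l2_rep_abs_AE) (use \<phi> sq in blast)
    have "\<psi> - \<psi>' = 0"
      by (rule lap.spectral_domain_dense[of "\<lambda>s. s"])
        (use L key[OF \<phi> a] in \<open>auto simp: spectral_integral_def cinner_simps\<close>)
    with a show ?R by simp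
  next
    assume R: ?R
    have "square_integrable (\<lambda>\<xi>. of_real (\<xi>\<^sup>2) * l2_rep (fourier \<phi>) \<xi>)"
      unfolding square_integrable_def
    proof
      show "integrable lborel (\<lambda>x. (cmod (complex_of_real (x\<^sup>2) * l2_rep (fourier \<phi>) x))\<^sup>2)"
      proof (subst integrable_cong_AE)
        show "AE x in lborel. (cmod (complex_of_real (x\<^sup>2) * l2_rep (fourier \<phi>) x))\<^sup>2 = (cmod (l2_rep (fourier \<psi>) x))\<^sup>2"
          using R by eventually_elim simp
      qed (auto intro: integrable_l2_rep_sq)
    qed measurable
    then show ?L using key R sq by blast
  qed
qed

lemma laplacian_eq_spectral_integral: "spectral_integral lap_pvm (\<lambda>s. s) = laplacian"
proof (intro equalityI subrelI)
  fix \<phi> \<psi> assume "(\<phi>, \<psi>) \<in> spectral_integral lap_pvm (\<lambda>s. s)"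
  then have R: "AE \<xi> in lborel. l2_rep (fourier \<psi>) \<xi> = of_real (\<xi>\<^sup>2) * l2_rep (fourier \<phi>) \<xi>"
    by (simp only: lap_spectral_integral_iff)
  have sq: "square_integrable (\<lambda>\<xi>. \<i> * of_real \<xi> * l2_rep (fourier \<phi>) \<xi>)"
    unfolding square_integrable_def
  proof
    show "integrable lborel (\<lambda>x. (cmod (\<i> * of_real x * l2_rep (fourier \<phi>) x))\<^sup>2)"
    proof (rule Bochner_Integration.integrable_bound)
      show "integrable lborel (\<lambda>x. (cmod (l2_rep (fourier \<phi>) x))\<^sup>2 + (cmod (l2_rep (fourier \<psi>) x))\<^sup>2)"
        by (intro Bochner_Integration.integrable_add integrable_l2_rep_sq)
      show "AE x in lborel. norm ((cmod (\<i> * of_real x * l2_rep (fourier \<phi>) x))\<^sup>2) \<le> norm ((cmod (l2_rep (fourier \<phi>) x))\<^sup>2 + (cmod (l2_rep (fourier \<psi>) x))\<^sup>2)"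
        using R
      proof eventually_elim
        case (elim x)
        \<comment> \<open>\<open>laplacian\<close> is a composition of two weak derivatives, so the
          intermediate first derivative must be shown to be square integrable. It is controlled by
          interpolation: \<open>x^2 \<le> 1 + x^4\<close>.\<close>
        have "(x\<^sup>2 - 1)\<^sup>2 = (x\<^sup>2)\<^sup>2 - 2 * x\<^sup>2 + 1" by (simp add: power2_eq_square algebra_simps)
        then have "x\<^sup>2 \<le> 1 + (x\<^sup>2)\<^sup>2"
          using zero_le_power2[of "x\<^sup>2 - 1"] zero_le_power2[of x] by linarith
        then have "x\<^sup>2 * (cmod (l2_rep (fourier \<phi>) x))\<^sup>2 \<le> (1 + (x\<^sup>2)\<^sup>2) * (cmod (l2_rep (fourier \<phi>) x))\<^sup>2"
          by (rule mult_right_mono) simp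
        then show ?case using elim by (simp add: norm_mult power_mult_distrib norm_power distrib_right)
      qed
    qed measurable
  qed measurable
  define \<theta> where "\<theta> = inv_fourier (l2_abs (\<lambda>\<xi>. \<i> * of_real \<xi> * l2_rep (fourier \<phi>) \<xi>))"
  have a: "AE \<xi> in lborel. l2_rep (fourier \<theta>) \<xi> = \<i> * of_real \<xi> * l2_rep (fourier \<phi>) \<xi>"
    unfolding \<theta>_def fourier_inv_fourier by (rule l2_rep_abs_AE[OF sq])
  have 1: "(\<phi>, \<theta>) \<in> weak_derivative" unfolding weak_derivative_eq_ft_deriv ft_deriv_def using a by simp
  have "AE \<xi> in lborel. l2_rep (fourier (- \<psi>)) \<xi> = - l2_rep (fourier \<psi>) \<xi>"
    using l2_rep_uminus_AE[of "fourier \<psi>"] fourier_scaleR[of "-1" \<psi>] by simp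
  with a R have "AE \<xi> in lborel. l2_rep (fourier (- \<psi>)) \<xi> = \<i> * of_real \<xi> * l2_rep (fourier \<theta>) \<xi>"
    by eventually_elim (simp add: power2_eq_square ii_mult del: mult_minus_left)
  then have 2: "(\<theta>, - \<psi>) \<in> weak_derivative" unfolding weak_derivative_eq_ft_deriv ft_deriv_def by simp
  have "(\<phi>, - (- \<psi>)) \<in> laplacian" unfolding laplacian_def using 1 2 by blast
  then show "(\<phi>, \<psi>) \<in> laplacian" by simp
next
  fix \<phi> \<psi> assume "(\<phi>, \<psi>) \<in> laplacian"
  then obtain \<psi>' \<theta> where p: "\<psi> = - \<psi>'" "(\<phi>, \<theta>) \<in> weak_derivative" "(\<theta>, \<psi>') \<in> weak_derivative"
    unfolding laplacian_def by blast
  have "AE \<xi> in lborel. l2_rep (fourier (- \<psi>')) \<xi> = - l2_rep (fourier \<psi>') \<xi>"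
    using l2_rep_uminus_AE[of "fourier \<psi>'"] fourier_scaleR[of "-1" \<psi>'] by simp
  moreover have "AE \<xi> in lborel. l2_rep (fourier \<theta>) \<xi> = \<i> * of_real \<xi> * l2_rep (fourier \<phi>) \<xi>"
    "AE \<xi> in lborel. l2_rep (fourier \<psi>') \<xi> = \<i> * of_real \<xi> * l2_rep (fourier \<theta>) \<xi>"
    using p(2,3) by (simp_all add: weak_derivative_eq_ft_deriv ft_deriv_def)
  ultimately have "AE \<xi> in lborel. l2_rep (fourier \<psi>) \<xi> = of_real (\<xi>\<^sup>2) * l2_rep (fourier \<phi>) \<xi>"
    unfolding p(1) by eventually_elim (simp add: power2_eq_square ii_mult)
  then show "(\<phi>, \<psi>) \<in> spectral_integral lap_pvm (\<lambda>s. s)" by (simp only: lap_spectral_integral_iff)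
qed

lemma cinner_laplacian:
  assumes "(\<phi>, \<theta>) \<in> weak_derivative" "(\<theta>, \<psi>) \<in> weak_derivative"
  shows "cinner (- \<psi>) \<phi> = of_real ((norm \<theta>)\<^sup>2)"
  using weak_derivative_skew[OF assms(2,1)] by (simp add: cinner_minus_left cinner_self)

subsection \<open>Resolvents of positive self-adjoint operators\<close>

text \<open>\<open>1 + A\<close> maps onto the whole space. Its range is closed because positivity
  gives \<open>|\<phi>| \<le> |\<phi> + A \<phi>|\<close>, and dense because a vector
  \<open>x\<close> orthogonal to it satisfies \<open>(x, - x)\<close> in the adjoint, which is
  \<open>A\<close>, and positivity then kills \<open>x\<close>. The same norm inequality gives the
  uniqueness that the definite description in \<open>resolvent\<close> requires.\<close>

lemma positive_self_adjoint_resolvent: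
  assumes A: "positive_self_adjoint A"
  shows "(resolvent A 1 f, f - resolvent A 1 f) \<in> A"
    and "(u, f - u) \<in> A \<Longrightarrow> resolvent A 1 f = u"
proof -
  have adj: "adjoint_operator A = A" and lin: "linear_operator A"
    and pos: "\<And>\<phi> \<psi>. (\<phi>, \<psi>) \<in> A \<Longrightarrow> 0 \<le> Re (cinner \<psi> \<phi>)"
    using A by (auto simp: positive_self_adjoint_def)
  have sc: "(scaleC a \<phi>, scaleC a \<psi>) \<in> A" if "(\<phi>, \<psi>) \<in> A" for a \<phi> \<psi>
    using lin that by (simp add: linear_operator_def)
  have sub: "subspace A"
    using lin unfolding linear_operator_def subspace_def
    by (auto simp: zero_prod_def scaleR_scaleC)
  have "A = (\<Inter>p\<in>A. {q. cinner (snd p) (fst q) = cinner (fst p) (snd q)})"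
    by (subst adj[symmetric]) (force simp: adjoint_operator_def)
  also have "closed \<dots>" by (intro closed_INT ballI closed_Collect_eq continuous_intros)
  finally have cl: "closed A" .
  have mono: "norm \<phi> \<le> norm (\<phi> + \<psi>)" if "(\<phi>, \<psi>) \<in> A" for \<phi> \<psi>
  proof -
    have "\<psi> \<bullet> \<phi> \<ge> 0" using pos[OF that] by (simp add: inner_eq_Re_cinner)
    then have "(norm \<phi>)\<^sup>2 \<le> (norm (\<phi> + \<psi>))\<^sup>2"
      unfolding power2_norm_eq_inner by (simp add: inner_simps inner_commute)
    then show ?thesis by (simp add: power2_le_iff_abs_le)
  qed
  have unique: "u = v" if "(u, f - u) \<in> A" "(v, f - v) \<in> A" for u v
  proof -
    have "(u - v, v - u) \<in> A" using subspace_diff[OF sub that] by simp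
    from mono[OF this] show ?thesis by simp
  qed
  define S where "S = (\<lambda>p. fst p + snd p) ` A"
  have S_iff: "z \<in> S \<longleftrightarrow> (\<exists>u. (u, z - u) \<in> A)" for z
  proof
    assume "z \<in> S"
    then obtain a b where "(a, b) \<in> A" "z = a + b" unfolding S_def by auto
    then show "\<exists>u. (u, z - u) \<in> A" by (intro exI[of _ a]) simp
  next
    assume "\<exists>u. (u, z - u) \<in> A"
    then obtain u where "(u, z - u) \<in> A" by blast
    then show "z \<in> S" unfolding S_def by (intro image_eqI[of _ _ "(u, z - u)"]) auto
  qed
  have S: "subspace S" unfolding S_def
    by (rule linear_subspace_image[OF _ sub]) (auto simp: linear_iff algebra_simps)
  have "closed S"
    unfolding closed_sequential_limits
  proof (intro allI impI, elim conjE)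
    fix X l assume "\<forall>n. X n \<in> S" and X: "X \<longlonglongrightarrow> l"
    then have "\<exists>u. (u, X n - u) \<in> A" for n unfolding S_iff by blast
    then obtain Y where Y: "\<And>n. (Y n, X n - Y n) \<in> A" by metis
    have "norm (Y m - Y n) \<le> norm (X m - X n)" for m n
      using mono[of "Y m - Y n" "(X m - Y m) - (X n - Y n)"] subspace_diff[OF sub Y[of m] Y[of n]]
      by (simp add: algebra_simps)
    then have "Cauchy Y" using LIMSEQ_imp_Cauchy[OF X]
      unfolding Cauchy_def dist_norm by (meson le_less_trans)
    then obtain y where y: "Y \<longlonglongrightarrow> y" using Cauchy_convergent convergent_def by blast
    have "(\<lambda>n. (Y n, X n - Y n)) \<longlonglongrightarrow> (y, l - y)" by (intro tendsto_Pair tendsto_diff X y)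
    then have "(y, l - y) \<in> A" by (rule closed_sequentially[OF cl, rotated]) (use Y in auto)
    then show "l \<in> S" unfolding S_iff by blast
  qed
  moreover have "closure S = UNIV"
  proof (rule closure_eq_UNIV_if_orthogonal_trivial[OF S])
    fix x assume x: "\<And>z. z \<in> S \<Longrightarrow> x \<bullet> z = 0"
    have *: "cinner x (\<xi> + \<eta>) = 0" if "(\<xi>, \<eta>) \<in> A" for \<xi> \<eta>
    proof -
      have "\<xi> + \<eta> \<in> S" unfolding S_iff by (rule exI[of _ \<xi>]) (use that in simp)
      moreover have "scaleC \<i> (\<xi> + \<eta>) \<in> S"
        unfolding S_iff scaleC_add_right by (rule exI[of _ "scaleC \<i> \<xi>"]) (use sc[OF that, of \<i>] in simp)
      moreover note x
      ultimately have "x \<bullet> (\<xi> + \<eta>) = 0" "x \<bullet> scaleC \<i> (\<xi> + \<eta>) = 0" by blast+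
      then show ?thesis by (simp add: cinner_eq_inner complex_eq_iff)
    qed
    have "cinner \<eta> x = cinner \<xi> (- x)" if "(\<xi>, \<eta>) \<in> A" for \<xi> \<eta>
    proof -
      have "cinner (\<xi> + \<eta>) x = cnj (cinner x (\<xi> + \<eta>))" by (rule cinner_commute)
      also have "cinner x (\<xi> + \<eta>) = 0" using that * by blast
      finally show ?thesis by (simp add: cinner_add_left cinner_minus_right eq_neg_iff_add_eq_0 add.commute)
    qed
    then have "(x, - x) \<in> A" by (subst adj[symmetric]) (auto simp: adjoint_operator_def)
    from pos[OF this] show "x = 0" by (simp add: cinner_simps cinner_self)
  qed
  ultimately have "f \<in> S" by simp
  then obtain u0 where u: "(u0, f - u0) \<in> A" unfolding S_iff by blast
  have r: "resolvent A 1 f = u" if "(u, f - u) \<in> A" for u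
    unfolding resolvent_def using that unique by (intro the_equality) auto
  show "(resolvent A 1 f, f - resolvent A 1 f) \<in> A" using r[OF u] u by simp
  show "(u, f - u) \<in> A \<Longrightarrow> resolvent A 1 f = u" by (rule r)
qed

subsection \<open>The regularised operators\<close>

lemma bounded_linear_mulop:
  assumes m: "m \<in> borel_measurable borel" "\<And>x. cmod (m x) \<le> C"
  shows "bounded_linear (mulop m)"
proof (rule bounded_linear_intro[of _ C])
  note sq = square_integrable_bounded_mult[OF m(1) square_integrable_l2_rep m(2)]
  show "mulop m (x + y) = mulop m x + mulop m y" for x y
    unfolding l2_eq_iff_AE
    using mulop_AE[OF m, of x] mulop_AE[OF m, of y] mulop_AE[OF m, of "x + y"] l2_rep_add_AE[of x y] l2_rep_add_AE[of "mulop m x" "mulop m y"]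
    by eventually_elim (simp add: algebra_simps)
  show "mulop m (r *\<^sub>R x) = r *\<^sub>R mulop m x" for r x
    unfolding l2_eq_iff_AE scaleR_scaleC
    using mulop_AE[OF m, of x] mulop_AE[OF m, of "scaleC r x"] l2_rep_scaleC_AE[of r x] l2_rep_scaleC_AE[of r "mulop m x"]
    by eventually_elim (simp add: algebra_simps)
  show "norm (mulop m x) \<le> norm x * C" for x
  proof -
    have C: "C \<ge> 0" using order_trans[OF norm_ge_zero m(2)] .
    have i: "integrable lborel (\<lambda>t. (cmod (m t * l2_rep x t))\<^sup>2)" using sq[of x] by (simp add: square_integrable_def)
    have "(norm (mulop m x))\<^sup>2 = (LINT t|lborel. (cmod (m t * l2_rep x t))\<^sup>2)"
      unfolding mulop_def by (rule norm_l2_abs_sq[OF sq])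
    also have "\<dots> \<le> (LINT t|lborel. C\<^sup>2 * (cmod (l2_rep x t))\<^sup>2)"
    proof (rule integral_mono[OF i])
      show "integrable lborel (\<lambda>t. C\<^sup>2 * (cmod (l2_rep x t))\<^sup>2)" using integrable_l2_rep_sq[of x] by simp
      show "(cmod (m t * l2_rep x t))\<^sup>2 \<le> C\<^sup>2 * (cmod (l2_rep x t))\<^sup>2" for t
        unfolding norm_mult power_mult_distrib by (intro mult_right_mono power_mono m) auto
    qed
    also have "\<dots> = (norm x * C)\<^sup>2" by (simp add: norm_l2_sq[symmetric] power_mult_distrib mult.commute)
    finally show ?thesis using C by (simp add: power2_le_iff_abs_le abs_mult)
  qed
qed

lemma mulop_scaleC:
  assumes m: "m \<in> borel_measurable borel" "\<And>x. cmod (m x) \<le> C"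
  shows "mulop m (scaleC a x) = scaleC a (mulop m x)"
  unfolding l2_eq_iff_AE
  using mulop_AE[OF m, of x] mulop_AE[OF m, of "scaleC a x"] l2_rep_scaleC_AE[of a x] l2_rep_scaleC_AE[of a "mulop m x"]
  by eventually_elim (simp add: algebra_simps)

lemma mulop_mulop:
  assumes m: "m \<in> borel_measurable borel" "\<And>x. cmod (m x) \<le> C"
    and k: "k \<in> borel_measurable borel" "\<And>x. cmod (k x) \<le> C'"
    and p: "\<And>x. m x * k x = 1"
  shows "mulop m (mulop k x) = x"
  unfolding l2_eq_iff_AE
  using mulop_AE[OF m, of "mulop k x"] mulop_AE[OF k, of x]
proof eventually_elim
  case (elim t)
  then have "l2_rep (mulop m (mulop k x)) t = (m t * k t) * l2_rep x t" by (simp add: mult.assoc)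
  then show ?case by (simp add: p)
qed

locale coefficient =
  fixes c :: "real \<Rightarrow> real"
  assumes c_measurable [measurable]: "c \<in> borel_measurable borel"
    and c_nonneg: "\<And>x. 0 \<le> c x" and c_le_1: "\<And>x. c x \<le> 1"
begin

text \<open>The arguments are the derivatives: the viscosity form of \<open>\<phi>\<close> and
  \<open>\<xi>\<close> is \<open>form \<epsilon> \<phi>' \<xi>'\<close>. \<open>energy\<close>
  follows the same convention.\<close>

definition form :: "real \<Rightarrow> l2 \<Rightarrow> l2 \<Rightarrow> complex" where
  "form \<epsilon> u v = cinner (mulop (\<lambda>x. complex_of_real (c x + \<epsilon>)) u) v"

lemma weight_bound': "\<epsilon> \<ge> 0 \<Longrightarrow> \<bar>c x + \<epsilon>\<bar> \<le> 1 + \<epsilon>"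
  using c_nonneg[of x] c_le_1[of x] by simp

lemma form_eq: "\<epsilon> \<ge> 0 \<Longrightarrow> form \<epsilon> u v = (LINT x|lborel. of_real (c x + \<epsilon>) * (l2_rep u x * cnj (l2_rep v x)))"
  unfolding form_def by (subst cinner_mulop[of _ "1 + \<epsilon>"]) (auto intro: weight_bound' simp: mult.assoc simp del: of_real_add)

lemma viscosity_form_eq:
  assumes "\<epsilon> \<ge> 0" "(\<phi>, \<phi>') \<in> weak_derivative" "(\<xi>, \<xi>') \<in> weak_derivative"
  shows "viscosity_form c \<epsilon> \<phi> \<xi> = form \<epsilon> \<phi>' \<xi>'"
  unfolding viscosity_form_def form_eq[OF assms(1)] weak_deriv_eqI[OF assms(2)] weak_deriv_eqI[OF assms(3)]
  by (simp add: scaleR_conv_of_real)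

lemma bounded_linear_weight: "\<epsilon> \<ge> 0 \<Longrightarrow> bounded_linear (mulop (\<lambda>x. complex_of_real (c x + \<epsilon>)))"
  by (rule bounded_linear_mulop[of _ "1 + \<epsilon>"]) (auto intro: weight_bound' simp del: of_real_add)

lemma form_integrable:
  assumes "\<epsilon> \<ge> 0"
  shows "integrable lborel (\<lambda>x. of_real (c x + \<epsilon>) * (l2_rep u x * cnj (l2_rep v x)))"
proof -
  have "integrable lborel (\<lambda>x. (complex_of_real (c x + \<epsilon>) * l2_rep u x) * cnj (l2_rep v x))"
    by (intro integrable_mult_cnj square_integrable_bounded_mult[of _ _ "1 + \<epsilon>"] square_integrable_l2_rep)
      (auto intro: weight_bound' assms simp del: of_real_add)
  then show ?thesis by (simp add: mult.assoc)
qed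

definition energy :: "real \<Rightarrow> l2 \<Rightarrow> real" where
  "energy \<epsilon> u = (LINT x|lborel. (c x + \<epsilon>) * (cmod (l2_rep u x))\<^sup>2)"

lemma energy_integrable: "\<epsilon> \<ge> 0 \<Longrightarrow> integrable lborel (\<lambda>x. (c x + \<epsilon>) * (cmod (l2_rep u x))\<^sup>2)"
proof -
  assume e: "\<epsilon> \<ge> 0"
  have "integrable lborel (\<lambda>x. cmod (of_real (c x + \<epsilon>) * (l2_rep u x * cnj (l2_rep u x))))"
    by (rule integrable_norm[OF form_integrable[OF e]])
  moreover have "cmod (of_real (c x + \<epsilon>) * (l2_rep u x * cnj (l2_rep u x))) = (c x + \<epsilon>) * (cmod (l2_rep u x))\<^sup>2" for x
    unfolding norm_mult norm_of_real using c_nonneg[of x] e by (simp add: power2_eq_square)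
  ultimately show ?thesis by simp
qed

lemma form_self: "\<epsilon> \<ge> 0 \<Longrightarrow> form \<epsilon> u u = of_real (energy \<epsilon> u)"
  unfolding form_eq energy_def integral_complex_of_real[symmetric]
  by (simp add: complex_norm_square[symmetric] del: of_real_power of_real_add)

lemma energy_nonneg: "\<epsilon> \<ge> 0 \<Longrightarrow> 0 \<le> energy \<epsilon> u"
  unfolding energy_def using c_nonneg by (intro integral_nonneg_AE AE_I2 mult_nonneg_nonneg add_nonneg_nonneg) auto

lemma energy_split: "\<epsilon> \<ge> 0 \<Longrightarrow> energy \<epsilon> u = energy 0 u + \<epsilon> * (norm u)\<^sup>2"
  unfolding energy_def norm_l2_sq distrib_right
  using energy_integrable[of 0 u] integrable_l2_rep_sq[of u] by simp

lemma energy_0_le: "\<epsilon> \<ge> 0 \<Longrightarrow> energy 0 u \<le> energy \<epsilon> u"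
  by (subst (2) energy_split) auto

text \<open>Young's inequality with weights \<open>1\<close> and \<open>1/4\<close>. The full weight
  falls on \<open>u\<close> because \<open>resolvent_variational\<close> has exactly one copy of its
  energy, with a minus sign, to absorb it.\<close>

lemma Re_form_le: "\<epsilon> \<ge> 0 \<Longrightarrow> Re (form \<epsilon> u v) \<le> energy \<epsilon> u + energy \<epsilon> v / 4"
proof -
  assume e: "\<epsilon> \<ge> 0"
  have "Re (form \<epsilon> u v) = (LINT x|lborel. Re (of_real (c x + \<epsilon>) * (l2_rep u x * cnj (l2_rep v x))))"
    unfolding form_eq[OF e] by (rule integral_Re[OF form_integrable[OF e], symmetric])
  also have "\<dots> \<le> (LINT x|lborel. (c x + \<epsilon>) * (cmod (l2_rep u x))\<^sup>2 + (c x + \<epsilon>) * (cmod (l2_rep v x))\<^sup>2 / 4)"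
  proof (rule integral_mono)
    show "Re (of_real (c x + \<epsilon>) * (l2_rep u x * cnj (l2_rep v x)))
       \<le> (c x + \<epsilon>) * (cmod (l2_rep u x))\<^sup>2 + (c x + \<epsilon>) * (cmod (l2_rep v x))\<^sup>2 / 4" for x
    proof -
      have "Re (l2_rep u x * cnj (l2_rep v x)) \<le> cmod (l2_rep u x) * cmod (l2_rep v x)"
        using complex_Re_le_cmod[of "l2_rep u x * cnj (l2_rep v x)"] by (simp add: norm_mult)
      also have "\<dots> \<le> (cmod (l2_rep u x))\<^sup>2 + (cmod (l2_rep v x))\<^sup>2 / 4"
        using zero_le_power2[of "cmod (l2_rep u x) - cmod (l2_rep v x) / 2"]
        by (simp add: power2_eq_square algebra_simps)
      finally have "(c x + \<epsilon>) * Re (l2_rep u x * cnj (l2_rep v x)) \<le> (c x + \<epsilon>) * ((cmod (l2_rep u x))\<^sup>2 + (cmod (l2_rep v x))\<^sup>2 / 4)"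
        using c_nonneg[of x] e by (intro mult_left_mono) auto
      moreover have "Re (of_real (c x + \<epsilon>) * z) = (c x + \<epsilon>) * Re z" for z by simp
      ultimately show ?thesis by (simp only: distrib_left times_divide_eq_right)
    qed
    show "integrable lborel (\<lambda>x. Re (of_real (c x + \<epsilon>) * (l2_rep u x * cnj (l2_rep v x))))"
      by (rule integrable_Re[OF form_integrable[OF e]])
    show "integrable lborel (\<lambda>x. (c x + \<epsilon>) * (cmod (l2_rep u x))\<^sup>2 + (c x + \<epsilon>) * (cmod (l2_rep v x))\<^sup>2 / 4)"
      using energy_integrable[OF e, of u] energy_integrable[OF e, of v] by simp
  qed
  also have "\<dots> = energy \<epsilon> u + energy \<epsilon> v / 4"
    unfolding energy_def using energy_integrable[OF e, of u] energy_integrable[OF e, of v] by simp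
  finally show ?thesis .
qed

abbreviation H\<epsilon> :: "real \<Rightarrow> l2_op" where
  "H\<epsilon> \<epsilon> \<equiv> form_operator W12 (viscosity_form c \<epsilon>)"

text \<open>The pair \<open>(u, sqrt (c + \<epsilon>) * u')\<close> belonging to \<open>u = (1 + H\<^sub>\<epsilon>)\<^sup>-\<^sup>1 f\<close> is the orthogonal
  projection of \<open>(f, 0)\<close> onto the closed subspace of all such pairs.\<close>

lemma resolvent_exists:
  assumes e: "\<epsilon> > 0"
  shows "\<exists>u u'. (u, u') \<in> weak_derivative \<and> (\<forall>v v'. (v, v') \<in> weak_derivative \<longrightarrow> form \<epsilon> u' v' = cinner (f - u) v)"
proof -
  \<comment> \<open>\<open>q\<close> is the square root of the weight and \<open>r\<close> its
    inverse. The bound \<open>1 / sqrt \<epsilon>\<close> on \<open>r\<close>, available since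
    \<open>\<epsilon> > 0\<close>, makes \<open>(u, s) \<mapsto> (u, r * s)\<close> continuous, so
    that \<open>M\<close>, its preimage of \<open>weak_derivative\<close>, is closed.\<close>
  define r where "r x = complex_of_real (1 / sqrt (c x + \<epsilon>))" for x
  define q where "q x = complex_of_real (sqrt (c x + \<epsilon>))" for x
  have [measurable]: "r \<in> borel_measurable borel" "q \<in> borel_measurable borel"
    unfolding r_def q_def by measurable
  have pos: "0 < c x + \<epsilon>" for x using c_nonneg[of x] e by linarith
  have rb: "cmod (r x) \<le> 1 / sqrt \<epsilon>" for x
    unfolding r_def norm_of_real using c_nonneg[of x] e by (auto intro!: divide_left_mono)
  have qb: "cmod (q x) \<le> sqrt (1 + \<epsilon>)" for x
    unfolding q_def norm_of_real using c_nonneg[of x] c_le_1[of x] e by auto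
  have qm: "AE x in lborel. l2_rep (mulop q v) x = q x * l2_rep v x" for v
    by (rule mulop_AE[OF _ qb]) simp
  have rq: "r x * q x = 1" "q x * r x = 1" for x
    using pos[of x] by (simp_all add: r_def q_def flip: of_real_mult)
  have blr: "bounded_linear (mulop r)" by (rule bounded_linear_mulop[OF _ rb]) simp
  define M where "M = (\<lambda>p. (fst p, mulop r (snd p))) -` weak_derivative"
  have lin: "linear (\<lambda>p. (fst p, mulop r (snd p)))"
    using bounded_linear.linear[OF blr] by (auto simp: linear_iff)
  have M: "subspace M" unfolding M_def
    by (rule linear_subspace_vimage[OF lin subspace_weak_derivative])
  have "closed M" unfolding M_def
    by (rule closed_vimage[OF closed_weak_derivative])
      (intro continuous_intros bounded_linear.continuous_on[OF blr])
  then obtain y where y: "y \<in> M" "\<And>z. z \<in> M \<Longrightarrow> ((f, 0) - y) \<bullet> z = 0"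
    using orthogonal_projection_exists[OF M] by blast
  obtain u s where us: "y = (u, s)" by force
  define u' where "u' = mulop r s"
  have u: "(u, u') \<in> weak_derivative" using y(1) by (simp add: M_def us u'_def)
  have s: "s = mulop q u'" unfolding u'_def by (rule mulop_mulop[OF _ qb _ rb, symmetric]) (auto simp: rq)
  have "form \<epsilon> u' v' = cinner (f - u) v" if v: "(v, v') \<in> weak_derivative" for v v'
  proof -
    have "mulop r (mulop q v') = v'" by (rule mulop_mulop[OF _ rb _ qb]) (auto simp: rq)
    then have "(v, mulop q v') \<in> M" using v by (simp add: M_def)
    from y(2)[OF this] have 1: "(f - u) \<bullet> v - s \<bullet> mulop q v' = 0" by (simp add: us)
    have "mulop r (mulop q (scaleC \<i> v')) = scaleC \<i> v'" by (rule mulop_mulop[OF _ rb _ qb]) (auto simp: rq)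
    then have "(scaleC \<i> v, mulop q (scaleC \<i> v')) \<in> M" using weak_derivative_scaleC[OF v] by (simp add: M_def)
    from y(2)[OF this] have 2: "(f - u) \<bullet> scaleC \<i> v - s \<bullet> scaleC \<i> (mulop q v') = 0"
      by (simp add: us mulop_scaleC[OF _ qb])
    from 1 2 have "cinner (f - u) v = cinner (mulop q u') (mulop q v')"
      by (simp add: cinner_eq_inner s)
    also have "\<dots> = (LINT x|lborel. of_real (c x + \<epsilon>) * (l2_rep u' x * cnj (l2_rep v' x)))"
      unfolding cinner_eq
    proof (rule integral_cong_AE)
      show "AE x in lborel. l2_rep (mulop q u') x * cnj (l2_rep (mulop q v') x) = of_real (c x + \<epsilon>) * (l2_rep u' x * cnj (l2_rep v' x))"
        using qm[of u'] qm[of v']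
      proof eventually_elim
        case (elim x)
        have "q x * q x = of_real (c x + \<epsilon>)" unfolding q_def of_real_mult[symmetric] using pos[of x] by simp
        moreover have "cnj (q x) = q x" by (simp add: q_def)
        ultimately show ?case using elim by (metis (no_types, lifting) complex_cnj_mult mult.assoc mult.commute)
      qed
    qed measurable
    also have "\<dots> = form \<epsilon> u' v'" using e by (simp add: form_eq)
    finally show ?thesis by simp
  qed
  with u show ?thesis by blast
qed

text \<open>\<open>resolvent\<close> is a definite description, so the weak solution must be unique:
  testing the difference of two solutions with itself gives a nonnegative energy equal to
  \<open>- |u - w|^2\<close>.\<close>

lemma resolvent_weak_solution:
  assumes e: "\<epsilon> > 0"
  obtains u' where "(resolvent (H\<epsilon> \<epsilon>) 1 f, u') \<in> weak_derivative"
    "\<And>v v'. (v, v') \<in> weak_derivative \<Longrightarrow> form \<epsilon> u' v' = cinner (f - resolvent (H\<epsilon> \<epsilon>) 1 f) v"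
proof -
  have iff: "(u, f - 1 *\<^sub>R u) \<in> H\<epsilon> \<epsilon> \<longleftrightarrow>
    (\<exists>u'. (u, u') \<in> weak_derivative \<and> (\<forall>v v'. (v, v') \<in> weak_derivative \<longrightarrow> form \<epsilon> u' v' = cinner (f - u) v))" for u
    using e by (auto simp: form_operator_def W12_def viscosity_form_eq)
      (metis viscosity_form_eq less_imp_le DomainI)+
  obtain u where u: "(u, f - 1 *\<^sub>R u) \<in> H\<epsilon> \<epsilon>" unfolding iff using resolvent_exists[OF e, of f] by blast
  have uniq: "w = u" if w: "(w, f - 1 *\<^sub>R w) \<in> H\<epsilon> \<epsilon>" for w
  proof -
    obtain u' w' where wu: "(u, u') \<in> weak_derivative" "(w, w') \<in> weak_derivative"
      and eq: "\<And>v v'. (v, v') \<in> weak_derivative \<Longrightarrow> form \<epsilon> u' v' = cinner (f - u) v"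
        "\<And>v v'. (v, v') \<in> weak_derivative \<Longrightarrow> form \<epsilon> w' v' = cinner (f - w) v"
      using u w unfolding iff by blast
    have d: "(u - w, u' - w') \<in> weak_derivative" using subspace_diff[OF subspace_weak_derivative wu] by simp
    have "form \<epsilon> (u' - w') (u' - w') = form \<epsilon> u' (u' - w') - form \<epsilon> w' (u' - w')"
      unfolding form_def using linear_diff[OF bounded_linear.linear[OF bounded_linear_weight]] e
      by (simp add: cinner_diff_left)
    also have "\<dots> = - cinner (u - w) (u - w)" using eq[OF d] by (simp add: cinner_simps)
    finally have "energy \<epsilon> (u' - w') = - (norm (u - w))\<^sup>2"
      using e by (simp add: form_self cinner_self flip: of_real_minus of_real_power)
    moreover have "energy \<epsilon> (u' - w') \<ge> 0" using e by (simp add: energy_nonneg)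
    ultimately have "norm (u - w) = 0" by (smt (verit) zero_le_power2 zero_eq_power2)
    then show ?thesis by simp
  qed
  have R: "resolvent (H\<epsilon> \<epsilon>) 1 f = u" unfolding resolvent_def by (rule the_equality) (rule u, erule uniq)
  from u[unfolded iff] obtain u' where "(u, u') \<in> weak_derivative"
    "\<And>v v'. (v, v') \<in> weak_derivative \<Longrightarrow> form \<epsilon> u' v' = cinner (f - u) v" by blast
  then show thesis by (intro that[of u']) (simp_all only: R)
qed

text \<open>Testing the weak equation for the resolvent \<open>u\<close> with the trial function
  \<open>v\<close> and with \<open>u\<close> itself rewrites \<open>|f - u|^2\<close> as
  \<open>(f - u) \<bullet> (f - v)\<close> plus \<open>form \<epsilon> u' v'\<close> minus the
  energy of \<open>u'\<close>, and Young's inequality disposes of the mixed terms. If some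
  \<open>v\<close> near \<open>f\<close> has little energy, the resolvent almost fixes
  \<open>f\<close>, with no reference to the size of \<open>v'\<close> in \<open>L2\<close> apart
  from the \<open>\<epsilon>\<close> part of the energy.\<close>

lemma resolvent_variational:
  assumes e: "\<epsilon> > 0" and v: "(v, v') \<in> weak_derivative"
  shows "(norm (f - resolvent (H\<epsilon> \<epsilon>) 1 f))\<^sup>2 \<le> (norm (f - v))\<^sup>2 + energy \<epsilon> v' / 2"
proof -
  define u where "u = resolvent (H\<epsilon> \<epsilon>) 1 f"
  obtain u' where u': "(u, u') \<in> weak_derivative"
    "\<And>v v'. (v, v') \<in> weak_derivative \<Longrightarrow> form \<epsilon> u' v' = cinner (f - u) v"
    using resolvent_weak_solution[OF e, of f] unfolding u_def by blast
  have 1: "(f - u) \<bullet> v = Re (form \<epsilon> u' v')" "(f - u) \<bullet> u = energy \<epsilon> u'"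
    using u'(2)[OF v] u'(2)[OF u'(1)] e by (simp_all add: inner_eq_Re_cinner form_self flip: u'(2))
      (metis Re_complex_of_real form_self less_imp_le)
  have "(norm (f - u))\<^sup>2 = (f - u) \<bullet> (f - v) + (f - u) \<bullet> v - (f - u) \<bullet> u"
    unfolding power2_norm_eq_inner by (simp add: inner_simps)
  also have "\<dots> \<le> (f - u) \<bullet> (f - v) + energy \<epsilon> v' / 4"
    unfolding 1 using Re_form_le[of \<epsilon> u' v'] e by simp
  also have "(f - u) \<bullet> (f - v) \<le> ((norm (f - u))\<^sup>2 + (norm (f - v))\<^sup>2) / 2"
    using zero_le_power2[of "norm ((f - u) - (f - v))"]
    unfolding power2_norm_eq_inner by (simp add: inner_simps inner_commute)
  finally show ?thesis by (simp add: u_def field_simps)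
qed

text \<open>The bound is a continuous function of the resolvent value, and the energy on the left is
  the degenerate one, free of \<open>\<epsilon>\<close>. In this form it survives the passage to
  \<open>\<epsilon> = 0\<close> under strong resolvent convergence.\<close>

lemma resolvent_energy:
  assumes e: "\<epsilon> > 0"
  obtains u' where "(resolvent (H\<epsilon> \<epsilon>) 1 f, u') \<in> weak_derivative"
    "energy 0 u' \<le> (f - resolvent (H\<epsilon> \<epsilon>) 1 f) \<bullet> resolvent (H\<epsilon> \<epsilon>) 1 f"
proof -
  define u where "u = resolvent (H\<epsilon> \<epsilon>) 1 f"
  obtain u' where u': "(u, u') \<in> weak_derivative"
    "\<And>v v'. (v, v') \<in> weak_derivative \<Longrightarrow> form \<epsilon> u' v' = cinner (f - u) v"
    using resolvent_weak_solution[OF e, of f] unfolding u_def by blast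
  have "(f - u) \<bullet> u = Re (form \<epsilon> u' u')" using u'(2)[OF u'(1)] by (simp add: inner_eq_Re_cinner)
  also have "\<dots> = energy \<epsilon> u'" using e by (simp add: form_self)
  finally show thesis using that[of u'] u'(1) energy_0_le[of \<epsilon> u'] e by (simp add: u_def)
qed

lemma continuous_energy: "X \<longlonglongrightarrow> u \<Longrightarrow> (\<lambda>n. energy 0 (X n)) \<longlonglongrightarrow> energy 0 u"
proof -
  assume X: "X \<longlonglongrightarrow> u"
  have "energy 0 v = Re (cinner (mulop (\<lambda>x. complex_of_real (c x + 0)) v) v)" for v
    using form_self[of 0 v] by (simp add: form_def)
  then show ?thesis
    by (simp only:) (intro tendsto_Re tendsto_cinner X bounded_linear.tendsto[OF bounded_linear_weight]; simp)
qed

lemma energy_cemb: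
  assumes "test_function a" "test_function b"
  shows "energy 0 (cemb a b) = (LINT x|lborel. c x * (a x)\<^sup>2) + (LINT x|lborel. c x * (b x)\<^sup>2)"
    and "(norm (cemb a b))\<^sup>2 = (LINT x|lborel. (a x)\<^sup>2) + (LINT x|lborel. (b x)\<^sup>2)"
    and "integrable lborel (\<lambda>x. c x * (a x)\<^sup>2)" "integrable lborel (\<lambda>x. (a x)\<^sup>2)"
proof -
  have sq: "integrable lborel (\<lambda>x. (a x)\<^sup>2)" if "test_function a" for a
    using square_integrable_of_real_test_function[OF that] by (simp add: square_integrable_def)
  have csq: "integrable lborel (\<lambda>x. c x * (a x)\<^sup>2)" if "test_function a" for a
  proof (rule Bochner_Integration.integrable_bound[OF sq[OF that]])
    have [measurable]: "a \<in> borel_measurable borel" by (rule borel_measurable_test_function[OF that])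
    show "(\<lambda>x. c x * (a x)\<^sup>2) \<in> borel_measurable lborel" by measurable
    show "AE x in lborel. norm (c x * (a x)\<^sup>2) \<le> norm ((a x)\<^sup>2)"
      using c_nonneg c_le_1 by (intro AE_I2) (auto simp: abs_mult intro!: mult_left_le_one_le)
  qed
  show "integrable lborel (\<lambda>x. c x * (a x)\<^sup>2)" "integrable lborel (\<lambda>x. (a x)\<^sup>2)"
    using assms csq sq by auto
  have [measurable]: "a \<in> borel_measurable borel" "b \<in> borel_measurable borel"
    using assms by (auto intro: borel_measurable_test_function)
  have r: "AE x in lborel. (cmod (l2_rep (cemb a b) x))\<^sup>2 = (a x)\<^sup>2 + (b x)\<^sup>2"
    using l2_rep_add_AE[of "emb a" "scaleC \<i> (emb b)"] l2_rep_scaleC_AE[of \<i> "emb b"]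
      l2_rep_abs_AE[OF square_integrable_of_real_test_function[OF assms(1)], folded emb_def]
      l2_rep_abs_AE[OF square_integrable_of_real_test_function[OF assms(2)], folded emb_def]
    by eventually_elim (simp add: cemb_def cmod_power2)
  have "energy 0 (cemb a b) = (LINT x|lborel. c x * (a x)\<^sup>2 + c x * (b x)\<^sup>2)"
    unfolding energy_def
    by (rule integral_cong_AE) (use r in \<open>auto elim!: eventually_mono simp: distrib_left\<close>)
  then show "energy 0 (cemb a b) = (LINT x|lborel. c x * (a x)\<^sup>2) + (LINT x|lborel. c x * (b x)\<^sup>2)"
    using csq assms by simp
  have "(norm (cemb a b))\<^sup>2 = (LINT x|lborel. (a x)\<^sup>2 + (b x)\<^sup>2)"
    unfolding norm_l2_sq
    by (rule integral_cong_AE) (use r in auto)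
  then show "(norm (cemb a b))\<^sup>2 = (LINT x|lborel. (a x)\<^sup>2) + (LINT x|lborel. (b x)\<^sup>2)"
    using sq assms by simp
qed

text \<open>Membership in the domain of the square root is made accessible by truncation:
  \<open>\<phi>n = E {0..n} \<phi>\<close> lies in the domain of \<open>H\<close> with quadratic
  form at most \<open>|\<psi>|^2\<close>, and it equals \<open>resolvent H 1 f\<close> for
  \<open>f = \<phi>n + w\<close>, where \<open>w\<close> is the value of \<open>H\<close> at it. The
  regularised resolvents of \<open>f\<close> then approximate it, \<open>resolvent_energy\<close>
  bounds their energies by a quantity tending to \<open>w \<bullet> \<phi>n\<close>, and test
  functions approximate one of them together with its derivative.\<close>

lemma viscosity_form_domain_approx:
  assumes H: "viscosity_operator c H" and \<psi>: "(\<phi>, \<psi>) \<in> function_of_operator sqrt H" and e: "e > 0"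
  obtains a b where "test_function a" "test_function b" "norm (\<phi> - cemb a b) < e"
    "energy 0 (cemb (deriv a) (deriv b)) \<le> (norm \<psi>)\<^sup>2 + e"
proof -
  have psa: "positive_self_adjoint H"
    and lim: "((\<lambda>\<epsilon>. resolvent (H\<epsilon> \<epsilon>) 1 f) \<longlongrightarrow> resolvent H 1 f) (at_right 0)" for f
    using H by (auto simp: viscosity_operator_def strong_resolvent_limit_def)
  obtain E where E: "projection_valued_measure E" "spectral_integral E (\<lambda>s. s) = H" "(\<phi>, \<psi>) \<in> spectral_integral E sqrt"
    using \<psi> by (auto simp: function_of_operator_def)
  interpret pvm E by unfold_locales (rule E(1))
  interpret finite_measure "\<mu> \<phi>" by (rule finite_measure_\<mu>)
  have nn: "AE x in \<mu> \<phi>. 0 \<le> x"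
    by (rule \<mu>_negative_eq_0) (use psa E(2) in \<open>auto simp: positive_self_adjoint_def\<close>)
  have sqd: "\<phi> \<in> spectral_domain E sqrt" using E(3) by (simp add: spectral_integral_def)
  have n\<psi>: "(norm \<psi>)\<^sup>2 = (LINT x|\<mu> \<phi>. (sqrt x)\<^sup>2)" by (rule spectral_integral_norm[OF _ E(3)]) simp
  define B where "B n = {0..real n}" for n :: nat
  have B [measurable]: "B n \<in> sets borel" for n by (simp add: B_def)
  have "(\<lambda>n. measure (\<mu> \<phi>) (B n)) \<longlonglongrightarrow> measure (\<mu> \<phi>) (\<Union>n. B n)"
    by (rule finite_Lim_measure_incseq) (auto simp: incseq_def B_def)
  moreover have "measure (\<mu> \<phi>) (\<Union>n. B n) = measure (\<mu> \<phi>) UNIV"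
  proof (rule measure_eq_AE)
    show "AE x in \<mu> \<phi>. (x \<in> (\<Union>n. B n)) = (x \<in> UNIV)"
      using nn by eventually_elim (auto simp: B_def real_arch_simple)
  qed auto
  ultimately have ml: "(\<lambda>n. measure (\<mu> \<phi>) (B n)) \<longlonglongrightarrow> (norm \<phi>)\<^sup>2" by (simp add: measure_\<mu>)
  have "(\<lambda>n. (norm \<phi>)\<^sup>2 - measure (\<mu> \<phi>) (B n)) \<longlonglongrightarrow> 0"
    using tendsto_diff[OF tendsto_const[of "(norm \<phi>)\<^sup>2"] ml] by simp
  \<comment> \<open>The error \<open>e\<close> in norm is spent in thirds: truncation,
    regularisation, and approximation by test functions.\<close>
  then have "\<forall>\<^sub>F n in sequentially. (norm \<phi>)\<^sup>2 - measure (\<mu> \<phi>) (B n) < (e / 3)\<^sup>2"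
    using e by (intro order_tendstoD) auto
  then obtain n where n: "(norm \<phi>)\<^sup>2 - measure (\<mu> \<phi>) (B n) < (e / 3)\<^sup>2"
    by (auto simp: eventually_sequentially)
  define \<phi>n where "\<phi>n = E (B n) \<phi>"
  have "(norm (\<phi> - \<phi>n))\<^sup>2 = (norm \<phi>)\<^sup>2 - measure (\<mu> \<phi>) (B n)"
  proof -
    have "\<phi>n \<bullet> \<phi> = (norm \<phi>n)\<^sup>2" unfolding \<phi>n_def inner_eq_Re_cinner by (simp add: cinner_E_self)
    then show ?thesis unfolding measure_\<mu>[OF B] \<phi>n_def[symmetric] power2_norm_eq_inner
      by (simp add: inner_simps inner_commute)
  qed
  with n have "(norm (\<phi> - \<phi>n))\<^sup>2 < (e / 3)\<^sup>2" by simp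
  then have d1: "norm (\<phi> - \<phi>n) < e / 3" by (rule power2_less_imp_less) (use e in simp)
  have \<mu>n: "\<mu> \<phi>n = density (\<mu> \<phi>) (\<lambda>x. ennreal (indicator (B n) x))"
    unfolding \<phi>n_def using \<mu>_E[OF B, of n \<phi>] by (simp add: ennreal_indicator)
  have "(\<integral>\<^sup>+ x. ennreal (x\<^sup>2) \<partial>\<mu> \<phi>n) = (\<integral>\<^sup>+ x. ennreal (indicator (B n) x) * ennreal (x\<^sup>2) \<partial>\<mu> \<phi>)"
    unfolding \<mu>n by (subst nn_integral_density) auto
  also have "\<dots> \<le> (\<integral>\<^sup>+ x. ennreal ((real n)\<^sup>2) \<partial>\<mu> \<phi>)"
    by (rule nn_integral_mono) (auto simp: B_def intro!: ennreal_leI power_mono split: split_indicator)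
  also have "\<dots> < \<infinity>" by (simp add: ennreal_mult_less_top emeasure_\<mu>)
  finally have "\<phi>n \<in> spectral_domain E (\<lambda>s. s)" by (simp add: spectral_domain_iff)
  then obtain w where w: "(\<phi>n, w) \<in> spectral_integral E (\<lambda>s. s)"
    using spectral_integral_exists[of "\<lambda>s. s"] by auto
  have "w \<bullet> \<phi>n = (LINT x|\<mu> \<phi>n. x)" using spectral_integral_quadratic[OF _ w] by (simp add: inner_eq_Re_cinner)
  also have "\<dots> = (LINT x|\<mu> \<phi>. indicator (B n) x * x)" unfolding \<mu>n by (subst integral_density) auto
  also have "\<dots> \<le> (norm \<psi>)\<^sup>2" unfolding n\<psi>
  proof (rule integral_mono_AE)
    show "integrable (\<mu> \<phi>) (\<lambda>x. indicator (B n) x * x)"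
      by (rule integrable_bounded_\<mu>[of _ "real n"]) (auto simp: B_def split: split_indicator)
    show "integrable (\<mu> \<phi>) (\<lambda>x. (sqrt x)\<^sup>2)" by (rule spectral_domain_integrable[OF _ sqd]) simp
    show "AE x in \<mu> \<phi>. indicator (B n) x * x \<le> (sqrt x)\<^sup>2"
      using nn by eventually_elim (auto split: split_indicator)
  qed
  finally have wn: "w \<bullet> \<phi>n \<le> (norm \<psi>)\<^sup>2" .
  define f where "f = \<phi>n + w"
  have R: "resolvent H 1 f = \<phi>n"
    by (rule positive_self_adjoint_resolvent(2)[OF psa]) (use w E(2) in \<open>simp add: f_def\<close>)
  have l1: "((\<lambda>\<epsilon>. resolvent (H\<epsilon> \<epsilon>) 1 f) \<longlongrightarrow> \<phi>n) (at_right 0)" using lim[of f] R by simp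
  have l2: "((\<lambda>\<epsilon>. (f - resolvent (H\<epsilon> \<epsilon>) 1 f) \<bullet> resolvent (H\<epsilon> \<epsilon>) 1 f) \<longlongrightarrow> w \<bullet> \<phi>n) (at_right 0)"
    using tendsto_inner[OF tendsto_diff[OF tendsto_const l1, of f] l1] by (simp add: f_def)
  have "\<forall>\<^sub>F \<epsilon> in at_right 0. dist (resolvent (H\<epsilon> \<epsilon>) 1 f) \<phi>n < e / 3 \<and>
      (f - resolvent (H\<epsilon> \<epsilon>) 1 f) \<bullet> resolvent (H\<epsilon> \<epsilon>) 1 f < w \<bullet> \<phi>n + e / 2 \<and> \<epsilon> > 0"
    using e by (intro eventually_conj tendstoD[OF l1] order_tendstoD(2)[OF l2] eventually_at_right_less) auto
  then obtain \<epsilon> where \<epsilon>: "\<epsilon> > 0" "dist (resolvent (H\<epsilon> \<epsilon>) 1 f) \<phi>n < e / 3"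
      "(f - resolvent (H\<epsilon> \<epsilon>) 1 f) \<bullet> resolvent (H\<epsilon> \<epsilon>) 1 f < w \<bullet> \<phi>n + e / 2"
    using eventually_happens[of _ "at_right (0::real)"] by (metis (mono_tags, lifting) trivial_limit_at_right_real)
  define u where "u = resolvent (H\<epsilon> \<epsilon>) 1 f"
  obtain u' where u': "(u, u') \<in> weak_derivative" "energy 0 u' \<le> (f - u) \<bullet> u"
    using resolvent_energy[OF \<epsilon>(1), of f] unfolding u_def by blast
  have eu: "energy 0 u' < (norm \<psi>)\<^sup>2 + e / 2 + e / 2" using u'(2) \<epsilon>(3) wn e by (simp add: u_def)
  have "\<exists>a b. test_function a \<and> test_function b \<and> norm (u - cemb a b) < 1 / Suc k \<and> norm (u' - cemb (deriv a) (deriv b)) < 1 / Suc k" for k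
    by (rule test_functions_dense_W12[OF u'(1), of "1 / Suc k"]) auto
  then obtain a b where ab: "\<And>k. test_function (a k)" "\<And>k. test_function (b k)"
    "\<And>k. norm (u - cemb (a k) (b k)) < 1 / Suc k" "\<And>k. norm (u' - cemb (deriv (a k)) (deriv (b k))) < 1 / Suc k"
    by metis
  have z: "(\<lambda>k. 1 / real (Suc k)) \<longlonglongrightarrow> 0" by (rule LIMSEQ_Suc[OF lim_1_over_n])
  have t1: "(\<lambda>k. cemb (a k) (b k)) \<longlonglongrightarrow> u"
    by (rule LIM_zero_cancel, rule Lim_null_comparison[OF _ z])
      (use ab(3) in \<open>auto intro!: always_eventually less_imp_le simp: norm_minus_commute\<close>)
  have t2: "(\<lambda>k. cemb (deriv (a k)) (deriv (b k))) \<longlonglongrightarrow> u'"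
    by (rule LIM_zero_cancel, rule Lim_null_comparison[OF _ z])
      (use ab(4) in \<open>auto intro!: always_eventually less_imp_le simp: norm_minus_commute\<close>)
  have "\<forall>\<^sub>F k in sequentially. dist (cemb (a k) (b k)) u < e / 3 \<and> energy 0 (cemb (deriv (a k)) (deriv (b k))) < (norm \<psi>)\<^sup>2 + e"
    using e eu by (intro eventually_conj tendstoD[OF t1] order_tendstoD(2)[OF continuous_energy[OF t2]]) auto
  then obtain k where k: "dist (cemb (a k) (b k)) u < e / 3" "energy 0 (cemb (deriv (a k)) (deriv (b k))) < (norm \<psi>)\<^sup>2 + e"
    by (auto simp: eventually_sequentially)
  have "dist \<phi> (cemb (a k) (b k)) \<le> dist \<phi> \<phi>n + dist \<phi>n u + dist u (cemb (a k) (b k))"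
    by (meson add_right_mono dist_triangle order_trans)
  also have "\<dots> < e" using d1 \<epsilon>(2) k(1) by (simp add: dist_norm norm_minus_commute u_def)
  finally show thesis using that[of "a k" "b k"] ab k(2) by (simp add: dist_norm)
qed

text \<open>For a fixed trial function the extra energy \<open>\<epsilon> * |v'|^2\<close>
  disappears as \<open>\<epsilon>\<close> tends to \<open>0\<close>, however large \<open>v'\<close>
  is; only afterwards is the trial function varied. The outcome \<open>resolvent H 1 f = f\<close>
  means that \<open>H\<close> maps \<open>f\<close> to \<open>0\<close>.\<close>

lemma viscosity_kernel_if_null_energy:
  assumes H: "viscosity_operator c H"
    and approx: "\<And>e. e > 0 \<Longrightarrow> \<exists>v v'. (v, v') \<in> weak_derivative \<and> (norm (f - v))\<^sup>2 + energy 0 v' < e"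
  shows "(f, 0) \<in> H"
proof -
  have psa: "positive_self_adjoint H"
    and lim: "((\<lambda>\<epsilon>. resolvent (H\<epsilon> \<epsilon>) 1 f) \<longlongrightarrow> resolvent H 1 f) (at_right 0)"
    using H by (auto simp: viscosity_operator_def strong_resolvent_limit_def)
  have "(norm (f - resolvent H 1 f))\<^sup>2 \<le> e" if e: "e > 0" for e
  proof -
    obtain v v' where v: "(v, v') \<in> weak_derivative" "(norm (f - v))\<^sup>2 + energy 0 v' < e" using approx[OF e] by blast
    have l: "((\<lambda>\<epsilon>. (norm (f - resolvent (H\<epsilon> \<epsilon>) 1 f))\<^sup>2) \<longlongrightarrow> (norm (f - resolvent H 1 f))\<^sup>2) (at_right 0)"
      by (intro tendsto_intros lim)
    have r: "((\<lambda>\<epsilon>. (norm (f - v))\<^sup>2 + (energy 0 v' + \<epsilon> * (norm v')\<^sup>2) / 2) \<longlongrightarrow> (norm (f - v))\<^sup>2 + (energy 0 v' + 0 * (norm v')\<^sup>2) / 2) (at_right 0)"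
      by (intro tendsto_intros) auto
    have "\<forall>\<^sub>F \<epsilon> in at_right 0. (norm (f - resolvent (H\<epsilon> \<epsilon>) 1 f))\<^sup>2 \<le> (norm (f - v))\<^sup>2 + (energy 0 v' + \<epsilon> * (norm v')\<^sup>2) / 2"
      using eventually_at_right_less[of 0]
    proof eventually_elim
      case (elim \<epsilon>)
      then show ?case using resolvent_variational[OF elim v(1), of f] energy_split[of \<epsilon> v'] by simp
    qed
    from tendsto_le[OF trivial_limit_at_right_real r l this] energy_nonneg[of 0 v'] v(2) show ?thesis by simp
  qed
  then have "(norm (f - resolvent H 1 f))\<^sup>2 \<le> 0" by (rule field_le_epsilon[of _ 0, simplified])
  then have "resolvent H 1 f = f" by simp
  then show ?thesis using positive_self_adjoint_resolvent(1)[OF psa, of f] by simp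
qed

end

subsection \<open>The interval between the two degenerate points is invariant\<close>

lemma coefficient_two_point: "0 \<le> \<delta> \<Longrightarrow> coefficient (two_point_coeff \<delta> x1 x2)"
proof
  show "two_point_coeff \<delta> x1 x2 \<in> borel_measurable borel"
    unfolding two_point_coeff_def Let_def by measurable
  fix x assume d: "0 \<le> \<delta>"
  show "0 \<le> two_point_coeff \<delta> x1 x2 x" by (simp add: two_point_coeff_def Let_def)
  have "r\<^sup>2 / (1 + r\<^sup>2) \<le> 1" for r :: real using zero_le_power2[of r] by (subst divide_le_eq_1) (auto simp: add_pos_nonneg)
  then show "two_point_coeff \<delta> x1 x2 x \<le> 1"
    unfolding two_point_coeff_def Let_def using d by (intro powr_le1) auto
qed

lemma two_point_coeff_le:
  assumes "0 \<le> \<delta>"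
  shows "two_point_coeff \<delta> x1 x2 x \<le> ((x - x1)\<^sup>2) powr \<delta>" "two_point_coeff \<delta> x1 x2 x \<le> ((x - x2)\<^sup>2) powr \<delta>"
proof -
  have *: "r\<^sup>2 / (1 + r\<^sup>2) \<le> r\<^sup>2" for r :: real
    using zero_le_power2[of r] by (simp add: divide_le_eq mult_le_cancel_left1 add_pos_nonneg)
  define r where "r = min \<bar>x - x1\<bar> \<bar>x - x2\<bar>"
  have r: "r\<^sup>2 \<le> (x - x1)\<^sup>2" "r\<^sup>2 \<le> (x - x2)\<^sup>2"
    by (auto simp: r_def abs_le_square_iff[symmetric])
  have e: "two_point_coeff \<delta> x1 x2 x = (r\<^sup>2 / (1 + r\<^sup>2)) powr \<delta>"
    by (simp add: two_point_coeff_def Let_def r_def)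
  show "two_point_coeff \<delta> x1 x2 x \<le> ((x - x1)\<^sup>2) powr \<delta>" "two_point_coeff \<delta> x1 x2 x \<le> ((x - x2)\<^sup>2) powr \<delta>"
    unfolding e using assms by (intro powr_mono2 order_trans[OF * r(1)] order_trans[OF * r(2)] divide_nonneg_nonneg; simp)+
qed

text \<open>\<open>hexp z / z^2\<close> is the derivative of \<open>hexp\<close>. For
  \<open>z \<le> 1\<close> the exponential beats \<open>z^2\<close>; for \<open>z \<ge> 1\<close>
  the derivative is at most \<open>1 / z^2\<close>, and \<open>\<delta> \<le> 1\<close> keeps the
  weight below \<open>z^2\<close>. The right side is a common integrable majorant.\<close>

lemma hexp_deriv_bound:
  assumes \<delta>: "0 < \<delta>" "\<delta> \<le> 1"
  shows "(z\<^sup>2) powr \<delta> * (hexp z / z\<^sup>2)\<^sup>2 \<le> 8 / (1 + z\<^sup>2)"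
proof (cases "z > 0")
  case False
  then show ?thesis by (simp add: hexp_def)
next
  case z: True
  show ?thesis
  proof (cases "z \<le> 1")
    case True
    have "1 + 1 / z + (1 / z)\<^sup>2 / 2 \<le> exp (1 / z)" using z by (intro exp_lower_Taylor_quadratic) auto
    then have "(1 / z)\<^sup>2 / 2 \<le> exp (1 / z)" using z by (smt (verit) divide_nonneg_pos)
    then have "hexp z \<le> 2 * z\<^sup>2" using z by (simp add: hexp_def exp_minus field_simps power2_eq_square)
    then have "hexp z / z\<^sup>2 \<le> 2" using z by (simp add: divide_le_eq)
    then have "(hexp z / z\<^sup>2)\<^sup>2 \<le> 2\<^sup>2" using hexp_bounds(1)[of z] by (intro power_mono) auto
    moreover have "(z\<^sup>2) powr \<delta> \<le> 1" using z True \<delta> by (intro powr_le1) (auto simp: power_le_one)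
    ultimately have "(z\<^sup>2) powr \<delta> * (hexp z / z\<^sup>2)\<^sup>2 \<le> 1 * 2\<^sup>2" by (intro mult_mono) auto
    also have "\<dots> \<le> 8 / (1 + z\<^sup>2)"
    proof -
      have "1 + z\<^sup>2 \<le> 2" using z True by (simp add: power_le_one)
      then have "8 / 2 \<le> 8 / (1 + z\<^sup>2)" by (intro divide_left_mono) (auto simp: add_pos_nonneg)
      then show ?thesis by simp
    qed
    finally show ?thesis .
  next
    case False
    then have z1: "1 \<le> z" "1 \<le> z\<^sup>2" by (auto simp: one_le_power)
    have "(z\<^sup>2) powr \<delta> \<le> (z\<^sup>2) powr 1" using z1 \<delta> by (intro powr_mono) auto
    then have a: "(z\<^sup>2) powr \<delta> \<le> z\<^sup>2" using z by simp
    have "hexp z / z\<^sup>2 \<le> 1 / z\<^sup>2" using hexp_bounds(2)[of z] by (intro divide_right_mono) auto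
    then have "(hexp z / z\<^sup>2)\<^sup>2 \<le> (1 / z\<^sup>2)\<^sup>2" using hexp_bounds(1)[of z] by (intro power_mono) auto
    with a have "(z\<^sup>2) powr \<delta> * (hexp z / z\<^sup>2)\<^sup>2 \<le> z\<^sup>2 * (1 / z\<^sup>2)\<^sup>2" by (intro mult_mono) auto
    also have "\<dots> = 1 / z\<^sup>2" using z by (simp add: power2_eq_square)
    also have "\<dots> = 8 / (8 * z\<^sup>2)" by simp
    also have "\<dots> \<le> 8 / (1 + z\<^sup>2)"
    proof (rule frac_le)
      show "0 < 1 + z\<^sup>2" "1 + z\<^sup>2 \<le> 8 * z\<^sup>2" using z1(2) by linarith+
    qed auto
    finally show ?thesis .
  qed
qed

lemma deriv_bump:
  "deriv (bump a b n) x = real n * (hexp (real n * (x - a)) / (real n * (x - a))\<^sup>2) * hexp (real n * (b - x))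
     - real n * (hexp (real n * (b - x)) / (real n * (b - x))\<^sup>2) * hexp (real n * (x - a))"
proof (rule DERIV_imp_deriv)
  have 1: "((\<lambda>x. hexp (real n * (x - a))) has_real_derivative (hexp (real n * (x - a)) / (real n * (x - a))\<^sup>2) * real n) (at x)"
    by (rule DERIV_chain2[OF hexp_has_derivative]) (auto intro!: derivative_eq_intros)
  have 2: "((\<lambda>x. hexp (real n * (b - x))) has_real_derivative (hexp (real n * (b - x)) / (real n * (b - x))\<^sup>2) * (- real n)) (at x)"
    by (rule DERIV_chain2[OF hexp_has_derivative]) (auto intro!: derivative_eq_intros)
  from DERIV_mult[OF 1 2]
  show "(bump a b n has_real_derivative real n * (hexp (real n * (x - a)) / (real n * (x - a))\<^sup>2) * hexp (real n * (b - x))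
     - real n * (hexp (real n * (b - x)) / (real n * (b - x))\<^sup>2) * hexp (real n * (x - a))) (at x)"
    unfolding bump_def[abs_def] by (rule DERIV_cong) (simp add: algebra_simps)
qed

lemma integrable_inverse_1_plus_sq: "integrable lborel (\<lambda>x::real. 1 / (1 + x\<^sup>2))"
  using integrable_inverse_1_plus_square by (simp add: set_integrable_def einterval_eq inverse_eq_divide)

text \<open>Scaling with \<open>z = n * y\<close> at each end: the weight contributes
  \<open>n powr (- 2 * \<delta>)\<close>, the squared derivative \<open>n^2\<close>, and the length
  element \<open>1 / n\<close>. Altogether this is \<open>n powr (1 - 2 * \<delta>)\<close>. Each
  end point is estimated with its own upper bound for the coefficient from
  \<open>two_point_coeff_le\<close>.\<close>

lemma bump_energy_bound:
  assumes \<delta>: "0 < \<delta>" "\<delta> \<le> 1" and n: "n > 0"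
  shows "(LINT x|lborel. two_point_coeff \<delta> x1 x2 x * (deriv (bump x1 x2 n) x)\<^sup>2)
    \<le> 32 * (LINT x|lborel. 1 / (1 + x\<^sup>2)) * real n powr (1 - 2 * \<delta>)"
proof -
  interpret coefficient "two_point_coeff \<delta> x1 x2" using \<delta> by (intro coefficient_two_point) auto
  define G where "G z = hexp z / z\<^sup>2" for z
  define p where "p = real n powr (2 - 2 * \<delta>)"
  have p0: "p \<ge> 0" by (simp add: p_def)
  define J where "J = (LINT x|lborel. 1 / (1 + x\<^sup>2) :: real)"
  have key: "((y)\<^sup>2) powr \<delta> * (real n * G (real n * y))\<^sup>2 \<le> 8 * p / (1 + (real n * y)\<^sup>2)" for y
  proof -
    have "((real n)\<^sup>2) powr \<delta> = real n powr (2 * \<delta>)"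
      using n by (simp add: powr_powr[symmetric] del: powr_powr)
    then have "(y\<^sup>2) powr \<delta> * (real n powr (2 * \<delta>)) = ((real n * y)\<^sup>2) powr \<delta>"
      by (simp add: power_mult_distrib powr_mult mult.commute)
    moreover have "(real n)\<^sup>2 = real n powr (2 * \<delta>) * p"
      using n unfolding p_def powr_add[symmetric] by simp
    ultimately have "(y\<^sup>2) powr \<delta> * (real n * G (real n * y))\<^sup>2 = p * (((real n * y)\<^sup>2) powr \<delta> * (G (real n * y))\<^sup>2)"
      by (simp add: power_mult_distrib mult_ac)
    also have "\<dots> \<le> p * (8 / (1 + (real n * y)\<^sup>2))"
      unfolding G_def by (intro mult_left_mono hexp_deriv_bound \<delta> p0)
    finally show ?thesis by (simp add: mult.commute)
  qed
  have pt: "two_point_coeff \<delta> x1 x2 x * (deriv (bump x1 x2 n) x)\<^sup>2 \<le>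
     16 * p * (1 / (1 + (- (real n * x1) + real n * x)\<^sup>2)) + 16 * p * (1 / (1 + (real n * x2 + (- real n) * x)\<^sup>2))" for x
  proof -
    define A where "A = real n * G (real n * (x - x1))"
    define B where "B = real n * G (real n * (x2 - x))"
    define a where "a = hexp (real n * (x2 - x))"
    define b where "b = hexp (real n * (x - x1))"
    have ab: "a\<^sup>2 \<le> 1" "b\<^sup>2 \<le> 1" unfolding a_def b_def using hexp_bounds by (auto intro!: power_le_one)
    have d: "deriv (bump x1 x2 n) x = A * a - B * b" by (simp add: deriv_bump A_def B_def a_def b_def G_def)
    have "(A * a - B * b)\<^sup>2 \<le> 2 * (A * a)\<^sup>2 + 2 * (B * b)\<^sup>2"
      using zero_le_power2[of "A * a + B * b"] by (simp add: power2_eq_square algebra_simps)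
    also have "\<dots> \<le> 2 * A\<^sup>2 + 2 * B\<^sup>2"
      using mult_left_mono[OF ab(1), of "A\<^sup>2"] mult_left_mono[OF ab(2), of "B\<^sup>2"] by (simp add: power_mult_distrib)
    finally have "two_point_coeff \<delta> x1 x2 x * (deriv (bump x1 x2 n) x)\<^sup>2 \<le> two_point_coeff \<delta> x1 x2 x * (2 * A\<^sup>2 + 2 * B\<^sup>2)"
      unfolding d using c_nonneg by (intro mult_left_mono)
    also have "\<dots> = 2 * (two_point_coeff \<delta> x1 x2 x * A\<^sup>2) + 2 * (two_point_coeff \<delta> x1 x2 x * B\<^sup>2)" by (simp add: algebra_simps)
    also have "\<dots> \<le> 2 * (((x - x1)\<^sup>2) powr \<delta> * A\<^sup>2) + 2 * (((x2 - x)\<^sup>2) powr \<delta> * B\<^sup>2)"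
      using two_point_coeff_le[of \<delta> x1 x2 x] \<delta>
      by (intro add_mono mult_left_mono mult_right_mono) (auto simp: power2_commute[of x2])
    also have "\<dots> \<le> 2 * (8 * p / (1 + (real n * (x - x1))\<^sup>2)) + 2 * (8 * p / (1 + (real n * (x2 - x))\<^sup>2))"
      unfolding A_def B_def by (intro add_mono mult_left_mono key) auto
    finally show ?thesis by (simp add: right_diff_distrib add.commute)
  qed
  have i: "integrable lborel (\<lambda>x. 1 / (1 + (- (real n * x1) + real n * x)\<^sup>2))"
    "integrable lborel (\<lambda>x. 1 / (1 + (real n * x2 + (- real n) * x)\<^sup>2))"
    using lborel_integrable_real_affine[OF integrable_inverse_1_plus_sq, of "real n" "- (real n * x1)"]
      lborel_integrable_real_affine[OF integrable_inverse_1_plus_sq, of "- real n" "real n * x2"] n by auto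
  have v: "(LINT x|lborel. 1 / (1 + (- (real n * x1) + real n * x)\<^sup>2)) = J / n"
    "(LINT x|lborel. 1 / (1 + (real n * x2 + (- real n) * x)\<^sup>2)) = J / n"
    unfolding J_def
    using lborel_integral_real_affine[of "real n" "\<lambda>x. 1 / (1 + x\<^sup>2)" "- (real n * x1)"]
      lborel_integral_real_affine[of "- real n" "\<lambda>x. 1 / (1 + x\<^sup>2)" "real n * x2"] n by auto
  have tf: "test_function (deriv (bump x1 x2 n))" by (intro test_function_deriv test_function_bump)
  have "(LINT x|lborel. two_point_coeff \<delta> x1 x2 x * (deriv (bump x1 x2 n) x)\<^sup>2)
    \<le> (LINT x|lborel. 16 * p * (1 / (1 + (- (real n * x1) + real n * x)\<^sup>2)) + 16 * p * (1 / (1 + (real n * x2 + (- real n) * x)\<^sup>2)))"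
    by (intro integral_mono pt energy_cemb(3)[OF tf tf] Bochner_Integration.integrable_add integrable_mult_right i)
  also have "\<dots> = 16 * p * (J / n) + 16 * p * (J / n)"
    using i by (simp only: Bochner_Integration.integral_add integrable_mult_right integral_mult_right_zero v)
  also have "\<dots> = 32 * J * (p / real n)" by simp
  also have "p / real n = real n powr (1 - 2 * \<delta>)"
  proof -
    have "p / real n = real n powr (2 - 2 * \<delta>) / real n powr 1" using n by (simp add: p_def)
    also have "\<dots> = real n powr (1 - 2 * \<delta>)" unfolding powr_diff[symmetric] by (simp add: algebra_simps)
    finally show ?thesis .
  qed
  finally show ?thesis by (simp add: J_def)
qed

section \<open>The indicator function of the interval is annihilated by the operator\<close>

definition interval_l2 :: "real \<Rightarrow> real \<Rightarrow> l2" where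
  "interval_l2 a b = l2_abs (\<lambda>x. complex_of_real (indicator {a..b} x))"

lemma bump_tendsto_interval: "(\<lambda>n. (norm (interval_l2 a b - emb (bump a b n)))\<^sup>2) \<longlonglongrightarrow> 0"
proof -
  have [measurable]: "bump a b n \<in> borel_measurable borel" for n
    by (intro borel_measurable_test_function test_function_bump)
  have sq: "square_integrable (\<lambda>x. complex_of_real (indicator {a..b} x) - complex_of_real (bump a b n x))" for n
    by (intro square_integrable_diff square_integrable_indicator_Icc square_integrable_of_real_test_function test_function_bump)
  have e: "(norm (interval_l2 a b - emb (bump a b n)))\<^sup>2 = (LINT x|lborel. (indicator {a..b} x - bump a b n x)\<^sup>2)" for n
  proof -
    have "interval_l2 a b - emb (bump a b n) = l2_abs (\<lambda>x. complex_of_real (indicator {a..b} x) - complex_of_real (bump a b n x))"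
      unfolding interval_l2_def emb_def
      by (intro l2_abs_diff square_integrable_indicator_Icc square_integrable_of_real_test_function test_function_bump)
    then show ?thesis using norm_l2_abs_sq[OF sq[of n]] by (simp flip: of_real_diff)
  qed
  have "(\<lambda>n. LINT x|lborel. (indicator {a..b} x - bump a b n x)\<^sup>2) \<longlonglongrightarrow> (LINT x|(lborel :: real measure). (0::real))"
  proof (rule integral_dominated_convergence[where w = "indicator {a..b}"])
    show "integrable lborel (indicat_real {a..b})" by (auto intro!: integrable_real_indicator simp: emeasure_lborel_Icc_eq)
    show "AE x in lborel. (\<lambda>n. (indicator {a..b} x - bump a b n x)\<^sup>2) \<longlonglongrightarrow> 0"
      using AE_not_point[of a] AE_not_point[of b]
    proof eventually_elim
      case (elim x)
      have "(\<lambda>n. (indicator {a..b} x - bump a b n x)\<^sup>2) \<longlonglongrightarrow> (indicator {a..b} x - indicator {a<..<b} x)\<^sup>2"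
        by (intro tendsto_intros bump_tendsto)
      moreover have "(indicator {a..b} x - indicator {a<..<b} x)\<^sup>2 = (0::real)" using elim by (auto split: split_indicator)
      ultimately show ?case by simp
    qed
    show "AE x in lborel. norm ((indicator {a..b} x - bump a b n x)\<^sup>2) \<le> indicator {a..b} x" for n
    proof (intro AE_I2)
      fix x
      show "norm ((indicator {a..b} x - bump a b n x)\<^sup>2) \<le> indicator {a..b} x"
        using bump_bounds[of a b n x] bump_eq_0[of x a b n]
        by (cases "x \<in> {a..b}") (auto simp: abs_square_le_1)
    qed
  qed measurable
  then show ?thesis unfolding e by simp
qed

lemma cemb_zero: "cemb a (\<lambda>x. 0) = emb a"
  by (simp add: cemb_def) (simp add: emb_def zero_l2_def[symmetric])

lemma interval_in_kernel:
  assumes \<delta>: "1 / 2 < \<delta>" "\<delta> < 1" and H: "viscosity_operator (two_point_coeff \<delta> x1 x2) H"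
  shows "(interval_l2 x1 x2, 0) \<in> H"
proof -
  interpret coefficient "two_point_coeff \<delta> x1 x2" using \<delta> by (intro coefficient_two_point) auto
  show ?thesis
  proof (rule viscosity_kernel_if_null_energy[OF H])
    fix e :: real assume e: "e > 0"
    define C where "C = 32 * (LINT x|lborel. 1 / (1 + x\<^sup>2) :: real)"
    \<comment> \<open>The assumption \<open>1 / 2 < \<delta>\<close> makes the exponent negative:
      the energy cost of cutting at a degenerate point tends to zero.\<close>
    have "(\<lambda>n. real n powr (1 - 2 * \<delta>)) \<longlonglongrightarrow> 0"
      using \<delta> by (intro tendsto_neg_powr filterlim_real_sequentially) auto
    then have "(\<lambda>n. (norm (interval_l2 x1 x2 - emb (bump x1 x2 n)))\<^sup>2 + C * real n powr (1 - 2 * \<delta>)) \<longlonglongrightarrow> 0 + C * 0"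
      by (intro tendsto_intros bump_tendsto_interval)
    then have "\<forall>\<^sub>F n in sequentially. (norm (interval_l2 x1 x2 - emb (bump x1 x2 n)))\<^sup>2 + C * real n powr (1 - 2 * \<delta>) < e \<and> n > 0"
      using e by (intro eventually_conj order_tendstoD(2) eventually_gt_at_top) auto
    then obtain n where n: "(norm (interval_l2 x1 x2 - emb (bump x1 x2 n)))\<^sup>2 + C * real n powr (1 - 2 * \<delta>) < e" "n > 0"
      by (auto simp: eventually_sequentially)
    have tf: "test_function (deriv (bump x1 x2 n))" by (intro test_function_deriv test_function_bump)
    have "energy 0 (emb (deriv (bump x1 x2 n))) = (LINT x|lborel. two_point_coeff \<delta> x1 x2 x * (deriv (bump x1 x2 n) x)\<^sup>2)"
      using energy_cemb(1)[OF tf test_function_zero] by (simp add: cemb_zero)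
    also have "\<dots> \<le> C * real n powr (1 - 2 * \<delta>)"
      unfolding C_def by (rule bump_energy_bound) (use \<delta> n in auto)
    finally have "(norm (interval_l2 x1 x2 - emb (bump x1 x2 n)))\<^sup>2 + energy 0 (emb (deriv (bump x1 x2 n))) < e"
      using n by simp
    then show "\<exists>v v'. (v, v') \<in> weak_derivative \<and> (norm (interval_l2 x1 x2 - v))\<^sup>2 + energy 0 v' < e"
      using emb_weak_derivative[OF test_function_bump] by blast
  qed
qed

text \<open>The semigroup fixes the indicator function by \<open>spectral_integral_kernel\<close>,
  because \<open>exp (- t * 0) = 1\<close>. Evaluating the kernel representation at it gives the
  mass of each row over the interval; this one identity carries all three negative results.\<close>

lemma kernel_on_interval:
  assumes \<delta>: "1 / 2 < \<delta>" "\<delta> < 1" and H: "viscosity_operator (two_point_coeff \<delta> x1 x2) H"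
    and K: "bounded_kernel_of (semigroup_of H t) k"
  shows "AE x in lborel. integrable lborel (\<lambda>y. k x y * indicator {x1..x2} y) \<and>
    (LINT y|lborel. k x y * indicator {x1..x2} y) = indicator {x1..x2} x"
proof -
  let ?f = "interval_l2 x1 x2"
  have f: "AE x in lborel. l2_rep ?f x = complex_of_real (indicator {x1..x2} x)"
    unfolding interval_l2_def by (rule l2_rep_abs_AE[OF square_integrable_indicator_Icc])
  have km: "(\<lambda>(x, y). k x y) \<in> borel_measurable (lborel \<Otimes>\<^sub>M lborel)"
    using K by (simp add: bounded_kernel_of_def)
  have kx [measurable]: "k x \<in> borel_measurable borel" for x
    using measurable_Pair2[OF km, of x] by simp
  obtain \<psi> where \<psi>: "(?f, \<psi>) \<in> semigroup_of H t" and ae: "AE x in lborel. integrable lborel (\<lambda>y. k x y *\<^sub>R l2_rep ?f y) \<and>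
           l2_rep \<psi> x = (LINT y|lborel. k x y *\<^sub>R l2_rep ?f y)"
    using K unfolding bounded_kernel_of_def by blast
  obtain E where E: "projection_valued_measure E" "spectral_integral E (\<lambda>s. s) = H"
    "(?f, \<psi>) \<in> spectral_integral E (\<lambda>s. exp (- t * s))"
    using \<psi> by (auto simp: semigroup_of_def function_of_operator_def)
  interpret pvm E by unfold_locales (rule E(1))
  have "\<psi> = ?f"
    by (rule spectral_integral_kernel[OF _ _ _ E(3)]) (use interval_in_kernel[OF \<delta> H] E(2) in auto)
  then have "AE x in lborel. integrable lborel (\<lambda>y. k x y *\<^sub>R l2_rep ?f y) \<and>
           l2_rep ?f x = (LINT y|lborel. k x y *\<^sub>R l2_rep ?f y)" using ae by simp
  then show ?thesis using f
  proof eventually_elim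
    case (elim x)
    have c: "AE y in lborel. k x y *\<^sub>R l2_rep ?f y = complex_of_real (k x y * indicator {x1..x2} y)"
      using f by eventually_elim (simp add: scaleR_conv_of_real)
    have i: "integrable lborel (\<lambda>y. complex_of_real (k x y * indicator {x1..x2} y))"
      using elim(1) integrable_cong_AE[OF _ _ c] by simp
    have "complex_of_real (indicator {x1..x2} x) = (LINT y|lborel. complex_of_real (k x y * indicator {x1..x2} y))"
      using elim integral_cong_AE[OF _ _ c] by simp
    then have "indicator {x1..x2} x = (LINT y|lborel. k x y * indicator {x1..x2} y)"
      unfolding integral_complex_of_real of_real_eq_iff .
    moreover have "integrable lborel (\<lambda>y. k x y * indicator {x1..x2} y)"
      using i by (simp only: complex_of_real_integrable_eq)
    ultimately show ?case by simp
  qed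
qed

section \<open>Consequences for size and sign of the kernel\<close>

lemma not_AE_notin_Icc: "a < b \<Longrightarrow> \<not> (AE x in lborel. x \<notin> {a..b :: real})"
proof
  assume ab: "a < b" and "AE x in lborel. x \<notin> {a..b}"
  then have "emeasure lborel {a..b} = 0" by (subst (asm) AE_iff_measurable[of "{a..b}"]) auto
  with ab show False by simp
qed

text \<open>For almost every \<open>x\<close> in the interval, mass \<open>1\<close> has to fit into
  length \<open>x2 - x1\<close> under the height \<open>m\<close>. The one-sided bound makes this
  applicable to the supremum norm and to a Gaussian majorant alike.\<close>

lemma kernel_upper_bound:
  fixes k :: "real \<Rightarrow> real \<Rightarrow> real"
  assumes L: "x1 < x2" and k: "AE x in lborel. integrable lborel (\<lambda>y. k x y * indicator {x1..x2} y) \<and>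
    (LINT y|lborel. k x y * indicator {x1..x2} y) = indicator {x1..x2} x"
    and m: "AE (x, y) in lborel \<Otimes>\<^sub>M lborel. k x y \<le> m"
  shows "1 \<le> m * (x2 - x1)"
proof (rule ccontr)
  assume n: "\<not> 1 \<le> m * (x2 - x1)"
  have "AE x in lborel. AE y in lborel. k x y \<le> m"
    using lborel_pair.AE_pair[OF m] by simp
  with k have "AE x in lborel. x \<notin> {x1..x2}"
  proof eventually_elim
    case (elim x)
    show ?case
    proof
      assume x: "x \<in> {x1..x2}"
      have "1 = (LINT y|lborel. k x y * indicator {x1..x2} y)" using elim x by simp
      also have "\<dots> \<le> (LINT y|lborel. m * indicator {x1..x2} y)"
      proof (rule integral_mono_AE)
        show "AE y in lborel. k x y * indicator {x1..x2} y \<le> m * indicator {x1..x2} y"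
          using elim(2) by eventually_elim (auto split: split_indicator)
      qed (use elim in \<open>auto intro!: integrable_real_indicator simp: emeasure_lborel_Icc_eq\<close>)
      also have "\<dots> = m * (x2 - x1)" using L by simp
      finally show False using n by simp
    qed
  qed
  with not_AE_notin_Icc[OF L] show False by simp
qed

lemma kernel_sup_norm_bound:
  fixes k :: "real \<Rightarrow> real \<Rightarrow> real"
  assumes L: "x1 < x2" and k: "AE x in lborel. integrable lborel (\<lambda>y. k x y * indicator {x1..x2} y) \<and>
    (LINT y|lborel. k x y * indicator {x1..x2} y) = indicator {x1..x2} x"
    and km: "(\<lambda>(x, y). k x y) \<in> borel_measurable (lborel \<Otimes>\<^sub>M lborel)"
  shows "ereal (inverse (x2 - x1)) \<le> kernel_sup_norm k"
proof (rule ccontr)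
  assume "\<not> ?thesis"
  then have "kernel_sup_norm k < ereal (inverse (x2 - x1))" by simp
  then obtain m where m: "kernel_sup_norm k < ereal m" "ereal m < ereal (inverse (x2 - x1))"
    using ereal_dense2 by blast
  have "AE p in lborel \<Otimes>\<^sub>M lborel. (\<lambda>(x, y). ereal \<bar>k x y\<bar>) p \<le> kernel_sup_norm k"
    unfolding kernel_sup_norm_def by (rule esssup_AE)
  then have "AE (x, y) in lborel \<Otimes>\<^sub>M lborel. k x y \<le> m"
  proof eventually_elim
    case (elim p)
    then have "(\<lambda>(x, y). ereal \<bar>k x y\<bar>) p < ereal m" using m(1) by (rule le_less_trans)
    then show ?case by (auto split: prod.splits)
  qed
  from kernel_upper_bound[OF L k this] m(2) L show False by (simp add: field_simps)
qed

lemma kernel_not_positive: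
  fixes k :: "real \<Rightarrow> real \<Rightarrow> real"
  assumes L: "x1 < x2" and k: "AE x in lborel. integrable lborel (\<lambda>y. k x y * indicator {x1..x2} y) \<and>
    (LINT y|lborel. k x y * indicator {x1..x2} y) = indicator {x1..x2} x"
  shows "\<not> (AE (x, y) in lborel \<Otimes>\<^sub>M lborel. 0 < k x y)"
proof
  assume p: "AE (x, y) in lborel \<Otimes>\<^sub>M lborel. 0 < k x y"
  have "AE x in lborel. AE y in lborel. 0 < k x y"
    using lborel_pair.AE_pair[OF p] by simp
  \<comment> \<open>Any set of positive measure off the interval would do. There the row has
    integral \<open>0\<close> over the interval, so positivity would force the interval itself to be
    a null set.\<close>
  with k have "AE x in lborel. x \<notin> {x2 + 1..x2 + 2}"
  proof eventually_elim
    case (elim x)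
    show ?case
    proof
      assume x: "x \<in> {x2 + 1..x2 + 2}"
      then have "(LINT y|lborel. k x y * indicator {x1..x2} y) = 0" using elim(1) by simp
      moreover have "AE y in lborel. 0 \<le> k x y * indicator {x1..x2} y"
        using elim(2) by eventually_elim (auto split: split_indicator)
      ultimately have "AE y in lborel. k x y * indicator {x1..x2} y = 0"
        using elim(1) by (subst (asm) integral_nonneg_eq_0_iff_AE) auto
      with elim(2) have "AE y in lborel. y \<notin> {x1..x2}"
        by eventually_elim (auto split: split_indicator_asm)
      with not_AE_notin_Icc[OF L] show False by simp
    qed
  qed
  with not_AE_notin_Icc[of "x2 + 1" "x2 + 2"] show False by simp
qed

lemma no_inverse_sqrt_bound:
  assumes L: "0 < L" and a: "0 < a"
  obtains t where "t \<ge> 1" "a * t powr (- 1 / 2) * L < (1::real)"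
proof
  \<comment> \<open>Chosen so that \<open>sqrt t = 1 + a * L\<close> exceeds both \<open>1\<close>
    and \<open>a * L\<close>.\<close>
  define t where "t = (1 + a * L)\<^sup>2"
  have p: "1 < 1 + a * L" using L a by simp
  show "t \<ge> 1" unfolding t_def using p by (simp add: one_le_power)
  have "t powr (- 1 / 2) = 1 / (1 + a * L)"
    using p unfolding t_def by (simp add: powr_minus_divide powr_half_sqrt real_sqrt_abs)
  then have "a * t powr (- 1 / 2) * L = (a * L) / (1 + a * L)" by simp
  also have "\<dots> < 1" using p by (simp add: divide_less_eq)
  finally show "a * t powr (- 1 / 2) * L < 1" .
qed

subsection \<open>Geometric sums over dyadic scales\<close>

text \<open>\<open>v / (1 + v)^2\<close> is at most a constant times the increment of
  \<open>v / (1 + v)\<close> from \<open>v\<close> to \<open>b * v\<close>. The sum along the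
  geometric sequence therefore telescopes, with a bound independent of \<open>w\<close> and
  \<open>N\<close>; it is the discrete form of integrating the derivative of a bounded
  function.\<close>

lemma sum_telescope_bound:
  fixes b w :: real
  assumes b: "b > 1" and w: "w \<ge> 0"
  shows "(\<Sum>k\<le>N. b ^ k * w / (1 + b ^ k * w)\<^sup>2) \<le> b / (b - 1)"
proof -
  define G where "G v = v / (1 + v)" for v :: real
  have step: "v / (1 + v)\<^sup>2 \<le> b / (b - 1) * (G (b * v) - G v)" if v: "v \<ge> 0" for v
  proof -
    have pos: "0 < 1 + v" "0 < 1 + b * v" using v b by (auto intro: add_pos_nonneg)
    have e: "G (b * v) - G v = (b - 1) * v / ((1 + b * v) * (1 + v))"
      using pos by (simp add: G_def diff_frac_eq algebra_simps)
    have "(b - 1) * v / (b * (1 + v) * (1 + v)) \<le> (b - 1) * v / ((1 + b * v) * (1 + v))"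
    proof (intro divide_left_mono mult_right_mono mult_pos_pos)
      show "1 + b * v \<le> b * (1 + v)" using b by (simp add: algebra_simps)
    qed (use pos b v in auto)
    then have "b / (b - 1) * ((b - 1) * v / (b * (1 + v) * (1 + v))) \<le> b / (b - 1) * (G (b * v) - G v)"
      unfolding e using b by (intro mult_left_mono) auto
    moreover have "b / (b - 1) * ((b - 1) * v / (b * (1 + v) * (1 + v))) = v / (1 + v)\<^sup>2"
      using b pos by (simp add: power2_eq_square)
    ultimately show ?thesis by simp
  qed
  have "(\<Sum>k\<le>N. b ^ k * w / (1 + b ^ k * w)\<^sup>2) \<le> (\<Sum>k\<le>N. b / (b - 1) * (G (b ^ Suc k * w) - G (b ^ k * w)))"
    using step[of "b ^ k * w" for k] b w by (intro sum_mono) (simp add: mult.assoc)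
  also have "\<dots> = b / (b - 1) * (\<Sum>k\<le>N. G (b ^ Suc k * w) - G (b ^ k * w))" by (simp add: sum_distrib_left)
  also have "(\<Sum>k\<le>N. G (b ^ Suc k * w) - G (b ^ k * w)) = G (b ^ Suc N * w) - G (b ^ 0 * w)"
    by (induction N) simp_all
  also have "b / (b - 1) * \<dots> \<le> b / (b - 1) * 1"
  proof (intro mult_left_mono)
    have "b ^ Suc N * w \<ge> 0" using b w by simp
    then have "G (b ^ Suc N * w) \<le> 1" unfolding G_def by (subst divide_le_eq_1) auto
    moreover have "G (b ^ 0 * w) \<ge> 0" using w by (simp add: G_def)
    ultimately show "G (b ^ Suc N * w) - G (b ^ 0 * w) \<le> 1" by linarith
  qed (use b in auto)
  finally show ?thesis by simp
qed

lemma four_powr: "(4 ^ k :: real) powr s = (4 powr s) ^ k"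
  by (simp add: powr_realpow[symmetric] powr_powr mult.commute powr_power)

lemma four_powr_gt_1: "s > 0 \<Longrightarrow> (4::real) powr s > 1"
  by simp

lemma powr_le_1_plus: "0 \<le> s \<Longrightarrow> s \<le> 1 \<Longrightarrow> 0 \<le> z \<Longrightarrow> z powr s \<le> 1 + (z :: real)"
proof (cases "z \<le> 1")
  case False
  assume "s \<le> 1"
  then have "z powr s \<le> z powr 1" using False by (intro powr_mono) auto
  then show ?thesis using False by simp
next
  case True
  assume "0 \<le> s" "0 \<le> z"
  then have "z powr s \<le> 1" using True by (intro powr_le1) auto
  then show ?thesis using \<open>0 \<le> z\<close> by linarith
qed

lemma square_ratio_le:
  fixes A B C m :: real
  assumes "0 < A" "0 < B" "0 \<le> C" "C * B \<le> m * A"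
  shows "C\<^sup>2 / A\<^sup>2 \<le> m\<^sup>2 / B\<^sup>2"
proof -
  have "C / A \<le> m / B" using assms by (simp add: divide_le_eq le_divide_eq mult_ac)
  then have "(C / A)\<^sup>2 \<le> (m / B)\<^sup>2" using assms by (intro power_mono) auto
  then show ?thesis by (simp add: power_divide)
qed

text \<open>The terms grow like \<open>4 powr (k * s)\<close> as long as
  \<open>4 ^ k * y^2 \<le> 1\<close> and decay afterwards, so the sum is about
  \<open>(y^2) powr (- s)\<close>. Cutting at \<open>k \<le> N\<close> permits the regularised
  weight with \<open>1 / 4 ^ N\<close> added, which stays finite at \<open>y = 0\<close> and is the
  one treated by the Hardy inequality.\<close>

lemma dyadic_sum_far:
  fixes s y :: real
  assumes s: "0 < s" "s \<le> 1"
  shows "(\<Sum>k\<le>N. (4 ^ k) powr s * ((1 / 4 ^ k) / (y\<^sup>2 + 1 / 4 ^ k))\<^sup>2) \<le>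
    16 * (4 powr s / (4 powr s - 1)) * (y\<^sup>2 + 1 / 4 ^ N) powr (- s)"
proof -
  define Y where "Y = y\<^sup>2 + 1 / 4 ^ N"
  have Y: "Y > 0" unfolding Y_def by (simp add: add_nonneg_pos)
  define w where "w = Y powr s"
  have w: "w > 0" using Y by (simp add: w_def)
  have "(4 ^ k) powr s * ((1 / 4 ^ k) / (y\<^sup>2 + 1 / 4 ^ k))\<^sup>2 \<le> 16 * Y powr (- s) * ((4 powr s) ^ k * w / (1 + (4 powr s) ^ k * w)\<^sup>2)"
    if k: "k \<le> N" for k
  proof -
    \<comment> \<open>For \<open>k \<le> N\<close> the regularisation adds at most \<open>1\<close>
      to \<open>4 ^ k * y^2\<close>, so \<open>1 + v powr s\<close> is at most
      \<open>4 * (1 + 4 ^ k * y^2)\<close>; squaring gives the factor \<open>16\<close>, and the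
      terms in \<open>v powr s\<close> telescope.\<close>
    define v where "v = 4 ^ k * Y"
    have v: "v > 0" using Y by (simp add: v_def)
    have vs: "(4 powr s) ^ k * w = v powr s" using Y by (simp add: v_def w_def powr_mult four_powr)
    have p: "0 < 1 + 4 ^ k * y\<^sup>2" by (simp add: add_pos_nonneg)
    have "(4::real) ^ k / 4 ^ N \<le> 1" using k by (simp add: power_increasing)
    moreover have "v = 4 ^ k * y\<^sup>2 + 4 ^ k / 4 ^ N" by (simp add: v_def Y_def distrib_left)
    moreover have "0 \<le> 4 ^ k * y\<^sup>2" by simp
    moreover have "q \<le> 1 \<Longrightarrow> v = p + q \<Longrightarrow> 0 \<le> p \<Longrightarrow> 1 + v \<le> 2 * (1 + p)" for p q :: real by (simp add: distrib_left)
    ultimately have "1 + v \<le> 2 * (1 + 4 ^ k * y\<^sup>2)" by blast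
    moreover have "1 + v powr s \<le> 2 * (1 + v)" using powr_le_1_plus[of s v] s v by simp
    ultimately have "1 + v powr s \<le> 4 * (1 + 4 ^ k * y\<^sup>2)" by argo
    then have le: "1 / (1 + 4 ^ k * y\<^sup>2)\<^sup>2 \<le> 16 / (1 + v powr s)\<^sup>2"
      using square_ratio_le[of "1 + 4 ^ k * y\<^sup>2" "1 + v powr s" 1 4] p by (simp add: add_pos_nonneg)
    have "(1 / 4 ^ k) / (y\<^sup>2 + 1 / 4 ^ k) = 1 / (1 + 4 ^ k * y\<^sup>2)" by (simp add: field_simps)
    then have "(4 ^ k) powr s * ((1 / 4 ^ k) / (y\<^sup>2 + 1 / 4 ^ k))\<^sup>2 = (4 powr s) ^ k * (1 / (1 + 4 ^ k * y\<^sup>2)\<^sup>2)"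
      by (simp add: four_powr power_divide)
    also have "\<dots> \<le> (4 powr s) ^ k * (16 / (1 + v powr s)\<^sup>2)" by (intro mult_left_mono le) auto
    also have "\<dots> = 16 * Y powr (- s) * ((4 powr s) ^ k * w / (1 + v powr s)\<^sup>2)"
      using w by (simp add: w_def powr_minus)
    finally show ?thesis by (simp add: vs)
  qed
  then have "(\<Sum>k\<le>N. (4 ^ k) powr s * ((1 / 4 ^ k) / (y\<^sup>2 + 1 / 4 ^ k))\<^sup>2)
    \<le> (\<Sum>k\<le>N. 16 * Y powr (- s) * ((4 powr s) ^ k * w / (1 + (4 powr s) ^ k * w)\<^sup>2))"
    by (intro sum_mono) auto
  also have "\<dots> = 16 * Y powr (- s) * (\<Sum>k\<le>N. (4 powr s) ^ k * w / (1 + (4 powr s) ^ k * w)\<^sup>2)"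
    by (simp add: sum_distrib_left)
  also have "\<dots> \<le> 16 * Y powr (- s) * (4 powr s / (4 powr s - 1))"
    using four_powr_gt_1[OF s(1)] w by (intro mult_left_mono sum_telescope_bound) auto
  finally show ?thesis by (simp add: Y_def mult_ac)
qed

text \<open>The weight times the price of a derivative is \<open>4 powr (- k * \<delta>)\<close>,
  and the ramp suppresses the scales larger than \<open>\<bar>y\<bar>\<close>. For
  \<open>\<bar>y\<bar> \<le> 1\<close> the dominant scale is \<open>\<bar>y\<bar>\<close> itself,
  giving \<open>(y^2) powr \<delta>\<close>; for larger \<open>\<bar>y\<bar>\<close> the geometric
  series gives a constant. Both regimes are comparable to the coefficient.\<close>

lemma dyadic_sum_near:
  fixes \<delta> y :: real
  assumes d: "0 < \<delta>" "\<delta> \<le> 1"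
  shows "(\<Sum>k\<le>N. (4 ^ k) powr (1 - \<delta>) * (1 / 4 ^ k) * (y\<^sup>2 / (y\<^sup>2 + 1 / 4 ^ k))\<^sup>2) \<le>
    8 * (4 powr \<delta> / (4 powr \<delta> - 1)) * (y\<^sup>2 / (1 + y\<^sup>2)) powr \<delta>"
proof (cases "y = 0")
  case True
  then show ?thesis by simp
next
  case False
  define b where "b = 4 powr \<delta>"
  have b: "b > 1" using four_powr_gt_1[OF d(1)] by (simp add: b_def)
  have y: "y\<^sup>2 > 0" using False by simp
  define w where "w = (y\<^sup>2) powr \<delta>"
  have w: "w > 0" using y by (simp add: w_def)
  define c where "c = (y\<^sup>2 / (1 + y\<^sup>2)) powr \<delta>"
  define T where "T k = (4 ^ k) powr (1 - \<delta>) * (1 / 4 ^ k) * (y\<^sup>2 / (y\<^sup>2 + 1 / 4 ^ k))\<^sup>2" for k :: nat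
  have T: "T k = (1 / b) ^ k * (4 ^ k * y\<^sup>2 / (1 + 4 ^ k * y\<^sup>2))\<^sup>2" for k
  proof -
    have "y\<^sup>2 / (y\<^sup>2 + 1 / 4 ^ k) = 4 ^ k * y\<^sup>2 / (1 + 4 ^ k * y\<^sup>2)" using y by (simp add: field_simps)
    moreover have "(4 ^ k) powr (1 - \<delta>) * (1 / 4 ^ k) = (1 / b) ^ k"
      by (simp add: powr_diff b_def four_powr power_divide)
    ultimately show ?thesis by (simp add: T_def)
  qed
  have 1: "(\<Sum>k\<le>N. T k) \<le> 4 * (b / (b - 1)) * w"
  proof -
    have "T k \<le> 4 * w * (b ^ k * w / (1 + b ^ k * w)\<^sup>2)" for k
    proof -
      define v where "v = 4 ^ k * y\<^sup>2"
      have v: "v > 0" using y by (simp add: v_def)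
      have vd: "v powr \<delta> = b ^ k * w" using y by (simp add: v_def w_def b_def powr_mult four_powr)
      \<comment> \<open>Writing \<open>v = v powr (1 - \<delta>) * v powr \<delta>\<close> trades
        the ratio \<open>v / (1 + v)\<close> for one in \<open>v powr \<delta> = b ^ k * w\<close>,
        which is the telescoping form.\<close>
      have "v powr (1 - \<delta>) \<le> 1 + v" using d v by (intro powr_le_1_plus) auto
      moreover have "v powr (1 - \<delta>) * v powr \<delta> = v" using v by (simp add: powr_add[symmetric])
      ultimately have "v powr (1 - \<delta>) * (1 + v powr \<delta>) \<le> 2 * (1 + v)" using v by (simp add: distrib_left)
      then have "(v powr (1 - \<delta>))\<^sup>2 / (1 + v)\<^sup>2 \<le> 4 / (1 + v powr \<delta>)\<^sup>2"
        using square_ratio_le[of "1 + v" "1 + v powr \<delta>" "v powr (1 - \<delta>)" 2] v by (simp add: add_pos_nonneg)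
      then have le: "(v powr \<delta>)\<^sup>2 * ((v powr (1 - \<delta>))\<^sup>2 / (1 + v)\<^sup>2) \<le> (v powr \<delta>)\<^sup>2 * (4 / (1 + v powr \<delta>)\<^sup>2)"
        by (intro mult_left_mono) auto
      have "T k = (1 / b) ^ k * (v / (1 + v))\<^sup>2" by (simp add: T v_def)
      also have "(v / (1 + v))\<^sup>2 = (v powr \<delta>)\<^sup>2 * ((v powr (1 - \<delta>))\<^sup>2 / (1 + v)\<^sup>2)"
        using v by (simp add: power_divide power_mult_distrib[symmetric] powr_add[symmetric])
      also have "(1 / b) ^ k * \<dots> \<le> (1 / b) ^ k * ((v powr \<delta>)\<^sup>2 * (4 / (1 + v powr \<delta>)\<^sup>2))"
        using b by (intro mult_left_mono le) auto
      also have "\<dots> = 4 * w * (b ^ k * w / (1 + b ^ k * w)\<^sup>2)"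
        unfolding vd using b by (simp add: power_divide power2_eq_square)
      finally show ?thesis .
    qed
    then have "(\<Sum>k\<le>N. T k) \<le> (\<Sum>k\<le>N. 4 * w * (b ^ k * w / (1 + b ^ k * w)\<^sup>2))" by (intro sum_mono)
    also have "\<dots> = 4 * w * (\<Sum>k\<le>N. b ^ k * w / (1 + b ^ k * w)\<^sup>2)" by (simp add: sum_distrib_left)
    also have "\<dots> \<le> 4 * w * (b / (b - 1))" using w b by (intro mult_left_mono sum_telescope_bound) auto
    finally show ?thesis by (simp add: mult_ac)
  qed
  have 2: "(\<Sum>k\<le>N. T k) \<le> b / (b - 1)"
  proof -
    have "T k \<le> (1 / b) ^ k" for k
    proof -
      have "0 \<le> 4 ^ k * y\<^sup>2 / (1 + 4 ^ k * y\<^sup>2)" "4 ^ k * y\<^sup>2 / (1 + 4 ^ k * y\<^sup>2) \<le> 1"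
        using y by (auto simp: divide_le_eq_1 add_pos_nonneg)
      then have "(4 ^ k * y\<^sup>2 / (1 + 4 ^ k * y\<^sup>2))\<^sup>2 \<le> 1" by (intro power_le_one)
      then show ?thesis unfolding T using b by (intro mult_left_le) auto
    qed
    then have "(\<Sum>k\<le>N. T k) \<le> (\<Sum>k\<le>N. (1 / b) ^ k)" by (intro sum_mono)
    also have "\<dots> \<le> (\<Sum>k. (1 / b) ^ k)" using b by (intro sum_le_suminf summable_geometric) auto
    also have "\<dots> = b / (b - 1)" using b by (subst suminf_geometric) (auto simp: field_simps)
    finally show ?thesis .
  qed
  have bb: "0 \<le> b / (b - 1)" using b by simp
  have two: "2 powr \<delta> \<le> (2::real)" using powr_mono[of \<delta> 1 "2::real"] d by simp
  have c0: "c \<ge> 0" by (simp add: c_def)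
  have dp: "0 < 1 + y\<^sup>2" using y by linarith
  have "(\<Sum>k\<le>N. T k) \<le> 8 * (b / (b - 1)) * c"
  proof (cases "y\<^sup>2 \<le> 1")
    case True
    have "y\<^sup>2 * (1 + y\<^sup>2) \<le> y\<^sup>2 * 2" using True by (intro mult_left_mono) auto
    then have "y\<^sup>2 \<le> y\<^sup>2 * 2 / (1 + y\<^sup>2)" using dp by (simp only: pos_le_divide_eq)
    then have "y\<^sup>2 \<le> 2 * (y\<^sup>2 / (1 + y\<^sup>2))" by (simp only: times_divide_eq_right mult.commute)
    then have "w \<le> (2 * (y\<^sup>2 / (1 + y\<^sup>2))) powr \<delta>" unfolding w_def using d y by (intro powr_mono2) auto
    also have "\<dots> = 2 powr \<delta> * c" unfolding c_def using y dp by (intro powr_mult)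
    also have "\<dots> \<le> 2 * c" using two c0 by (intro mult_right_mono)
    finally have "4 * (b / (b - 1)) * w \<le> 4 * (b / (b - 1)) * (2 * c)" using bb by (intro mult_left_mono) auto
    with 1 show ?thesis by simp
  next
    case False
    have "1 \<le> 2 * (y\<^sup>2 / (1 + y\<^sup>2))" using False dp by (simp add: le_divide_eq)
    then have "1 powr \<delta> \<le> (2 * (y\<^sup>2 / (1 + y\<^sup>2))) powr \<delta>" using d by (intro powr_mono2) auto
    also have "\<dots> = 2 powr \<delta> * c" unfolding c_def using y dp by (intro powr_mult)
    also have "\<dots> \<le> 2 * c" using two c0 by (intro mult_right_mono)
    finally have "1 \<le> 2 * c" by simp
    then have "b / (b - 1) * 1 \<le> b / (b - 1) * (8 * c)" using bb c0 by (intro mult_left_mono) auto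
    with 2 show ?thesis by (simp add: mult_ac)
  qed
  then show ?thesis by (simp add: T_def b_def c_def)
qed

subsection \<open>A Hardy inequality\<close>

text \<open>The vector field \<open>w\<close> equals \<open>y * (y\<^sup>2 + e) powr (- s)\<close> near the first degenerate point; the
  factor \<open>\<kappa>\<close> makes \<open>w\<^sup>2\<close> vanish at the second one and at infinity.\<close>

lemma kappa_weight_bound:
  fixes a b :: real
  assumes d: "0 < \<delta>" "\<delta> \<le> 1" and L: "\<bar>b - a\<bar> \<le> L" 
  shows "b\<^sup>2 / (1 + a\<^sup>2)\<^sup>2 * (a\<^sup>2) powr \<delta> \<le> (2 + 2 * L\<^sup>2) * (let r = min \<bar>a\<bar> \<bar>b\<bar> in (r\<^sup>2 / (1 + r\<^sup>2)) powr \<delta>)"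
proof -
  have L0: "L \<ge> 0" using L by linarith
  have pa: "0 < 1 + a\<^sup>2" and pb: "0 < 1 + b\<^sup>2" by (simp_all add: add_pos_nonneg)
  have K1: "1 \<le> 2 + 2 * L\<^sup>2" using zero_le_power2[of L] by linarith
  have "(1 + a\<^sup>2) powr \<delta> \<le> (1 + a\<^sup>2) powr 1" using d by (intro powr_mono) auto
  then have p1: "(1 + a\<^sup>2) powr \<delta> \<le> 1 + a\<^sup>2" using pa by simp
  have aa: "(a\<^sup>2) powr \<delta> / (1 + a\<^sup>2) \<le> (a\<^sup>2 / (1 + a\<^sup>2)) powr \<delta>"
    unfolding powr_divide by (intro divide_left_mono p1 mult_pos_pos) (use pa in auto)
  have aa1: "(a\<^sup>2) powr \<delta> / (1 + a\<^sup>2) \<le> 1"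
    by (rule order_trans[OF aa powr_le1]) (use d pa in \<open>auto simp: divide_le_eq_1\<close>)
  have e: "b\<^sup>2 / (1 + a\<^sup>2)\<^sup>2 * (a\<^sup>2) powr \<delta> = b\<^sup>2 / (1 + a\<^sup>2) * ((a\<^sup>2) powr \<delta> / (1 + a\<^sup>2))"
    by (simp add: power2_eq_square[of "1 + a\<^sup>2"])
  show ?thesis
  proof (cases "\<bar>a\<bar> \<le> \<bar>b\<bar>")
    case True
    have "\<bar>b\<bar> \<le> \<bar>a\<bar> + L" using L by linarith
    then have "b\<^sup>2 \<le> (\<bar>a\<bar> + L)\<^sup>2" using L0 by (metis abs_ge_zero power2_abs power_mono)
    also have "\<dots> \<le> 2 * a\<^sup>2 + 2 * L\<^sup>2" using zero_le_power2[of "\<bar>a\<bar> - L"] by (simp add: power2_eq_square algebra_simps)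
    also have "\<dots> \<le> (2 + 2 * L\<^sup>2) * (1 + a\<^sup>2)" using mult_nonneg_nonneg[of "L\<^sup>2" "a\<^sup>2"] by (simp add: algebra_simps)
    finally have "b\<^sup>2 / (1 + a\<^sup>2) \<le> 2 + 2 * L\<^sup>2" using pa by (simp add: divide_le_eq)
    then have "b\<^sup>2 / (1 + a\<^sup>2) * ((a\<^sup>2) powr \<delta> / (1 + a\<^sup>2)) \<le> (2 + 2 * L\<^sup>2) * (a\<^sup>2 / (1 + a\<^sup>2)) powr \<delta>"
      using aa pa by (intro mult_mono) auto
    moreover have "min \<bar>a\<bar> \<bar>b\<bar> = \<bar>a\<bar>" using True by simp
    ultimately show ?thesis unfolding e by simp
  next
    case False
    then have "b\<^sup>2 \<le> a\<^sup>2" by (simp add: abs_le_square_iff[symmetric])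
    then have "b\<^sup>2 / (1 + a\<^sup>2) \<le> b\<^sup>2 / (1 + b\<^sup>2)" using pb by (intro divide_left_mono mult_pos_pos) (auto simp: add_pos_nonneg)
    moreover have "b\<^sup>2 / (1 + b\<^sup>2) \<le> (b\<^sup>2 / (1 + b\<^sup>2)) powr \<delta>"
    proof (cases "b = 0")
      case False
      have "(b\<^sup>2 / (1 + b\<^sup>2)) powr 1 \<le> (b\<^sup>2 / (1 + b\<^sup>2)) powr \<delta>"
        using d pb False by (intro powr_mono') (auto simp: divide_le_eq_1)
      then show ?thesis using False pb by simp
    qed simp
    ultimately have "b\<^sup>2 / (1 + a\<^sup>2) * ((a\<^sup>2) powr \<delta> / (1 + a\<^sup>2)) \<le> (b\<^sup>2 / (1 + b\<^sup>2)) powr \<delta> * 1"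
      using aa1 pa by (intro mult_mono) auto
    also have "\<dots> \<le> (2 + 2 * L\<^sup>2) * (b\<^sup>2 / (1 + b\<^sup>2)) powr \<delta>"
      using mult_right_mono[OF K1, of "(b\<^sup>2 / (1 + b\<^sup>2)) powr \<delta>"] by simp
    moreover have "min \<bar>a\<bar> \<bar>b\<bar> = \<bar>b\<bar>" using False by simp
    ultimately show ?thesis unfolding e by simp
  qed
qed

text \<open>The derivative of \<open>W * a^2\<close> integrates to zero. In it \<open>W'\<close> is
  bounded below by a multiple of the wanted weight, up to the bounded error \<open>B\<close>, and
  the cross term is absorbed by completing the square at the price of \<open>W\<close>'s field
  squared, which \<open>kappa_weight_bound\<close> compares with the coefficient. The factor
  \<open>\<kappa>\<close> is indispensable for this comparison because the coefficient also vanishes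
  at \<open>x2\<close>. Adding \<open>e\<close> makes the field differentiable at \<open>x1\<close>;
  \<open>C\<close> does not depend on it.\<close>

lemma hardy_two_point:
  assumes d: "1 / 2 < \<delta>" "\<delta> < 1" and x12: "x1 \<noteq> x2"
  obtains C where "C > 0" "\<And>e a. e > 0 \<Longrightarrow> test_function a \<Longrightarrow>
    integrable lborel (\<lambda>x. ((x - x1)\<^sup>2 + e) powr (\<delta> - 1) * (a x)\<^sup>2) \<and>
    (LINT x|lborel. ((x - x1)\<^sup>2 + e) powr (\<delta> - 1) * (a x)\<^sup>2) \<le>
      C * ((LINT x|lborel. two_point_coeff \<delta> x1 x2 x * (deriv a x)\<^sup>2) + (LINT x|lborel. (a x)\<^sup>2))"
proof -
  interpret coefficient "two_point_coeff \<delta> x1 x2" using d by (intro coefficient_two_point) auto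
  define s where "s = 1 - \<delta>"
  have s: "0 < s" "s < 1 / 2" using d by (auto simp: s_def)
  define L where "L = \<bar>x2 - x1\<bar>"
  have L: "L > 0" using x12 by (simp add: L_def)
  define \<kappa> where "\<kappa> x = (x - x2)\<^sup>2 / (1 + (x - x1)\<^sup>2)\<^sup>2" for x
  define \<kappa>' where "\<kappa>' x = 2 * (x - x2) / (1 + (x - x1)\<^sup>2)\<^sup>2 - 4 * (x - x1) * (x - x2)\<^sup>2 / (1 + (x - x1)\<^sup>2) ^ 3" for x
  \<comment> \<open>\<open>1 - 2 * s = 2 * \<delta> - 1\<close> is the constant left in the
    derivative of \<open>y * (y^2 + e) powr (- s)\<close>. Half of it pays for the cross term, half
    remains for the estimate.\<close>
  define \<tau> where "\<tau> = (1 - 2 * s) / 2"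
  have \<tau>: "\<tau> > 0" using s by (simp add: \<tau>_def)
  define B where "B = 4 * (1 + L) + 16 * (1 + L)\<^sup>2"
  define C3 where "C3 = 2 + 2 * L\<^sup>2"
  \<comment> \<open>A lower bound for \<open>\<kappa>\<close> at points within \<open>L / 2\<close>
    of \<open>x1\<close>: there the distance from \<open>x2\<close> is at least
    \<open>L / 2\<close>.\<close>
  define \<kappa>0 where "\<kappa>0 = (L\<^sup>2 / 4) / (1 + L\<^sup>2 / 4)\<^sup>2"
  have up: "0 < 1 + y\<^sup>2" for y :: real by (simp add: add_pos_nonneg)
  have \<kappa>0: "\<kappa>0 > 0" using L up[of "L / 2"] by (auto simp: \<kappa>0_def power_divide intro!: divide_pos_pos)
  have \<kappa>nn: "\<kappa> x \<ge> 0" for x by (simp add: \<kappa>_def)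
  have B0: "B > 0" using L by (simp add: B_def add_pos_nonneg)
  have \<kappa>d: "(\<kappa> has_real_derivative \<kappa>' x) (at x)" for x
  proof -
    have p: "1 + (x - x1)\<^sup>2 \<noteq> 0" using up[of "x - x1"] by linarith
    have 1: "(\<kappa> has_real_derivative
      (2 * (x - x2) * (1 + (x - x1)\<^sup>2)\<^sup>2 - (x - x2)\<^sup>2 * (2 * (1 + (x - x1)\<^sup>2) * (2 * (x - x1)))) / ((1 + (x - x1)\<^sup>2)\<^sup>2 * (1 + (x - x1)\<^sup>2)\<^sup>2)) (at x)"
      unfolding \<kappa>_def using p by (auto intro!: derivative_eq_intros)
    have 2: "(2 * (x - x2) * u\<^sup>2 - (x - x2)\<^sup>2 * (2 * u * (2 * (x - x1)))) / (u\<^sup>2 * u\<^sup>2) =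
       2 * (x - x2) / u\<^sup>2 - 4 * (x - x1) * (x - x2)\<^sup>2 / u ^ 3" if "u \<noteq> 0" for u
      using that by (simp add: diff_divide_distrib power2_eq_square power3_eq_cube mult_ac)
    show ?thesis unfolding \<kappa>'_def by (rule DERIV_cong[OF 1 2[OF p]])
  qed
  have \<kappa>'b: "\<bar>\<kappa>' x\<bar> * (1 + \<bar>x - x1\<bar>) \<le> B" for x
  proof -
    define y where "y = \<bar>x - x1\<bar>"
    define u where "u = 1 + y\<^sup>2"
    have y0: "y \<ge> 0" by (simp add: y_def)
    have u1: "u \<ge> 1" by (simp add: u_def)
    have ue: "1 + (x - x1)\<^sup>2 = u" by (simp add: u_def y_def)
    have x2: "\<bar>x - x2\<bar> \<le> (1 + L) * (1 + y)"
    proof -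
      have "\<bar>x - x2\<bar> \<le> y + L" by (simp add: y_def L_def)
      also have "\<dots> \<le> (1 + L) * (1 + y)" using y0 L by (simp add: algebra_simps)
      finally show ?thesis .
    qed
    have yu: "(1 + y)\<^sup>2 \<le> 2 * u" unfolding u_def using zero_le_power2[of "1 - y"] by (simp add: power2_eq_square algebra_simps)
    have t1: "\<bar>2 * (x - x2) / u\<^sup>2\<bar> * (1 + y) \<le> 4 * (1 + L)"
    proof -
      have "\<bar>2 * d / u\<^sup>2\<bar> * (1 + y) = 2 * (\<bar>d\<bar> * (1 + y)) / u\<^sup>2" for d by (simp add: abs_mult)
      then have "\<bar>2 * (x - x2) / u\<^sup>2\<bar> * (1 + y) = 2 * (\<bar>x - x2\<bar> * (1 + y)) / u\<^sup>2" .
      also have "\<dots> \<le> 2 * ((1 + L) * (1 + y) * (1 + y)) / u\<^sup>2"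
        using x2 y0 by (intro divide_right_mono mult_left_mono mult_right_mono) auto
      also have "\<dots> = 2 * (1 + L) * (1 + y)\<^sup>2 / u\<^sup>2" by (simp add: power2_eq_square)
      also have "\<dots> \<le> 2 * (1 + L) * (2 * u) / u\<^sup>2"
        using yu L by (intro divide_right_mono mult_left_mono) auto
      also have "\<dots> = 4 * (1 + L) / u" using u1 by (simp add: power2_eq_square)
      also have "\<dots> \<le> 4 * (1 + L)" using u1 L by (simp add: divide_le_eq mult_le_cancel_left1)
      finally show ?thesis .
    qed
    have t2: "\<bar>4 * (x - x1) * (x - x2)\<^sup>2 / u ^ 3\<bar> * (1 + y) \<le> 16 * (1 + L)\<^sup>2"
    proof -
      have sq: "(x - x2)\<^sup>2 \<le> ((1 + L) * (1 + y))\<^sup>2" using x2 by (metis abs_ge_zero power2_abs power_mono)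
      have "\<bar>4 * d * d'\<^sup>2 / u ^ 3\<bar> * (1 + y) = 4 * (\<bar>d\<bar> * d'\<^sup>2 * (1 + y)) / u ^ 3" for d d'
        using u1 by (simp add: abs_mult)
      then have "\<bar>4 * (x - x1) * (x - x2)\<^sup>2 / u ^ 3\<bar> * (1 + y) = 4 * (y * (x - x2)\<^sup>2 * (1 + y)) / u ^ 3"
        unfolding y_def .
      also have "\<dots> \<le> 4 * ((1 + y) * ((1 + L) * (1 + y))\<^sup>2 * (1 + y)) / u ^ 3"
        using sq y0 u1 by (intro divide_right_mono mult_left_mono mult_right_mono mult_mono) auto
      also have "\<dots> = 4 * (1 + L)\<^sup>2 * ((1 + y)\<^sup>2)\<^sup>2 / u ^ 3"
      proof -
        have "4 * (q * (p * q)\<^sup>2 * q) = 4 * p\<^sup>2 * (q\<^sup>2)\<^sup>2" for p q :: real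
          by (simp add: power2_eq_square mult_ac)
        then show ?thesis by (simp only:)
      qed
      also have "\<dots> \<le> 4 * (1 + L)\<^sup>2 * (2 * u)\<^sup>2 / u ^ 3"
        using yu u1 by (intro divide_right_mono mult_left_mono power_mono) auto
      also have "\<dots> = 16 * (1 + L)\<^sup>2 / u" using u1 by (simp add: power2_eq_square power3_eq_cube)
      also have "\<dots> \<le> 16 * (1 + L)\<^sup>2" using u1 by (simp add: divide_le_eq mult_le_cancel_left1)
      finally show ?thesis .
    qed
    have "\<bar>\<kappa>' x\<bar> * (1 + y) \<le> (\<bar>2 * (x - x2) / u\<^sup>2\<bar> + \<bar>4 * (x - x1) * (x - x2)\<^sup>2 / u ^ 3\<bar>) * (1 + y)"
      unfolding \<kappa>'_def ue using y0 by (intro mult_right_mono abs_triangle_ineq4) auto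
    also have "\<dots> \<le> B" unfolding distrib_right B_def by (intro add_mono t1 t2)
    finally show ?thesis by (simp add: y_def)
  qed
  \<comment> \<open>\<open>B\<close> comes from the term with \<open>\<kappa>'\<close>; the second
    summand pays for the points farther than \<open>L / 2\<close> from \<open>x1\<close>, where
    \<open>\<kappa>\<close> may be small but the weight itself is at most
    \<open>(L\<^sup>2 / 4) powr (- s)\<close>.\<close>
  define A where "A = B + \<tau> * \<kappa>0 * (L\<^sup>2 / 4) powr (- s)"
  have A0: "A > 0" unfolding A_def using B0 \<tau> \<kappa>0 by (intro add_pos_nonneg) auto
  define C where "C = (A + C3 / \<tau>) / (\<tau> * \<kappa>0)"
  have C3: "C3 > 0" unfolding C3_def by (simp add: add_pos_nonneg)
  have C0: "C > 0" unfolding C_def using A0 \<tau> \<kappa>0 C3 by (intro divide_pos_pos add_pos_pos mult_pos_pos) auto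
  show thesis
  proof (rule that[OF C0])
    fix e :: real and a assume e: "e > 0" and a: "test_function a"
    define m where "m x = ((x - x1)\<^sup>2 + e) powr (- s)" for x
    have base: "(x - x1)\<^sup>2 + e > 0" for x using e by (simp add: add_nonneg_pos)
    have m0: "m x > 0" for x using base[of x] by (simp add: m_def)
    define m' where "m' x = - s * ((x - x1)\<^sup>2 + e) powr (- s - 1) * (2 * (x - x1))" for x
    have md: "(m has_real_derivative m' x) (at x)" for x
    proof -
      have "((\<lambda>x. (x - x1)\<^sup>2 + e) has_real_derivative 2 * (x - x1)) (at x)" by (auto intro!: derivative_eq_intros)
      from DERIV_fun_powr[OF this base, of "- s"] show ?thesis by (simp add: m_def[abs_def] m'_def)
    qed
    define W where "W x = \<kappa> x * ((x - x1) * m x)" for x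
    define W' where "W' x = \<kappa>' x * ((x - x1) * m x) + \<kappa> x * (1 * m x + (x - x1) * m' x)" for x
    have Wd: "(W has_real_derivative W' x) (at x)" for x
    proof -
      have "((\<lambda>x. (x - x1) * m x) has_real_derivative 1 * m x + (x - x1) * m' x) (at x)"
        using md by (auto intro!: derivative_eq_intros)
      from DERIV_mult[OF \<kappa>d this] show ?thesis unfolding W_def[abs_def] W'_def by (simp add: algebra_simps)
    qed
    define F where "F x = W x * (a x)\<^sup>2" for x
    define F' where "F' x = W' x * (a x)\<^sup>2 + W x * (2 * a x * deriv a x)" for x
    have ad: "(a has_real_derivative deriv a x) (at x)" for x by (rule smooth_has_deriv[OF test_function_smooth[OF a]])
    have Fd: "(F has_real_derivative F' x) (at x)" for x
      unfolding F_def[abs_def] F'_def using Wd ad by (auto intro!: derivative_eq_intros)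
    have pn: "1 + (x - x1)\<^sup>2 \<noteq> 0" for x using up[of "x - x1"] by linarith
    have mc: "continuous_on UNIV m" "continuous_on UNIV m'"
      unfolding m_def m'_def using base by (auto intro!: continuous_intros simp: less_imp_neq[symmetric])
    have \<kappa>c: "continuous_on UNIV \<kappa>" "continuous_on UNIV \<kappa>'"
      unfolding \<kappa>_def \<kappa>'_def using pn by (auto intro!: continuous_intros)
    have Wc: "continuous_on UNIV W" "continuous_on UNIV W'"
      unfolding W_def W'_def by (intro continuous_intros mc \<kappa>c)+
    have F'c: "continuous_on UNIV F'"
      unfolding F'_def by (intro continuous_intros Wc test_function_continuous a test_function_deriv)
    obtain R where R: "\<And>x. \<bar>x\<bar> > R \<Longrightarrow> a x = 0" using test_function_support[OF a] by metis
    have I0: "(LINT x|lborel. F' x) = 0"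
      by (rule integral_derivative_compact_support[of F F' R])
        (use Fd F'c R in \<open>auto simp: has_real_derivative_iff_has_vector_derivative F_def\<close>)
    have Fi: "integrable lborel F'"
      by (rule integrable_compact_support[OF F'c, of R]) (simp add: F'_def R)
    have ai: "integrable lborel (\<lambda>x. (a x)\<^sup>2)" by (rule energy_cemb(4)[OF a a])
    have ci: "integrable lborel (\<lambda>x. two_point_coeff \<delta> x1 x2 x * (deriv a x)\<^sup>2)"
      by (rule energy_cemb(3)[OF test_function_deriv[OF a] test_function_deriv[OF a]])
    have mi: "integrable lborel (\<lambda>x. m x * (a x)\<^sup>2)"
    proof (rule integrable_compact_support[of _ R])
      show "continuous_on UNIV (\<lambda>x. m x * (a x)\<^sup>2)"
        by (intro continuous_on_mult continuous_on_power mc test_function_continuous[OF a])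
    qed (simp add: R)
    have pt: "\<tau> * \<kappa>0 * (m x * (a x)\<^sup>2) \<le> F' x + A * (a x)\<^sup>2 + C3 / \<tau> * (two_point_coeff \<delta> x1 x2 x * (deriv a x)\<^sup>2)" for x
    proof -
      define y where "y = x - x1"
      have ms: "m x \<le> (y\<^sup>2) powr (- s)" if "y \<noteq> 0"
        unfolding m_def y_def[symmetric] using s e that by (intro powr_mono2') auto
      have ym: "\<bar>y\<bar> * m x \<le> 1 + \<bar>y\<bar>"
      proof (cases "y = 0")
        case False
        have "\<bar>y\<bar> * m x \<le> \<bar>y\<bar> powr 1 * (\<bar>y\<bar> powr 2) powr (- s)"
          using ms[OF False] False by (simp add: mult_left_mono)
        also have "\<dots> = \<bar>y\<bar> powr (1 - 2 * s)" by (simp only: powr_powr powr_add[symmetric]) simp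
        also have "\<dots> \<le> 1 + \<bar>y\<bar>" using s by (intro powr_le_1_plus) auto
        finally show ?thesis .
      qed simp
      have y2m: "y\<^sup>2 * m x \<le> (y\<^sup>2) powr \<delta>"
      proof (cases "y = 0")
        case False
        have "y\<^sup>2 * m x \<le> (y\<^sup>2) powr 1 * (y\<^sup>2) powr (- s)" using ms[OF False] by (simp add: mult_left_mono)
        also have "\<dots> = (y\<^sup>2) powr \<delta>" unfolding powr_add[symmetric] by (simp add: s_def)
        finally show ?thesis .
      qed simp
      have m'e: "y * m' x = - 2 * s * (y\<^sup>2 / (y\<^sup>2 + e)) * m x"
      proof -
        have "((x - x1)\<^sup>2 + e) powr (- s - 1) = m x / (y\<^sup>2 + e)"
          unfolding m_def y_def using base[of x] by (simp add: powr_diff)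
        then show ?thesis by (simp add: m'_def y_def[symmetric] power2_eq_square)
      qed
      have W1: "m x + y * m' x \<ge> 2 * \<tau> * m x"
      proof -
        have "y\<^sup>2 / (y\<^sup>2 + e) \<le> 1" using e by (subst divide_le_eq_1) (auto simp: add_nonneg_pos)
        then have "2 * s * (y\<^sup>2 / (y\<^sup>2 + e)) * m x \<le> 2 * s * 1 * m x" using s m0[of x] by (intro mult_right_mono mult_left_mono) auto
        moreover have "2 * \<tau> * m x = m x - 2 * s * 1 * m x" by (simp add: \<tau>_def field_simps)
        moreover have "m x + - 2 * s * (y\<^sup>2 / (y\<^sup>2 + e)) * m x = m x - 2 * s * (y\<^sup>2 / (y\<^sup>2 + e)) * m x" by simp
        ultimately show ?thesis unfolding m'e by linarith
      qed
      have W2: "\<bar>\<kappa>' x * (y * m x)\<bar> \<le> B"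
      proof -
        have "\<bar>\<kappa>' x * (y * m x)\<bar> = \<bar>\<kappa>' x\<bar> * (\<bar>y\<bar> * m x)" using m0[of x] by (simp add: abs_mult)
        also have "\<dots> \<le> \<bar>\<kappa>' x\<bar> * (1 + \<bar>y\<bar>)" using ym by (intro mult_left_mono) auto
        also have "\<dots> \<le> B" using \<kappa>'b[of x] by (simp add: y_def)
        finally show ?thesis .
      qed
      have W'ge: "W' x \<ge> 2 * \<tau> * (\<kappa> x * m x) - B"
      proof -
        have "\<kappa> x * (m x + y * m' x) \<ge> \<kappa> x * (2 * \<tau> * m x)" using W1 \<kappa>nn by (intro mult_left_mono)
        then show ?thesis using W2 by (simp add: W'_def y_def[symmetric] mult_ac)
      qed
      have cross: "W x * (2 * a x * deriv a x) \<ge> - (\<tau> * (\<kappa> x * m x) * (a x)\<^sup>2) - C3 / \<tau> * (two_point_coeff \<delta> x1 x2 x * (deriv a x)\<^sup>2)"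
      proof -
        have km: "\<kappa> x * m x \<ge> 0" using \<kappa>nn[of x] m0[of x] by simp
        \<comment> \<open>The square is weighted so that its middle term is the cross term and its
          first term costs exactly \<open>\<tau> * \<kappa> * m * a^2\<close>.\<close>
        have "0 \<le> (\<kappa> x * m x) / \<tau> * (\<tau> * a x + y * deriv a x)\<^sup>2" by (rule mult_nonneg_nonneg[OF divide_nonneg_pos[OF km \<tau>] zero_le_power2])
        also have "\<dots> = \<tau> * (\<kappa> x * m x) * (a x)\<^sup>2 + W x * (2 * a x * deriv a x) + (\<kappa> x * (y\<^sup>2 * m x)) / \<tau> * (deriv a x)\<^sup>2"
          using \<tau> by (simp add: W_def y_def[symmetric] power2_eq_square field_simps)
        also have "(\<kappa> x * (y\<^sup>2 * m x)) / \<tau> * (deriv a x)\<^sup>2 \<le> (C3 * two_point_coeff \<delta> x1 x2 x) / \<tau> * (deriv a x)\<^sup>2"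
        proof (intro mult_right_mono divide_right_mono)
          have "\<kappa> x * (y\<^sup>2 * m x) \<le> \<kappa> x * (y\<^sup>2) powr \<delta>" using y2m \<kappa>nn by (intro mult_left_mono)
          also have "\<dots> \<le> C3 * two_point_coeff \<delta> x1 x2 x"
            unfolding \<kappa>_def C3_def two_point_coeff_def y_def
            by (rule kappa_weight_bound) (use d in \<open>auto simp: L_def\<close>)
          finally show "\<kappa> x * (y\<^sup>2 * m x) \<le> C3 * two_point_coeff \<delta> x1 x2 x" .
        qed (use \<tau> in auto)
        finally show ?thesis by simp
      qed
      have low: "\<tau> * \<kappa>0 * m x \<le> \<tau> * (\<kappa> x * m x) + \<tau> * \<kappa>0 * (L\<^sup>2 / 4) powr (- s)"
      proof (cases "y\<^sup>2 \<le> L\<^sup>2 / 4")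
        case True
        have "y\<^sup>2 \<le> (L / 2)\<^sup>2" using True by (simp add: power_divide)
        then have "\<bar>y\<bar> \<le> \<bar>L / 2\<bar>" by (simp only: abs_le_square_iff)
        then have "\<bar>y\<bar> \<le> L / 2" using L by simp
        then have "L / 2 \<le> \<bar>x - x2\<bar>" 
          using abs_triangle_ineq[of "x - x1" "x2 - x"] abs_minus_commute[of x2 x] by (simp add: y_def L_def)
        then have "(L / 2)\<^sup>2 \<le> (x - x2)\<^sup>2" using L by (metis abs_ge_zero less_imp_le half_gt_zero power2_abs power_mono)
        then have x2: "L\<^sup>2 / 4 \<le> (x - x2)\<^sup>2" by (simp add: power_divide)
        have "\<kappa>0 \<le> \<kappa> x"
          unfolding \<kappa>0_def \<kappa>_def
        proof (rule frac_le)
          show "0 < (1 + (x - x1)\<^sup>2)\<^sup>2" using pn[of x] by simp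
          show "(1 + (x - x1)\<^sup>2)\<^sup>2 \<le> (1 + L\<^sup>2 / 4)\<^sup>2" using True unfolding y_def by (intro power_mono) auto
        qed (use x2 in auto)
        then have "\<tau> * (\<kappa>0 * m x) \<le> \<tau> * (\<kappa> x * m x)" using \<tau> m0[of x] by (intro mult_left_mono mult_right_mono) auto
        moreover have "0 \<le> \<tau> * \<kappa>0 * (L\<^sup>2 / 4) powr (- s)" using \<tau> \<kappa>0 by simp
        ultimately show ?thesis by simp
      next
        case False
        have "m x \<le> (L\<^sup>2 / 4) powr (- s)"
          unfolding m_def y_def[symmetric] using False s e L by (intro powr_mono2') auto
        then have "\<tau> * \<kappa>0 * m x \<le> \<tau> * \<kappa>0 * (L\<^sup>2 / 4) powr (- s)" using \<tau> \<kappa>0 by (intro mult_left_mono) auto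
        moreover have "0 \<le> \<tau> * (\<kappa> x * m x)" using \<tau> \<kappa>nn[of x] m0[of x] by simp
        ultimately show ?thesis by linarith
      qed
      have "(\<tau> * \<kappa>0 * m x) * (a x)\<^sup>2 \<le> (\<tau> * (\<kappa> x * m x) + \<tau> * \<kappa>0 * (L\<^sup>2 / 4) powr (- s)) * (a x)\<^sup>2"
        using low by (intro mult_right_mono) auto
      moreover have "(2 * \<tau> * (\<kappa> x * m x) - B) * (a x)\<^sup>2 \<le> W' x * (a x)\<^sup>2" using W'ge by (intro mult_right_mono) auto
      ultimately show ?thesis using cross unfolding F'_def A_def by (simp add: algebra_simps)
    qed
    have "\<tau> * \<kappa>0 * (LINT x|lborel. m x * (a x)\<^sup>2) = (LINT x|lborel. \<tau> * \<kappa>0 * (m x * (a x)\<^sup>2))" by simp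
    also have "\<dots> \<le> (LINT x|lborel. F' x + A * (a x)\<^sup>2 + C3 / \<tau> * (two_point_coeff \<delta> x1 x2 x * (deriv a x)\<^sup>2))"
      by (intro integral_mono pt integrable_mult_right mi Bochner_Integration.integrable_add Fi ai ci)
    also have "\<dots> = A * (LINT x|lborel. (a x)\<^sup>2) + C3 / \<tau> * (LINT x|lborel. two_point_coeff \<delta> x1 x2 x * (deriv a x)\<^sup>2)"
      using Fi ai ci I0 by (simp only: Bochner_Integration.integral_add Bochner_Integration.integrable_add integrable_mult_right integral_mult_right_zero)
    also have "\<dots> \<le> (A + C3 / \<tau>) * (LINT x|lborel. (a x)\<^sup>2) + (A + C3 / \<tau>) * (LINT x|lborel. two_point_coeff \<delta> x1 x2 x * (deriv a x)\<^sup>2)"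
      using A0 C3 \<tau> c_nonneg by (intro add_mono mult_right_mono) (auto intro!: integral_nonneg_AE)
    finally have key: "\<tau> * \<kappa>0 * (LINT x|lborel. m x * (a x)\<^sup>2) \<le> (A + C3 / \<tau>) * (LINT x|lborel. (a x)\<^sup>2) +
      (A + C3 / \<tau>) * (LINT x|lborel. two_point_coeff \<delta> x1 x2 x * (deriv a x)\<^sup>2)" .
    have "X \<le> K / p * (Q + M)" if "p * X \<le> K * M + K * Q" "p > 0" for p X K Q M :: real
    proof -
      have "X * p \<le> K * (Q + M)" using that(1) by (simp only: distrib_left mult.commute[of X] add.commute[of "K * Q"])
      then show ?thesis using that(2) by (simp only: times_divide_eq_left pos_le_divide_eq)
    qed
    from this[OF key] have "(LINT x|lborel. m x * (a x)\<^sup>2) \<le> C * ((LINT x|lborel. two_point_coeff \<delta> x1 x2 x * (deriv a x)\<^sup>2) + (LINT x|lborel. (a x)\<^sup>2))"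
      unfolding C_def using \<tau> \<kappa>0 by simp
    then show "integrable lborel (\<lambda>x. ((x - x1)\<^sup>2 + e) powr (\<delta> - 1) * (a x)\<^sup>2) \<and>
      (LINT x|lborel. ((x - x1)\<^sup>2 + e) powr (\<delta> - 1) * (a x)\<^sup>2) \<le>
      C * ((LINT x|lborel. two_point_coeff \<delta> x1 x2 x * (deriv a x)\<^sup>2) + (LINT x|lborel. (a x)\<^sup>2))"
      using mi by (simp add: m_def s_def)
  qed
qed

subsection \<open>Splitting off the degenerate points\<close>

text \<open>A rational cutoff of length scale \<open>sqrt q\<close>. Its merit is that
  \<open>q * (ramp')^2\<close> is dominated by \<open>(1 - ramp)^2\<close>, so in the
  \<open>K\<close>-functional the derivative of the cutoff costs no more than the \<open>L2\<close>
  error.\<close>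

definition ramp :: "real \<Rightarrow> real \<Rightarrow> real" where
  "ramp q y = y\<^sup>2 / (y\<^sup>2 + q)"

definition cutoff :: "real \<Rightarrow> real \<Rightarrow> real \<Rightarrow> real \<Rightarrow> real" where
  "cutoff q x1 x2 x = ramp q (x - x1) * ramp q (x - x2)"

lemma ramp_bounds: "q > 0 \<Longrightarrow> 0 \<le> ramp q y" "q > 0 \<Longrightarrow> ramp q y \<le> 1" "q > 0 \<Longrightarrow> 1 - ramp q y = q / (y\<^sup>2 + q)"
proof -
  assume q: "q > 0"
  then have p: "0 < y\<^sup>2 + q" by (simp add: add_nonneg_pos)
  show "0 \<le> ramp q y" "ramp q y \<le> 1" using p q by (auto simp: ramp_def divide_le_eq_1)
  show "1 - ramp q y = q / (y\<^sup>2 + q)" using p by (simp add: ramp_def field_simps)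
qed

lemma smooth_ramp: "q > 0 \<Longrightarrow> smooth (\<lambda>x. ramp q (x - a))"
proof -
  assume q: "q > 0"
  have n: "y * y + q \<noteq> 0" for y using zero_le_square[of y] q by linarith
  have "smooth (\<lambda>y. (y * y) * inverse (y * y + q))"
    using n by (intro smooth_mult smooth_inverse smooth_add smooth_ident smooth_const)
  from smooth_affine[OF this, of 1 "- a"] show ?thesis
    by (simp add: ramp_def[abs_def] power2_eq_square divide_inverse)
qed

lemma ramp_has_derivative:
  "q > 0 \<Longrightarrow> ((\<lambda>x. ramp q (x - a)) has_real_derivative 2 * (x - a) * q / ((x - a)\<^sup>2 + q)\<^sup>2) (at x)"
proof -
  assume q: "q > 0"
  have p: "(x - a)\<^sup>2 + q \<noteq> 0" using zero_le_power2[of "x - a"] q by linarith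
  have "((\<lambda>x. ramp q (x - a)) has_real_derivative
    (2 * (x - a) * ((x - a)\<^sup>2 + q) - (x - a)\<^sup>2 * (2 * (x - a))) / (((x - a)\<^sup>2 + q) * ((x - a)\<^sup>2 + q))) (at x)"
    unfolding ramp_def using p by (auto intro!: derivative_eq_intros)
  moreover have "(2 * y * (u + q) - u * (2 * y)) / ((u + q) * (u + q)) = 2 * y * q / (u + q)\<^sup>2" for u y
    by (simp add: power2_eq_square distrib_left)
  ultimately show ?thesis by (simp only:)
qed

text \<open>The quotient of the two sides is \<open>4 * y^2 * q / (y^2 + q)^2\<close>, at most
  \<open>1\<close> by the inequality of arithmetic and geometric means.\<close>

lemma ramp_derivative_bound:
  assumes q: "q > 0"
  shows "q * (2 * y * q / (y\<^sup>2 + q)\<^sup>2)\<^sup>2 \<le> (1 - ramp q y)\<^sup>2"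
proof -
  have p: "0 < y\<^sup>2 + q" using q by (simp add: add_nonneg_pos)
  have "4 * y\<^sup>2 * q \<le> (y\<^sup>2 + q)\<^sup>2" using zero_le_power2[of "y\<^sup>2 - q"] by (simp add: power2_eq_square algebra_simps)
  then have le: "4 * y\<^sup>2 * q / (y\<^sup>2 + q)\<^sup>2 \<le> 1" using p by (subst divide_le_eq_1) simp
  have "q * (2 * y * q / u\<^sup>2)\<^sup>2 = (q / u)\<^sup>2 * (4 * y\<^sup>2 * q / u\<^sup>2)" for u
    by (simp add: power_divide power_mult_distrib power2_eq_square)
  then have "q * (2 * y * q / (y\<^sup>2 + q)\<^sup>2)\<^sup>2 = (q / (y\<^sup>2 + q))\<^sup>2 * (4 * y\<^sup>2 * q / (y\<^sup>2 + q)\<^sup>2)" .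
  also have "\<dots> \<le> (q / (y\<^sup>2 + q))\<^sup>2 * 1" by (intro mult_left_mono le) auto
  finally show ?thesis using q by (simp add: ramp_bounds(3))
qed

text \<open>The pointwise estimate at one scale: \<open>p1\<close>, \<open>p2\<close> are the ramps
  at the two points, \<open>d1\<close>, \<open>d2\<close> their derivatives, \<open>A\<close>,
  \<open>A'\<close> the test function and its derivative, and \<open>P\<close> stands for the ramp
  at the nearer point. Both the defect \<open>1 - p1 * p2\<close> and the cutoff derivative are
  reduced to \<open>1 - p1\<close> and \<open>1 - p2\<close>; the constant \<open>6\<close> is
  \<open>2\<close> for the defect and \<open>4\<close> for the derivative.\<close>

lemma cutoff_algebra:
  fixes p1 p2 d1 d2 q P A A' :: real
  assumes p: "0 \<le> p1" "p1 \<le> 1" "0 \<le> p2" "p2 \<le> 1" and P: "p1 * p2 \<le> P" and q: "q \<ge> 0"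
    and d: "q * d1\<^sup>2 \<le> (1 - p1)\<^sup>2" "q * d2\<^sup>2 \<le> (1 - p2)\<^sup>2"
  shows "((1 - p1 * p2) * A)\<^sup>2 + q * ((d1 * p2 + p1 * d2) * A + p1 * p2 * A')\<^sup>2
    \<le> 6 * ((1 - p1)\<^sup>2 + (1 - p2)\<^sup>2) * A\<^sup>2 + 2 * (q * P\<^sup>2) * A'\<^sup>2"
proof -
  have sum2: "(a + b)\<^sup>2 \<le> 2 * a\<^sup>2 + 2 * b\<^sup>2" for a b :: real
    using zero_le_power2[of "a - b"] by (simp add: power2_eq_square algebra_simps)
  have pp: "0 \<le> p1 * p2" "p1 * p2 \<le> 1" using p by (auto intro: mult_le_one)
  have "0 \<le> (1 - p1) * (1 - p2)" using p by (intro mult_nonneg_nonneg) auto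
  then have "1 - p1 * p2 \<le> (1 - p1) + (1 - p2)" by (simp add: algebra_simps)
  then have "(1 - p1 * p2)\<^sup>2 \<le> ((1 - p1) + (1 - p2))\<^sup>2" using pp by (intro power_mono) auto
  also have "\<dots> \<le> 2 * (1 - p1)\<^sup>2 + 2 * (1 - p2)\<^sup>2" by (rule sum2)
  finally have 1: "(1 - p1 * p2)\<^sup>2 \<le> 2 * (1 - p1)\<^sup>2 + 2 * (1 - p2)\<^sup>2" .
  have "(d1 * p2 + p1 * d2)\<^sup>2 \<le> 2 * (d1 * p2)\<^sup>2 + 2 * (p1 * d2)\<^sup>2" by (rule sum2)
  also have "\<dots> \<le> 2 * d1\<^sup>2 + 2 * d2\<^sup>2"
  proof -
    have "p1\<^sup>2 \<le> 1" "p2\<^sup>2 \<le> 1" using p by (auto intro: power_le_one)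
    then have "d1\<^sup>2 * p2\<^sup>2 \<le> d1\<^sup>2 * 1" "p1\<^sup>2 * d2\<^sup>2 \<le> 1 * d2\<^sup>2" by (intro mult_left_mono mult_right_mono; simp)+
    then show ?thesis by (simp add: power_mult_distrib)
  qed
  finally have "q * (d1 * p2 + p1 * d2)\<^sup>2 \<le> q * (2 * d1\<^sup>2 + 2 * d2\<^sup>2)" using q by (intro mult_left_mono)
  also have "\<dots> = 2 * (q * d1\<^sup>2) + 2 * (q * d2\<^sup>2)" by (simp add: distrib_left)
  also have "\<dots> \<le> 2 * (1 - p1)\<^sup>2 + 2 * (1 - p2)\<^sup>2" using d by linarith
  finally have 2: "q * (d1 * p2 + p1 * d2)\<^sup>2 \<le> 2 * (1 - p1)\<^sup>2 + 2 * (1 - p2)\<^sup>2" .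
  have 3: "(p1 * p2)\<^sup>2 \<le> P\<^sup>2" using pp P by (intro power_mono) auto
  have id: "q * (2 * (D * A)\<^sup>2 + 2 * (R * A')\<^sup>2) = 2 * (q * D\<^sup>2 * A\<^sup>2) + 2 * (q * R\<^sup>2 * A'\<^sup>2)" for D R
    by (simp only: power_mult_distrib distrib_left mult_ac)
  have "((1 - p1 * p2) * A)\<^sup>2 \<le> (2 * (1 - p1)\<^sup>2 + 2 * (1 - p2)\<^sup>2) * A\<^sup>2"
    unfolding power_mult_distrib using 1 by (intro mult_right_mono) auto
  moreover have "q * ((d1 * p2 + p1 * d2) * A + p1 * p2 * A')\<^sup>2 \<le> q * (2 * ((d1 * p2 + p1 * d2) * A)\<^sup>2 + 2 * (p1 * p2 * A')\<^sup>2)"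
    by (rule mult_left_mono[OF sum2 q])
  moreover have "q * (2 * ((d1 * p2 + p1 * d2) * A)\<^sup>2 + 2 * (p1 * p2 * A')\<^sup>2) = 2 * (q * (d1 * p2 + p1 * d2)\<^sup>2 * A\<^sup>2) + 2 * (q * (p1 * p2)\<^sup>2 * A'\<^sup>2)"
    using id[of "d1 * p2 + p1 * d2" "p1 * p2"] by (simp only: mult.assoc)
  moreover have "q * (d1 * p2 + p1 * d2)\<^sup>2 * A\<^sup>2 \<le> (2 * (1 - p1)\<^sup>2 + 2 * (1 - p2)\<^sup>2) * A\<^sup>2"
    using 2 by (intro mult_right_mono) auto
  moreover have "q * (p1 * p2)\<^sup>2 * A'\<^sup>2 \<le> q * P\<^sup>2 * A'\<^sup>2" using 3 q by (intro mult_right_mono mult_left_mono) auto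
  moreover have "X + Y \<le> 6 * B * A\<^sup>2 + 2 * (q * P\<^sup>2) * A'\<^sup>2"
    if "X \<le> T" "Y \<le> Z" "Z = 2 * U + 2 * V" "U \<le> T" "V \<le> q * P\<^sup>2 * A'\<^sup>2" "T = 2 * B * A\<^sup>2" for X Y Z T U V B
    using that by (simp add: mult.assoc)
  moreover have "(2 * (1 - p1)\<^sup>2 + 2 * (1 - p2)\<^sup>2) * A\<^sup>2 = 2 * ((1 - p1)\<^sup>2 + (1 - p2)\<^sup>2) * A\<^sup>2"
    by (simp only: distrib_left)
  ultimately show ?thesis by blast
qed

lemma smooth_cutoff: "q > 0 \<Longrightarrow> smooth (cutoff q x1 x2)"
  unfolding cutoff_def[abs_def] by (intro smooth_mult smooth_ramp)

lemma two_point_coeff_commute: "two_point_coeff \<delta> x2 x1 = two_point_coeff \<delta> x1 x2"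
  by (simp add: fun_eq_iff two_point_coeff_def min.commute)

lemma norm_emb_sq: "test_function a \<Longrightarrow> (norm (emb a))\<^sup>2 = (LINT x|lborel. (a x)\<^sup>2)"
  unfolding emb_def by (subst norm_l2_abs_sq) (auto intro: square_integrable_of_real_test_function)

lemma integrable_test_function_sq: "test_function a \<Longrightarrow> integrable lborel (\<lambda>x. (a x)\<^sup>2)"
  using square_integrable_of_real_test_function by (simp add: square_integrable_def)

text \<open>Summed over the dyadic scales \<open>q = 4 ^ (- k)\<close>, the \<open>K\<close>-functional of a test function between
  \<open>L\<^sub>2\<close> and \<open>W\<^sup>1\<^sup>,\<^sup>2\<close>, bounded by means of the cutoffs, is controlled by the degenerate form.\<close>

lemma dyadic_K_functional:
  assumes d: "1 / 2 < \<delta>" "\<delta> < 1" and x12: "x1 \<noteq> x2"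
  obtains C where "C > 0" "\<And>N a. test_function a \<Longrightarrow>
    (\<Sum>k\<le>N. (4 ^ k) powr (1 - \<delta>) *
       ((norm (emb a - emb (\<lambda>x. cutoff (1 / 4 ^ k) x1 x2 x * a x)))\<^sup>2 +
        1 / 4 ^ k * (norm (emb (deriv (\<lambda>x. cutoff (1 / 4 ^ k) x1 x2 x * a x))))\<^sup>2))
    \<le> C * ((LINT x|lborel. two_point_coeff \<delta> x1 x2 x * (deriv a x)\<^sup>2) + (LINT x|lborel. (a x)\<^sup>2))"
proof -
  interpret coefficient "two_point_coeff \<delta> x1 x2" using d by (intro coefficient_two_point) auto
  define s where "s = 1 - \<delta>"
  have s: "0 < s" "s \<le> 1" using d by (auto simp: s_def)
  obtain Ca where Ca: "Ca > 0" "\<And>e a. e > 0 \<Longrightarrow> test_function a \<Longrightarrow>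
    integrable lborel (\<lambda>x. ((x - x1)\<^sup>2 + e) powr (\<delta> - 1) * (a x)\<^sup>2) \<and>
    (LINT x|lborel. ((x - x1)\<^sup>2 + e) powr (\<delta> - 1) * (a x)\<^sup>2) \<le>
      Ca * ((LINT x|lborel. two_point_coeff \<delta> x1 x2 x * (deriv a x)\<^sup>2) + (LINT x|lborel. (a x)\<^sup>2))"
    using hardy_two_point[OF d x12] by blast
  obtain Cb where Cb: "Cb > 0" "\<And>e a. e > 0 \<Longrightarrow> test_function a \<Longrightarrow>
    integrable lborel (\<lambda>x. ((x - x2)\<^sup>2 + e) powr (\<delta> - 1) * (a x)\<^sup>2) \<and>
    (LINT x|lborel. ((x - x2)\<^sup>2 + e) powr (\<delta> - 1) * (a x)\<^sup>2) \<le>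
      Cb * ((LINT x|lborel. two_point_coeff \<delta> x1 x2 x * (deriv a x)\<^sup>2) + (LINT x|lborel. (a x)\<^sup>2))"
    using hardy_two_point[OF d x12[symmetric]] unfolding two_point_coeff_commute[of \<delta> x2 x1] by blast
  define C1 where "C1 = 16 * (4 powr s / (4 powr s - 1))"
  define C2 where "C2 = 8 * (4 powr \<delta> / (4 powr \<delta> - 1))"
  have C1: "C1 > 0" unfolding C1_def using four_powr_gt_1[OF s(1)] by auto
  have C2: "C2 > 0" unfolding C2_def using four_powr_gt_1[of \<delta>] d by auto
  define C where "C = 6 * C1 * (Ca + Cb) + 2 * C2"
  have C: "C > 0" unfolding C_def using C1 C2 Ca(1) Cb(1) by (simp add: add_pos_pos)
  show thesis
  proof (rule that[OF C])
    fix N :: nat and a assume a: "test_function a"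
    define \<theta> where "\<theta> k = cutoff (1 / 4 ^ k) x1 x2" for k :: nat
    define h where "h k x = \<theta> k x * a x" for k :: nat and x
    have th: "test_function (h k)" for k
      unfolding h_def \<theta>_def by (intro test_function_smooth_mult a smooth_cutoff) simp
    have td: "test_function (\<lambda>x. a x + (- 1) * h k x)" for k by (intro test_function_lincomb a th)
    define c where "c = two_point_coeff \<delta> x1 x2"
    define Q where "Q = (LINT x|lborel. c x * (deriv a x)\<^sup>2)"
    define M where "M = (LINT x|lborel. (a x)\<^sup>2)"
    have ci: "integrable lborel (\<lambda>x. c x * (deriv a x)\<^sup>2)"
      unfolding c_def by (rule energy_cemb(3)[OF test_function_deriv[OF a] test_function_deriv[OF a]])
    have Q0: "Q \<ge> 0" unfolding Q_def c_def using c_nonneg by (intro integral_nonneg_AE) auto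
    have M0: "M \<ge> 0" unfolding M_def by (intro integral_nonneg_AE) auto
    have pt: "(a x + (- 1) * h k x)\<^sup>2 + 1 / 4 ^ k * (deriv (h k) x)\<^sup>2 \<le>
       6 * (((1 / 4 ^ k) / ((x - x1)\<^sup>2 + 1 / 4 ^ k))\<^sup>2 + ((1 / 4 ^ k) / ((x - x2)\<^sup>2 + 1 / 4 ^ k))\<^sup>2) * (a x)\<^sup>2
       + 2 * (1 / 4 ^ k * (ramp (1 / 4 ^ k) (min \<bar>x - x1\<bar> \<bar>x - x2\<bar>))\<^sup>2) * (deriv a x)\<^sup>2" for k x
    proof -
      define q :: real where "q = 1 / 4 ^ k"
      have q: "q > 0" by (simp add: q_def)
      define p1 where "p1 = ramp q (x - x1)"
      define p2 where "p2 = ramp q (x - x2)"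
      define d1 where "d1 = 2 * (x - x1) * q / ((x - x1)\<^sup>2 + q)\<^sup>2"
      define d2 where "d2 = 2 * (x - x2) * q / ((x - x2)\<^sup>2 + q)\<^sup>2"
      have p: "0 \<le> p1" "p1 \<le> 1" "0 \<le> p2" "p2 \<le> 1" unfolding p1_def p2_def using ramp_bounds[OF q] by auto
      have P: "p1 * p2 \<le> ramp q (min \<bar>x - x1\<bar> \<bar>x - x2\<bar>)"
      proof (cases "\<bar>x - x1\<bar> \<le> \<bar>x - x2\<bar>")
        case True
        then have "ramp q (min \<bar>x - x1\<bar> \<bar>x - x2\<bar>) = p1" by (simp add: p1_def ramp_def)
        then show ?thesis using p by (simp add: mult_left_le)
      next
        case False
        then have "ramp q (min \<bar>x - x1\<bar> \<bar>x - x2\<bar>) = p2" by (simp add: p2_def ramp_def)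
        then show ?thesis using p by (simp add: mult_left_le_one_le)
      qed
      have "(h k has_real_derivative (d1 * p2 + p1 * d2) * a x + p1 * p2 * deriv a x) (at x)"
      proof -
        have 1: "(cutoff q x1 x2 has_real_derivative d1 * p2 + d2 * p1) (at x)"
          unfolding cutoff_def[abs_def] p1_def p2_def d1_def d2_def
          by (rule DERIV_mult[OF ramp_has_derivative[OF q] ramp_has_derivative[OF q]])
        have 2: "(a has_real_derivative deriv a x) (at x)" by (rule smooth_has_deriv[OF test_function_smooth[OF a]])
        have "((\<lambda>x. cutoff q x1 x2 x * a x) has_real_derivative (d1 * p2 + d2 * p1) * a x + deriv a x * cutoff q x1 x2 x) (at x)"
          by (rule DERIV_mult[OF 1 2])
        then show ?thesis unfolding h_def[abs_def] \<theta>_def q_def[symmetric]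
          by (rule DERIV_cong) (simp add: cutoff_def p1_def p2_def mult_ac)
      qed
      then have dh: "deriv (h k) x = (d1 * p2 + p1 * d2) * a x + p1 * p2 * deriv a x" by (rule DERIV_imp_deriv)
      have ha: "a x + (- 1) * h k x = (1 - p1 * p2) * a x"
        by (simp add: h_def \<theta>_def cutoff_def p1_def p2_def q_def algebra_simps)
      have "((1 - p1 * p2) * a x)\<^sup>2 + q * ((d1 * p2 + p1 * d2) * a x + p1 * p2 * deriv a x)\<^sup>2
        \<le> 6 * ((1 - p1)\<^sup>2 + (1 - p2)\<^sup>2) * (a x)\<^sup>2 + 2 * (q * (ramp q (min \<bar>x - x1\<bar> \<bar>x - x2\<bar>))\<^sup>2) * (deriv a x)\<^sup>2"
        by (rule cutoff_algebra[OF p P less_imp_le[OF q]])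
          (unfold p1_def p2_def d1_def d2_def, rule ramp_derivative_bound[OF q], rule ramp_derivative_bound[OF q])
      then show ?thesis
        unfolding ha dh unfolding p1_def p2_def ramp_bounds(3)[OF q] unfolding q_def .
    qed
    \<comment> \<open>The weights that \<open>dyadic_sum_far\<close> produces at the two points;
      they are of Hardy form with \<open>e = 1 / 4 ^ N\<close>, and the Hardy constants are the same
      for every \<open>N\<close>.\<close>
    define V where "V x = ((x - x1)\<^sup>2 + 1 / 4 ^ N) powr (- s) + ((x - x2)\<^sup>2 + 1 / 4 ^ N) powr (- s)" for x
    have ptsum: "(\<Sum>k\<le>N. (4 ^ k) powr s * ((a x + (- 1) * h k x)\<^sup>2 + 1 / 4 ^ k * (deriv (h k) x)\<^sup>2))
      \<le> 6 * C1 * (V x * (a x)\<^sup>2) + 2 * C2 * (c x * (deriv a x)\<^sup>2)" for x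
    proof -
      define r where "r = min \<bar>x - x1\<bar> \<bar>x - x2\<bar>"
      define X where "X k = (4 ^ k) powr s * ((1 / 4 ^ k) / ((x - x1)\<^sup>2 + 1 / 4 ^ k))\<^sup>2" for k :: nat
      define Y where "Y k = (4 ^ k) powr s * ((1 / 4 ^ k) / ((x - x2)\<^sup>2 + 1 / 4 ^ k))\<^sup>2" for k :: nat
      define Z where "Z k = (4 ^ k) powr s * (1 / 4 ^ k) * (ramp (1 / 4 ^ k) r)\<^sup>2" for k :: nat
      have "(\<Sum>k\<le>N. (4 ^ k) powr s * ((a x + (- 1) * h k x)\<^sup>2 + 1 / 4 ^ k * (deriv (h k) x)\<^sup>2))
        \<le> (\<Sum>k\<le>N. (6 * (a x)\<^sup>2) * X k + (6 * (a x)\<^sup>2) * Y k + (2 * (deriv a x)\<^sup>2) * Z k)"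
      proof (intro sum_mono)
        fix k
        have "(4 ^ k) powr s * ((a x + (- 1) * h k x)\<^sup>2 + 1 / 4 ^ k * (deriv (h k) x)\<^sup>2)
         \<le> (4 ^ k) powr s * (6 * (((1 / 4 ^ k) / ((x - x1)\<^sup>2 + 1 / 4 ^ k))\<^sup>2 + ((1 / 4 ^ k) / ((x - x2)\<^sup>2 + 1 / 4 ^ k))\<^sup>2) * (a x)\<^sup>2
       + 2 * (1 / 4 ^ k * (ramp (1 / 4 ^ k) r)\<^sup>2) * (deriv a x)\<^sup>2)"
          unfolding r_def by (intro mult_left_mono pt) auto
        also have "W * (6 * (g1 + g2) * A + 2 * (i * j) * B) = (6 * A) * (W * g1) + (6 * A) * (W * g2) + (2 * B) * (W * i * j)"
          for W g1 g2 A i j B :: real by (simp add: algebra_simps)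
        finally show "(4 ^ k) powr s * ((a x + (- 1) * h k x)\<^sup>2 + 1 / 4 ^ k * (deriv (h k) x)\<^sup>2)
         \<le> (6 * (a x)\<^sup>2) * X k + (6 * (a x)\<^sup>2) * Y k + (2 * (deriv a x)\<^sup>2) * Z k"
          unfolding X_def Y_def Z_def .
      qed
      also have "\<dots> = (6 * (a x)\<^sup>2) * (\<Sum>k\<le>N. X k) + (6 * (a x)\<^sup>2) * (\<Sum>k\<le>N. Y k) + (2 * (deriv a x)\<^sup>2) * (\<Sum>k\<le>N. Z k)"
        by (simp only: sum.distrib sum_distrib_left)
      also have "\<dots> \<le> (6 * (a x)\<^sup>2) * (C1 * ((x - x1)\<^sup>2 + 1 / 4 ^ N) powr (- s)) + (6 * (a x)\<^sup>2) * (C1 * ((x - x2)\<^sup>2 + 1 / 4 ^ N) powr (- s))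
         + (2 * (deriv a x)\<^sup>2) * (C2 * c x)"
      proof (intro add_mono mult_left_mono)
        show "(\<Sum>k\<le>N. X k) \<le> C1 * ((x - x1)\<^sup>2 + 1 / 4 ^ N) powr (- s)"
          unfolding X_def C1_def by (rule dyadic_sum_far[OF s])
        show "(\<Sum>k\<le>N. Y k) \<le> C1 * ((x - x2)\<^sup>2 + 1 / 4 ^ N) powr (- s)"
          unfolding Y_def C1_def by (rule dyadic_sum_far[OF s])
        show "(\<Sum>k\<le>N. Z k) \<le> C2 * c x"
          using dyadic_sum_near[of \<delta> r N] d unfolding Z_def C2_def s_def ramp_def
          by (simp add: c_def two_point_coeff_def Let_def r_def)
      qed auto
      finally show ?thesis by (simp add: V_def algebra_simps)
    qed
    have Vi: "integrable lborel (\<lambda>x. V x * (a x)\<^sup>2)" "(LINT x|lborel. V x * (a x)\<^sup>2) \<le> (Ca + Cb) * (Q + M)"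
    proof -
      have e: "0 < 1 / (4::real) ^ N" by simp
      note A = Ca(2)[OF e a] and B = Cb(2)[OF e a]
      have ms: "\<delta> - 1 = - s" by (simp add: s_def)
      show "integrable lborel (\<lambda>x. V x * (a x)\<^sup>2)"
        unfolding V_def distrib_right using A B unfolding ms by (intro Bochner_Integration.integrable_add) auto
      have "(LINT x|lborel. V x * (a x)\<^sup>2) = (LINT x|lborel. ((x - x1)\<^sup>2 + 1 / 4 ^ N) powr (- s) * (a x)\<^sup>2) + (LINT x|lborel. ((x - x2)\<^sup>2 + 1 / 4 ^ N) powr (- s) * (a x)\<^sup>2)"
        unfolding V_def distrib_right using A B unfolding ms by (intro Bochner_Integration.integral_add) auto
      also have "\<dots> \<le> Ca * (Q + M) + Cb * (Q + M)"
        using A B unfolding ms Q_def M_def c_def by (intro add_mono) auto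
      finally show "(LINT x|lborel. V x * (a x)\<^sup>2) \<le> (Ca + Cb) * (Q + M)" by (simp add: distrib_right)
    qed
    have ni: "integrable lborel (\<lambda>x. (a x + (- 1) * h k x)\<^sup>2)" "integrable lborel (\<lambda>x. (deriv (h k) x)\<^sup>2)" for k
      by (rule integrable_test_function_sq[OF td], rule integrable_test_function_sq[OF test_function_deriv[OF th]])
    have nrm: "(norm (emb a - emb (h k)))\<^sup>2 + 1 / 4 ^ k * (norm (emb (deriv (h k))))\<^sup>2 =
       (LINT x|lborel. (a x + (- 1) * h k x)\<^sup>2 + 1 / 4 ^ k * (deriv (h k) x)\<^sup>2)" for k
    proof -
      have "emb a - emb (h k) = emb (\<lambda>x. a x + (- 1) * h k x)" using emb_lincomb[OF a th, of "- 1" k] by simp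
      then have "(norm (emb a - emb (h k)))\<^sup>2 = (LINT x|lborel. (a x + (- 1) * h k x)\<^sup>2)" by (simp only: norm_emb_sq[OF td])
      then show ?thesis using norm_emb_sq[OF test_function_deriv[OF th], of k]
        by (simp only: Bochner_Integration.integral_add[OF ni(1) integrable_mult_right[OF ni(2)]] integral_mult_right_zero)
    qed
    have "(\<Sum>k\<le>N. (4 ^ k) powr s * ((norm (emb a - emb (h k)))\<^sup>2 + 1 / 4 ^ k * (norm (emb (deriv (h k))))\<^sup>2))
      = (LINT x|lborel. (\<Sum>k\<le>N. (4 ^ k) powr s * ((a x + (- 1) * h k x)\<^sup>2 + 1 / 4 ^ k * (deriv (h k) x)\<^sup>2)))"
      unfolding nrm
      by (subst Bochner_Integration.integral_sum)
        (intro integrable_mult_right Bochner_Integration.integrable_add ni, simp only: integral_mult_right_zero)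
    also have "\<dots> \<le> (LINT x|lborel. 6 * C1 * (V x * (a x)\<^sup>2) + 2 * C2 * (c x * (deriv a x)\<^sup>2))"
      by (intro integral_mono ptsum Bochner_Integration.integrable_sum integrable_mult_right Bochner_Integration.integrable_add ni Vi ci)
    also have "\<dots> = 6 * C1 * (LINT x|lborel. V x * (a x)\<^sup>2) + 2 * C2 * Q"
      unfolding Q_def
      by (subst Bochner_Integration.integral_add[OF integrable_mult_right[OF Vi(1)] integrable_mult_right[OF ci]])
        (simp only: integral_mult_right_zero)
    also have "\<dots> \<le> 6 * C1 * ((Ca + Cb) * (Q + M)) + 2 * C2 * (Q + M)"
      using Vi(2) C1 C2 M0 by (intro add_mono mult_left_mono) auto
    also have "\<dots> = C * (Q + M)" by (simp add: C_def algebra_simps)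
    finally show "(\<Sum>k\<le>N. (4 ^ k) powr (1 - \<delta>) *
       ((norm (emb a - emb (\<lambda>x. cutoff (1 / 4 ^ k) x1 x2 x * a x)))\<^sup>2 +
        1 / 4 ^ k * (norm (emb (deriv (\<lambda>x. cutoff (1 / 4 ^ k) x1 x2 x * a x))))\<^sup>2))
    \<le> C * ((LINT x|lborel. two_point_coeff \<delta> x1 x2 x * (deriv a x)\<^sup>2) + (LINT x|lborel. (a x)\<^sup>2))"
      unfolding Q_def M_def c_def s_def h_def[abs_def] \<theta>_def .
  qed
qed

subsection \<open>Fractional powers of the Laplacian\<close>

text \<open>\<open>q * y / (1 + q * y)\<close> is comparable to \<open>min 1 (q * y)\<close>, so its
  integral against the spectral measure of the Laplacian is comparable to the squared
  \<open>K\<close>-functional between \<open>L2\<close> and \<open>W12\<close> at the scale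
  \<open>sqrt q\<close>. The value \<open>0\<close> for negative \<open>y\<close> keeps it
  nonnegative everywhere; spectral measures of the Laplacian do not charge that half line.\<close>

definition hfun :: "real \<Rightarrow> real \<Rightarrow> real" where
  "hfun q y = (if y < 0 then 0 else q * y / (1 + q * y))"

lemma borel_measurable_hfun [measurable]: "hfun q \<in> borel_measurable borel"
  unfolding hfun_def by measurable

lemma hfun_bounds:
  assumes "q > 0"
  shows "0 \<le> hfun q y" "hfun q y \<le> 1" "y \<ge> 0 \<Longrightarrow> hfun q y \<le> q * y"
proof -
  have p: "0 \<le> q * y" if "\<not> y < 0" using that assms by simp
  show "0 \<le> hfun q y" using p by (auto simp: hfun_def)
  show "hfun q y \<le> 1" using p by (auto simp: hfun_def divide_le_eq_1)
  show "hfun q y \<le> q * y" if "y \<ge> 0"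
  proof -
    have "q * y * 1 \<le> q * y * (1 + q * y)" using assms that by (intro mult_left_mono) auto
    moreover have "0 < 1 + q * y" using assms that by (simp add: add_pos_nonneg)
    ultimately show ?thesis using that by (simp add: hfun_def pos_divide_le_eq)
  qed
qed

lemma dyadic_interval:
  fixes y :: real
  assumes "1 \<le> y" "y \<le> 4 ^ N"
  shows "\<exists>k\<le>N. 4 ^ k \<le> y \<and> y \<le> 4 ^ Suc k"
  using assms
proof (induction N)
  case (Suc N)
  show ?case
  proof (cases "y \<le> 4 ^ N")
    case True
    then show ?thesis using Suc.IH Suc.prems by (meson le_SucI)
  next
    case False
    then show ?thesis using Suc.prems by (intro exI[of _ N]) auto
  qed
qed auto

text \<open>A single summand suffices: at the \<open>k\<close> with
  \<open>4 ^ k \<le> y \<le> 4 ^ Suc k\<close> the function \<open>hfun\<close> is at least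
  \<open>1/2\<close>, and \<open>y powr s\<close> exceeds \<open>(4 ^ k) powr s\<close> by at most
  the factor \<open>4 powr s\<close>. The \<open>1\<close> covers \<open>y \<le> 1\<close>.\<close>

lemma powr_le_dyadic_sum:
  fixes y s :: real
  assumes s: "0 < s" and l: "0 \<le> y" "y \<le> 4 ^ N"
  shows "y powr s \<le> 1 + 2 * 4 powr s * (\<Sum>k\<le>N. (4 ^ k) powr s * hfun (1 / 4 ^ k) y)"
proof -
  have nn: "0 \<le> (4 ^ k) powr s * hfun (1 / 4 ^ k) y" for k by (intro mult_nonneg_nonneg hfun_bounds) auto
  show ?thesis
  proof (cases "y \<le> 1")
    case True
    then have "y powr s \<le> 1" using s l by (intro powr_le1) auto
    moreover have "0 \<le> 2 * 4 powr s * (\<Sum>k\<le>N. (4 ^ k) powr s * hfun (1 / 4 ^ k) y)"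
      by (intro mult_nonneg_nonneg sum_nonneg nn) auto
    ultimately show ?thesis by linarith
  next
    case False
    then obtain k where k: "k \<le> N" "4 ^ k \<le> y" "y \<le> 4 ^ Suc k" using dyadic_interval[of y N] l by auto
    have "y powr s \<le> (4 * 4 ^ k) powr s" using k s l by (intro powr_mono2) auto
    also have "\<dots> = 2 * 4 powr s * ((4 ^ k) powr s * (1 / 2))" by (simp add: powr_mult)
    also have "\<dots> \<le> 2 * 4 powr s * ((4 ^ k) powr s * hfun (1 / 4 ^ k) y)"
    proof (intro mult_left_mono)
      define z where "z = 1 / 4 ^ k * y"
      have z: "1 \<le> z" using k(2) by (simp add: z_def)
      have "hfun (1 / 4 ^ k) y = z / (1 + z)" using l by (simp add: hfun_def z_def)
      moreover have "1 / 2 \<le> z / (1 + z)" using z by (simp add: field_simps)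
      ultimately show "1 / 2 \<le> hfun (1 / 4 ^ k) y" by simp
    qed auto
    also have "\<dots> \<le> 2 * 4 powr s * (\<Sum>k\<le>N. (4 ^ k) powr s * hfun (1 / 4 ^ k) y)"
      using k(1) nn by (intro mult_left_mono member_le_sum[of k "{..N}" "\<lambda>k. (4 ^ k) powr s * hfun (1 / 4 ^ k) y"]) auto
    finally show ?thesis by simp
  qed
qed

context pvm
begin

context
  assumes lap: "spectral_integral E (\<lambda>s. s) = laplacian"
begin

lemma laplacian_\<mu>_nonneg: "AE x in \<mu> \<phi>. 0 \<le> x"
proof (rule \<mu>_negative_eq_0)
  fix \<phi> \<psi> assume "(\<phi>, \<psi>) \<in> spectral_integral E (\<lambda>s. s)"
  then obtain \<psi>' \<theta> where "\<psi> = - \<psi>'" "(\<phi>, \<theta>) \<in> weak_derivative" "(\<theta>, \<psi>') \<in> weak_derivative"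
    unfolding lap laplacian_def by blast
  then show "0 \<le> Re (cinner \<psi> \<phi>)" using cinner_laplacian[of \<phi> \<theta> \<psi>'] by simp
qed

lemma nn_integral_hfun_le_norm:
  "q > 0 \<Longrightarrow> (\<integral>\<^sup>+ x. ennreal (hfun q x) \<partial>\<mu> \<phi>) \<le> ennreal ((norm \<phi>)\<^sup>2)"
proof -
  assume q: "q > 0"
  have "(\<integral>\<^sup>+ x. ennreal (hfun q x) \<partial>\<mu> \<phi>) \<le> (\<integral>\<^sup>+ x. 1 \<partial>\<mu> \<phi>)"
    using hfun_bounds(2)[OF q] by (intro nn_integral_mono) simp
  also have "\<dots> = ennreal ((norm \<phi>)\<^sup>2)" by (simp add: emeasure_\<mu>)
  finally show ?thesis .
qed

text \<open>The easy half of the \<open>K\<close>-functional characterisation, for an arbitrary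
  competitor \<open>\<eta>\<close>: split \<open>\<phi>\<close> into
  \<open>\<phi> - emb \<eta>\<close>, where \<open>hfun \<le> 1\<close> is used, and
  \<open>emb \<eta>\<close>, where \<open>hfun q x \<le> q * x\<close> is used and the first moment
  of the spectral measure is the squared norm of the derivative.\<close>

lemma nn_integral_hfun_test_function:
  assumes q: "q > 0" and \<eta>: "test_function \<eta>"
  shows "(\<integral>\<^sup>+ x. ennreal (hfun q x) \<partial>\<mu> \<phi>) \<le> ennreal (2 * ((norm (\<phi> - emb \<eta>))\<^sup>2 + q * (norm (emb (deriv \<eta>)))\<^sup>2))"
proof -
  have w1: "(emb \<eta>, emb (deriv \<eta>)) \<in> weak_derivative" by (rule emb_weak_derivative[OF \<eta>])
  have w2: "(emb (deriv \<eta>), emb (deriv (deriv \<eta>))) \<in> weak_derivative"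
    by (rule emb_weak_derivative[OF test_function_deriv[OF \<eta>]])
  have L: "(emb \<eta>, - emb (deriv (deriv \<eta>))) \<in> spectral_integral E (\<lambda>s. s)"
    unfolding lap laplacian_def using w1 w2 by blast
  then have dom: "emb \<eta> \<in> spectral_domain E (\<lambda>s. s)" by (simp add: spectral_integral_def)
  have quad: "(LINT x|\<mu> (emb \<eta>). x) = (norm (emb (deriv \<eta>)))\<^sup>2"
    using spectral_integral_quadratic[OF _ L] cinner_laplacian[OF w1 w2] by (simp del: of_real_power)
  have "(\<integral>\<^sup>+ x. ennreal (hfun q x) \<partial>\<mu> (emb \<eta>)) \<le> (\<integral>\<^sup>+ x. ennreal (q * x) \<partial>\<mu> (emb \<eta>))"
    by (rule nn_integral_mono_AE)
      (use laplacian_\<mu>_nonneg[of "emb \<eta>"] hfun_bounds(3)[OF q] in \<open>auto elim!: eventually_mono intro: ennreal_leI\<close>)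
  also have "\<dots> = ennreal (LINT x|\<mu> (emb \<eta>). q * x)"
    by (rule nn_integral_eq_integral)
      (use spectral_domain_integrable(2)[OF _ dom] laplacian_\<mu>_nonneg[of "emb \<eta>"] q in \<open>auto elim!: eventually_mono\<close>)
  also have "\<dots> = ennreal (q * (norm (emb (deriv \<eta>)))\<^sup>2)" by (simp add: quad)
  finally have h: "(\<integral>\<^sup>+ x. ennreal (hfun q x) \<partial>\<mu> (emb \<eta>)) \<le> ennreal (q * (norm (emb (deriv \<eta>)))\<^sup>2)" .
  have "(\<integral>\<^sup>+ x. ennreal (hfun q x) \<partial>\<mu> \<phi>) = (\<integral>\<^sup>+ x. ennreal (hfun q x) \<partial>\<mu> ((\<phi> - emb \<eta>) + emb \<eta>))" by simp
  also have "\<dots> \<le> 2 * (\<integral>\<^sup>+ x. ennreal (hfun q x) \<partial>\<mu> (\<phi> - emb \<eta>)) + 2 * (\<integral>\<^sup>+ x. ennreal (hfun q x) \<partial>\<mu> (emb \<eta>))"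
    by (rule nn_integral_\<mu>_add) measurable
  also have "\<dots> \<le> 2 * ennreal ((norm (\<phi> - emb \<eta>))\<^sup>2) + 2 * ennreal (q * (norm (emb (deriv \<eta>)))\<^sup>2)"
    by (intro add_mono mult_left_mono nn_integral_hfun_le_norm q h) auto
  also have "\<dots> = ennreal (2 * ((norm (\<phi> - emb \<eta>))\<^sup>2 + q * (norm (emb (deriv \<eta>)))\<^sup>2))"
    using q by (simp add: distrib_left ennreal_mult ennreal_plus)
  finally show ?thesis .
qed

end

end

text \<open>\<open>M\<close> is fixed before \<open>H\<close>, \<open>E\<close> and the vectors, so
  the bound is uniform over every spectral measure of the Laplacian that
  \<open>function_of_operator\<close> may present. The dyadic inequality for
  \<open>x powr (1 - \<delta>)\<close> is integrated, with the cutoff test functions as competitors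
  at each scale.\<close>

lemma subelliptic_estimate:
  assumes d: "1 / 2 < \<delta>" "\<delta> < 1" and x12: "x1 \<noteq> x2"
  obtains M where "M > 0" "\<And>H E \<phi> \<psi>. viscosity_operator (two_point_coeff \<delta> x1 x2) H \<Longrightarrow>
     (\<phi>, \<psi>) \<in> function_of_operator sqrt H \<Longrightarrow>
     projection_valued_measure E \<Longrightarrow> spectral_integral E (\<lambda>s. s) = laplacian \<Longrightarrow>
     (\<integral>\<^sup>+ x. ennreal (x powr (1 - \<delta>)) \<partial>spectral_scalar_measure E \<phi>) \<le> ennreal (M * ((norm \<phi>)\<^sup>2 + (norm \<psi>)\<^sup>2))"
proof -
  interpret coefficient "two_point_coeff \<delta> x1 x2" using d by (intro coefficient_two_point) auto
  define s where "s = 1 - \<delta>"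
  have s: "0 < s" using d by (simp add: s_def)
  obtain C where C: "C > 0" "\<And>N a. test_function a \<Longrightarrow>
    (\<Sum>k\<le>N. (4 ^ k) powr s *
       ((norm (emb a - emb (\<lambda>x. cutoff (1 / 4 ^ k) x1 x2 x * a x)))\<^sup>2 +
        1 / 4 ^ k * (norm (emb (deriv (\<lambda>x. cutoff (1 / 4 ^ k) x1 x2 x * a x))))\<^sup>2))
    \<le> C * ((LINT x|lborel. two_point_coeff \<delta> x1 x2 x * (deriv a x)\<^sup>2) + (LINT x|lborel. (a x)\<^sup>2))"
    using dyadic_K_functional[OF d x12] unfolding s_def by blast
  define D where "D = 2 * 4 powr s"
  have D: "D > 0" by (simp add: D_def)
  \<comment> \<open>\<open>1\<close> comes from the spectrum below \<open>1\<close>; in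
    \<open>8 * C\<close> a factor \<open>4\<close> stems from splitting twice, off the approximation
    error and into real and imaginary part, and a factor \<open>2\<close> from
    \<open>nn_integral_hfun_test_function\<close>.\<close>
  define M where "M = 1 + D * (8 * C)"
  have M: "M > 0" unfolding M_def using C D by (simp add: add_pos_pos)
  show thesis
  proof (rule that[OF M])
    fix H E \<phi> \<psi>
    assume H: "viscosity_operator (two_point_coeff \<delta> x1 x2) H"
      and \<psi>: "(\<phi>, \<psi>) \<in> function_of_operator sqrt H"
      and E: "projection_valued_measure E" "spectral_integral E (\<lambda>s. s) = laplacian"
    interpret pvm E by unfold_locales (rule E(1))
    define J where "J k \<phi> = (\<integral>\<^sup>+ x. ennreal (hfun (1 / 4 ^ k) x) \<partial>\<mu> \<phi>)" for k :: nat and \<phi>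
    define W where "W N = (\<Sum>k\<le>N. (4 ^ k :: real) powr s)" for N :: nat
    have Jadd: "J k (u + v) \<le> 2 * J k u + 2 * J k v" for k u v
      unfolding J_def by (rule nn_integral_\<mu>_add) measurable
    have Jemb: "(\<Sum>k\<le>N. ennreal ((4 ^ k) powr s) * J k (emb a)) \<le>
       ennreal (2 * C * ((LINT x|lborel. two_point_coeff \<delta> x1 x2 x * (deriv a x)\<^sup>2) + (LINT x|lborel. (a x)\<^sup>2)))"
      if a: "test_function a" for a N
    proof -
      define \<eta> where "\<eta> k x = cutoff (1 / 4 ^ k) x1 x2 x * a x" for k :: nat and x
      have t\<eta>: "test_function (\<eta> k)" for k
        unfolding \<eta>_def by (intro test_function_smooth_mult a smooth_cutoff) simp
      have nn: "0 \<le> 2 * ((norm (emb a - emb (\<eta> k)))\<^sup>2 + 1 / 4 ^ k * (norm (emb (deriv (\<eta> k))))\<^sup>2)" for k by simp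
      have "(\<Sum>k\<le>N. ennreal ((4 ^ k) powr s) * J k (emb a)) \<le>
        (\<Sum>k\<le>N. ennreal ((4 ^ k) powr s) * ennreal (2 * ((norm (emb a - emb (\<eta> k)))\<^sup>2 + 1 / 4 ^ k * (norm (emb (deriv (\<eta> k))))\<^sup>2)))"
        unfolding J_def by (intro sum_mono mult_left_mono nn_integral_hfun_test_function[OF E(2)] t\<eta>) auto
      also have "\<dots> = ennreal (\<Sum>k\<le>N. (4 ^ k) powr s * (2 * ((norm (emb a - emb (\<eta> k)))\<^sup>2 + 1 / 4 ^ k * (norm (emb (deriv (\<eta> k))))\<^sup>2)))"
        unfolding ennreal_mult[OF powr_ge_zero nn, symmetric]
        by (subst sum_ennreal) (intro mult_nonneg_nonneg powr_ge_zero nn, rule refl)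
      also have "(\<Sum>k\<le>N. (4 ^ k) powr s * (2 * ((norm (emb a - emb (\<eta> k)))\<^sup>2 + 1 / 4 ^ k * (norm (emb (deriv (\<eta> k))))\<^sup>2)))
        = 2 * (\<Sum>k\<le>N. (4 ^ k) powr s * ((norm (emb a - emb (\<eta> k)))\<^sup>2 + 1 / 4 ^ k * (norm (emb (deriv (\<eta> k))))\<^sup>2))"
        unfolding sum_distrib_left by (intro sum.cong refl) (rule mult.left_commute)
      also have "ennreal \<dots> \<le> ennreal (2 * (C * ((LINT x|lborel. two_point_coeff \<delta> x1 x2 x * (deriv a x)\<^sup>2) + (LINT x|lborel. (a x)\<^sup>2))))"
        unfolding \<eta>_def[abs_def] by (intro ennreal_leI mult_left_mono C(2)[OF a]) auto
      finally show ?thesis by (simp add: mult.assoc)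
    qed
    \<comment> \<open>The approximation error \<open>e\<close> enters with the factor
      \<open>W N\<close>, which grows with \<open>N\<close>. Hence the order of limits:
      \<open>e\<close> tends to \<open>0\<close> for fixed \<open>N\<close> in \<open>Jlim\<close>,
      and \<open>N\<close> goes to infinity only at the end.\<close>
    have Jsum: "(\<Sum>k\<le>N. ennreal ((4 ^ k) powr s) * J k \<phi>) \<le>
       ennreal (2 * W N * e\<^sup>2 + 8 * C * ((norm \<psi>)\<^sup>2 + e + (norm \<phi> + e)\<^sup>2))" if e: "e > 0" for N e
    proof -
      obtain a b where ab: "test_function a" "test_function b" "norm (\<phi> - cemb a b) < e"
        "energy 0 (cemb (deriv a) (deriv b)) \<le> (norm \<psi>)\<^sup>2 + e"
        using viscosity_form_domain_approx[OF H \<psi> e] by blast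
      define u where "u = cemb a b"
      define A where "A = (LINT x|lborel. two_point_coeff \<delta> x1 x2 x * (deriv a x)\<^sup>2) + (LINT x|lborel. (a x)\<^sup>2)"
      define B where "B = (LINT x|lborel. two_point_coeff \<delta> x1 x2 x * (deriv b x)\<^sup>2) + (LINT x|lborel. (b x)\<^sup>2)"
      have A0: "A \<ge> 0" "B \<ge> 0" unfolding A_def B_def using c_nonneg by (auto intro!: add_nonneg_nonneg integral_nonneg_AE)
      have AB: "A + B \<le> (norm \<psi>)\<^sup>2 + e + (norm \<phi> + e)\<^sup>2"
      proof -
        have "A + B = energy 0 (cemb (deriv a) (deriv b)) + (norm u)\<^sup>2"
          unfolding A_def B_def u_def energy_cemb(1)[OF test_function_deriv[OF ab(1)] test_function_deriv[OF ab(2)]]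
            energy_cemb(2)[OF ab(1,2)] by simp
        moreover have "norm u \<le> norm \<phi> + e" using norm_triangle_ineq4[of \<phi> "\<phi> - u"] ab(3) by (simp add: u_def)
        then have "(norm u)\<^sup>2 \<le> (norm \<phi> + e)\<^sup>2" by (intro power_mono) auto
        ultimately show ?thesis using ab(4) by simp
      qed
      have Jd: "J k (\<phi> - u) \<le> ennreal (e\<^sup>2)" for k
      proof -
        have "J k (\<phi> - u) \<le> ennreal ((norm (\<phi> - u))\<^sup>2)" unfolding J_def by (rule nn_integral_hfun_le_norm[OF E(2)]) simp
        also have "\<dots> \<le> ennreal (e\<^sup>2)" using ab(3) by (intro ennreal_leI power_mono) (auto simp: u_def)
        finally show ?thesis .
      qed
      have Jb: "J k (scaleC \<i> (emb b)) = J k (emb b)" for k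
        unfolding J_def by (subst nn_integral_\<mu>_scaleC) auto
      have "J k \<phi> \<le> 2 * ennreal (e\<^sup>2) + (4 * J k (emb a) + 4 * J k (emb b))" for k
      proof -
        have "J k \<phi> \<le> 2 * J k (\<phi> - u) + 2 * J k u" using Jadd[of k "\<phi> - u" u] by simp
        also have "\<dots> \<le> 2 * ennreal (e\<^sup>2) + 2 * (2 * J k (emb a) + 2 * J k (scaleC \<i> (emb b)))"
          unfolding u_def cemb_def by (intro add_mono mult_left_mono Jd[unfolded u_def cemb_def] Jadd) auto
        also have "\<dots> = 2 * ennreal (e\<^sup>2) + (4 * J k (emb a) + 4 * J k (emb b))"
          unfolding Jb by (simp add: distrib_left mult.assoc[symmetric])
        finally show ?thesis .
      qed
      then have "(\<Sum>k\<le>N. ennreal ((4 ^ k) powr s) * J k \<phi>) \<le>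
         (\<Sum>k\<le>N. ennreal ((4 ^ k) powr s) * (2 * ennreal (e\<^sup>2) + (4 * J k (emb a) + 4 * J k (emb b))))"
        by (intro sum_mono mult_left_mono) auto
      also have "\<dots> = 2 * ennreal (e\<^sup>2) * (\<Sum>k\<le>N. ennreal ((4 ^ k) powr s)) + (4 * (\<Sum>k\<le>N. ennreal ((4 ^ k) powr s) * J k (emb a)) + 4 * (\<Sum>k\<le>N. ennreal ((4 ^ k) powr s) * J k (emb b)))"
        by (simp only: sum_distrib_left sum.distrib[symmetric], intro sum.cong refl)
          (simp only: distrib_left mult_ac)
      also have "\<dots> \<le> 2 * ennreal (e\<^sup>2) * ennreal (W N) + (4 * ennreal (2 * C * A) + 4 * ennreal (2 * C * B))"
        unfolding A_def B_def W_def
        by (intro add_mono mult_left_mono Jemb ab) (simp_all add: sum_ennreal)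
      also have "\<dots> = ennreal (2 * e\<^sup>2 * W N + (4 * (2 * C * A) + 4 * (2 * C * B)))"
      proof -
        have "W N \<ge> 0" by (simp add: W_def sum_nonneg)
        moreover have "2 * ennreal x * ennreal y + (4 * ennreal u + 4 * ennreal v) = ennreal (2 * x * y + (4 * u + 4 * v))"
          if "0 \<le> x" "0 \<le> y" "0 \<le> u" "0 \<le> v" for x y u v
          using that by (simp add: ennreal_mult ennreal_plus)
        ultimately show ?thesis using C(1) A0 by simp
      qed
      also have "2 * e\<^sup>2 * W N + (4 * (2 * C * A) + 4 * (2 * C * B)) = 2 * W N * e\<^sup>2 + 8 * C * (A + B)" by (simp add: algebra_simps)
      also have "ennreal \<dots> \<le> ennreal (2 * W N * e\<^sup>2 + 8 * C * ((norm \<psi>)\<^sup>2 + e + (norm \<phi> + e)\<^sup>2))"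
        using AB C(1) by (intro ennreal_leI add_left_mono mult_left_mono) auto
      finally show ?thesis .
    qed
    have Jlim: "(\<Sum>k\<le>N. ennreal ((4 ^ k) powr s) * J k \<phi>) \<le> ennreal (8 * C * ((norm \<psi>)\<^sup>2 + (norm \<phi>)\<^sup>2))" for N
    proof -
      have z: "(\<lambda>n. 1 / real (Suc n)) \<longlonglongrightarrow> 0" by (rule LIMSEQ_Suc[OF lim_1_over_n])
      have "(\<lambda>n. ennreal (2 * W N * (1 / real (Suc n))\<^sup>2 + 8 * C * ((norm \<psi>)\<^sup>2 + 1 / real (Suc n) + (norm \<phi> + 1 / real (Suc n))\<^sup>2)))
        \<longlonglongrightarrow> ennreal (2 * W N * 0\<^sup>2 + 8 * C * ((norm \<psi>)\<^sup>2 + 0 + (norm \<phi> + 0)\<^sup>2))"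
        by (intro tendsto_ennrealI tendsto_add tendsto_mult tendsto_const tendsto_power z)
      then have l: "(\<lambda>n. ennreal (2 * W N * (1 / real (Suc n))\<^sup>2 + 8 * C * ((norm \<psi>)\<^sup>2 + 1 / real (Suc n) + (norm \<phi> + 1 / real (Suc n))\<^sup>2)))
        \<longlonglongrightarrow> ennreal (8 * C * ((norm \<psi>)\<^sup>2 + (norm \<phi>)\<^sup>2))" by simp
      show ?thesis by (rule LIMSEQ_le_const[OF l]) (intro exI[of _ 0] allI impI Jsum, simp)
    qed
    have trunc: "(\<integral>\<^sup>+ x. ennreal (x powr s) * indicator {..4 ^ N} x \<partial>\<mu> \<phi>) \<le> ennreal (M * ((norm \<phi>)\<^sup>2 + (norm \<psi>)\<^sup>2))" for N :: nat
    proof -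
      have "(\<integral>\<^sup>+ x. ennreal (x powr s) * indicator {..4 ^ N} x \<partial>\<mu> \<phi>) \<le>
         (\<integral>\<^sup>+ x. 1 + ennreal D * (\<Sum>k\<le>N. ennreal ((4 ^ k) powr s) * ennreal (hfun (1 / 4 ^ k) x)) \<partial>\<mu> \<phi>)"
      proof (rule nn_integral_mono_AE, use laplacian_\<mu>_nonneg[OF E(2), of \<phi>] in eventually_elim)
        case (elim x)
        show ?case
        proof (cases "x \<le> 4 ^ N")
          case True
          have "ennreal (x powr s) \<le> ennreal (1 + D * (\<Sum>k\<le>N. (4 ^ k) powr s * hfun (1 / 4 ^ k) x))"
            unfolding D_def by (intro ennreal_leI powr_le_dyadic_sum s elim True)
          also have "\<dots> = 1 + ennreal D * (\<Sum>k\<le>N. ennreal ((4 ^ k) powr s) * ennreal (hfun (1 / 4 ^ k) x))"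
          proof -
            have h: "0 \<le> hfun (1 / 4 ^ k) x" for k :: nat by (rule hfun_bounds) simp
            then have "(\<Sum>k\<le>N. ennreal ((4 ^ k) powr s) * ennreal (hfun (1 / 4 ^ k) x)) = ennreal (\<Sum>k\<le>N. (4 ^ k) powr s * hfun (1 / 4 ^ k) x)"
              by (simp add: ennreal_mult[symmetric] sum_ennreal)
            moreover have "0 \<le> (\<Sum>k\<le>N. (4 ^ k) powr s * hfun (1 / 4 ^ k) x)" by (intro sum_nonneg mult_nonneg_nonneg h) auto
            ultimately show ?thesis using D by (simp add: ennreal_mult ennreal_plus)
          qed
          finally show ?thesis using True by simp
        qed simp
      qed
      also have "\<dots> = (\<integral>\<^sup>+ x. 1 \<partial>\<mu> \<phi>) + ennreal D * (\<Sum>k\<le>N. ennreal ((4 ^ k) powr s) * J k \<phi>)"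
        unfolding J_def by (simp add: nn_integral_add nn_integral_cmult nn_integral_sum)
      also have "\<dots> \<le> ennreal ((norm \<phi>)\<^sup>2) + ennreal D * ennreal (8 * C * ((norm \<psi>)\<^sup>2 + (norm \<phi>)\<^sup>2))"
        by (intro add_mono mult_left_mono Jlim) (auto simp: emeasure_\<mu>)
      also have "\<dots> = ennreal ((norm \<phi>)\<^sup>2 + D * (8 * C * ((norm \<psi>)\<^sup>2 + (norm \<phi>)\<^sup>2)))"
        using D C(1) by (simp add: ennreal_mult[symmetric])
      also have "\<dots> \<le> ennreal (M * ((norm \<phi>)\<^sup>2 + (norm \<psi>)\<^sup>2))"
        unfolding M_def by (intro ennreal_leI) (simp add: algebra_simps)
      finally show ?thesis .
    qed
    \<comment> \<open>The truncated bounds do not depend on \<open>N\<close>, so Fatou's lemma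
      removes the truncation.\<close>
    have "(\<integral>\<^sup>+ x. ennreal (x powr s) \<partial>\<mu> \<phi>) = (\<integral>\<^sup>+ x. liminf (\<lambda>N. ennreal (x powr s) * indicator {..4 ^ N} x) \<partial>\<mu> \<phi>)"
    proof (rule nn_integral_cong)
      fix x :: real
      obtain n where n: "x < 4 ^ n" using real_arch_pow[of 4 x] by auto
      have "\<forall>\<^sub>F N in sequentially. ennreal (x powr s) * indicator {..4 ^ N} x = ennreal (x powr s)"
        unfolding eventually_sequentially
      proof (intro exI[of _ n] allI impI)
        fix N assume "n \<le> N"
        then have "(4::real) ^ n \<le> 4 ^ N" by (intro power_increasing) auto
        with n have "x \<le> 4 ^ N" by linarith
        then show "ennreal (x powr s) * indicator {..4 ^ N} x = ennreal (x powr s)" by simp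
      qed
      then have "(\<lambda>N. ennreal (x powr s) * indicator {..4 ^ N} x) \<longlonglongrightarrow> ennreal (x powr s)" by (rule tendsto_eventually)
      then show "ennreal (x powr s) = liminf (\<lambda>N. ennreal (x powr s) * indicator {..4 ^ N} x)"
        by (intro lim_imp_Liminf[symmetric]) auto
    qed
    also have "\<dots> \<le> liminf (\<lambda>N. \<integral>\<^sup>+ x. ennreal (x powr s) * indicator {..4 ^ N} x \<partial>\<mu> \<phi>)"
      by (rule nn_integral_liminf) measurable
    also have "\<dots> \<le> limsup (\<lambda>N. \<integral>\<^sup>+ x. ennreal (x powr s) * indicator {..4 ^ N} x \<partial>\<mu> \<phi>)"
      by (rule Liminf_le_Limsup) simp
    also have "\<dots> \<le> ennreal (M * ((norm \<phi>)\<^sup>2 + (norm \<psi>)\<^sup>2))"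
      by (rule Limsup_bounded) (use trunc in \<open>auto intro: always_eventually\<close>)
    finally show "(\<integral>\<^sup>+ x. ennreal (x powr (1 - \<delta>)) \<partial>\<mu> \<phi>) \<le> ennreal (M * ((norm \<phi>)\<^sup>2 + (norm \<psi>)\<^sup>2))" by (simp add: s_def)
  qed
qed

text \<open>The domain inclusion needs a spectral measure of the Laplacian to exist, and
  \<open>lap_pvm\<close> provides it. The inequality has to hold for the \<open>\<eta>\<close>
  obtained from any such measure, which is why the estimate was kept general in
  \<open>E\<close>.\<close>

lemma viscosity_operator_subelliptic:
  assumes d: "1 / 2 < \<delta>" "\<delta> < 1" and x12: "x1 \<noteq> x2" and H: "viscosity_operator (two_point_coeff \<delta> x1 x2) H"
  shows "subelliptic H (1 - \<delta>)"
proof -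
  obtain M where M: "M > 0" "\<And>E \<phi> \<psi>. (\<phi>, \<psi>) \<in> function_of_operator sqrt H \<Longrightarrow>
     projection_valued_measure E \<Longrightarrow> spectral_integral E (\<lambda>s. s) = laplacian \<Longrightarrow>
     (\<integral>\<^sup>+ x. ennreal (x powr (1 - \<delta>)) \<partial>spectral_scalar_measure E \<phi>) \<le> ennreal (M * ((norm \<phi>)\<^sup>2 + (norm \<psi>)\<^sup>2))"
    using subelliptic_estimate[OF d x12] H by metis
  define g where "g = (\<lambda>s :: real. s powr ((1 - \<delta>) / 2))"
  have g [measurable]: "g \<in> borel_measurable borel" unfolding g_def by measurable
  have g2: "(g x)\<^sup>2 = x powr (1 - \<delta>)" for x
    unfolding g_def power2_eq_square powr_add[symmetric] by simp
  have dom: "Domain (function_of_operator sqrt H) \<subseteq> Domain (function_of_operator g laplacian)"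
  proof
    fix \<phi> assume "\<phi> \<in> Domain (function_of_operator sqrt H)"
    then obtain \<psi> where \<psi>: "(\<phi>, \<psi>) \<in> function_of_operator sqrt H" by blast
    have "(\<integral>\<^sup>+ x. ennreal ((g x)\<^sup>2) \<partial>lap.\<mu> \<phi>) \<le> ennreal (M * ((norm \<phi>)\<^sup>2 + (norm \<psi>)\<^sup>2))"
      unfolding g2 by (rule M(2)[OF \<psi> projection_valued_measure_lap_pvm laplacian_eq_spectral_integral])
    also have "\<dots> < \<infinity>" by simp
    finally have "\<phi> \<in> spectral_domain lap_pvm g" by (simp add: lap.spectral_domain_iff)
    then have "\<phi> \<in> Domain (spectral_integral lap_pvm g)" by (simp only: lap.Domain_spectral_integral[OF g])
    then obtain \<eta> where "(\<phi>, \<eta>) \<in> spectral_integral lap_pvm g" by blast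
    then have "(\<phi>, \<eta>) \<in> function_of_operator g laplacian"
      unfolding function_of_operator_def
      using projection_valued_measure_lap_pvm laplacian_eq_spectral_integral by blast
    then show "\<phi> \<in> Domain (function_of_operator g laplacian)" by blast
  qed
  have ineq: "(norm \<psi>)\<^sup>2 + 1 * (norm \<phi>)\<^sup>2 \<ge> inverse M * (norm \<eta>)\<^sup>2"
    if \<psi>: "(\<phi>, \<psi>) \<in> function_of_operator sqrt H" and \<eta>: "(\<phi>, \<eta>) \<in> function_of_operator g laplacian" for \<phi> \<psi> \<eta>
  proof -
    obtain E where E: "projection_valued_measure E" "spectral_integral E (\<lambda>s. s) = laplacian" "(\<phi>, \<eta>) \<in> spectral_integral E g"
      using \<eta> by (auto simp: function_of_operator_def)
    interpret pvm E by unfold_locales (rule E(1))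
    have "ennreal ((norm \<eta>)\<^sup>2) = (\<integral>\<^sup>+ x. ennreal ((g x)\<^sup>2) \<partial>\<mu> \<phi>)" by (rule spectral_integral_nn_integral[OF g E(3)])
    also have "\<dots> \<le> ennreal (M * ((norm \<phi>)\<^sup>2 + (norm \<psi>)\<^sup>2))" unfolding g2 by (rule M(2)[OF \<psi> E(1,2)])
    finally have "(norm \<eta>)\<^sup>2 \<le> M * ((norm \<phi>)\<^sup>2 + (norm \<psi>)\<^sup>2)" using M(1) by (simp add: ennreal_le_iff)
    then show ?thesis using M(1) by (simp add: inverse_eq_divide pos_divide_le_eq mult.commute add.commute)
  qed
  show ?thesis
    unfolding subelliptic_def g_def[symmetric]
  proof (intro conjI)
    show "\<exists>\<mu>>0. \<exists>\<nu>\<ge>0. Domain (function_of_operator sqrt H) \<subseteq> Domain (function_of_operator g laplacian) \<and>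
      (\<forall>\<phi> \<psi> \<eta>. (\<phi>, \<psi>) \<in> function_of_operator sqrt H \<longrightarrow> (\<phi>, \<eta>) \<in> function_of_operator g laplacian \<longrightarrow>
        \<mu> * (norm \<eta>)\<^sup>2 \<le> (norm \<psi>)\<^sup>2 + \<nu> * (norm \<phi>)\<^sup>2)"
      using M(1) dom ineq by (intro exI[of _ "inverse M"] conjI exI[of _ "1::real"]) auto
  qed (use d in auto)
qed

section \<open>Assembly of subellipticity and the failure of the kernel bounds\<close>

theorem mainTheorem7:
  fixes \<delta> x1 x2 :: real and H0 :: l2_op
  assumes "1 / 2 < \<delta>" and "\<delta> < 1" and "x1 < x2"
    and "viscosity_operator (two_point_coeff \<delta> x1 x2) H0"
  shows "subelliptic H0 (1 - \<delta>) \<and>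
    (\<forall>K :: real \<Rightarrow> real \<Rightarrow> real \<Rightarrow> real.
      (\<forall>t>0. bounded_kernel_of (semigroup_of H0 t) (K t)) \<longrightarrow>
        (\<forall>t>0. kernel_sup_norm (K t) \<ge> ereal (inverse (x2 - x1))) \<and>
        \<not> (\<exists>a>0. \<forall>t\<ge>1. kernel_sup_norm (K t) \<le> ereal (a * t powr (- 1 / 2))) \<and>
        \<not> (\<exists>a>0. \<exists>b>0. \<forall>t\<ge>1. AE (x, y) in lborel \<Otimes>\<^sub>M lborel.
              K t x y \<le> a * t powr (- 1 / 2) * exp (- b * \<bar>x - y\<bar>\<^sup>2 / t)) \<and>
        \<not> (\<exists>a'>0. \<exists>b'>0. \<forall>t>0. AE (x, y) in lborel \<Otimes>\<^sub>M lborel.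
              K t x y \<ge> a' * t powr (- 1 / 2) * exp (- b' * \<bar>x - y\<bar>\<^sup>2 / t)))"
proof (intro conjI allI impI)
  show "subelliptic H0 (1 - \<delta>)"
    by (rule viscosity_operator_subelliptic) (use assms in auto)
  fix K :: "real \<Rightarrow> real \<Rightarrow> real \<Rightarrow> real"
  assume K: "\<forall>t>0. bounded_kernel_of (semigroup_of H0 t) (K t)"
  have k: "AE x in lborel. integrable lborel (\<lambda>y. K t x y * indicator {x1..x2} y) \<and>
    (LINT y|lborel. K t x y * indicator {x1..x2} y) = indicator {x1..x2} x" if "t > 0" for t
    by (rule kernel_on_interval[OF assms(1,2,4)]) (use K that in auto)
  have sup: "kernel_sup_norm (K t) \<ge> ereal (inverse (x2 - x1))" if "t > 0" for t
    by (rule kernel_sup_norm_bound[OF assms(3) k[OF that]]) (use K that in \<open>auto simp: bounded_kernel_of_def\<close>)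
  then show "kernel_sup_norm (K t) \<ge> ereal (inverse (x2 - x1))" if "t > 0" for t using that .
  have L: "0 < x2 - x1" using assms(3) by simp
  show "\<not> (\<exists>a>0. \<forall>t\<ge>1. kernel_sup_norm (K t) \<le> ereal (a * t powr (- 1 / 2)))"
  proof clarify
    fix a :: real assume a: "a > 0" "\<forall>t\<ge>1. kernel_sup_norm (K t) \<le> ereal (a * t powr (- 1 / 2))"
    obtain t where t: "t \<ge> 1" "a * t powr (- 1 / 2) * (x2 - x1) < 1" using no_inverse_sqrt_bound[OF L a(1)] by blast
    have "ereal (inverse (x2 - x1)) \<le> kernel_sup_norm (K t)" using sup t(1) by simp
    also have "\<dots> \<le> ereal (a * t powr (- 1 / 2))" using a(2) t(1) by blast
    finally have "inverse (x2 - x1) \<le> a * t powr (- 1 / 2)" by simp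
    then have "inverse (x2 - x1) * (x2 - x1) \<le> a * t powr (- 1 / 2) * (x2 - x1)" using L by (intro mult_right_mono) auto
    then show False using t(2) L by simp
  qed
  show "\<not> (\<exists>a>0. \<exists>b>0. \<forall>t\<ge>1. AE (x, y) in lborel \<Otimes>\<^sub>M lborel.
              K t x y \<le> a * t powr (- 1 / 2) * exp (- b * \<bar>x - y\<bar>\<^sup>2 / t))"
  proof clarify
    fix a b :: real assume ab: "a > 0" "b > 0" and g: "\<forall>t\<ge>1. AE (x, y) in lborel \<Otimes>\<^sub>M lborel.
              K t x y \<le> a * t powr (- 1 / 2) * exp (- b * \<bar>x - y\<bar>\<^sup>2 / t)"
    obtain t where t: "t \<ge> 1" "a * t powr (- 1 / 2) * (x2 - x1) < 1" using no_inverse_sqrt_bound[OF L ab(1)] by blast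
    \<comment> \<open>Discarding the Gaussian factor reduces the second negative claim to a uniform
      upper bound, which a large \<open>t\<close> contradicts as in the first.\<close>
    have le: "a * t powr (- 1 / 2) * exp (- b * \<bar>x - y\<bar>\<^sup>2 / t) \<le> a * t powr (- 1 / 2)" for x y :: real
    proof -
      have "exp (- b * \<bar>x - y\<bar>\<^sup>2 / t) \<le> 1" using ab t by (simp add: divide_nonpos_pos)
      then show ?thesis using ab by (intro mult_left_le) auto
    qed
    have "AE (x, y) in lborel \<Otimes>\<^sub>M lborel. K t x y \<le> a * t powr (- 1 / 2) * exp (- b * \<bar>x - y\<bar>\<^sup>2 / t)"
      using g t(1) by blast
    then have "AE (x, y) in lborel \<Otimes>\<^sub>M lborel. K t x y \<le> a * t powr (- 1 / 2)"
    proof eventually_elim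
      case (elim z)
      then show ?case unfolding case_prod_beta using le[of "fst z" "snd z"] by linarith
    qed
    then have "1 \<le> a * t powr (- 1 / 2) * (x2 - x1)"
      by (rule kernel_upper_bound[OF assms(3) k, rotated]) (use t(1) in simp)
    then show False using t(2) by simp
  qed
  show "\<not> (\<exists>a'>0. \<exists>b'>0. \<forall>t>0. AE (x, y) in lborel \<Otimes>\<^sub>M lborel.
              K t x y \<ge> a' * t powr (- 1 / 2) * exp (- b' * \<bar>x - y\<bar>\<^sup>2 / t))"
  proof clarify
    fix a b :: real assume ab: "a > 0" "b > 0" and g: "\<forall>t>0. AE (x, y) in lborel \<Otimes>\<^sub>M lborel.
              a * t powr (- 1 / 2) * exp (- b * \<bar>x - y\<bar>\<^sup>2 / t) \<le> K t x y"
    \<comment> \<open>Of the Gaussian lower bound only its strict positivity at the single time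
      \<open>t = 1\<close> is exploited.\<close>
    have pos: "0 < a * 1 powr (- 1 / 2) * exp (- b * \<bar>x - y\<bar>\<^sup>2 / 1)" for x y :: real using ab by simp
    have "AE (x, y) in lborel \<Otimes>\<^sub>M lborel. a * 1 powr (- 1 / 2) * exp (- b * \<bar>x - y\<bar>\<^sup>2 / 1) \<le> K 1 x y"
      using g zero_less_one by blast
    then have "AE (x, y) in lborel \<Otimes>\<^sub>M lborel. 0 < K 1 x y"
    proof eventually_elim
      case (elim z)
      then show ?case unfolding case_prod_beta using pos[of "fst z" "snd z"] by linarith
    qed
    then show False using kernel_not_positive[OF assms(3) k[of 1]] by simp
  qed
qed

end
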